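(* Let $\tau$ be a Tutte constellation. Then $H_1(\Sigma_2^\tau,\mathbb Z)=0$.
   Context: Matroids are on finite ground sets. For a matroid $M$ on $E$, $\Lambda_M$ is its lattice of flats, $\langle S\rangle$ the closure of $S$, $F_1\vee F_2=\langle F_1\cup F_2\rangle$; the corank of a flat $F$ is $\mathrm{rk}(M)-\mathrm{rk}(F)$. A modular cut in a geometric lattice $\Lambda=\Lambda_M$ is a subset $\Gamma\subseteq\Lambda$ closed under passing to larger flats and such that $F_1\cap F_2\in\Gamma$ whenever $F_1,F_2\in\Gamma$ satisfy $\mathrm{rk}(F_1)+\mathrm{rk}(F_2)=\mathrm{rk}(F_1\cap F_2)+\mathrm{rk}(F_1\vee F_2)$. A Tutte constellation is a pair $\tau=(\Lambda,\Gamma)$ of a geometric lattice $\Lambda$ and a modular cut $\Gamma$ in $\Lambda$; its type is the isomorphism type of the simple matroid $M$ (with ground set $E$) whose lattice of flats is $\Lambda$. A flat $F$ is indecomposable in $\Lambda$ (or in $\tau$) if $M/F$ is connected, and decomposable otherwise; a corank $2$ flat is indecomposable iff it is contained in at least $3$ hyperplanes. An upper sublattice of $\Lambda=\Lambda_M$ is a subset of the form $\{\langle S\rangle:I\subseteq S\subseteq E-J\}$ for disjoint $I,J\subseteq E$ with $I$ independent and $E-J$ spanning, ordered by inclusion (equivalently: a subset that is a geometric lattice under inclusion, has the same joins as $\Lambda$, and whose rank equals the corank in $\Lambda$ of its bottom element; meets in the upper sublattice may be smaller than in $\Lambda$). A subconstellation $\sigma$ of $\tau$ is a pair $(\Lambda_\sigma,\Gamma_\sigma)$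 with $\Lambda_\sigma$ an upper sublattice of $\Lambda$ and $\Gamma_\sigma=\Gamma\cap\Lambda_\sigma$; subconstellations are ordered by inclusion of lattices. Consider the following classes of subconstellations $\sigma$ of $\tau$: - Class 0: type $U_{1,1}$, $\Gamma_\sigma=\{E\}$. - Class 1: type $U_{2,2}$, $\Gamma_\sigma=\{E\}$, and the bottom element of $\Lambda_\sigma$ is an indecomposable flat of $\Lambda$. - Class 2a: type $U_{2,3}$, $\Gamma_\sigma=\{E\}$. - Class 2b: type $U_{3,3}$, $\Gamma_\sigma=\{E\}$, and each corank $2$ flat of $\Lambda_\sigma$ is indecomposable in $\tau$. - Class 2c: type $U_{3,4}$, $\Gamma_\sigma=\{H_1,H_2,E\}$ where $H_1,H_2$ are two hyperplanes whose meet in $\Lambda_\sigma$ is the bottom element of $\Lambda_\sigma$ (a corank $3$ flat of $\Lambda$). - Class 2d: type $M(K_{2,3})$ (the rank $4$ graphic matroid of the complete bipartite graph $K_{2,3}$), $\Gamma_\sigma=\{H_1,H_2,H_3,H_4,E\}$ where the pairwise meets $H_i\wedge H_j$ ($i\ne j$) in $\Lambda_\sigma$ are the six corank $3$ flats (atoms) of $\Lambda_\sigma$, and such that the three corank $2$ flats of $\Lambda_\sigma$ that are decomposable in $\Lambda_\sigma$ remain decomposable in $\tau$. (Explicitly, labelling the edges of $K_{2,3}$ by $1,\dots,6$ with serial pairs $\{1,4\},\{2,5\},\{3,6\}$, one has $\{H_1,\dots,H_4\}=\{123,156,246,345\}$ up to isomorphism, and the three corank $2$ flats are $14,25,36$.)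 $\mathcal X_2^\tau$ is the poset of all subconstellations of $\tau$ of classes 0, 1, 2a, 2b, 2c, 2d, and $\Sigma_2^\tau$ is its order complex, i.e. the simplicial complex whose vertices are the elements of $\mathcal X_2^\tau$ and whose faces are the finite chains. $H_1(-,\mathbb Z)$ denotes singular homology (of the geometric realization). *)

theory Defs
  imports "HOL-Homology.Homology"
begin

section \<open>Matroids\<close>

record 'a matroid =
  ground :: "'a set"
  indep :: "'a set set"

definition matroid :: "'a matroid \<Rightarrow> bool" where
  "matroid M \<longleftrightarrow>
     finite (ground M) \<and> indep M \<subseteq> Pow (ground M) \<and> {} \<in> indep M \<and>
     (\<forall>I\<in>indep M. \<forall>J. J \<subseteq> I \<longrightarrow> J \<in> indep M) \<and>
     (\<forall>I\<in>indep M. \<forall>J\<in>indep M. card I < card J \<longrightarrow> (\<exists>x\<in>J - I. insert x I \<in> indep M))"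

definition rk :: "'a matroid \<Rightarrow> 'a set \<Rightarrow> nat" where
  "rk M S = Max (card ` {I \<in> indep M. I \<subseteq> S})"

definition cl :: "'a matroid \<Rightarrow> 'a set \<Rightarrow> 'a set" where
  "cl M S = {x \<in> ground M. rk M (insert x S) = rk M S}"

definition flats :: "'a matroid \<Rightarrow> 'a set set" where
  "flats M = {F. F \<subseteq> ground M \<and> cl M F = F}"

definition spanning :: "'a matroid \<Rightarrow> 'a set \<Rightarrow> bool" where
  "spanning M S \<longleftrightarrow> S \<subseteq> ground M \<and> cl M S = ground M"

definition contract :: "'a matroid \<Rightarrow> 'a set \<Rightarrow> 'a matroid" where
  "contract M X =
     \<lparr>ground = ground M - X,
      indep = {I. I \<subseteq> ground M - X \<and> rk M (I \<union> X) = card I + rk M X}\<rparr>"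

definition circuit :: "'a matroid \<Rightarrow> 'a set \<Rightarrow> bool" where
  "circuit M C \<longleftrightarrow> C \<subseteq> ground M \<and> C \<notin> indep M \<and> (\<forall>D. D \<subset> C \<longrightarrow> D \<in> indep M)"

definition connected_matroid :: "'a matroid \<Rightarrow> bool" where
  "connected_matroid M \<longleftrightarrow>
     (\<forall>e\<in>ground M. \<forall>f\<in>ground M. e \<noteq> f \<longrightarrow> (\<exists>C. circuit M C \<and> e \<in> C \<and> f \<in> C))"

definition matroid_isomorphic :: "'a matroid \<Rightarrow> 'b matroid \<Rightarrow> bool" where
  "matroid_isomorphic M N \<longleftrightarrow>
     (\<exists>f. bij_betw f (ground M) (ground N) \<and>
          (\<forall>I. I \<subseteq> ground M \<longrightarrow> (I \<in> indep M \<longleftrightarrow> f ` I \<in> indep N)))"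

definition uniform_matroid :: "nat \<Rightarrow> nat \<Rightarrow> nat matroid" where
  "uniform_matroid r n = \<lparr>ground = {..<n}, indep = {I. I \<subseteq> {..<n} \<and> card I \<le> r}\<rparr>"

text \<open>A simple graph is given by its set of edges, each edge being the two-element set of its
  end points. A cycle is listed by its vertices, without repeating the starting point.\<close>

definition is_cycle :: "'v set set \<Rightarrow> 'v list \<Rightarrow> bool" where
  "is_cycle F vs \<longleftrightarrow>
     distinct vs \<and> 3 \<le> length vs \<and>
     (\<forall>i<length vs. {vs ! i, vs ! (Suc i mod length vs)} \<in> F)"

definition graphic_matroid :: "'v set set \<Rightarrow> 'v set matroid" where
  "graphic_matroid G = \<lparr>ground = G, indep = {F. F \<subseteq> G \<and> (\<nexists>vs. is_cycle F vs)}\<rparr>"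

definition complete_bipartite_edges :: "'v set \<Rightarrow> 'v set \<Rightarrow> 'v set set" where
  "complete_bipartite_edges A B = {{a, b} |a b. a \<in> A \<and> b \<in> B}"

definition matroid_K23 :: "nat set matroid" where
  "matroid_K23 = graphic_matroid (complete_bipartite_edges {0, 1} {2, 3, 4})"


section \<open>Geometric lattices as families of sets\<close>

text \<open>Here \<open>L\<close> is a finite family of sets which is a lattice under inclusion, but whose meets
  need not be intersections (as happens for upper sublattices). Its top is \<open>\<Union>L\<close> and its bottom
  is \<open>\<Inter>L\<close>. Since the meet of \<open>A\<close> and \<open>B\<close> is the largest member of \<open>L\<close> contained in \<open>A \<inter> B\<close>,
  it is the union of all such members; dually for joins.\<close>

definition lat_meet :: "'a set set \<Rightarrow> 'a set \<Rightarrow> 'a set \<Rightarrow> 'a set" where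
  "lat_meet L A B = \<Union>{C \<in> L. C \<subseteq> A \<inter> B}"

definition lat_Join :: "'a set set \<Rightarrow> 'a set set \<Rightarrow> 'a set" where
  "lat_Join L \<A> = \<Inter>{C \<in> L. \<Union>\<A> \<subseteq> C}"

text \<open>The rank of \<open>F\<close> is its height, i.e. the largest number of members of a chain
  strictly below \<open>F\<close>.\<close>

definition lat_rank :: "'a set set \<Rightarrow> 'a set \<Rightarrow> nat" where
  "lat_rank L F = Max (card ` {C. C \<subseteq> {G \<in> L. G \<subset> F} \<and> Complete_Partial_Order.chain (\<subseteq>) C})"

definition lat_corank :: "'a set set \<Rightarrow> 'a set \<Rightarrow> nat" where
  "lat_corank L F = lat_rank L (\<Union>L) - lat_rank L F"

definition atoms :: "'a set set \<Rightarrow> 'a set set" where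
  "atoms L = {A \<in> L. lat_rank L A = 1}"

definition hyperplanes :: "'a set set \<Rightarrow> 'a set set" where
  "hyperplanes L = {H \<in> L. lat_corank L H = 1}"

text \<open>The simple matroid whose lattice of flats is \<open>L\<close>, realized on the set of atoms of \<open>L\<close>:
  a flat \<open>F \<in> L\<close> corresponds to the set of atoms below \<open>F\<close>.\<close>

definition lat_matroid :: "'a set set \<Rightarrow> 'a set matroid" where
  "lat_matroid L =
     \<lparr>ground = atoms L, indep = {\<A>. \<A> \<subseteq> atoms L \<and> lat_rank L (lat_Join L \<A>) = card \<A>}\<rparr>"

definition has_type :: "'a set set \<Rightarrow> 'b matroid \<Rightarrow> bool" where
  "has_type L N \<longleftrightarrow> matroid_isomorphic (lat_matroid L) N"

definition indecomposable :: "'a set set \<Rightarrow> 'a set \<Rightarrow> bool" where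
  "indecomposable L F \<longleftrightarrow> connected_matroid (contract (lat_matroid L) {A \<in> atoms L. A \<subseteq> F})"


section \<open>Tutte constellations and subconstellations\<close>

definition modular_cut :: "'a matroid \<Rightarrow> 'a set set \<Rightarrow> bool" where
  "modular_cut M \<Gamma> \<longleftrightarrow>
     \<Gamma> \<subseteq> flats M \<and>
     (\<forall>F\<in>\<Gamma>. \<forall>G\<in>flats M. F \<subseteq> G \<longrightarrow> G \<in> \<Gamma>) \<and>
     (\<forall>F\<in>\<Gamma>. \<forall>G\<in>\<Gamma>. rk M F + rk M G = rk M (F \<inter> G) + rk M (cl M (F \<union> G)) \<longrightarrow> F \<inter> G \<in> \<Gamma>)"

type_synonym 'a constellation = "'a set set \<times> 'a set set"

definition tutte_constellation :: "'a matroid \<Rightarrow> 'a constellation \<Rightarrow> bool" where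
  "tutte_constellation M \<tau> \<longleftrightarrow> matroid M \<and> fst \<tau> = flats M \<and> modular_cut M (snd \<tau>)"

definition upper_sublattice :: "'a matroid \<Rightarrow> 'a set set \<Rightarrow> bool" where
  "upper_sublattice M L \<longleftrightarrow>
     (\<exists>I J. I \<subseteq> ground M \<and> J \<subseteq> ground M \<and> I \<inter> J = {} \<and>
            I \<in> indep M \<and> spanning M (ground M - J) \<and>
            L = {cl M S |S. I \<subseteq> S \<and> S \<subseteq> ground M - J})"

definition subconstellations :: "'a matroid \<Rightarrow> 'a constellation \<Rightarrow> 'a constellation set" where
  "subconstellations M \<tau> = {(L, snd \<tau> \<inter> L) |L. upper_sublattice M L}"

definition sub_le :: "'a constellation \<Rightarrow> 'a constellation \<Rightarrow> bool" where
  "sub_le \<sigma> \<sigma>' \<longleftrightarrow> fst \<sigma> \<subseteq> fst \<sigma>'"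

text \<open>In the following, \<open>\<Union>(fst \<tau>)\<close> is the ground set \<open>E\<close>, which is also the top of every
  upper sublattice, and \<open>\<Inter>(fst \<sigma>)\<close> is the bottom of the lattice of \<open>\<sigma>\<close>.\<close>

definition class0 :: "'a constellation \<Rightarrow> 'a constellation \<Rightarrow> bool" where
  "class0 \<tau> \<sigma> \<longleftrightarrow> has_type (fst \<sigma>) (uniform_matroid 1 1) \<and> snd \<sigma> = {\<Union>(fst \<tau>)}"

definition class1 :: "'a constellation \<Rightarrow> 'a constellation \<Rightarrow> bool" where
  "class1 \<tau> \<sigma> \<longleftrightarrow>
     has_type (fst \<sigma>) (uniform_matroid 2 2) \<and> snd \<sigma> = {\<Union>(fst \<tau>)} \<and>
     indecomposable (fst \<tau>) (\<Inter>(fst \<sigma>))"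

definition class2a :: "'a constellation \<Rightarrow> 'a constellation \<Rightarrow> bool" where
  "class2a \<tau> \<sigma> \<longleftrightarrow> has_type (fst \<sigma>) (uniform_matroid 2 3) \<and> snd \<sigma> = {\<Union>(fst \<tau>)}"

definition class2b :: "'a constellation \<Rightarrow> 'a constellation \<Rightarrow> bool" where
  "class2b \<tau> \<sigma> \<longleftrightarrow>
     has_type (fst \<sigma>) (uniform_matroid 3 3) \<and> snd \<sigma> = {\<Union>(fst \<tau>)} \<and>
     (\<forall>F\<in>fst \<sigma>. lat_corank (fst \<sigma>) F = 2 \<longrightarrow> indecomposable (fst \<tau>) F)"

definition class2c :: "'a constellation \<Rightarrow> 'a constellation \<Rightarrow> bool" where
  "class2c \<tau> \<sigma> \<longleftrightarrow>
     has_type (fst \<sigma>) (uniform_matroid 3 4) \<and>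
     (\<exists>H1\<in>hyperplanes (fst \<sigma>). \<exists>H2\<in>hyperplanes (fst \<sigma>).
        H1 \<noteq> H2 \<and> snd \<sigma> = {H1, H2, \<Union>(fst \<tau>)} \<and>
        lat_meet (fst \<sigma>) H1 H2 = \<Inter>(fst \<sigma>))"

text \<open>As \<open>M(K\<^sub>2\<^sub>,\<^sub>3)\<close> has six atoms, the equation with \<open>atoms\<close> says that the six
  pairwise meets of the four hyperplanes are distinct and are exactly the atoms.\<close>

definition class2d :: "'a constellation \<Rightarrow> 'a constellation \<Rightarrow> bool" where
  "class2d \<tau> \<sigma> \<longleftrightarrow>
     has_type (fst \<sigma>) matroid_K23 \<and>
     (\<exists>\<H>. \<H> \<subseteq> hyperplanes (fst \<sigma>) \<and> card \<H> = 4 \<and> snd \<sigma> = insert (\<Union>(fst \<tau>)) \<H> \<and>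
        {lat_meet (fst \<sigma>) H H' |H H'. H \<in> \<H> \<and> H' \<in> \<H> \<and> H \<noteq> H'} = atoms (fst \<sigma>)) \<and>
     (\<forall>F\<in>fst \<sigma>. lat_corank (fst \<sigma>) F = 2 \<longrightarrow> \<not> indecomposable (fst \<sigma>) F \<longrightarrow>
        \<not> indecomposable (fst \<tau>) F)"

definition X2 :: "'a matroid \<Rightarrow> 'a constellation \<Rightarrow> 'a constellation set" where
  "X2 M \<tau> = {\<sigma> \<in> subconstellations M \<tau>.
     class0 \<tau> \<sigma> \<or> class1 \<tau> \<sigma> \<or> class2a \<tau> \<sigma> \<or> class2b \<tau> \<sigma> \<or> class2c \<tau> \<sigma> \<or> class2d \<tau> \<sigma>}"


section \<open>Order complexes and geometric realization\<close>

text \<open>A simplicial complex is given by its set of (nonempty, finite) faces.\<close>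

definition order_complex :: "('v \<Rightarrow> 'v \<Rightarrow> bool) \<Rightarrow> 'v set \<Rightarrow> 'v set set" where
  "order_complex ord P = {C. C \<subseteq> P \<and> finite C \<and> C \<noteq> {} \<and> Complete_Partial_Order.chain ord C}"

text \<open>Points are given by barycentric coordinates. The product topology is the right one for a
  complex with finitely many vertices, which is all that is needed here (see \<open>finite_X2\<close>
  below); for infinite complexes it may be coarser than the weak topology.\<close>

definition geometric_realization :: "'v set set \<Rightarrow> ('v \<Rightarrow> real) topology" where
  "geometric_realization K =
     subtopology (powertop_real UNIV)
       {x. (\<forall>v. 0 \<le> x v) \<and> {v. x v \<noteq> 0} \<in> K \<and> (\<Sum>v | x v \<noteq> 0. x v) = 1}"

definition Sigma2 :: "'a matroid \<Rightarrow> 'a constellation \<Rightarrow> 'a constellation set set" where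
  "Sigma2 M \<tau> = order_complex sub_le (X2 M \<tau>)"

lemma finite_X2:
  assumes "matroid M"
  shows "finite (X2 M \<tau>)"
proof -
  have "X2 M \<tau> \<subseteq> (\<lambda>L. (L, snd \<tau> \<inter> L)) ` Pow (Pow (ground M))"
    unfolding X2_def subconstellations_def upper_sublattice_def cl_def by auto
  then show ?thesis
    using assms unfolding matroid_def by (meson finite_Pow_iff finite_imageI finite_subset)
qed

end

(* A space has trivial first homology if every function on pairs of vertices that is additive on
faces, with values in an arbitrary abelian group, is a difference of values at the vertices: after
subdividing a singular cycle into open vertex stars, one compares each piece with an edge path.

For the poset of the theorem such a cocycle induces, via the elements of class 1, a cochain on the
pairs of hyperplanes off the modular cut that meet in an indecomposable flat of corank 2, and
classes 2a-2d say that its sum around certain triangles and quadrangles vanishes. Tutte's homotopy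
theorem, in this language, is the existence of a potential for the cochain on the off hyperplanes
over K in the restriction to S. It is proved by induction on the corank of K and the size of S. If
S/K is connected and remains so after deleting some e, then a potential for S - e extends to S.
Otherwise there is a series pair s, t, and potentials over K + s and K + t are glued; only there is
class 2d needed. Finally a potential on the elements of class 0 extends to all classes, because the
elements of class 0 below a given element are connected through elements of class 1 below it. *)

theory Submission
  imports Defs
begin

text \<open>A single coefficient group such as the integers would only see the dual of the first
  homology and miss torsion; the criterion is therefore used with the tautological cocycle that
  sends an edge to its class modulo boundaries. Paths of hyperplanes never occur as objects: two
  potentials are compared by a path theorem, which makes their difference constant on the
  hyperplanes off the cut. This theorem and the choice of most auxiliary flats rest on one
  uncrossing result on two modular cuts that together contain every hyperplane over K; besides the
  given cut it is applied to the sets over which a fixed set has least possible relative rank. The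
  obstacle is the comparison of the potentials over K + s and K + t. It takes place on the
  hyperplanes containing s and t, which fall into classes, one for each component of S/(K + s + t),
  with no edge between different classes. The classes are linked by corank 2 flats from which one
  can pass to s alone and to t alone. If the cut blocks all of these, six elements can be found on
  which it has the pattern of class 2d.\<close>

notation insert (infixr "+:" 90)

section \<open>A criterion for trivial first homology\<close>

text \<open>A predicate rather than a type, since the subgroup in question, the bounding chains,
  depends on the space.\<close>

definition add_subgroup :: "'c::ab_group_add set \<Rightarrow> bool" where
 "add_subgroup B \<longleftrightarrow> 0 : B \<and> (\<forall>x\<in>B. \<forall>y\<in>B. x - y : B)"

lemma add_subgroup_zero: "add_subgroup B \<Longrightarrow> 0 : B"
 and add_subgroup_diff: "add_subgroup B \<Longrightarrow> x : B \<Longrightarrow> y : B \<Longrightarrow> x - y : B" by (auto simp: add_subgroup_def)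

lemma add_subgroup_minus: "add_subgroup B \<Longrightarrow> x : B \<Longrightarrow> - x : B"
 using add_subgroup_diff[of B 0 x] add_subgroup_zero[of B] by simp

lemma add_subgroup_add: "add_subgroup B \<Longrightarrow> x : B \<Longrightarrow> y : B \<Longrightarrow> x + y : B"
 using add_subgroup_diff[of B x "- y"] add_subgroup_minus[of B y] by simp

lemma add_subgroup_frag_extend:
 assumes B: "add_subgroup B" and f: "\<And>x. x : Poly_Mapping.keys c \<Longrightarrow> f x : B"
 shows "frag_extend f c : B"
proof -
 have sub: "Poly_Mapping.keys c <= {x. f x : B}" using f by auto
 show ?thesis using sub
 proof (induction c rule: frag_induction)
  case (diff a b)
  thus ?case by (simp add: frag_extend_diff add_subgroup_diff[OF B])
 qed (auto simp: add_subgroup_zero[OF B])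
qed

text \<open>Coefficients in a quotient \<open>'c / B\<close> by a subgroup \<open>B\<close> which is not determined by a type
 are provided by the product of all quotients of \<open>'c\<close>.\<close>

definition uq_rel :: "('c::ab_group_add set \<Rightarrow> 'c) \<Rightarrow> ('c set \<Rightarrow> 'c) \<Rightarrow> bool" where
 "uq_rel f g \<longleftrightarrow> (\<forall>B. add_subgroup B \<longrightarrow> f B - g B : B)"

lemma uq_relD: "uq_rel f g \<Longrightarrow> add_subgroup B \<Longrightarrow> f B - g B : B" by (auto simp: uq_rel_def)

quotient_type (overloaded) 'c uq = "'c::ab_group_add set \<Rightarrow> 'c" / uq_rel
proof (rule equivpI)
 show "reflp (uq_rel :: ('c set \<Rightarrow> 'c) \<Rightarrow> _)" by (auto simp: uq_rel_def reflp_def add_subgroup_zero)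
 show "symp (uq_rel :: ('c set \<Rightarrow> 'c) \<Rightarrow> _)" unfolding uq_rel_def symp_def by (metis add_subgroup_minus minus_diff_eq)
 show "transp (uq_rel :: ('c set \<Rightarrow> 'c) \<Rightarrow> _)"
  unfolding uq_rel_def transp_def by (metis add_subgroup_add diff_add_cancel add_diff_eq)
qed

instantiation uq :: (ab_group_add) ab_group_add
begin

lift_definition zero_uq :: "'a uq" is "\<lambda>_. 0" .

lift_definition plus_uq :: "'a uq \<Rightarrow> 'a uq \<Rightarrow> 'a uq" is "\<lambda>f g B. f B + g B"
 unfolding uq_rel_def by (simp add: add_diff_add add_subgroup_add)

lift_definition uminus_uq :: "'a uq \<Rightarrow> 'a uq" is "\<lambda>f B. - f B"
 unfolding uq_rel_def by (metis add_subgroup_minus minus_diff_minus)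

lift_definition minus_uq :: "'a uq \<Rightarrow> 'a uq \<Rightarrow> 'a uq" is "\<lambda>f g B. f B - g B"
 unfolding uq_rel_def by (metis add_subgroup_diff diff_diff_eq2 diff_add_eq diff_diff_eq add.commute)

instance
proof
 fix a b c :: "'a uq"
 show "a + b + c = a + (b + c)" by transfer (simp add: uq_rel_def add.assoc add_subgroup_zero)
 show "a + b = b + a" by transfer (simp add: uq_rel_def add.commute add_subgroup_zero)
 show "0 + a = a" by transfer (simp add: uq_rel_def add_subgroup_zero)
 show "- a + a = 0" by transfer (simp add: uq_rel_def add_subgroup_zero)
 show "a - b = a + - b" by transfer (simp add: uq_rel_def add_subgroup_zero)
qed

end

text \<open>The quotient map onto \<open>'c / B\<close>, followed by the inclusion of this factor in
  the product of all quotients.\<close>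

lift_definition to_uq :: "'c::ab_group_add set \<Rightarrow> 'c \<Rightarrow> 'c uq" is "\<lambda>B x B'. if B' = B then x else 0" .

lemma to_uq_eqI: "x - y : B \<Longrightarrow> to_uq B x = to_uq B y" by transfer (auto simp: uq_rel_def add_subgroup_zero)

lemma to_uq_add: "to_uq B x + to_uq B y = to_uq B (x + y)" by transfer (auto simp: uq_rel_def add_subgroup_zero)

text \<open>Only the coordinate \<open>B\<close> of the representatives matters. A splitting with
  values in \<open>uq\<close> thus becomes a splitting modulo \<open>B\<close> with values in the
  original group.\<close>

lemma to_uq_eq_diff:
 assumes "add_subgroup B" and "to_uq B x = p - q"
 shows "x - (rep_uq p B - rep_uq q B) : B"
proof -
 have "to_uq B x = abs_uq (\<lambda>B. rep_uq p B - rep_uq q B)"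
  using assms(2) by (metis Quotient3_abs_rep Quotient3_uq minus_uq.abs_eq)
 hence "uq_rel (\<lambda>B'. if B' = B then x else 0) (\<lambda>B. rep_uq p B - rep_uq q B)" by (simp add: to_uq_def uq.abs_eq_iff id_def)
 from uq_relD[OF this assms(1)] show ?thesis by simp
qed

section \<open>First singular homology and starlike sets\<close>

lemma trivial_homology_1I:
 assumes "\<And>c. singular_relcycle 1 X {} c \<Longrightarrow> singular_relboundary 1 X {} c"
 shows "trivial_group (homology_group 1 X)"
proof -
 have "carrier (relative_homology_group (int 1) X {}) = {\<one>\<^bsub>relative_homology_group (int 1) X {}\<^esub>}"
 proof
  show "carrier (relative_homology_group (int 1) X {}) <= {\<one>\<^bsub>relative_homology_group (int 1) X {}\<^esub>}"
   unfolding carrier_relative_homology_group one_relative_homology_group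
   using assms homologous_rel_set_eq_relboundary[of 1 X "{}"] by blast
  show "{\<one>\<^bsub>relative_homology_group (int 1) X {}\<^esub>} <= carrier (relative_homology_group (int 1) X {})"
   using group.is_monoid[OF group_relative_homology_group] monoid.one_closed by blast
 qed
 thus ?thesis using group_relative_homology_group[of "int 1" X "{}"] by (simp add: trivial_group_def)
qed

lemma cycle_bounds_if_trivial_homology:
 assumes "trivial_group (homology_group 1 X)" "singular_relcycle 1 X {} c"
 shows "singular_relboundary 1 X {} c"
proof -
 have "homologous_rel_set 1 X {} c : carrier (relative_homology_group (int 1) X {})"
  unfolding carrier_relative_homology_group using assms(2) by blast
 hence "homologous_rel_set 1 X {} c = singular_relboundary_set 1 X {}"
  using assms(1) one_relative_homology_group[of 1 X "{}"] by (auto simp: trivial_group_def)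
 thus ?thesis using homologous_rel_set_eq_relboundary by blast
qed

text \<open>The straight-line homotopy from the identity to the constant \<open>p\<close>; into a
  product topology its continuity is checked one coordinate at a time.\<close>

lemma starlike_contractible_space:
 fixes T :: "('v \<Rightarrow> real) set"
 assumes p: "p : T"
  and star: "\<And>x t. x : T \<Longrightarrow> 0 \<le> t \<Longrightarrow> t \<le> 1 \<Longrightarrow> (\<lambda>i. (1 - t) * x i + t * p i) : T"
 shows "contractible_space (subtopology (powertop_real UNIV) T)"
proof -
 let ?X = "subtopology (powertop_real UNIV) T"
 let ?I = "top_of_set {0..1::real}"
 have "homotopic_with (\<lambda>_. True) ?X ?X id (\<lambda>_. p)" unfolding homotopic_with_def
 proof (intro exI conjI)
  let ?h = "\<lambda>(t::real, x). \<lambda>i. (1 - t) * x i + t * p i"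
  have "continuous_map (prod_topology ?I ?X) euclideanreal (\<lambda>z. ?h z i)" for i
  proof -
   have 1: "continuous_map (prod_topology ?I ?X) euclideanreal fst"
    using continuous_map_fst[of ?I ?X] continuous_map_into_fulltopology by blast
   have 2: "continuous_map (prod_topology ?I ?X) euclideanreal (\<lambda>z. snd z i)"
    using continuous_map_compose[OF continuous_map_snd[of ?I ?X]
      continuous_map_from_subtopology[OF continuous_map_product_projection[of i UNIV "\<lambda>_. euclideanreal"]]]
    by (simp add: o_def)
   show ?thesis unfolding case_prod_beta by (intro continuous_intros 1 2)
  qed
  hence "continuous_map (prod_topology ?I ?X) (powertop_real UNIV) ?h" by (simp add: continuous_map_componentwise_UNIV)
  thus "continuous_map (prod_topology ?I ?X) ?X ?h" using star by (auto simp: continuous_map_in_subtopology)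
 qed auto
 thus ?thesis unfolding contractible_space_def by blast
qed

text \<open>\<open>c\<close> already bounds inside the contractible set \<open>T\<close>, and
  boundaries in \<open>T\<close> are boundaries in \<open>S\<close>.\<close>

lemma starlike_cycle_bounds:
 fixes T :: "('v \<Rightarrow> real) set"
 assumes "p : T"
  and "\<And>x t. x : T \<Longrightarrow> 0 \<le> t \<Longrightarrow> t \<le> 1 \<Longrightarrow> (\<lambda>i. (1 - t) * x i + t * p i) : T"
  and T: "T <= S"
  and c: "singular_chain 1 (subtopology (powertop_real UNIV) T) c" "chain_boundary 1 c = 0"
 shows "singular_relboundary 1 (subtopology (powertop_real UNIV) S) {} c"
proof -
 have "trivial_group (homology_group 1 (subtopology (powertop_real UNIV) T))"
  using trivial_reduced_homology_group_contractible_space[OF starlike_contractible_space[OF assms(1,2)], of 1]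
   un_reduced_homology_group[of 1 "subtopology (powertop_real UNIV) T"] by simp
 moreover have "singular_relcycle 1 (subtopology (powertop_real UNIV) T) {} c" using c by (simp add: singular_cycle)
 ultimately show ?thesis using cycle_bounds_if_trivial_homology singular_boundary_mono[OF T] by blast
qed

section \<open>Singular edges and their end points\<close>

definition vtx :: "nat \<Rightarrow> nat \<Rightarrow> real" where
 "vtx k = (\<lambda>j. if j = k then 1 else 0)"

text \<open>Restricted to the simplex because singular simplices are extensional functions.\<close>

definition pt :: "'a \<Rightarrow> (nat \<Rightarrow> real) \<Rightarrow> 'a" where
 "pt x = (\<lambda>_\<in>standard_simplex 0. x)"

lemma pt_vtx: "pt x (vtx 0) = x" by (simp add: pt_def vtx_def standard_simplex_0)

lemma vtx_in: "k \<le> p \<Longrightarrow> vtx k : standard_simplex p" unfolding vtx_def by simp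

text \<open>Face 0 omits vertex 0, so it is the end point at \<open>vtx 1\<close>; this fixes the
  signs.\<close>

lemma boundary_edge: "chain_boundary 1 (frag_of \<gamma>) = frag_of (pt (\<gamma> (vtx 1))) - frag_of (pt (\<gamma> (vtx 0)))"
proof -
 have "singular_face 1 0 \<gamma> = pt (\<gamma> (vtx 1))" "singular_face 1 1 \<gamma> = pt (\<gamma> (vtx 0))"
  by (auto simp: singular_face_def pt_def vtx_def standard_simplex_0 simplical_face_def restrict_def fun_eq_iff
    intro!: arg_cong[where f=\<gamma>])
 thus ?thesis by (simp add: chain_boundary_of)
qed

definition seg :: "('v \<Rightarrow> real) \<Rightarrow> ('v \<Rightarrow> real) \<Rightarrow> (nat \<Rightarrow> real) \<Rightarrow> 'v \<Rightarrow> real" where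
 "seg p q = oriented_simplex 1 (\<lambda>j. if j = 0 then p else q)"

lemma seg_vtx: "seg p q (vtx 0) = p" "seg p q (vtx 1) = q"
 using vtx_in[of 0 1] vtx_in[of 1 1] by (auto simp: seg_def oriented_simplex_def vtx_def fun_eq_iff)

lemma boundary_seg: "chain_boundary 1 (frag_of (seg p q)) = frag_of (pt q) - frag_of (pt p)"
 by (simp add: boundary_edge seg_vtx del: One_nat_def)

lemma singular_seg:
 assumes "\<And>t. 0 \<le> t \<Longrightarrow> t \<le> 1 \<Longrightarrow> (\<lambda>i. (1 - t) * p i + t * q i) : T"
 shows "singular_chain 1 (subtopology (powertop_real UNIV) T) (frag_of (seg p q))"
proof -
 have "(\<lambda>x i. \<Sum>j\<le>1. (if j = 0 then p else q) i * x j) ` standard_simplex 1 <= T"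
 proof clarify
  fix x assume x: "x : standard_simplex 1"
  hence "x 0 = 1 - x 1" "0 \<le> x 1" "x 1 \<le> 1" by (auto simp: standard_simplex_def)
  thus "(\<lambda>i. \<Sum>j\<le>1. (if j = 0 then p else q) i * x j) : T" using assms[of "x 1"] by (simp add: mult.commute)
 qed
 thus ?thesis unfolding singular_chain_of seg_def
  by (intro simplicial_imp_singular_simplex) (simp only: simplicial_simplex_oriented_simplex)
qed

definition real_pts :: "'v set set \<Rightarrow> ('v \<Rightarrow> real) set" where
 "real_pts K = {x. (\<forall>v. 0 \<le> x v) \<and> {v. x v \<noteq> 0} : K \<and> (\<Sum>v | x v \<noteq> 0. x v) = 1}"

definition unit_vec :: "'v \<Rightarrow> 'v \<Rightarrow> real" where
 "unit_vec v = (\<lambda>i. if i = v then 1 else 0)"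

section \<open>Cycles in the realization of a simplicial complex\<close>

locale complex =
 fixes K :: "'v set set"
 assumes faces: "\<And>s. s : K \<Longrightarrow> finite s \<and> s \<noteq> {}"
  and subfaces: "\<And>s t. s : K \<Longrightarrow> t <= s \<Longrightarrow> t \<noteq> {} \<Longrightarrow> t : K"
begin

abbreviation X where "X \<equiv> subtopology (powertop_real UNIV) (real_pts K)"

definition bds :: "('v \<Rightarrow> real) chain set" where
 "bds = {c. singular_relboundary 1 X {} c}"

lemma bds_sub: "add_subgroup bds" unfolding add_subgroup_def bds_def using singular_relboundary_diff by auto

text \<open>The union of the two supports is a face and contains the support of every convex
  combination, so all sums can be taken over this one finite set.\<close>

lemma mix:
 assumes x: "x : real_pts K" and p: "p : real_pts K" and un: "{v. x v \<noteq> 0} Un {v. p v \<noteq> 0} : K"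
  and t: "0 \<le> t" "t \<le> 1"
 shows "(\<lambda>i. (1 - t) * x i + t * p i) : real_pts K"
proof -
 let ?y = "\<lambda>i. (1 - t) * x i + t * p i"
 let ?s = "{v. x v \<noteq> 0} Un {v. p v \<noteq> 0}"
 have fin: "finite ?s" using un faces by blast
 have 0: "0 \<le> x v" "0 \<le> p v" for v using x p by (auto simp: real_pts_def)
 have "(\<Sum>v\<in>?s. x v) = (\<Sum>v | x v \<noteq> 0. x v)" "(\<Sum>v\<in>?s. p v) = (\<Sum>v | p v \<noteq> 0. p v)"
  by (intro sum.mono_neutral_right[OF fin]; blast)+
 hence sx: "(\<Sum>v\<in>?s. x v) = 1" "(\<Sum>v\<in>?s. p v) = 1" using x p unfolding real_pts_def by simp_all
 have ysub: "{v. ?y v \<noteq> 0} <= ?s" by auto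
 have "(\<Sum>v\<in>?s. ?y v) = 1" by (simp only: sum.distrib sum_distrib_left[symmetric] sx) simp
 moreover have "(\<Sum>v | ?y v \<noteq> 0. ?y v) = (\<Sum>v\<in>?s. ?y v)" by (rule sum.mono_neutral_left[OF fin ysub]) blast
 ultimately have s1: "(\<Sum>v | ?y v \<noteq> 0. ?y v) = 1" by simp
 hence "{v. ?y v \<noteq> 0} \<noteq> {}" using sum.empty[of ?y] by (metis zero_neq_one)
 from subfaces[OF un ysub this] have "{v. ?y v \<noteq> 0} : K" .
 moreover have "0 \<le> ?y v" for v using 0 t by simp
 ultimately show ?thesis using s1 unfolding real_pts_def by blast
qed

lemma unit_vec_in: "{v} : K \<Longrightarrow> unit_vec v : real_pts K" by (simp add: real_pts_def unit_vec_def)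

definition face where "face s = {x : real_pts K. {v. x v \<noteq> 0} <= s}"
text \<open>The open star of \<open>v\<close>. Openness makes it usable for subdivision; in general
  it is only starlike about the vertex.\<close>

definition star where "star v = {x : real_pts K. x v \<noteq> 0}"

lemma face_convex:
 assumes s: "s : K" and "x : face s" "p : face s" "0 \<le> t" "t \<le> 1"
 shows "(\<lambda>i. (1 - t) * x i + t * p i) : face s"
proof -
 have "{v. x v \<noteq> 0} Un {v. p v \<noteq> 0} \<noteq> {}" and sub: "{v. x v \<noteq> 0} Un {v. p v \<noteq> 0} <= s"
  using assms(2,3) faces by (fastforce simp: face_def real_pts_def)+
 with subfaces[OF s] have "{v. x v \<noteq> 0} Un {v. p v \<noteq> 0} : K" by blast
 hence "(\<lambda>i. (1 - t) * x i + t * p i) : real_pts K" using assms by (intro mix) (auto simp: face_def)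
 moreover have "{v. (1 - t) * x v + t * p v \<noteq> 0} <= {v. x v \<noteq> 0} Un {v. p v \<noteq> 0}" by auto
 ultimately show ?thesis using sub unfolding face_def by blast
qed

lemma star_face: "x : star v \<Longrightarrow> {v} : K" using subfaces[of "{w. x w \<noteq> 0}" "{v}"] by (auto simp: star_def real_pts_def)

text \<open>The coordinate at \<open>v\<close> stays positive, and mixing with the vertex does not
  enlarge the support, which contains \<open>v\<close> already. The first orientation contracts the
  star, the second provides the segments that leave \<open>v\<close>.\<close>

lemma star_convex:
 assumes "x : star v" and t: "0 \<le> t" "t \<le> 1"
 shows "(\<lambda>i. (1 - t) * x i + t * unit_vec v i) : star v"
  and "(\<lambda>i. (1 - t) * unit_vec v i + t * x i) : star v"
proof -
 have x: "x : real_pts K" "x v \<noteq> 0" "0 < x v" using assms(1) by (auto simp: star_def real_pts_def order.strict_iff_order)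
 have u: "{w. x w \<noteq> 0} Un {w. unit_vec v w \<noteq> 0} = {w. x w \<noteq> 0}"
  "{w. unit_vec v w \<noteq> 0} Un {w. x w \<noteq> 0} = {w. x w \<noteq> 0}" using x(2) by (auto simp: unit_vec_def)
 have uv: "unit_vec v : real_pts K" using unit_vec_in star_face assms(1) by blast
 have K: "{w. x w \<noteq> 0} : K" using x by (simp add: real_pts_def)
 have "(1 - t) * x v + t * unit_vec v v > 0" "(1 - t) * unit_vec v v + t * x v > 0"
 proof -
  have "(1 - t) * x v + t * 1 > 0" "(1 - t) * 1 + t * x v > 0"
   using x(3) t by (cases "t = 1"; cases "t = 0"; simp add: add_nonneg_pos add_pos_nonneg)+
  thus "(1 - t) * x v + t * unit_vec v v > 0" "(1 - t) * unit_vec v v + t * x v > 0" by (simp_all add: unit_vec_def)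
 qed
 moreover have "(\<lambda>i. (1 - t) * x i + t * unit_vec v i) : real_pts K" by (rule mix[OF x(1) uv _ t]) (simp only: u K)
 moreover have "(\<lambda>i. (1 - t) * unit_vec v i + t * x i) : real_pts K" by (rule mix[OF uv x(1) _ t]) (simp only: u K)
 ultimately show "(\<lambda>i. (1 - t) * x i + t * unit_vec v i) : star v"
  "(\<lambda>i. (1 - t) * unit_vec v i + t * x i) : star v" by (simp_all add: star_def)
qed

lemma openin_star: "openin X (star v)"
proof -
 have "openin (powertop_real UNIV) {x : topspace (powertop_real UNIV). x v : - {0}}"
  by (rule openin_continuous_map_preimage[OF continuous_map_product_projection]) auto
 hence "openin X ({x. x v \<noteq> 0} Int real_pts K)" by (intro openin_subtopology_Int) simp
 moreover have "{x. x v \<noteq> 0} Int real_pts K = star v" by (auto simp: star_def)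
 ultimately show ?thesis by simp
qed

lemma face_cycle:
 assumes "s : K" "singular_chain 1 (subtopology (powertop_real UNIV) (face s)) c" "chain_boundary 1 c = 0"
 shows "c : bds"
proof -
 obtain v where v: "v : s" using faces[OF assms(1)] by blast
 hence "{v} : K" using subfaces[OF assms(1)] by blast
 hence "unit_vec v : face s" using v unit_vec_in by (auto simp: face_def unit_vec_def)
 moreover have "face s <= real_pts K" by (auto simp: face_def)
 ultimately have "singular_relboundary 1 X {} c"
  using starlike_cycle_bounds[OF _ face_convex[OF assms(1)] _ assms(2,3)] by blast
 thus ?thesis by (simp add: bds_def)
qed

lemma star_cycle:
 assumes "x : star v" "singular_chain 1 (subtopology (powertop_real UNIV) (star v)) c" "chain_boundary 1 c = 0"
 shows "c : bds"
proof -
 have "unit_vec v : star v" using unit_vec_in star_face[OF assms(1)] by (auto simp: star_def unit_vec_def)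
 moreover have "star v <= real_pts K" by (auto simp: star_def)
 ultimately have "singular_relboundary 1 X {} c" using starlike_cycle_bounds[OF _ star_convex(1) _ assms(2,3)] by blast
 thus ?thesis by (simp add: bds_def)
qed

abbreviation e where "e v w \<equiv> frag_of (seg (unit_vec v) (unit_vec w))"

lemma face_seg: "s : K \<Longrightarrow> p : face s \<Longrightarrow> q : face s \<Longrightarrow>
  singular_chain 1 (subtopology (powertop_real UNIV) (face s)) (frag_of (seg p q))" by (intro singular_seg face_convex)

lemma unit_face: "s : K \<Longrightarrow> v : s \<Longrightarrow> unit_vec v : face s"
 using unit_vec_in[of v] subfaces[of s "{v}"] by (auto simp: face_def unit_vec_def)

text \<open>A loop inside one convex face bounds.\<close>

lemma triangle:
 assumes "s : K" "p : face s" "q : face s" "z : face s"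
 shows "frag_of (seg p q) + frag_of (seg q z) - frag_of (seg p z) : bds"
proof (rule face_cycle[OF assms(1)])
 show "singular_chain 1 (subtopology (powertop_real UNIV) (face s))
   (frag_of (seg p q) + frag_of (seg q z) - frag_of (seg p z))"
  by (intro singular_chain_add singular_chain_diff face_seg assms)
qed (simp only: chain_boundary_add chain_boundary_diff boundary_seg, simp)

text \<open>\<open>f v\<close> plays the role of a chain from a base point to \<open>v\<close>,
  compatible with edges up to boundaries. A homologous cycle of small simplices is, modulo
  boundaries, a sum of end-point differences of one function, and such a sum depends on the boundary
  of the cycle only.\<close>

lemma cycle_bounds:
 fixes f :: "'v \<Rightarrow> ('v \<Rightarrow> real) chain"
 assumes f: "\<And>v w. {v, w} : K \<Longrightarrow> e v w - (f w - f v) : bds"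
  and c: "singular_chain 1 X c" "chain_boundary 1 c = 0"
 shows "c : bds"
proof -
 \<comment> \<open>The chain to \<open>v\<close> is prolonged by the segment from \<open>v\<close>
   to \<open>x\<close>; \<open>g\<close> does this with an arbitrarily chosen vertex of the support
   of \<open>x\<close>.\<close>
 define h where "h v x = f v + frag_of (seg (unit_vec v) x)" for v x
 define g where "g x = h (SOME v. x v \<noteq> 0) x" for x
 have hh: "h v x - h w x : bds" if "x : real_pts K" "x v \<noteq> 0" "x w \<noteq> 0" for v w x
 proof -
  let ?s = "{u. x u \<noteq> 0}"
  have s: "?s : K" using that(1) by (simp add: real_pts_def)
  have fc: "x : face ?s" "unit_vec v : face ?s" "unit_vec w : face ?s" using that unit_face[OF s] by (auto simp: face_def)
  have "{w, v} : K" using subfaces[OF s] that by auto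
  from add_subgroup_diff[OF bds_sub triangle[OF s fc(3,2,1)] f[OF this]] show ?thesis by (simp add: h_def algebra_simps)
 qed
 have gh: "g x - h v x : bds" if "x : star v" for x v
 proof -
  have "x v \<noteq> 0" "x : real_pts K" using that by (auto simp: star_def)
  thus ?thesis unfolding g_def using hh someI[of "\<lambda>v. x v \<noteq> 0"] by blast
 qed
 have edge: "frag_of \<gamma> - (g (\<gamma> (vtx 1)) - g (\<gamma> (vtx 0))) : bds"
  if \<gamma>: "singular_simplex 1 X \<gamma>" and im: "\<gamma> : standard_simplex 1 \<rightarrow> star v" for \<gamma> v
 proof -
  have st: "\<gamma> (vtx 1) : star v" "\<gamma> (vtx 0) : star v" using im vtx_in[of 0 1] vtx_in[of 1 1] by (auto simp: Pi_iff)
  have sub: "star v <= real_pts K" by (auto simp: star_def)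
  let ?c = "frag_of \<gamma> + frag_of (seg (unit_vec v) (\<gamma> (vtx 0))) - frag_of (seg (unit_vec v) (\<gamma> (vtx 1)))"
  have \<gamma>': "singular_chain 1 (subtopology (powertop_real UNIV) (star v)) (frag_of \<gamma>)"
   using \<gamma> im unfolding singular_chain_of singular_simplex_subtopology by blast
  have "?c : bds"
  proof (rule star_cycle[OF st(1)])
   show "singular_chain 1 (subtopology (powertop_real UNIV) (star v)) ?c"
    by (intro singular_chain_add singular_chain_diff singular_seg star_convex st \<gamma>')
   show "chain_boundary 1 ?c = 0"
    unfolding chain_boundary_add chain_boundary_diff boundary_seg unfolding boundary_edge by simp
  qed
  from add_subgroup_diff[OF bds_sub this add_subgroup_diff[OF bds_sub gh[OF st(1)] gh[OF st(2)]]]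
  show ?thesis by (simp add: h_def algebra_simps)
 qed
 have cyc: "singular_relcycle 1 X {} c" using c by (simp add: singular_cycle)
 have cover: "topspace X <= \<Union>(range star)"
 proof
  fix x assume "x : topspace X"
  hence x: "x : real_pts K" by simp
  hence "{v. x v \<noteq> 0} \<noteq> {}" using faces by (auto simp: real_pts_def)
  thus "x : \<Union>(range star)" using x by (auto simp: star_def)
 qed
 \<comment> \<open>Subdivision: every simplex of the homologous cycle \<open>c'\<close> lies in one
   vertex star.\<close>
 obtain c' where c': "singular_relcycle 1 X {} c'" "homologous_rel 1 X {} c c'"
  "\<And>\<gamma>. \<gamma> : Poly_Mapping.keys c' \<Longrightarrow> \<exists>V\<in>range star. \<gamma> : standard_simplex 1 \<rightarrow> V"
  using small_homologous_rel_relcycle_exists[OF _ cover cyc] openin_star by blast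
 let ?F = "\<lambda>\<gamma>. frag_of \<gamma> - (g (\<gamma> (vtx 1)) - g (\<gamma> (vtx 0)))"
 have "singular_chain 1 X c'" "chain_boundary 1 c' = 0" using c'(1) by (auto simp: singular_cycle)
 hence "frag_extend ?F c' : bds"
  using edge c'(3) by (intro add_subgroup_frag_extend bds_sub) (fastforce simp: singular_chain_def)
 \<comment> \<open>Summing end-point differences over a chain evaluates \<open>g\<close> on its
   boundary.\<close>
 moreover have "frag_extend ?F d = d - frag_extend (\<lambda>\<sigma>. g (\<sigma> (vtx 0))) (chain_boundary 1 d)" for d using subset_UNIV
 proof (induction d rule: frag_induction)
  case (one \<gamma>)
  thus ?case by (simp add: boundary_edge frag_extend_diff pt_vtx del: One_nat_def)
 next
  case (diff a b)
  thus ?case by (simp add: chain_boundary_diff frag_extend_diff)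
 qed simp
 ultimately have "c' : bds" using \<open>chain_boundary 1 c' = 0\<close> by simp
 moreover have "c - c' : bds" using c'(2) by (simp add: homologous_rel_def bds_def)
 ultimately show ?thesis using add_subgroup_add[OF bds_sub] by fastforce
qed

end

text \<open>The splitting hypothesis is applied to one cocycle, the class of the edge from
  \<open>u\<close> to \<open>v\<close> modulo boundaries, which is additive on faces because
  triangles bound. The type \<open>uq\<close> is what makes its coefficient group available.\<close>

theorem trivial_homology_1_if_cocycles_split:
 fixes K :: "'v set set"
 assumes "\<And>s. s : K \<Longrightarrow> finite s \<and> s \<noteq> {}"
  and "\<And>s t. s : K \<Longrightarrow> t <= s \<Longrightarrow> t \<noteq> {} \<Longrightarrow> t : K"
  and split: "\<And>a :: 'v \<Rightarrow> 'v \<Rightarrow> ('v \<Rightarrow> real) chain uq.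
   (\<And>u v w. {u, v, w} : K \<Longrightarrow> a u v + a v w = a u w) \<Longrightarrow>
   \<exists>f. \<forall>u v. {u, v} : K \<longrightarrow> a u v = f v - f u"
 shows "trivial_group (homology_group 1 (geometric_realization K))"
proof -
 interpret complex K using assms(1,2) by unfold_locales
 have "to_uq bds (e u v) + to_uq bds (e v w) = to_uq bds (e u w)" if "{u, v, w} : K" for u v w
  unfolding to_uq_add by (rule to_uq_eqI, rule triangle[OF that]) (auto intro: unit_face[OF that])
 then obtain f where f: "\<And>u v. {u, v} : K \<Longrightarrow> to_uq bds (e u v) = f v - f u" using split[of "\<lambda>u v. to_uq bds (e u v)"] by blast
 have "c : bds" if "singular_relcycle 1 X {} c" for c
  using cycle_bounds[of "\<lambda>v. rep_uq (f v) bds" c] to_uq_eq_diff[OF bds_sub f] that by (auto simp: singular_cycle)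
 hence "trivial_group (homology_group 1 X)" by (intro trivial_homology_1I) (auto simp: bds_def)
 thus ?thesis by (simp add: geometric_realization_def real_pts_def)
qed

section \<open>Rank functions, connectivity and modular cuts\<close>

text \<open>Restriction to \<open>S\<close> and contraction of \<open>K\<close> are expressed by
  considering the sets between \<open>K\<close> and \<open>S\<close>; no minor is formed in this
  part.\<close>

locale rank_fun =
 fixes r :: "'a set \<Rightarrow> nat"
 assumes mono: "X <= Y \<Longrightarrow> r X \<le> r Y"
  and submod: "r (X Un Y) + r (X Int Y) \<le> r X + r Y"
  and unit: "r (x+:X) \<le> Suc (r X)"
begin

text \<open>A closure in the whole type. In the application everything outside the ground set is a
  loop and lies in every \<open>C X\<close>.\<close>

definition C :: "'a set \<Rightarrow> 'a set" where
 "C X = {x. r (x+:X) = r X}"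

lemma C_iff: "x : C X \<longleftrightarrow> r (x+:X) = r X" by (simp add: C_def)

lemma mono_insert: "r X \<le> r (x+:X)" by (rule mono) auto

lemma r_in: "x : C X \<Longrightarrow> r (x+:X) = r X" by (simp add: C_def)

lemma r_notin: "x ~: C X \<Longrightarrow> r (x+:X) = Suc (r X)" using unit[of x X] mono_insert[of X x] by (auto simp: C_def)

lemma subset_C: "X <= C X" by (auto simp: C_def insert_absorb)

lemma C_mono: assumes "X <= Y" shows "C X <= C Y"
proof
 fix x assume "x : C X"
 hence 1: "r (x+:X) = r X" by (simp add: C_def)
 have "x+:X Un Y = x+:Y" using assms by auto
 with submod[of "x+:X" Y] 1 mono[of X "x+:X Int Y"] assms mono[of Y "x+:Y"]
 have "r (x+:Y) = r Y" by fastforce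
 thus "x : C Y" by (simp add: C_def)
qed

lemma C_eqI: assumes "X <= Y" "r Y = r X" shows "C Y = C X"
proof
 show "C X <= C Y" using C_mono assms by auto
 show "C Y <= C X"
 proof
  fix y assume "y : C Y"
  hence "r (y+:Y) = r Y" by (simp add: C_def)
  moreover have "r (y+:X) \<le> r (y+:Y)" by (rule mono) (use assms in auto)
  ultimately have "r (y+:X) = r X" using assms mono_insert[of X y] by auto
  thus "y : C X" by (simp add: C_def)
 qed
qed

text \<open>\<open>C X\<close> may be infinite, and then the axioms do not control its rank;
  closures are therefore used through finite subsets.\<close>

lemma r_Un_C: assumes "finite T" "T <= C X" shows "r (X Un T) = r X" using assms
proof (induction T rule: finite_induct)
 case (insert t T)
 hence "r (X Un T) = r X" by auto
 moreover have "t : C (X Un T)" using insert C_mono[of X "X Un T"] by auto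
 ultimately show ?case by (simp add: C_iff)
qed simp

lemma r_between_C: "\<lbrakk>finite Y; X <= Y; Y <= C X\<rbrakk> \<Longrightarrow> r Y = r X" by (metis r_Un_C sup.absorb_iff2)

lemma C_between: "\<lbrakk>finite Y; X <= Y; Y <= C X\<rbrakk> \<Longrightarrow> C Y = C X" by (intro C_eqI r_between_C) auto

lemma C_insert_in: "x : C X \<Longrightarrow> C (x+:X) = C X" by (intro C_eqI) (auto simp: C_iff)

lemma C_subset_C: "\<lbrakk>finite Y; Y <= C X\<rbrakk> \<Longrightarrow> C Y <= C X"
 using C_between[of "X Un Y" X] C_mono[of Y "X Un Y"] subset_C[of X] r_Un_C[of Y X]
  C_eqI[of X "X Un Y"] by auto

lemma r_le_C: "\<lbrakk>finite Y; Y <= C X\<rbrakk> \<Longrightarrow> r Y \<le> r X" using r_Un_C[of Y X] mono[of Y "X Un Y"] by auto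

lemma r_cong_C: assumes "finite X" "finite Y" "C X = C Y" shows "r X = r Y"
proof (rule antisym)
 show "r X \<le> r Y" using subset_C[of X] assms by (intro r_le_C) auto
 show "r Y \<le> r X" using subset_C[of Y] assms by (intro r_le_C) auto
qed

lemma C_Un_cong: assumes "finite X" "finite Y" "C X = C Y" shows "C (X Un Z) = C (Y Un Z)"
proof -
 have "C (X Un Z) <= C (Y Un Z)" if "finite X" "X <= C Y" for X Y
 proof -
  have "X <= C (Y Un Z)" using that C_mono[of Y "Y Un Z"] by auto
  hence "r (Y Un Z Un X) = r (Y Un Z)" using r_Un_C that by blast
  hence "C (Y Un Z Un X) = C (Y Un Z)" by (intro C_eqI) auto
  moreover have "C (X Un Z) <= C (Y Un Z Un X)" by (intro C_mono) auto
  ultimately show ?thesis by simp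
 qed
 from this[of X Y] this[of Y X] show ?thesis using assms subset_C[of X] subset_C[of Y] by auto
qed

lemma exch: assumes "y : C (x+:X)" "y ~: C X" shows "x : C (y+:X)"
proof -
 have "r (y+:x+:X) = r (x+:X)" using assms by (simp add: C_iff)
 moreover have "r (y+:X) = Suc (r X)" using assms r_notin by auto
 moreover have "r (y+:X) \<le> r (x+:y+:X)" by (rule mono) auto
 ultimately show ?thesis using unit[of x X] by (simp add: C_iff insert_commute)
qed

text \<open>The form in which submodularity is used throughout: a cover of \<open>S\<close> by two
  sets over \<open>W\<close> has nonnegative excess \<open>r A + r B - r S - r W\<close>.
  Separations are the covers of excess zero.\<close>

lemma cover_ge: assumes "A Un B = S" "W <= A" "W <= B" shows "r S + r W \<le> r A + r B"
 using submod[of A B] mono[of W "A Int B"] assms by auto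

lemma ex_notin_C: assumes "finite S" "K <= S" "r K < r S" shows "\<exists>x\<in>S. x ~: C K" using r_between_C[of S K] assms by auto

lemma ex_pair_notin_C: assumes "finite S" "K <= S" "r K + 2 \<le> r S"
 shows "\<exists>x\<in>S. \<exists>y\<in>S. x ~: C K \<and> y ~: C (x+:K)"
proof -
 obtain x where x: "x : S" "x ~: C K" using ex_notin_C[of S K] assms by auto
 hence "r (x+:K) < r S" using r_notin[of x K] assms by auto
 thus ?thesis using ex_notin_C[of S "x+:K"] x assms by auto
qed

text \<open>A modular cut carried by sets instead of flats: \<open>g X\<close> stands for "the
  closure of \<open>X\<close> is in the cut". Hence the second clause, which allows passing to
  subsets of the same rank; the third one is the condition on modular pairs.\<close>

definition cut :: "'a set \<Rightarrow> ('a set \<Rightarrow> bool) \<Rightarrow> bool" where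
 "cut S g \<longleftrightarrow>
   (\<forall>X Y. X <= Y \<longrightarrow> Y <= S \<longrightarrow> g X \<longrightarrow> g Y) \<and>
   (\<forall>X Y. X <= Y \<longrightarrow> Y <= S \<longrightarrow> r Y = r X \<longrightarrow> g Y \<longrightarrow> g X) \<and>
   (\<forall>X Y. X <= S \<longrightarrow> Y <= S \<longrightarrow> g X \<longrightarrow> g Y \<longrightarrow> r X + r Y = r (X Un Y) + r (X Int Y) \<longrightarrow> g (X Int Y))"

lemma cut_subset: assumes "cut S g" "T <= S" shows "cut T g"
proof -
 have "X <= S" if "X <= T" for X using that assms by auto
 thus ?thesis using assms(1) unfolding cut_def by (intro conjI) simp_all
qed

lemma cut_mono: "\<lbrakk>cut S g; X <= Y; Y <= S; g X\<rbrakk> \<Longrightarrow> g Y" unfolding cut_def by (drule conjunct1) blast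

lemma cut_down: "\<lbrakk>cut S g; X <= Y; Y <= S; r Y = r X; g Y\<rbrakk> \<Longrightarrow> g X" unfolding cut_def by (drule conjunct2, drule conjunct1) blast

text \<open>Submodularity supplies the opposite inequality, so \<open>X\<close> and \<open>Y\<close>
  are a modular pair and \<open>W\<close> has the rank of their intersection.\<close>

lemma cut_meet:
 assumes "cut S g" "X <= S" "Y <= S" "g X" "g Y" "W <= X" "W <= Y" "r X + r Y \<le> r (X Un Y) + r W"
 shows "g W"
proof -
 have W: "r W \<le> r (X Int Y)" using mono assms by auto
 with submod[of X Y] assms have "r X + r Y = r (X Un Y) + r (X Int Y)" "r (X Int Y) = r W" by auto
 moreover from this have "g (X Int Y)" using assms unfolding cut_def by simp
 ultimately show ?thesis using cut_down[OF assms(1), of W "X Int Y"] assms by auto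
qed

lemma cut_cong: assumes "cut S g" "X <= S" "Y <= S" "finite S" "C X = C Y" shows "g X = g Y"
proof -
 have f: "finite X" "finite Y" using assms(2,3,4) by (auto intro: finite_subset)
 have 1: "r X = r Y" by (rule r_cong_C[OF f assms(5)])
 have "Y <= C X" using subset_C[of Y] assms(5) by simp
 hence 2: "r (X Un Y) = r X" by (rule r_Un_C[OF f(2)])
 have u: "X Un Y <= S" using assms(2,3) by blast
 have "g X \<longleftrightarrow> g (X Un Y)" using cut_mono[OF assms(1) Un_upper1 u] cut_down[OF assms(1) Un_upper1 u 2] by blast
 moreover have "g Y \<longleftrightarrow> g (X Un Y)" using cut_mono[OF assms(1) Un_upper2 u] cut_down[OF assms(1) Un_upper2 u] 1 2 by simp blast
 ultimately show ?thesis by blast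
qed

text \<open>Two non-parallel points over \<open>L\<close> are a modular pair meeting in
  \<open>L\<close>. Read backwards: over a set off the cut, one of two such points is off the
  cut.\<close>

lemma cut_point:
 assumes "cut S g" "L <= S" "x : S" "y : S" "y ~: C (x+:L)"
  "g (x+:L)" "g (y+:L)"
 shows "g L"
proof (rule cut_meet[OF assms(1), of "x+:L" "y+:L"])
 have "r (y+:x+:L) = Suc (r (x+:L))" using r_notin assms by auto
 moreover have "x+:L Un y+:L = y+:x+:L" by auto
 ultimately show "r (x+:L) + r (y+:L) \<le> r (x+:L Un y+:L) + r L" using unit[of y L] by auto
qed (use assms in auto)

text \<open>Uncrossing: a pair \<open>A, B\<close> over a point \<open>p\<close> with \<open>A\<close> minimal either yields the desired
 separation of \<open>S\<close> when crossed with a pair over a second point, or can be made smaller.\<close>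

theorem two_cuts:
 assumes fin: "finite S" and "K <= S" and g1: "cut S g1" and g2: "cut S g2" and "g1 S" "g2 S"
  and cov: "\<And>H. K <= H \<Longrightarrow> H <= S \<Longrightarrow> Suc (r H) = r S \<Longrightarrow> g1 H \<or> g2 H"
 shows "\<exists>A B. K <= A \<and> K <= B \<and> A Un B = S \<and> r A + r B = r S + r K \<and> g1 A \<and> g2 B" using \<open>K <= S\<close> cov
proof (induction "r S - r K" arbitrary: K rule: less_induct)
 case less
 note KS = less.prems(1) and cov = less.prems(2)
 have rKS: "r K \<le> r S" using mono KS by auto
 consider "r S = r K" | "r S = Suc (r K)" | "r K + 2 \<le> r S" using rKS by linarith
 thus ?case
 proof cases
  case 1 thus ?thesis using KS assms by (intro exI[of _ S]) auto
 next
  case 2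
  hence "g1 K \<or> g2 K" using cov[of K] KS by auto
  moreover have "g1 K \<Longrightarrow> ?thesis" by (intro exI[of _ K] exI[of _ S]) (use KS assms in auto)
  moreover have "g2 K \<Longrightarrow> ?thesis" by (intro exI[of _ S] exI[of _ K]) (use KS assms in auto)
  ultimately show ?thesis by blast
 next
  case 3
  let ?G = "\<exists>A B. K <= A \<and> K <= B \<and> A Un B = S \<and> r A + r B = r S + r K \<and> g1 A \<and> g2 B"
  show ?G
  proof (rule ccontr)
   assume neg: "\<not> ?G"
   have ng1: "\<not> g1 K"
   proof
    assume "g1 K"
    hence ?G by (intro exI[of _ K] exI[of _ S]) (use KS assms in auto)
    thus False using neg by blast
   qed
   \<comment> \<open>The induction hypothesis over \<open>p+:K\<close> yields a cover whose excess
     over \<open>K\<close> is 1 instead of 0.\<close>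
   define valid where "valid p A B \<longleftrightarrow> p : S \<and> p ~: C K \<and> p+:K <= A \<and> p+:K <= B \<and>
    A Un B = S \<and> r A + r B = Suc (r S + r K) \<and> g1 A \<and> g2 B" for p A B
   have ex_valid: "\<exists>A B. valid p A B" if "p : S" "p ~: C K" for p
   proof -
    have "r (p+:K) = Suc (r K)" using that r_notin by auto
    hence "\<exists>A B. p+:K <= A \<and> p+:K <= B \<and> A Un B = S \<and>
      r A + r B = r S + r (p+:K) \<and> g1 A \<and> g2 B" using 3 that KS cov by (intro less.hyps) auto
    thus ?thesis using that r_notin[of p K] unfolding valid_def by auto
   qed
   have not_two: False if "p : S" "q : S" "q ~: C (p+:K)" "g1 (p+:K)" "g1 (q+:K)" for p q
    using cut_point[OF g1 KS that(1,2,3,4,5)] ng1 by auto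
   have down1: "g1 (p+:K)" if "valid p A B" "r A \<le> Suc (r K)" for p A B
    using that cut_down[OF g1, of "p+:K" A] r_notin[of p K] mono[of "p+:K" A] unfolding valid_def by auto
   \<comment> \<open>First parts that are larger than a point over \<open>K\<close>. A first part of
     rank at most \<open>r K + 1\<close> puts \<open>p+:K\<close> in the first cut, which by
     \<open>not_two\<close> cannot happen for two non-parallel points.\<close>
   define VP where "VP = {A. \<exists>p B. valid p A B \<and> r K + 2 \<le> r A}"
   show False
   proof (cases "VP = {}")
    case True
    have "g1 (p+:K)" if p: "p : S" "p ~: C K" for p
    proof -
     obtain A B where v: "valid p A B" using ex_valid[OF p] by blast
     hence "\<not> r K + 2 \<le> r A" using \<open>VP = {}\<close> unfolding VP_def by blast
     thus ?thesis using down1[OF v] by simp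
    qed
    moreover obtain x y where "x : S" "y : S" "x ~: C K" "y ~: C (x+:K)" using ex_pair_notin_C[OF fin KS 3] by blast
    moreover from this have "y ~: C K" using C_mono[of K "x+:K"] by auto
    ultimately show False using not_two by blast
   next
    case False
    then obtain A where "A : VP" and minA: "\<And>A'. A' : VP \<Longrightarrow> card A \<le> card A'"
     using ex_has_least_nat[of "\<lambda>A. A : VP" _ card] by blast
    then obtain p B where v: "valid p A B" and rA: "r K + 2 \<le> r A" unfolding VP_def by auto
    have AB: "A Un B = S" "r A + r B = Suc (r S + r K)" "p : A" "p : B" "K <= A" "K <= B"
     "g1 A" "g2 B" "A <= S" "B <= S" "p ~: C K" "p : S" using v unfolding valid_def by auto
    have q1: "g1 (q+:K)" if q: "q : A" "q ~: C B" for q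
    proof -
     have qK: "q ~: C K" "q : S" "q ~: C (p+:K)" using q AB C_mono[of K B] C_mono[of "p+:K" B] by auto
     obtain A' B' where v': "valid q A' B'" using ex_valid qK by blast
     have AB': "A' Un B' = S" "r A' + r B' = Suc (r S + r K)" "q : A'" "q : B'" "K <= A'" "K <= B'"
      "g1 A'" "g2 B'" "A' <= S" "B' <= S" using v' unfolding valid_def by auto
     \<comment> \<open>Crossing the two covers produces two new covers whose total excess over
       \<open>K\<close> is at most 2.\<close>
     have sub: "r (A Un A') + r (A Int A') \<le> r A + r A'" "r (B Un B') + r (B Int B') \<le> r B + r B'" using submod by auto
     have c1: "(A Int A') Un (B Un B') = S" "(A Un A') Un (B Int B') = S" using AB(1) AB'(1) by auto
     have rq: "r (q+:K) = Suc (r K)" using r_notin qK by auto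
     note ss = AB(3,4,5,6,9,10,11,12) AB'(3,4,5,6,9,10)
     show ?thesis
     proof (cases "p : A'")
      case True
      \<comment> \<open>Both points lie in \<open>A Int A'\<close> and in \<open>B Un B'\<close>, so
        this cover takes the whole excess 2. The other cover has none and is the one assumed not to
        exist.\<close>
      have "r (q+:p+:K) = r K + 2" using r_notin[OF qK(3)] r_notin[OF AB(11)] by simp
      moreover have "q+:p+:K <= A Int A'" "q+:p+:K <= B Un B'" using True q(1) ss by blast+
      ultimately have "r S + (r K + 2) \<le> r (A Int A') + r (B Un B')" using cover_ge[OF c1(1), of "q+:p+:K"] by simp
      moreover have "r S + r K \<le> r (A Un A') + r (B Int B')" by (rule cover_ge[OF c1(2), of K]) (use ss in blast)+
      ultimately have e: "r (A Un A') + r (B Int B') = r S + r K" "r B + r B' = r (B Un B') + r (B Int B')"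
       using sub AB(2) AB'(2) by linarith+
      have "g2 (B Int B')" by (rule cut_meet[OF g2 AB(10) AB'(10) AB(8) AB'(8)]) (use e in auto)
      moreover have "g1 (A Un A')" by (rule cut_mono[OF g1 _ _ AB(7)]) (use ss in blast)+
      moreover have "K <= A Un A'" "K <= B Int B'" using ss by blast+
      ultimately have ?G using e(1) c1(2) by blast
      thus ?thesis using neg by blast
     next
      case False
      hence pB: "p : B'" using AB(12) AB'(1) by blast
      have "q+:K <= A Int A'" "q+:K <= B Un B'" using q(1) ss by blast+
      hence "r S + Suc (r K) \<le> r (A Int A') + r (B Un B')" using cover_ge[OF c1(1), of "q+:K"] rq by simp
      moreover have "p+:K <= A Un A'" "p+:K <= B Int B'" using pB ss by blast+
      hence "r S + Suc (r K) \<le> r (A Un A') + r (B Int B')" using cover_ge[OF c1(2), of "p+:K"] r_notin[OF AB(11)] by simp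
      \<comment> \<open>Now each new cover has excess exactly 1, and \<open>A Int A'\<close>, which
        misses \<open>p\<close>, is a valid first part over \<open>q\<close>. Minimality of
        \<open>A\<close> leaves only the case of a point.\<close>
      ultimately have e: "r (A Int A') + r (B Un B') = Suc (r S + r K)"
        "r A + r A' = r (A Un A') + r (A Int A')" using sub AB(2) AB'(2) by linarith+
      have "g1 (A Int A')" by (rule cut_meet[OF g1 AB(9) AB'(9) AB(7) AB'(7)]) (use e in auto)
      moreover have "g2 (B Un B')" by (rule cut_mono[OF g2 _ _ AB(8)]) (use ss in blast)+
      moreover have "q+:K <= A Int A'" "q+:K <= B Un B'" using q(1) ss by blast+
      ultimately have vv: "valid q (A Int A') (B Un B')" unfolding valid_def using qK(1,2) e(1) c1(1) by blast
      have "A Int A' \<subset> A" using False AB(3) by blast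
      hence "card (A Int A') < card A" using psubset_card_mono finite_subset[OF AB(9) fin] by blast
      hence "A Int A' ~: VP" using minA[of "A Int A'"] by auto
      hence "\<not> r K + 2 \<le> r (A Int A')" using vv unfolding VP_def by blast
      thus ?thesis using down1[OF vv] by simp
     qed
    qed
    have "A - C B \<noteq> {}"
    proof
     assume "A - C B = {}"
     hence "S <= C B" using AB(1) subset_C[of B] by blast
     hence "r S = r B" using r_between_C[of S B] fin AB(10) by blast
     thus False using AB(2) rA by linarith
    qed
    then obtain q where q: "q : A" "q ~: C B" by blast
    \<comment> \<open>All of \<open>A\<close> outside \<open>C B\<close> is parallel to
      \<open>q\<close>. These elements go to one side with \<open>q\<close>, the rest of
      \<open>A\<close> joins \<open>B\<close>.\<close>
    have qs: "A - C B <= C (q+:K)" using not_two[of q] q1 q AB(9) by blast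
    let ?A = "q+:K Un (A - C B)" and ?B = "B Un (A Int C B)"
    have fA: "finite A" using AB(9) fin by (rule finite_subset)
    have "q ~: C K" using q C_mono[OF AB(6)] by blast
    hence r1: "r ?A = Suc (r K)" using r_Un_C[OF _ qs] fA r_notin by simp
    have r2: "r ?B = r B" using r_Un_C[of "A Int C B" B] fA by simp
    have un: "?A Un ?B = S" using AB(1,5,6) q by blast
    have kk: "K <= ?A" "K <= ?B" using AB(6) by blast+
    have "r S + r K \<le> r ?A + r ?B" by (rule cover_ge[OF un kk])
    hence "r ?A + r ?B = r S + r K" using r1 r2 AB(2) rA by linarith
    moreover have "g1 ?A" by (rule cut_mono[OF g1 _ _ q1[OF q]]) (use un in blast)+
    moreover have "g2 ?B" by (rule cut_mono[OF g2 _ _ AB(8)]) (use un in blast)+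
    ultimately show False using neg un kk by blast
   qed
  qed
 qed
qed

end

section \<open>Derived cuts, connectedness and indecomposable corank 2 flats\<close>

context rank_fun begin

lemma C_Diff_nonempty: "\<lbrakk>finite X; r L < r X\<rbrakk> \<Longrightarrow> \<exists>x\<in>X. x ~: C L" using r_le_C[of X L] by auto

lemma r_insert2: "\<lbrakk>x ~: C L; y ~: C (x+:L)\<rbrakk> \<Longrightarrow> r (y+:x+:L) = r L + 2" by (simp add: r_notin)

lemma r_eq_notin: "\<lbrakk>r (y+:x+:L) = r L + 2\<rbrakk> \<Longrightarrow> x ~: C L \<and> y ~: C (x+:L) \<and> y ~: C L \<and> x ~: C (y+:L)"
 using unit[of x L] unit[of y "x+:L"] unit[of y L] unit[of x "y+:L"] by (auto simp: C_iff insert_commute)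

lemma notin_sym: "\<lbrakk>x ~: C L; y ~: C (x+:L)\<rbrakk> \<Longrightarrow> y ~: C L \<and> x ~: C (y+:L)" using r_eq_notin[OF r_insert2] by blast

text \<open>Rank increments can only grow when the base shrinks, and \<open>card T\<close> bounds
  them from above.\<close>

lemma r_free:
 assumes "finite T" "r (H Un T) = r H + card T" "X <= H"
 shows "r (X Un T) = r X + card T"
proof -
 have up: "r (X Un T) \<le> r X + card T" using assms(1)
 proof (induction T rule: finite_induct)
  case (insert t T) thus ?case using unit[of t "X Un T"] by simp
 qed simp
 have "r (H Un T) + r X \<le> r (X Un T) + r H" by (rule cover_ge) (use assms in blast)+
 thus ?thesis using up assms(2) by linarith
qed

text \<open>The cut of the contraction by \<open>T\<close>: a constant increment \<open>n\<close>
  keeps modular pairs of subsets of \<open>H\<close> modular after \<open>T\<close> is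
  added.\<close>

lemma cut_shift:
 assumes g: "cut S g" and "H <= S" "T <= S" and n: "\<And>X. X <= H \<Longrightarrow> r (X Un T) = r X + n"
 shows "cut H (\<lambda>X. g (X Un T))" unfolding cut_def
proof (intro conjI allI impI)
 fix X Y assume "X <= Y" "Y <= H" "g (X Un T)"
 thus "g (Y Un T)" using assms(2,3) cut_mono[OF g, of "X Un T" "Y Un T"] by blast
next
 fix X Y assume a: "X <= Y" "Y <= H" "r Y = r X" "g (Y Un T)"
 hence "r (X Un T) = r (Y Un T)" using n[of X] n[of Y] by auto
 thus "g (X Un T)" using a assms(2,3) cut_down[OF g, of "X Un T" "Y Un T"] by auto
next
 fix X Y assume a: "X <= H" "Y <= H" "g (X Un T)" "g (Y Un T)" "r X + r Y = r (X Un Y) + r (X Int Y)"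
 have "r (X Un T Un (Y Un T)) = r (X Un Y) + n" using n[of "X Un Y"] a(1,2) by (simp add: Un_ac)
 moreover have "r (X Int Y Un T) = r (X Int Y) + n" by (intro n) (use a in blast)
 ultimately show "g (X Int Y Un T)" using a assms(2,3) n[of X] n[of Y] cut_meet[OF g, of "X Un T" "Y Un T" "X Int Y Un T"] by auto
qed

text \<open>These are the sets over which \<open>T\<close> has its least possible relative rank
  \<open>n\<close>; for \<open>n = 0\<close> and a single element, the sets spanning it. Such cuts
  are what \<open>two_cuts\<close> is fed with besides \<open>g\<close>.\<close>

lemma cut_span:
 assumes n: "\<And>X. X <= H \<Longrightarrow> r X + n \<le> r (X Un T)"
 shows "cut H (\<lambda>X. r (X Un T) \<le> r X + n)" unfolding cut_def
proof (intro conjI allI impI)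
 fix X Y assume a: "X <= Y" "Y <= H" "r (X Un T) \<le> r X + n"
 have "r (Y Un T) + r X \<le> r (X Un T) + r Y" by (rule cover_ge) (use a in blast)+
 thus "r (Y Un T) \<le> r Y + n" using a(3) by linarith
next
 fix X Y assume a: "X <= Y" "Y <= H" "r Y = r X" "r (Y Un T) \<le> r Y + n"
 have "r (X Un T) \<le> r (Y Un T)" using a by (intro mono) blast
 thus "r (X Un T) \<le> r X + n" using a by linarith
next
 fix X Y assume a: "X <= H" "Y <= H" "r (X Un T) \<le> r X + n" "r (Y Un T) \<le> r Y + n"
  "r X + r Y = r (X Un Y) + r (X Int Y)"
 have "(X Un T) Un (Y Un T) = X Un Y Un T" "(X Int Y) Un T = (X Un T) Int (Y Un T)" by blast+
 hence "r (X Un Y Un T) + r (X Int Y Un T) \<le> r (X Un T) + r (Y Un T)" using submod[of "X Un T" "Y Un T"] by simp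
 moreover have "r (X Un Y) + n \<le> r (X Un Y Un T)" using a by (intro n) blast
 ultimately show "r (X Int Y Un T) \<le> r (X Int Y) + n" using a by linarith
qed

text \<open>Connectedness of the restriction to \<open>S\<close> contracted by \<open>K\<close>. A
  side of rank \<open>r K\<close> consists of loops, so loops do not disturb connectedness.\<close>

definition conn :: "'a set \<Rightarrow> 'a set \<Rightarrow> bool" where
 "conn S K \<longleftrightarrow> (\<forall>A B. K <= A \<longrightarrow> K <= B \<longrightarrow> A Un B = S \<longrightarrow> r A + r B = r S + r K \<longrightarrow> r A = r K \<or> r B = r K)"

text \<open>Three pairwise non-parallel points over \<open>L\<close>. For \<open>L\<close> of corank
  2 this means three hyperplanes through \<open>L\<close>, the criterion for \<open>L\<close> to be
  indecomposable.\<close>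

definition tri :: "'a set \<Rightarrow> 'a set \<Rightarrow> bool" where
 "tri S L \<longleftrightarrow> (\<exists>x\<in>S. \<exists>y\<in>S. \<exists>z\<in>S. x ~: C L \<and> y ~: C (x+:L) \<and> z ~: C (x+:L) \<and> z ~: C (y+:L))"

lemma connD: "\<lbrakk>conn S K; K <= A; K <= B; A Un B = S; r A + r B \<le> r S + r K\<rbrakk> \<Longrightarrow> r A = r K \<or> r B = r K"
 using cover_ge[of A B S K] unfolding conn_def by simp

lemma triI: "\<lbrakk>x : S; y : S; z : S; x ~: C L; y ~: C (x+:L); z ~: C (x+:L); z ~: C (y+:L)\<rbrakk> \<Longrightarrow> tri S L" unfolding tri_def by blast

lemma tri_mono: "tri S L \<Longrightarrow> S <= T \<Longrightarrow> tri T L" unfolding tri_def by blast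

lemma tri_cong: assumes "C L = C L'" "finite L" "finite L'" shows "tri S L = tri S L'"
proof -
 have "C (x+:L) = C (x+:L')" for x using C_Un_cong[OF assms(2,3,1), of "{x}"] by simp
 thus ?thesis unfolding tri_def using assms(1) by simp
qed

text \<open>If only the hyperplanes spanned with \<open>x\<close> and with \<open>y\<close> passed
  through \<open>L\<close>, they would be the two sides of a separation.\<close>

lemma conn_tri:
 assumes "finite S" "L <= S" "r L + 2 = r S" "conn S L" shows "tri S L"
proof (rule ccontr)
 assume nt: "\<not> tri S L"
 obtain x y where xy: "x : S" "y : S" "x ~: C L" "y ~: C (x+:L)" using ex_pair_notin_C[of S L] assms by auto
 let ?A = "S Int C (x+:L)" and ?B = "S Int C (y+:L)"
 have sub: "x+:L <= ?A" "y+:L <= ?B" using xy assms(2) subset_C[of "x+:L"] subset_C[of "y+:L"] by blast+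
 have r1: "r ?A = Suc (r L)" using r_between_C[OF _ sub(1)] assms(1) r_notin[OF xy(3)] by simp
 have r2: "r ?B = Suc (r L)" using r_between_C[OF _ sub(2)] assms(1) r_notin[of y L] notin_sym[OF xy(3,4)] by simp
 have "?A Un ?B = S" using nt xy unfolding tri_def by blast
 hence "r ?A = r L \<or> r ?B = r L" by (rule connD[OF assms(4), rotated 2]) (use sub r1 r2 assms(3) in auto)
 thus False using r1 r2 by simp
qed

text \<open>One side of a cover contains two of the three points and therefore has full
  rank.\<close>

lemma tri_conn:
 assumes "r L + 2 = r S" "tri S L" shows "conn S L" unfolding conn_def
proof (intro allI impI)
 fix A B assume AB: "L <= A" "L <= B" "A Un B = S" "r A + r B = r S + r L"
 obtain x y z where t: "x : S" "y : S" "z : S" "x ~: C L" "y ~: C (x+:L)" "z ~: C (x+:L)" "z ~: C (y+:L)"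
  using assms(2) unfolding tri_def by blast
 have two: "r L + 2 \<le> r D" if "L <= D" "(x : D \<and> y : D) \<or> (x : D \<and> z : D) \<or> (y : D \<and> z : D)" for D
 proof -
  have "y ~: C L" using notin_sym t by blast
  hence "r (y+:x+:L) = r L + 2" "r (z+:x+:L) = r L + 2" "r (z+:y+:L) = r L + 2" using r_insert2 t by blast+
  thus ?thesis using mono[of "y+:x+:L" D] mono[of "z+:x+:L" D] mono[of "z+:y+:L" D] that by auto
 qed
 have "r L \<le> r A" "r L \<le> r B" using mono AB by auto
 moreover have "r L + 2 \<le> r A \<or> r L + 2 \<le> r B" using two[OF AB(1)] two[OF AB(2)] t AB(3) by blast
 ultimately show "r A = r L \<or> r B = r L" using AB(4) assms(1) by linarith
qed

text \<open>The traces on \<open>S'\<close> of a separation of \<open>S\<close> already have the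
  least possible rank sum, so passing to them does not change the ranks of the sides.\<close>

lemma conn_superset:
 assumes c: "conn S' K" and "S' <= S" "r S' = r S" "K <= S'" shows "conn S K" unfolding conn_def
proof (intro allI impI)
 fix A B assume AB: "K <= A" "K <= B" "A Un B = S" "r A + r B = r S + r K"
 have m: "r (A Int S') \<le> r A" "r (B Int S') \<le> r B" by (auto intro: mono)
 have un: "(A Int S') Un (B Int S') = S'" using AB(3) assms(2) by blast
 have k: "K <= A Int S'" "K <= B Int S'" using AB assms(4) by blast+
 have "r S' + r K \<le> r (A Int S') + r (B Int S')" by (rule cover_ge[OF un k])
 moreover have "r (A Int S') = r K \<or> r (B Int S') = r K" by (rule connD[OF c k un]) (use m AB(4) assms(3) in linarith)
 ultimately show "r A = r K \<or> r B = r K" using m AB(4) assms(3) by linarith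
qed

text \<open>Serves to move a hyperplane \<open>H\<close> that avoids \<open>e\<close> along one edge
  to a hyperplane \<open>e+:L\<close> through \<open>e\<close>. If no \<open>L\<close> were
  suitable, every hyperplane of \<open>H\<close> over \<open>K\<close> would lie in one of two cuts
  of \<open>H\<close>, and the separation of \<open>H\<close> obtained by uncrossing would extend to
  \<open>S\<close>.\<close>

lemma good_corank2:
 assumes fin: "finite S" and con: "conn S K" and g: "cut S g" "g S"
  and H: "K <= H" "H <= S" "Suc (r H) = r S" and flat: "S Int C H <= H" and e: "e : S" "e ~: C H" "\<not> g (e+:K)"
 shows "\<exists>L x. K <= L \<and> L <= H \<and> r L + 2 = r S \<and> \<not> g (e+:L) \<and> tri S L \<and> x : H \<and> x ~: C L"
proof (rule ccontr)
 assume neg: "\<not> ?thesis"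
 define T where "T = S - C H"
 have eT: "e : T" using e T_def by blast
 have re: "r (X Un {e}) = r X + 1" if "X <= H" for X using r_free[of "{e}" H X] r_notin[OF e(2)] that by simp
 have re': "r X + 1 \<le> r (X Un T)" if "X <= H" for X using re[OF that] mono[of "X Un {e}" "X Un T"] eT by auto
 have c1: "cut H (\<lambda>X. g (X Un {e}))" by (rule cut_shift[OF g(1) H(2) _ re]) (use e in auto)
 have c2: "cut H (\<lambda>X. r (X Un T) \<le> r X + 1)" by (rule cut_span[OF re'])
 have fH: "finite H" using fin H(2) finite_subset by blast
 have "r (H Un {e}) = r S" using re[of H] H by simp
 hence gH: "g (H Un {e})" using cut_down[OF g(1), of "H Un {e}" S] g(2) H e by auto
 have HT: "r (H Un T) \<le> r H + 1" using mono[of "H Un T" S] H T_def by auto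
 have "\<exists>A B. K <= A \<and> K <= B \<and> A Un B = H \<and> r A + r B = r H + r K \<and> g (A Un {e}) \<and> r (B Un T) \<le> r B + 1"
 proof (rule two_cuts[OF fH H(1) c1 c2 gH HT])
  fix L assume L: "K <= L" "L <= H" "Suc (r L) = r H"
  show "g (L Un {e}) \<or> r (L Un T) \<le> r L + 1"
  proof (rule ccontr)
   assume n: "\<not> ?thesis"
   obtain x where x: "x : H" "x ~: C L" using C_Diff_nonempty[OF fH, of L] L by auto
   have eL: "r (e+:L) = r L + 1" using re[OF L(2)] by simp
   have "finite (L Un T)" using fin L H T_def by (meson finite_Diff finite_Un finite_subset)
   \<comment> \<open>An element outside \<open>H\<close> and outside the span of \<open>e+:L\<close>
     provides the third hyperplane through \<open>L\<close>.\<close>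
   then obtain z where z: "z : L Un T" "z ~: C (e+:L)" using C_Diff_nonempty[of "L Un T" "e+:L"] n eL by auto
   hence zT: "z : T" using subset_C[of "e+:L"] by blast
   have "C (x+:L) <= C H" using x L C_mono[of "x+:L" H] by auto
   hence "tri S L" using x z zT e H T_def by (intro triI[of x S e z]) blast+
   thus False using neg L H n x by auto
  qed
 qed
 then obtain A B where AB: "K <= A" "K <= B" "A Un B = H" "r A + r B = r H + r K" "g (A Un {e})" "r (B Un T) \<le> r B + 1" by blast
 \<comment> \<open>Adding \<open>T\<close> to \<open>B\<close> raises its rank by one only, as much
   as passing from \<open>H\<close> to \<open>S\<close> does.\<close>
 have un: "A Un (B Un T) = S" using AB(3) H(2) flat T_def by blast
 have kk: "K <= B Un T" using AB(2) by blast
 have "r A + r (B Un T) \<le> r S + r K" using AB(4,6) H(3) by linarith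
 hence "r A = r K \<or> r (B Un T) = r K" by (rule connD[OF con AB(1) kk un])
 moreover have "r K \<le> r B" "r B + 1 \<le> r (B Un T)" using mono[OF AB(2)] re'[of B] AB(3) by blast+
 ultimately have "r A = r K" by linarith
 have "A Un {e} <= S" using AB(3) H e by blast
 moreover have "e+:K <= A Un {e}" using AB(1) by blast
 moreover have "r (A Un {e}) = r (e+:K)" using re[of A] re[of K] AB(3) H(1) \<open>r A = r K\<close> by auto
 ultimately have "g (e+:K)" using cut_down[OF g(1)] AB(5) by blast
 thus False using e(3) by blast
qed

end

section \<open>Tutte's path theorem\<close>

context rank_fun begin

text \<open>It suffices to find two non-parallel points with connected contraction, as one of them
  is off the cut. They are found in a smallest side \<open>A\<close> of a separation over some
  point, outside the span of the other side.\<close>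

theorem exists_conn_point:
 assumes fin: "finite S" and KS: "K <= S" and con: "conn S K" and rk2: "r K + 2 \<le> r S"
  and g: "cut S g" and ngK: "\<not> g K"
 shows "\<exists>e\<in>S. e ~: C K \<and> conn S (e+:K) \<and> \<not> g (e+:K)"
proof -
 \<comment> \<open>A separation over \<open>p+:K\<close>, measured over \<open>K\<close>: excess 1,
   both sides larger than the point \<open>p\<close>.\<close>
 define sep where "sep p A B \<longleftrightarrow> p : S \<and> p ~: C K \<and> p+:K <= A \<and> p+:K <= B \<and>
  A Un B = S \<and> r A + r B = Suc (r S + r K) \<and> r K + 2 \<le> r A \<and> r K + 2 \<le> r B" for p A B
 have sepI: "\<exists>A B. sep p A B" if p: "p : S" "p ~: C K" and nc: "\<not> conn S (p+:K)" for p
 proof -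
  have rp: "r (p+:K) = Suc (r K)" using p r_notin by simp
  obtain A B where AB: "p+:K <= A" "p+:K <= B" "A Un B = S" "r A + r B = r S + r (p+:K)"
   "r A \<noteq> r (p+:K)" "r B \<noteq> r (p+:K)" using nc unfolding conn_def by blast
  have "r (p+:K) \<le> r A" "r (p+:K) \<le> r B" using AB(1,2) mono by blast+
  hence "sep p A B" unfolding sep_def using AB p rp by simp
  thus ?thesis by blast
 qed
 have sep_sym: "sep p A B \<Longrightarrow> sep p B A" for p A B unfolding sep_def by (simp add: Un_commute add.commute)
 have "\<exists>q1\<in>S. \<exists>q2\<in>S. q1 ~: C K \<and> q2 ~: C (q1+:K) \<and> conn S (q1+:K) \<and> conn S (q2+:K)"
 proof (cases "\<exists>p A B. sep p A B")
  case False
  obtain x y where xy: "x : S" "y : S" "x ~: C K" "y ~: C (x+:K)" using ex_pair_notin_C[OF fin KS rk2] by blast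
  hence "y ~: C K" using notin_sym by blast
  thus ?thesis using xy sepI False by blast
 next
  case True
  then obtain A where "\<exists>p B. sep p A B" and minA: "\<And>A'. (\<exists>p B. sep p A' B) \<Longrightarrow> card A \<le> card A'"
   using ex_has_least_nat[of "\<lambda>A. \<exists>p B. sep p A B" _ card] by blast
  then obtain p B where s: "sep p A B" by blast
  have AB: "A Un B = S" "r A + r B = Suc (r S + r K)" "p : A" "p : B" "K <= A" "K <= B"
   "r K + 2 \<le> r A" "r K + 2 \<le> r B" "A <= S" "B <= S" "p ~: C K" "p : S" using s unfolding sep_def by auto
  have fA: "finite A" using AB(9) fin by (rule finite_subset)
  have rp: "r (p+:K) = Suc (r K)" using r_notin AB(11) by simp
  \<comment> \<open>A separation over a point \<open>q\<close> of \<open>A\<close> outside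
    \<open>C B\<close>, crossed with the given one, would lead to a side smaller than
    \<open>A\<close> or to a separation over \<open>K\<close>.\<close>
  have no: False if q: "q : A" "q ~: C B" and s': "sep q A' B'" and pB: "p : B'" for q A' B'
  proof -
   have AB': "A' Un B' = S" "r A' + r B' = Suc (r S + r K)" "q : A'" "q : B'" "K <= A'" "K <= B'"
    "r K + 2 \<le> r A'" "r K + 2 \<le> r B'" "A' <= S" "B' <= S" "q ~: C K" "q : S" using s' unfolding sep_def by auto
   have "p+:K <= B" using AB by blast
   hence qp: "q ~: C (p+:K)" using q C_mono by blast
   have r2: "r (q+:p+:K) = r K + 2" using r_insert2[OF AB(11) qp] .
   have rq: "r (q+:K) = Suc (r K)" using r_notin AB'(11) by simp
   have sub: "r (A Un A') + r (A Int A') \<le> r A + r A'" "r (B Un B') + r (B Int B') \<le> r B + r B'"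
    "r (A Un B') + r (A Int B') \<le> r A + r B'" "r (B Un A') + r (B Int A') \<le> r B + r A'" using submod by auto
   note ss = AB(3,4,5,6,9,10,11,12) AB'(3,4,5,6,9,10)
   have pA': "p ~: A'"
   proof
    assume "p : A'"
    hence "r S + r (q+:p+:K) \<le> r A' + r B'" by (intro cover_ge[OF AB'(1)]) (use pB ss in blast)+
    thus False using r2 AB'(2) by linarith
   qed
   have u: "(A Int A') Un (B Un B') = S" "(A Un A') Un (B Int B') = S"
    "(A Int B') Un (B Un A') = S" "(A Un B') Un (B Int A') = S" using AB(1) AB'(1) by auto
   have 1: "r S + r (q+:K) \<le> r (A Int A') + r (B Un B')" by (rule cover_ge[OF u(1)]) (use q ss in blast)+
   have 2: "r S + r (p+:K) \<le> r (A Un A') + r (B Int B')" by (rule cover_ge[OF u(2)]) (use pB ss in blast)+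
   have e: "r (A Int A') + r (B Un B') = Suc (r S + r K)" using 1 2 rq rp sub(1,2) AB(2) AB'(2) by linarith
   have big: "r K + 2 \<le> r (B Un B')" using r2 mono[of "q+:p+:K" "B Un B'"] ss by auto
   have kk: "q+:K <= A Int A'" "q+:K <= B Un B'" using q ss by blast+
   have "r (A Int A') = Suc (r K)"
   proof (rule ccontr)
    assume ne: "r (A Int A') \<noteq> Suc (r K)"
    have "Suc (r K) \<le> r (A Int A')" using mono[OF kk(1)] rq by simp
    with ne have "r K + 2 \<le> r (A Int A')" by linarith
    hence "sep q (A Int A') (B Un B')" unfolding sep_def using AB'(11,12) kk u(1) e big by blast
    hence "card A \<le> card (A Int A')" using minA by blast
    moreover have "A Int A' \<subset> A" using pA' AB(3) by blast
    ultimately show False using psubset_card_mono[OF fA, of "A Int A'"] by simp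
   qed
   moreover have "r S + r (q+:p+:K) \<le> r (A Int B') + r (B Un A')" by (rule cover_ge[OF u(3)]) (use q pB ss in blast)+
   moreover have kk2: "K <= A Un B'" "K <= B Int A'" using ss by blast+
   ultimately have "r (A Un B') + r (B Int A') \<le> r S + r K" using sub(3,4) r2 AB(2) AB'(2) by linarith
   hence "r (A Un B') = r K \<or> r (B Int A') = r K" by (rule connD[OF con kk2 u(4)])
   moreover have "r A \<le> r (A Un B')" by (rule mono) blast
   ultimately have 3: "r (B Int A') = r K" using AB(7) by linarith
   have "r A' + r K \<le> r (A Int A') + r (B Int A')" by (rule cover_ge) (use AB(1) AB'(9) ss in blast)+
   thus False using 3 \<open>r (A Int A') = Suc (r K)\<close> AB'(7) by linarith
  qed
  have cq: "conn S (q+:K)" if q: "q : A" "q ~: C B" for q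
  proof (rule ccontr)
   assume "\<not> ?thesis"
   moreover have "q : S" "q ~: C K" using q AB(9) C_mono[OF AB(6)] by blast+
   ultimately obtain A' B' where "sep q A' B'" using sepI by blast
   moreover from this have "p : A' \<or> p : B'" using AB(12) unfolding sep_def by blast
   ultimately show False using no[OF q, of A' B'] no[OF q, of B' A'] sep_sym by blast
  qed
  have ne: "A - C B \<noteq> {}"
  proof
   assume "A - C B = {}"
   hence "S <= C B" using AB(1) subset_C[of B] by blast
   hence "r S = r B" using r_between_C[of S B] fin AB(10) by blast
   thus False using AB(2,7) by linarith
  qed
  then obtain q where q: "q : A" "q ~: C B" by blast
  have qK: "q ~: C K" using q C_mono[OF AB(6)] by blast
  \<comment> \<open>Otherwise the part of \<open>A\<close> outside \<open>C B\<close> is a single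
    point over \<open>K\<close>, and this point would split off from the rest.\<close>
  have "\<exists>q'\<in>A - C B. q' ~: C (q+:K)"
  proof (rule ccontr)
   assume "\<not> ?thesis"
   hence qs: "A - C B <= C (q+:K)" by blast
   let ?A = "q+:K Un (A - C B)" and ?B = "B Un (A Int C B)"
   have r1: "r ?A = Suc (r K)" using r_Un_C[OF _ qs] fA r_notin[OF qK] by simp
   have r2: "r ?B = r B" using r_Un_C[of "A Int C B" B] fA by simp
   have un: "?A Un ?B = S" using AB(1,5,6) q by blast
   have kk: "K <= ?A" "K <= ?B" using AB(6) by blast+
   have "r ?A = r K \<or> r ?B = r K" by (rule connD[OF con kk un]) (use r1 r2 AB(2,7) in linarith)
   thus False using r1 r2 AB(8) by linarith
  qed
  then obtain q' where q': "q' : A" "q' ~: C B" "q' ~: C (q+:K)" by blast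
  have "q : S" "q' : S" using q(1) q'(1) AB(9) by blast+
  thus ?thesis using qK q'(3) cq[OF q] cq[OF q'(1,2)] by blast
 qed
 then obtain q1 q2 where q: "q1 : S" "q2 : S" "q1 ~: C K" "q2 ~: C (q1+:K)" "conn S (q1+:K)" "conn S (q2+:K)" by blast
 have q2: "q2 ~: C K" using notin_sym[OF q(3,4)] by (rule conjunct1)
 show ?thesis
 proof (cases "g (q1+:K)")
  case True
  have ng: "\<not> g (q2+:K)" using cut_point[OF g KS q(1,2,4) True] ngK by blast
  show ?thesis
  proof (rule bexI[where x = q2])
   show "q2 ~: C K \<and> conn S (q2+:K) \<and> \<not> g (q2+:K)" using q(6) q2 ng by simp
  qed (rule q(2))
 next
  case False
  show ?thesis
  proof (rule bexI[where x = q1])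
   show "q1 ~: C K \<and> conn S (q1+:K) \<and> \<not> g (q1+:K)" using q(3,5) False by simp
  qed (rule q(1))
 qed
qed

text \<open>Both hyperplanes are moved, along at most one edge each, to hyperplanes through a point
  \<open>e\<close> off the cut with connected contraction; the induction continues over
  \<open>e+:K\<close>. This is Tutte's path theorem with an invariant function \<open>h\<close> in
  place of paths.\<close>

theorem hyperplanes_connected:
 assumes fin: "finite S" and g: "cut S g" "g S"
  and inv: "\<And>X Y. X <= S \<Longrightarrow> Y <= S \<Longrightarrow> C X = C Y \<Longrightarrow> h X = h Y"
  and K: "K <= S" "conn S K"
  and step: "\<And>L x y. \<lbrakk>K <= L; L <= S; r L + 2 = r S; tri S L; x : S; y : S; x ~: C L; y ~: C (x+:L);
    \<not> g (x+:L); \<not> g (y+:L)\<rbrakk> \<Longrightarrow> h (x+:L) = h (y+:L)"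
  and X: "K <= X" "X <= S" "Suc (r X) = r S" "\<not> g X" and Y: "K <= Y" "Y <= S" "Suc (r Y) = r S" "\<not> g Y"
 shows "h X = h Y" using K step X Y
proof (induction "r S - r K" arbitrary: K X Y rule: less_induct)
 case less
 note K = less.prems(1,2) and step = less.prems(3)
 note X = less.prems(4-7) and Y = less.prems(8-11)
 have rK: "r K \<le> r X" using mono X(1) by blast
 show ?case
 proof (cases "r K + 2 \<le> r S")
  case False
  hence "r K = r X" "r K = r Y" using rK X(3) Y(3) by linarith+
  hence "C X = C K" "C Y = C K" using C_eqI[OF X(1)] C_eqI[OF Y(1)] by simp_all
  thus ?thesis using inv[OF X(2) Y(2)] by simp
 next
  case True
  have ngK: "\<not> g K" using cut_mono[OF g(1) X(1,2)] X(4) by blast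
  obtain e where e: "e : S" "e ~: C K" "conn S (e+:K)" "\<not> g (e+:K)" using exists_conn_point[OF fin K True g(1) ngK] by blast
  have move: "\<exists>X'. e+:K <= X' \<and> X' <= S \<and> Suc (r X') = r S \<and> \<not> g X' \<and> h X = h X'"
   if X: "K <= X" "X <= S" "Suc (r X) = r S" "\<not> g X" for X
  proof -
   define H where "H = S Int C X"
   have XH: "X <= H" using X subset_C H_def by blast
   have fH: "finite H" using fin H_def by blast
   have rH: "r H = r X" using r_between_C[OF fH XH] H_def by blast
   have CH: "C H = C X" using C_eqI[OF XH rH] .
   have HS: "H <= S" using H_def by blast
   have "h H = h X" by (rule inv[OF HS X(2) CH])
   moreover have "\<not> g H" using cut_down[OF g(1) XH HS rH] X(4) by blast
   moreover have "S Int C H <= H" using CH H_def by simp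
   moreover have "K <= H" using XH X(1) by blast
   ultimately have H: "K <= H" "H <= S" "Suc (r H) = r S" "S Int C H <= H" "\<not> g H" "h H = h X" using HS X(3) rH by simp_all
   show ?thesis
   proof (cases "e : C X")
    case True
    hence "e+:K <= H" using H e H_def by blast
    thus ?thesis using H(2,3,5) H(6)[symmetric] by blast
   next
    case False
    hence eH: "e ~: C H" using CH by simp
    obtain L x where L: "K <= L" "L <= H" "r L + 2 = r S" "\<not> g (e+:L)" "tri S L" "x : H" "x ~: C L"
     using good_corank2[OF fin K(2) g H(1,2,3,4) e(1) eH e(4)] by blast
    have xL: "x+:L <= H" using L by blast
    have "r (x+:L) = r H" using r_notin[OF L(7)] L(3) H(3) by linarith
    hence Cx: "C (x+:L) = C H" using C_eqI[OF xL] by simp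
    have gx: "\<not> g (x+:L)" using cut_mono[OF g(1), of "x+:L" H] xL H(2,5) by blast
    have LS: "L <= S" "x : S" using L H by blast+
    have eL: "e ~: C L" using C_mono[OF L(2)] eH by blast
    have "h (x+:L) = h (e+:L)" by (rule step[OF L(1) LS(1) L(3,5) LS(2) e(1) L(7) _ gx L(4)]) (use Cx eH in simp)
    moreover have "h (x+:L) = h H" by (rule inv[OF _ H(2) Cx]) (use xL H(2) in blast)
    moreover have "Suc (r (e+:L)) = r S" using r_notin[OF eL] L(3) by simp
    ultimately show ?thesis using L(1,4) LS(1) e(1) H(6) by (metis insert_mono insert_subset)
   qed
  qed
  obtain X' where X': "e+:K <= X'" "X' <= S" "Suc (r X') = r S" "\<not> g X'" "h X = h X'" using move[OF X] by blast
  obtain Y' where Y': "e+:K <= Y'" "Y' <= S" "Suc (r Y') = r S" "\<not> g Y'" "h Y = h Y'" using move[OF Y] by blast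
  have "h X' = h Y'"
  proof (rule less.hyps[of "e+:K" X' Y'])
   show "r S - r (e+:K) < r S - r K" using r_notin[OF e(2)] True by linarith
   show "e+:K <= S" using e K by blast
  next
   fix L x y
   assume "e+:K <= L" "L <= S" "r L + 2 = r S" "tri S L" "x : S" "y : S" "x ~: C L" "y ~: C (x+:L)"
    "\<not> g (x+:L)" "\<not> g (y+:L)"
   thus "h (x+:L) = h (y+:L)" by (intro step) blast+
  qed (use e X' Y' in simp_all)
  thus ?thesis using X' Y' by simp
 qed
qed

end

section \<open>Independence over a set and the configuration of class 2d\<close>

context rank_fun begin

lemma indep2:
 assumes "r (x+:y+:L) = r L + 2"
 shows "x ~: C L" "y ~: C L" "x ~: C (y+:L)" "y ~: C (x+:L)"
  "r (x+:L) = r L + 1" "r (y+:L) = r L + 1" using r_eq_notin[OF assms] r_notin[of x L] r_notin[of y L] by auto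

lemma indep3_aux:
 assumes "r (x+:y+:z+:J) = r J + 3"
 shows "x ~: C (y+:z+:J)" "r (y+:z+:J) = r J + 2" "y ~: C (z+:J)" "z ~: C J"
 using assms unit[of x "y+:z+:J"] unit[of y "z+:J"] unit[of z J] by (auto simp: C_iff)

lemma indep3:
 assumes "r (x+:y+:z+:J) = r J + 3"
 shows "x ~: C J" "y ~: C J" "z ~: C J"
  "x ~: C (y+:J)" "y ~: C (x+:J)" "x ~: C (z+:J)" "z ~: C (x+:J)" "y ~: C (z+:J)" "z ~: C (y+:J)"
  "x ~: C (y+:z+:J)" "y ~: C (x+:z+:J)" "z ~: C (x+:y+:J)"
  "r (x+:y+:J) = r J + 2" "r (x+:z+:J) = r J + 2" "r (y+:z+:J) = r J + 2"
proof -
 have 1: "r (y+:x+:z+:J) = r J + 3" "r (z+:x+:y+:J) = r J + 3" using assms by (simp_all add: insert_commute)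
 note a = indep3_aux[OF assms] and b = indep3_aux[OF 1(1)] and c = indep3_aux[OF 1(2)]
 show "x ~: C (y+:z+:J)" "y ~: C (x+:z+:J)" "z ~: C (x+:y+:J)"
  "r (x+:y+:J) = r J + 2" "r (x+:z+:J) = r J + 2" "r (y+:z+:J) = r J + 2" using a b c by auto
 from indep2[OF this(4)] indep2[OF this(5)] indep2[OF this(6)]
 show "x ~: C J" "y ~: C J" "z ~: C J"
  "x ~: C (y+:J)" "y ~: C (x+:J)" "x ~: C (z+:J)" "z ~: C (x+:J)" "y ~: C (z+:J)" "z ~: C (y+:J)" by auto
qed

lemma indep3I: "\<lbrakk>x ~: C J; y ~: C (x+:J); z ~: C (y+:x+:J)\<rbrakk> \<Longrightarrow> r (x+:y+:z+:J) = r J + 3"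
 using r_notin[of x J] r_notin[of y "x+:J"] r_notin[of z "y+:x+:J"] by (simp add: insert_commute)

text \<open>Over \<open>B\<close> the six elements form a copy of \<open>M(K_{2,3})\<close> with
  series pairs \<open>s,t\<close>, then \<open>x,x'\<close> and \<open>y,y'\<close>: the unions of
  two pairs are the three circuits, and the other twelve four-element sets are independent.\<close>

definition k23 :: "'a set \<Rightarrow> 'a \<Rightarrow> 'a \<Rightarrow> 'a \<Rightarrow> 'a \<Rightarrow> 'a \<Rightarrow> 'a \<Rightarrow> bool" where
 "k23 B s t x x' y y' \<longleftrightarrow>
   r (s+:t+:x+:x'+:B) = r B + 3 \<and>
   r (s+:t+:y+:y'+:B) = r B + 3 \<and>
   r (x+:x'+:y+:y'+:B) = r B + 3 \<and>
   (\<forall>p\<in>{x,x'}. \<forall>q\<in>{y,y'}. r (s+:t+:p+:q+:B) = r B + 4) \<and>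
   (\<forall>p\<in>{s,t}. \<forall>q\<in>{y,y'}. r (p+:x+:x'+:q+:B) = r B + 4) \<and>
   (\<forall>p\<in>{s,t}. \<forall>q\<in>{x,x'}. r (p+:q+:y+:y'+:B) = r B + 4)"

end

section \<open>Potentials of cochains on hyperplanes\<close>

text \<open>Hyperplanes are given by arbitrary spanning sets; \<open>a_inv\<close> makes
  \<open>a\<close> a function of their closures. Each class contributes the vanishing of
  \<open>a\<close> around the boundary of one kind of cell.\<close>

locale tutte_cochain = rank_fun r for r :: "'a set \<Rightarrow> nat" +
 fixes E :: "'a set" and g :: "'a set \<Rightarrow> bool" and a :: "'a set \<Rightarrow> 'a set \<Rightarrow> 'b::ab_group_add"
 assumes finE: "finite E" and cutg: "cut E g" and gE: "g E"
  and a_inv: "C X = C X' \<Longrightarrow> C Y = C Y' \<Longrightarrow> a X Y = a X' Y'"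
  and a_anti: "a Y X = - a X Y" and a_refl: "a X X = 0"
  and class_2a: "\<lbrakk>L <= E; r L + 2 = r E; x : E; y : E; z : E; r (x+:y+:L) = r E;
    r (x+:z+:L) = r E; r (y+:z+:L) = r E;
    \<not> g (x+:L); \<not> g (y+:L); \<not> g (z+:L)\<rbrakk>
   \<Longrightarrow> a (x+:L) (y+:L) + a (y+:L) (z+:L) = a (x+:L) (z+:L)"
  and class_2b: "\<lbrakk>J <= E; r J + 3 = r E; x : E; y : E; z : E; r (x+:y+:z+:J) = r E;
    tri E (x+:J); tri E (y+:J); tri E (z+:J);
    \<not> g (x+:y+:J); \<not> g (x+:z+:J); \<not> g (y+:z+:J)\<rbrakk>
   \<Longrightarrow> a (x+:y+:J) (x+:z+:J) + a (x+:z+:J) (y+:z+:J)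
     = a (x+:y+:J) (y+:z+:J)"
  and class_2c: "\<lbrakk>J <= E; r J + 3 = r E; x : E; y : E; z : E; w : E;
    r (x+:y+:z+:J) = r E; r (x+:y+:w+:J) = r E;
    r (x+:z+:w+:J) = r E; r (y+:z+:w+:J) = r E;
    g (x+:y+:J); g (z+:w+:J);
    \<not> g (x+:z+:J); \<not> g (x+:w+:J); \<not> g (y+:z+:J); \<not> g (y+:w+:J)\<rbrakk>
   \<Longrightarrow> a (x+:z+:J) (x+:w+:J) + a (x+:w+:J) (y+:w+:J)
    + a (y+:w+:J) (y+:z+:J) + a (y+:z+:J) (x+:z+:J) = 0"
  and class_2d: "\<lbrakk>B <= E; r B + 4 = r E; {s,t,x,x',y,y'} <= E; k23 B s t x x' y y';
    \<not> tri E (s+:t+:B); \<not> tri E (x+:x'+:B); \<not> tri E (y+:y'+:B);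
    g (s+:x+:y+:B); g (s+:x'+:y'+:B);
    g (t+:x+:y'+:B); g (t+:x'+:y+:B);
    \<not> g (s+:x+:y'+:B); \<not> g (s+:x'+:y+:B);
    \<not> g (t+:x+:y+:B); \<not> g (t+:x'+:y'+:B);
    \<not> g (s+:t+:x+:x'+:B); \<not> g (s+:t+:y+:y'+:B);
    \<not> g (x+:x'+:y+:y'+:B)\<rbrakk>
   \<Longrightarrow> a (s+:t+:x+:x'+:B) (s+:x+:y'+:B)
    + a (s+:x+:y'+:B) (s+:t+:y+:y'+:B)
    + a (s+:t+:y+:y'+:B) (t+:x+:y+:B)
    + a (t+:x+:y+:B) (s+:t+:x+:x'+:B) = 0"
begin

lemma a_zero: "C X = C Y \<Longrightarrow> a X Y = 0" using a_inv[of X Y Y Y] a_refl[of Y] by simp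

lemma g_cong: "\<lbrakk>X <= E; Y <= E; C X = C Y\<rbrakk> \<Longrightarrow> g X = g Y" using cut_cong[OF cutg _ _ finE] by blast

lemma g_mono: "\<lbrakk>X <= Y; Y <= E; g X\<rbrakk> \<Longrightarrow> g Y" using cut_mono[OF cutg] by blast

text \<open>Class 2a without distinctness: coinciding hyperplanes contribute 0.\<close>

lemma a_line:
 assumes L: "L <= E" "r L + 2 = r E" and E: "x : E" "y : E" "z : E"
  and nc: "x ~: C L" "y ~: C L" "z ~: C L"
  and ng: "\<not> g (x+:L)" "\<not> g (y+:L)" "\<not> g (z+:L)"
 shows "a (x+:L) (y+:L) + a (y+:L) (z+:L) = a (x+:L) (z+:L)"
proof -
 have fL: "finite L" using L(1) finE finite_subset by blast
 have eqC: "C (u+:L) = C (v+:L)" if "u ~: C L" "v ~: C L" "v : C (u+:L)" for u v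
  using C_eqI[of "u+:L" "v+:u+:L"] C_eqI[of "v+:L" "v+:u+:L"]
   r_in[OF that(3)] r_notin[OF that(1)] r_notin[OF that(2)] by auto
 have rk: "r (u+:v+:L) = r E" if "u ~: C L" "v ~: C L" "C (u+:L) \<noteq> C (v+:L)" for u v
  using r_insert2[of v L u] that eqC[of v u] L(2) by auto
 show ?thesis
 proof (cases "C (x+:L) = C (y+:L) \<or> C (x+:L) = C (z+:L) \<or> C (y+:L) = C (z+:L)")
  case True
  thus ?thesis
  proof (elim disjE)
   assume e: "C (x+:L) = C (y+:L)"
   show ?thesis using a_zero[OF e] a_inv[OF e refl, of "z+:L"] by simp
  next
   assume e: "C (x+:L) = C (z+:L)"
   show ?thesis using a_zero[OF e] a_inv[OF refl e, of "y+:L"] a_anti[of "x+:L" "y+:L"] by simp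
  next
   assume e: "C (y+:L) = C (z+:L)"
   show ?thesis using a_zero[OF e] a_inv[OF refl e, of "x+:L"] by simp
  qed
 next
  case False
  thus ?thesis using class_2a[OF L E] rk nc ng by blast
 qed
qed

text \<open>If one of the lines \<open>xy\<close>, \<open>zw\<close> avoids the cut, the square is filled by two triangles
 and two concurrent triples instead of a cell of class 2c.\<close>

lemma square:
 assumes J: "J <= E" "r J + 3 = r E" and E: "x : E" "y : E" "z : E" "w : E"
  and rk: "r (x+:y+:z+:J) = r E" "r (x+:y+:w+:J) = r E"
   "r (x+:z+:w+:J) = r E" "r (y+:z+:w+:J) = r E"
  and ng: "\<not> g (x+:z+:J)" "\<not> g (x+:w+:J)" "\<not> g (y+:z+:J)" "\<not> g (y+:w+:J)"
 shows "a (x+:z+:J) (x+:w+:J) + a (x+:w+:J) (y+:w+:J)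
    + a (y+:w+:J) (y+:z+:J) + a (y+:z+:J) (x+:z+:J) = 0"
proof -
 have half: "a (x+:z+:J) (x+:w+:J) + a (x+:w+:J) (y+:w+:J)
    + a (y+:w+:J) (y+:z+:J) + a (y+:z+:J) (x+:z+:J) = 0"
  if E: "x : E" "y : E" "z : E" "w : E"
  and rk: "r (x+:y+:z+:J) = r E" "r (x+:y+:w+:J) = r E"
   "r (x+:z+:w+:J) = r E" "r (y+:z+:w+:J) = r E"
  and ng: "\<not> g (x+:z+:J)" "\<not> g (x+:w+:J)" "\<not> g (y+:z+:J)" "\<not> g (y+:w+:J)"
  and zw: "\<not> g (z+:w+:J)"
  for x y z w
 proof -
  have rk': "r (x+:y+:z+:J) = r J + 3" "r (x+:y+:w+:J) = r J + 3"
   "r (x+:z+:w+:J) = r J + 3" "r (y+:z+:w+:J) = r J + 3" using rk J(2) by auto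
  note i1 = indep3[OF rk'(1)] and i2 = indep3[OF rk'(2)] and i3 = indep3[OF rk'(3)] and i4 = indep3[OF rk'(4)]
  have "tri E (x+:J)" by (rule triI[of y E z w]) (use E i1 i2 i3 i4 in \<open>simp_all add: insert_commute\<close>)
  moreover have "tri E (y+:J)" by (rule triI[of x E z w]) (use E i1 i2 i3 i4 in \<open>simp_all add: insert_commute\<close>)
  moreover have "tri E (z+:J)" by (rule triI[of x E y w]) (use E i1 i2 i3 i4 in \<open>simp_all add: insert_commute\<close>)
  moreover have "tri E (w+:J)" by (rule triI[of x E y z]) (use E i1 i2 i3 i4 in \<open>simp_all add: insert_commute\<close>)
  ultimately have tr: "tri E (x+:J)" "tri E (y+:J)" "tri E (z+:J)" "tri E (w+:J)" by simp_all
  have 1: "a (x+:z+:J) (x+:w+:J) + a (x+:w+:J) (z+:w+:J)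
   = a (x+:z+:J) (z+:w+:J)" by (rule class_2b[OF J E(1,3,4) rk(3) tr(1,3,4) ng(1,2) zw])
  have 2: "a (y+:z+:J) (y+:w+:J) + a (y+:w+:J) (z+:w+:J)
   = a (y+:z+:J) (z+:w+:J)" by (rule class_2b[OF J E(2,3,4) rk(4) tr(2,3,4) ng(3,4) zw])
  have z: "z+:J <= E" "r (z+:J) + 2 = r E" "w+:J <= E" "r (w+:J) + 2 = r E"
   using E J r_notin[OF i1(3)] r_notin[OF i2(3)] by auto
  have 3: "a (y+:z+:J) (x+:z+:J) + a (x+:z+:J) (w+:z+:J)
   = a (y+:z+:J) (w+:z+:J)" by (rule a_line[OF z(1,2)]) (use E i1 i3 i4 ng zw in \<open>auto simp: insert_commute\<close>)
  have 4: "a (x+:w+:J) (y+:w+:J) + a (y+:w+:J) (z+:w+:J)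
   = a (x+:w+:J) (z+:w+:J)" by (rule a_line[OF z(3,4)]) (use E i2 i3 i4 ng zw in \<open>auto simp: insert_commute\<close>)
  have c: "w+:z+:J = z+:w+:J" by (rule insert_commute)
  let ?a = "a (x+:z+:J) (x+:w+:J)" and ?b = "a (x+:w+:J) (y+:w+:J)"
  and ?c = "a (y+:z+:J) (y+:w+:J)" and ?d = "a (y+:z+:J) (x+:z+:J)"
  have "?a = a (x+:z+:J) (z+:w+:J) - a (x+:w+:J) (z+:w+:J)" using 1 by (simp add: eq_diff_eq)
  moreover have "?c = a (y+:z+:J) (z+:w+:J) - a (y+:w+:J) (z+:w+:J)" using 2 by (simp add: eq_diff_eq)
  moreover have "?d = a (y+:z+:J) (z+:w+:J) - a (x+:z+:J) (z+:w+:J)" using 3 unfolding c by (simp add: eq_diff_eq)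
  moreover have "?b = a (x+:w+:J) (z+:w+:J) - a (y+:w+:J) (z+:w+:J)" using 4 by (simp add: eq_diff_eq)
  moreover have "a (y+:w+:J) (y+:z+:J) = - ?c" by (rule a_anti)
  ultimately show ?thesis by (simp only:) (simp add: algebra_simps)
 qed
 consider "g (x+:y+:J) \<and> g (z+:w+:J)" | "\<not> g (z+:w+:J)" | "\<not> g (x+:y+:J)" by blast
 thus ?thesis
 proof cases
  case 1 thus ?thesis using class_2c[OF J E rk] ng by blast
 next
  case 2 show ?thesis by (rule half[OF E rk ng 2])
 next
  case 3
  have "a (z+:x+:J) (z+:y+:J) + a (z+:y+:J) (w+:y+:J)
    + a (w+:y+:J) (w+:x+:J) + a (w+:x+:J) (z+:x+:J) = 0"
   by (rule half[OF E(3,4,1,2)]) (use rk ng 3 in \<open>simp_all add: insert_commute\<close>)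
  moreover have c: "z+:x+:J = x+:z+:J" "z+:y+:J = y+:z+:J"
   "w+:y+:J = y+:w+:J" "w+:x+:J = x+:w+:J" by auto
  ultimately have e: "a (x+:z+:J) (y+:z+:J) + a (y+:z+:J) (y+:w+:J)
    + a (y+:w+:J) (x+:w+:J) + a (x+:w+:J) (x+:z+:J) = 0" by simp
  have "a (x+:z+:J) (x+:w+:J) = - a (x+:w+:J) (x+:z+:J)"
   "a (x+:w+:J) (y+:w+:J) = - a (y+:w+:J) (x+:w+:J)"
   "a (y+:w+:J) (y+:z+:J) = - a (y+:z+:J) (y+:w+:J)"
   "a (y+:z+:J) (x+:z+:J) = - a (x+:z+:J) (y+:z+:J)" by (rule a_anti)+
  hence "?thesis \<longleftrightarrow> - (a (x+:z+:J) (y+:z+:J) + a (y+:z+:J) (y+:w+:J)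
    + a (y+:w+:J) (x+:w+:J) + a (x+:w+:J) (x+:z+:J)) = 0" by (simp only:) (simp add: algebra_simps)
  thus ?thesis using e by simp
 qed
qed

text \<open>If the corank 2 flat over one of the series pairs is indecomposable, the two circuit
  hyperplanes through it become adjacent, and triangles of class 2b together with squares fill the
  quadrangle. Thus class 2d is called upon in the decomposable case only.\<close>

lemma class_2d_tri:
 assumes B: "B <= E" "r B + 4 = r E" and E: "{s,t,x,x',y,y'} <= E" and k: "k23 B s t x x' y y'"
  and gg: "g (s+:x+:y+:B)" "g (s+:x'+:y'+:B)"
    "g (t+:x+:y'+:B)" "g (t+:x'+:y+:B)"
  and ng: "\<not> g (s+:x+:y'+:B)" "\<not> g (s+:x'+:y+:B)"
    "\<not> g (t+:x+:y+:B)" "\<not> g (t+:x'+:y'+:B)"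
    "\<not> g (s+:t+:x+:x'+:B)" "\<not> g (s+:t+:y+:y'+:B)"
    "\<not> g (x+:x'+:y+:y'+:B)"
 shows "a (s+:t+:x+:x'+:B) (s+:x+:y'+:B)
    + a (s+:x+:y'+:B) (s+:t+:y+:y'+:B)
    + a (s+:t+:y+:y'+:B) (t+:x+:y+:B)
    + a (t+:x+:y+:B) (s+:t+:x+:x'+:B) = 0"
proof -
 define P where "P = s+:t+:x+:x'+:B"
 define Q where "Q = s+:t+:y+:y'+:B"
 define Z where "Z = x+:x'+:y+:y'+:B"
 define T1 where "T1 = s+:x+:y'+:B"
 define T2 where "T2 = s+:x'+:y+:B"
 define T3 where "T3 = t+:x+:y+:B"
 define T4 where "T4 = t+:x'+:y'+:B"
 have rP: "r P = r B + 3" "r Q = r B + 3" "r Z = r B + 3" using k unfolding k23_def P_def Q_def Z_def by auto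
 have E': "s : E" "t : E" "x : E" "x' : E" "y : E" "y' : E" using E by auto
 have q1: "r (s+:t+:p+:q+:B) = r B + 4" if "p : {x,x'}" "q : {y,y'}" for p q using k that unfolding k23_def by blast
 have q2: "r (p+:x+:x'+:q+:B) = r B + 4" if "p : {s,t}" "q : {y,y'}" for p q using k that unfolding k23_def by blast
 have q3: "r (p+:q+:y+:y'+:B) = r B + 4" if "p : {s,t}" "q : {x,x'}" for p q using k that unfolding k23_def by blast
 have q1': "r (s+:t+:x+:y+:B) = r E" "r (s+:t+:x+:y'+:B) = r E"
  "r (s+:t+:x'+:y+:B) = r E" "r (s+:t+:x'+:y'+:B) = r E" using q1 B by auto
 have q2': "r (s+:x+:x'+:y+:B) = r E" "r (s+:x+:x'+:y'+:B) = r E"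
  "r (t+:x+:x'+:y+:B) = r E" "r (t+:x+:x'+:y'+:B) = r E" using q2 B by auto
 have q3': "r (s+:x+:y+:y'+:B) = r E" "r (s+:x'+:y+:y'+:B) = r E"
  "r (t+:x+:y+:y'+:B) = r E" "r (t+:x'+:y+:y'+:B) = r E" using q3 B by auto
 note q = q1' q2' q3'
 have three: "r (u+:v+:w+:B) = r B + 3" "r (u+:B) = r B + 1" "r (v+:B) = r B + 1" "r (w+:B) = r B + 1" "r (z+:B) = r B + 1"
  if "r (z+:u+:v+:w+:B) = r E" for z u v w
  using that B(2) unit[of z "u+:v+:w+:B"] unit[of u "v+:w+:B"] unit[of v "w+:B"] unit[of w B]
   unit[of u B] unit[of v B] unit[of z B] unit[of v "u+:B"] unit[of w "v+:u+:B"] unit[of z "v+:u+:w+:B"]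
   unit[of w "u+:B"] unit[of u "w+:B"] unit[of v "w+:u+:B"] unit[of u "w+:v+:B"]
   unit[of w "v+:B"] unit[of v "z+:B"] unit[of w "v+:z+:B"] unit[of u "w+:v+:z+:B"] by (simp_all add: insert_commute)
 have one: "r (s+:B) + 3 = r E" "r (t+:B) + 3 = r E" "r (x+:B) + 3 = r E" "r (x'+:B) + 3 = r E"
  "r (y+:B) + 3 = r E" "r (y'+:B) + 3 = r E" using three[OF q1'(1)] three[OF q1'(4)] B(2) by auto
 have sub: "s+:B <= E" "t+:B <= E" "x+:B <= E" "x'+:B <= E" "y+:B <= E" "y'+:B <= E" using E' B(1) by auto
 have tP: "r (u+:v+:w+:B) = r B + 3 \<Longrightarrow> u+:v+:w+:B <= D \<Longrightarrow> r D = r B + 3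
   \<Longrightarrow> D <= E \<Longrightarrow> C (u+:v+:w+:B) = C D" for u v w D using C_eqI[of "u+:v+:w+:B" D] by simp
 have DE: "P <= E" "Q <= E" "Z <= E" using E' B unfolding P_def Q_def Z_def by auto
 have CP: "C (u+:v+:w+:B) = C P" if "{u,v,w} <= {s,t,x,x'}" "r (z+:u+:v+:w+:B) = r E" for u v w z
  by (rule tP[OF three(1)[OF that(2)] _ rP(1) DE(1)]) (use that(1) in \<open>unfold P_def, blast\<close>)
 have CQ: "C (u+:v+:w+:B) = C Q" if "{u,v,w} <= {s,t,y,y'}" "r (z+:u+:v+:w+:B) = r E" for u v w z
  by (rule tP[OF three(1)[OF that(2)] _ rP(2) DE(2)]) (use that(1) in \<open>unfold Q_def, blast\<close>)
 have CZ: "C (u+:v+:w+:B) = C Z" if "{u,v,w} <= {x,x',y,y'}" "r (z+:u+:v+:w+:B) = r E" for u v w z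
  by (rule tP[OF three(1)[OF that(2)] _ rP(3) DE(3)]) (use that(1) in \<open>unfold Z_def, blast\<close>)
 have ngP: "\<not> g P" "\<not> g Q" "\<not> g Z" using ng unfolding P_def Q_def Z_def by auto
 have ng': "\<not> g T1" "\<not> g T2" "\<not> g T3" "\<not> g T4" using ng unfolding T1_def T2_def T3_def T4_def by auto
 have ngC: "C X = C D \<Longrightarrow> X <= E \<Longrightarrow> D <= E \<Longrightarrow> \<not> g D \<Longrightarrow> \<not> g X" for X D using g_cong by blast
 \<comment> \<open>\<open>ap\<close>, \<open>be\<close> and \<open>ga\<close> are the sums of
   \<open>a\<close> along the two-edge paths through \<open>T\<close> from \<open>P\<close> to
   \<open>Q\<close>, from \<open>Q\<close> to \<open>Z\<close> and from \<open>P\<close> to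
   \<open>Z\<close>.\<close>
 define ap where "ap T = a P T + a T Q" for T
 define be where "be T = a Q T + a T Z" for T
 define ga where "ga T = a P T + a T Z" for T
 have ga: "ga T = ap T + be T" for T unfolding ga_def ap_def be_def using a_anti[of Q T] by simp
 have C1: "C (x+:x'+:s+:B) = C P" by (rule CP[of _ _ _ y]) (use q in \<open>auto simp: insert_commute\<close>)
 have C2: "C (y+:y'+:s+:B) = C Q" by (rule CQ[of _ _ _ x]) (use q in \<open>auto simp: insert_commute\<close>)
 have C3: "C (x+:x'+:t+:B) = C P" by (rule CP[of _ _ _ y]) (use q in \<open>auto simp: insert_commute\<close>)
 have C4: "C (y+:y'+:t+:B) = C Q" by (rule CQ[of _ _ _ x]) (use q in \<open>auto simp: insert_commute\<close>)
 have C5: "C (s+:t+:x+:B) = C P" by (rule CP[of _ _ _ y]) (use q in \<open>auto simp: insert_commute\<close>)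
 have C6: "C (y+:y'+:x+:B) = C Z" by (rule CZ[of _ _ _ s]) (use q in \<open>auto simp: insert_commute\<close>)
 have C7: "C (s+:t+:x'+:B) = C P" by (rule CP[of _ _ _ y]) (use q in \<open>auto simp: insert_commute\<close>)
 have C8: "C (y+:y'+:x'+:B) = C Z" by (rule CZ[of _ _ _ s]) (use q in \<open>auto simp: insert_commute\<close>)
 have C9: "C (s+:t+:y+:B) = C Q" by (rule CQ[of _ _ _ x]) (use q in \<open>auto simp: insert_commute\<close>)
 have C10: "C (x+:x'+:y+:B) = C Z" by (rule CZ[of _ _ _ s]) (use q in \<open>auto simp: insert_commute\<close>)
 have C11: "C (s+:t+:y'+:B) = C Q" by (rule CQ[of _ _ _ x]) (use q in \<open>auto simp: insert_commute\<close>)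
 have C12: "C (x+:x'+:y'+:B) = C Z" by (rule CZ[of _ _ _ s]) (use q in \<open>auto simp: insert_commute\<close>)
 note CC = C1 C2 C3 C4 C5 C6 C7 C8 C9 C10 C11 C12
 have nn: "\<not> g (x+:x'+:s+:B)" "\<not> g (y+:y'+:s+:B)"
   "\<not> g (x+:x'+:t+:B)" "\<not> g (y+:y'+:t+:B)"
   "\<not> g (s+:t+:x+:B)" "\<not> g (y+:y'+:x+:B)"
   "\<not> g (s+:t+:x'+:B)" "\<not> g (y+:y'+:x'+:B)"
   "\<not> g (s+:t+:y+:B)" "\<not> g (x+:x'+:y+:B)"
   "\<not> g (s+:t+:y'+:B)" "\<not> g (x+:x'+:y'+:B)"
  using ngC[OF C1] ngC[OF C2] ngC[OF C3] ngC[OF C4] ngC[OF C5] ngC[OF C6] ngC[OF C7] ngC[OF C8] ngC[OF C9] ngC[OF C10]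
   ngC[OF C11] ngC[OF C12] ngP DE E' B(1) by simp_all
 have sq: "a X T + a T Y = a X T' + a T' Y"
  if J: "J <= E" "r J + 3 = r E" and "u : E" "v : E" "w : E" "z : E"
  and "r (u+:v+:w+:J) = r E" "r (u+:v+:z+:J) = r E"
   "r (u+:w+:z+:J) = r E" "r (v+:w+:z+:J) = r E"
  and "\<not> g (u+:w+:J)" "\<not> g T" "\<not> g T'" "\<not> g (v+:z+:J)"
  and e: "C (u+:w+:J) = C X" "u+:z+:J = T" "C (v+:z+:J) = C Y" "v+:w+:J = T'"
  for J u v w z X Y T T'
 proof -
  have "a (u+:w+:J) T + a T (v+:z+:J) + a (v+:z+:J) T' + a T' (u+:w+:J) = 0"
   unfolding e(2,4)[symmetric] by (rule square) (use that in simp_all)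
  hence h: "a X T + a T Y + a Y T' + a T' X = 0"
   using a_inv[OF e(1) refl, of T] a_inv[OF refl e(3), of T] a_inv[OF e(3) refl, of T'] a_inv[OF refl e(1), of T'] by simp
  show ?thesis using h unfolding a_anti[of Y T'] a_anti[of T' X] by (simp add: algebra_simps)
 qed
 have tr: "tri E (u+:v+:B)"
  if "p : E" "q : E" "w : E" "r (u+:v+:p+:q+:B) = r E"
   "r (u+:v+:p+:w+:B) = r E" "r (u+:v+:q+:w+:B) = r E" for p q w u v
 proof -
  let ?L = "u+:v+:B"
  have "r ?L + 2 = r E" using that(4) three[of p u v q] B(2) unit[of p "q+:?L"] unit[of q ?L] unit[of u "v+:B"] unit[of v B]
   by (simp add: insert_commute)
  hence "r (p+:q+:?L) = r ?L + 2" "r (p+:w+:?L) = r ?L + 2" "r (q+:w+:?L) = r ?L + 2"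
   using that(4-6) by (simp_all add: insert_commute)
  from indep2[OF this(1)] indep2[OF this(2)] indep2[OF this(3)] show ?thesis using that(1-3) by (intro triI[of p E q w]) auto
 qed
 have tg: "a X T + a T Y = a X Y"
  if J: "J <= E" "r J + 3 = r E" and "u : E" "v : E" "w : E"
  and "r (u+:v+:w+:J) = r E"
  and "tri E (u+:J)" "tri E (v+:J)" "tri E (w+:J)" "\<not> g X" "\<not> g T" "\<not> g Y" "X <= E" "Y <= E"
  and e: "C (u+:v+:J) = C X" "u+:w+:J = T" "C (v+:w+:J) = C Y"
  for J u v w X Y T
 proof -
  have ss: "u+:v+:J <= E" "v+:w+:J <= E" using that by auto
  have n: "\<not> g (u+:v+:J)" "\<not> g (v+:w+:J)" using ngC[OF e(1) ss(1)] ngC[OF e(3) ss(2)] that by auto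
  have "a (u+:v+:J) T + a T (v+:w+:J) = a (u+:v+:J) (v+:w+:J)"
   unfolding e(2)[symmetric] by (rule class_2b[OF J]) (use that n in simp_all)
  thus ?thesis using a_inv[OF e(1) refl, of T] a_inv[OF refl e(3), of T] a_inv[OF e(1) e(3)] by simp
 qed
 note Td = T1_def T2_def T3_def T4_def
 \<comment> \<open>Each of the six elements gives one square: over it, the four elements outside its
   series pair are in general position. A square equates two path sums.\<close>
 have s1: "ap T1 = ap T2" unfolding ap_def
  by (rule sq[OF sub(1) one(1) E'(3,5,4,6)]) (use q nn ng' C1 C2 in \<open>simp_all add: insert_commute Td\<close>)
 have s2: "ap T3 = ap T4" unfolding ap_def
  by (rule sq[OF sub(2) one(2) E'(3,6,4,5)]) (use q nn ng' C3 C4 in \<open>simp_all add: insert_commute Td\<close>)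
 have s3: "ga T1 = ga T3" unfolding ga_def
  by (rule sq[OF sub(3) one(3) E'(1,5,2,6)]) (use q nn ng' C5 C6 in \<open>simp_all add: insert_commute Td\<close>)
 have s4: "ga T2 = ga T4" unfolding ga_def
  by (rule sq[OF sub(4) one(4) E'(1,6,2,5)]) (use q nn ng' C7 C8 in \<open>simp_all add: insert_commute Td\<close>)
 have s5: "be T2 = be T3" unfolding be_def
  by (rule sq[OF sub(5) one(5) E'(1,3,2,4)]) (use q nn ng' C9 C10 in \<open>simp_all add: insert_commute Td\<close>)
 have s6: "be T1 = be T4" unfolding be_def
  by (rule sq[OF sub(6) one(6) E'(1,4,2,3)]) (use q nn ng' C11 C12 in \<open>simp_all add: insert_commute Td\<close>)
 have fin: ?thesis if "ap T1 = ap T3"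
 proof -
  have "a P T1 + a T1 Q = a P T3 + a T3 Q" using that unfolding ap_def .
  hence "a P T1 + a T1 Q + a Q T3 + a T3 P = 0" unfolding a_anti[of Q T3] a_anti[of T3 P] by (simp add: algebra_simps)
  thus ?thesis unfolding P_def Q_def T1_def T3_def .
 qed
 have tsx: "tri E (s+:x+:B)" by (rule tr[of y y' t]) (use q E' in \<open>auto simp: insert_commute\<close>)
 have tsx': "tri E (s+:x'+:B)" by (rule tr[of y y' t]) (use q E' in \<open>auto simp: insert_commute\<close>)
 have tsy: "tri E (s+:y+:B)" by (rule tr[of x x' t]) (use q E' in \<open>auto simp: insert_commute\<close>)
 have tsy': "tri E (s+:y'+:B)" by (rule tr[of x x' t]) (use q E' in \<open>auto simp: insert_commute\<close>)
 have ttx: "tri E (t+:x+:B)" by (rule tr[of y y' s]) (use q E' in \<open>auto simp: insert_commute\<close>)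
 have tty: "tri E (t+:y+:B)" by (rule tr[of x x' s]) (use q E' in \<open>auto simp: insert_commute\<close>)
 have txy: "tri E (x+:y+:B)" by (rule tr[of s t x']) (use q E' in \<open>auto simp: insert_commute\<close>)
 have txy': "tri E (x+:y'+:B)" by (rule tr[of s t x']) (use q E' in \<open>auto simp: insert_commute\<close>)
 have tx'y: "tri E (x'+:y+:B)" by (rule tr[of s t x]) (use q E' in \<open>auto simp: insert_commute\<close>)
 have tx'y': "tri E (x'+:y'+:B)" by (rule tr[of s t x]) (use q E' in \<open>auto simp: insert_commute\<close>)
 note tt = tsx tsx' tsy tsy' ttx tty txy txy' tx'y tx'y'
 consider "tri E (s+:t+:B)" | "tri E (x+:x'+:B)" | "tri E (y+:y'+:B)"
  | "\<not> tri E (s+:t+:B)" "\<not> tri E (x+:x'+:B)" "\<not> tri E (y+:y'+:B)" by blast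
 thus ?thesis
 proof cases
  case 1
  have "ap T1 = a P Q" unfolding ap_def
   by (rule tg[OF sub(1) one(1) E'(3,2,6)]) (use 1 q ng' ngP DE tt C5 C11 in \<open>simp_all add: insert_commute Td\<close>)
  moreover have "ap T3 = a P Q" unfolding ap_def
   by (rule tg[OF sub(2) one(2) E'(3,1,5)]) (use 1 q ng' ngP DE tt C5 C9 in \<open>simp_all add: insert_commute Td\<close>)
  ultimately show ?thesis by (intro fin) simp
 next
  case 2
  have "ga T1 = a P Z" unfolding ga_def
   by (rule tg[OF sub(3) one(3) E'(1,4,6)]) (use 2 q ng' ngP DE tt C1 C12 in \<open>simp_all add: insert_commute Td\<close>)
  moreover have "ga T2 = a P Z" unfolding ga_def
   by (rule tg[OF sub(4) one(4) E'(1,3,5)]) (use 2 q ng' ngP DE tt C1 C10 in \<open>simp_all add: insert_commute Td\<close>)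
  ultimately have "be T1 = be T2" using s1 unfolding ga by (metis add_left_cancel)
  thus ?thesis using s3 s5 unfolding ga by (intro fin) simp
 next
  case 3
  have "be T1 = a Q Z" unfolding be_def
   by (rule tg[OF sub(6) one(6) E'(1,5,3)]) (use 3 q ng' ngP DE tt C2 C10 C12 C6 in \<open>simp_all add: insert_commute Td\<close>)
  moreover have "be T2 = a Q Z" unfolding be_def
   by (rule tg[OF sub(5) one(5) E'(1,6,4)]) (use 3 q ng' ngP DE tt C2 C8 C10 in \<open>simp_all add: insert_commute Td\<close>)
  ultimately show ?thesis using s3 s5 unfolding ga by (intro fin) simp
 next
  case 4
  show ?thesis by (rule class_2d[OF B E k 4 gg ng])
 qed
qed

end

section \<open>Potentials up to corank 3\<close>

context rank_fun begin

lemma C_eq_sub: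
 assumes "finite X" "finite Y" "Y <= C X" "r Y = r X" shows "C Y = C X"
proof -
 have 1: "r (X Un Y) = r X" using r_Un_C assms by blast
 have "C (X Un Y) = C X" by (rule C_eqI) (use 1 in auto)
 moreover have "C (X Un Y) = C Y" by (rule C_eqI) (use 1 assms(4) in auto)
 ultimately show ?thesis by simp
qed

lemma C_insert_cong: "\<lbrakk>finite X; finite Y; C X = C Y\<rbrakk> \<Longrightarrow> C (x+:X) = C (x+:Y)" using C_Un_cong[of X Y "{x}"] by simp

lemma C_point:
 assumes "x ~: C L" "y ~: C L" "y : C (x+:L)" shows "C (x+:L) = C (y+:L)"
 using C_eqI[of "x+:L" "y+:x+:L"] C_eqI[of "y+:L" "y+:x+:L"]
  r_in[OF assms(3)] r_notin[OF assms(1)] r_notin[OF assms(2)] by auto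

lemma point_of:
 assumes "finite L" "K <= L" "r L = Suc (r K)"
 obtains p where "p : L" "p ~: C K" "C (p+:K) = C L"
proof -
 obtain p where p: "p : L" "p ~: C K" using C_Diff_nonempty[OF assms(1), of K] assms(3) by auto
 have "C L = C (p+:K)" by (rule C_eqI) (use p assms r_notin[OF p(2)] in auto)
 thus thesis using that p by simp
qed

end

context tutte_cochain begin

text \<open>The condition is imposed at the flats with \<open>tri S L\<close>, not
  \<open>tri E L\<close>: a corank 2 flat that is decomposable in the restriction to
  \<open>S\<close> demands nothing of a potential on \<open>S\<close>.\<close>

definition pot :: "'a set \<Rightarrow> 'a set \<Rightarrow> ('a set \<Rightarrow> 'b) \<Rightarrow> bool" where
 "pot S K f \<longleftrightarrow> (\<forall>X Y. C X = C Y \<longrightarrow> f X = f Y) \<and>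
  (\<forall>L x y. K <= L \<longrightarrow> L <= S \<longrightarrow> r L + 2 = r S \<longrightarrow> tri S L \<longrightarrow> x : S \<longrightarrow> y : S \<longrightarrow> x ~: C L \<longrightarrow> y ~: C L \<longrightarrow>
   \<not> g (x+:L) \<longrightarrow> \<not> g (y+:L) \<longrightarrow> f (y+:L) = f (x+:L) + a (x+:L) (y+:L))"

lemma a_cyc:
 assumes "a X Y + a Y Z = a X Z" shows "a Z X + a X Y = a Z Y"
 unfolding a_anti[of Z X] a_anti[of Z Y] assms[symmetric] by simp

lemma potI:
 assumes "\<And>X Y. C X = C Y \<Longrightarrow> f X = f Y"
  and "\<And>L x y. \<lbrakk>K <= L; L <= S; r L + 2 = r S; tri S L; x : S; y : S; x ~: C L; y ~: C L; y ~: C (x+:L);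
   \<not> g (x+:L); \<not> g (y+:L)\<rbrakk> \<Longrightarrow> f (y+:L) = f (x+:L) + a (x+:L) (y+:L)"
 shows "pot S K f" unfolding pot_def
proof (intro conjI allI impI)
 show "f X = f Y" if "C X = C Y" for X Y by (rule assms(1)[OF that])
 fix L x y assume h: "K <= L" "L <= S" "r L + 2 = r S" "tri S L" "x : S" "y : S" "x ~: C L" "y ~: C L"
   "\<not> g (x+:L)" "\<not> g (y+:L)"
 show "f (y+:L) = f (x+:L) + a (x+:L) (y+:L)"
 proof (cases "y : C (x+:L)")
  case True
  hence e: "C (x+:L) = C (y+:L)" using C_point h by blast
  show ?thesis using assms(1)[OF e] a_zero[OF e] by simp
 next
  case False thus ?thesis using assms(2) h by blast
 qed
qed

lemma pot_inv: "pot S K f \<Longrightarrow> C X = C Y \<Longrightarrow> f X = f Y" unfolding pot_def by blast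

lemma pot_step:
 "\<lbrakk>pot S K f; K <= L; L <= S; r L + 2 = r S; tri S L; x : S; y : S; x ~: C L; y ~: C L;
  \<not> g (x+:L); \<not> g (y+:L)\<rbrakk> \<Longrightarrow> f (y+:L) = f (x+:L) + a (x+:L) (y+:L)" unfolding pot_def by (drule conjunct2) blast

text \<open>\<open>L\<close> may be replaced by \<open>L Un K\<close>, which has the same
  closure.\<close>

lemma pot_edge:
 assumes p: "pot S K f" and S: "S <= E" "K <= S" and L: "K <= C L" "L <= S" "r L + 2 = r S" "tri S L"
  and x: "x : S" "y : S" "x ~: C L" "y ~: C L" "\<not> g (x+:L)" "\<not> g (y+:L)"
 shows "f (y+:L) = f (x+:L) + a (x+:L) (y+:L)"
proof -
 have fin: "finite L" "finite (L Un K)" using S L(2) finE finite_subset by (meson Un_least order_trans)+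
 have e: "C (L Un K) = C L" by (rule C_between[OF fin(2)]) (use L(1) subset_C[of L] in auto)
 have ex: "C (u+:(L Un K)) = C (u+:L)" for u by (rule C_insert_cong[OF fin(2,1) e])
 have "r (L Un K) = r L" by (rule r_cong_C[OF fin(2,1) e])
 moreover have "tri S (L Un K)" using tri_cong[OF e fin(2,1)] L(4) by simp
 moreover have ng: "\<not> g (u+:(L Un K))" if "u : S" "\<not> g (u+:L)" for u
 proof -
  have "u+:(L Un K) <= E" "u+:L <= E" using that(1) S L(2) by blast+
  from g_cong[OF this ex] show ?thesis using that(2) by blast
 qed
 ultimately have "f (y+:(L Un K)) = f (x+:(L Un K)) + a (x+:(L Un K)) (y+:(L Un K))"
  by (intro pot_step[OF p]) (use x L(2,3) S(2) e in simp_all)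
 thus ?thesis using pot_inv[OF p ex[of y]] pot_inv[OF p ex[of x]] a_inv[OF ex[of x] ex[of y]] by simp
qed

text \<open>All hyperplanes concerned pass through one flat, so the cochain measured from one of
  them off the cut is a potential.\<close>

lemma pot_le2:
 assumes S: "S <= E" "r S = r E" "K <= S" "r S \<le> r K + 2"
 shows "\<exists>f. pot S K f"
proof -
 have fS: "finite S" using S(1) finE finite_subset by blast
 have CL: "C L = C K \<and> r L = r K" if "K <= L" "r L + 2 = r S" for L
  using C_eqI[OF that(1)] mono[OF that(1)] that(2) S(4) by simp
 show ?thesis
 proof (cases "\<exists>x0\<in>S. x0 ~: C K \<and> \<not> g (x0+:K)")
  case True
  then obtain x0 where x0: "x0 : S" "x0 ~: C K" "\<not> g (x0+:K)" by blast
  have "pot S K (\<lambda>X. a (x0+:K) X)"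
  proof (rule potI)
   show "a (x0+:K) X = a (x0+:K) Y" if "C X = C Y" for X Y by (rule a_inv[OF refl that])
   fix L x y assume h: "K <= L" "L <= S" "r L + 2 = r S" "x : S" "y : S" "x ~: C L" "y ~: C L"
    "\<not> g (x+:L)" "\<not> g (y+:L)"
   have c: "C K = C L" using CL[OF h(1,3)] by simp
   have fin: "finite K" "finite L" using fS S(3) h(2) finite_subset by blast+
   have cx: "C (x0+:K) = C (x0+:L)" by (rule C_insert_cong[OF fin c])
   have LE: "L <= E" "r L + 2 = r E" "x0+:L <= E" "x0+:K <= E" using h S x0 by auto
   have "\<not> g (x0+:L)" using g_cong[OF LE(4,3) cx] x0(3) by blast
   hence "a (x0+:L) (x+:L) + a (x+:L) (y+:L) = a (x0+:L) (y+:L)" by (intro a_line[OF LE(1,2)]) (use h x0 S c in auto)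
   thus "a (x0+:K) (y+:L) = a (x0+:K) (x+:L) + a (x+:L) (y+:L)" using a_inv[OF cx refl] by simp
  qed
  thus ?thesis by blast
 next
  case False
  have "pot S K (\<lambda>_. 0)"
  proof (rule potI)
   fix L x y assume h: "K <= L" "L <= S" "r L + 2 = r S" "x : S" "x ~: C L" "\<not> g (x+:L)"
   have "x ~: C K" using CL[OF h(1,3)] h(5) by simp
   hence "g (x+:K)" using False h by blast
   moreover have "x+:K <= x+:L" "x+:L <= E" using h S by auto
   ultimately have "g (x+:L)" using g_mono by blast
   thus "0 = 0 + a (x+:L) (y+:L)" for y using h(6) by blast
  qed simp
  thus ?thesis by blast
 qed
qed

text \<open>Over \<open>K\<close> this is plane geometry: corank 2 flats are points and hyperplanes
  are lines. Values are propagated from a base line \<open>X0\<close> through the pencil of a point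
  \<open>e\<close>, and from there to the remaining lines.\<close>

theorem pot_corank3:
 assumes S: "S <= E" "r S = r E" "K <= S" "r K + 3 = r S" and con: "conn S K"
 shows "\<exists>f. pot S K f"
proof (cases "g K")
 case True
 have "pot S K (\<lambda>_. 0)"
 proof (rule potI)
  fix L x y assume h: "K <= L" "L <= S" "x : S" "\<not> g (x+:L)"
  have "K <= x+:L" "x+:L <= E" using h S by auto
  hence "g (x+:L)" using g_mono True by blast
  thus "0 = 0 + a (x+:L) (y+:L)" for y using h by blast
 qed simp
 thus ?thesis by blast
next
 case False
 have fS: "finite S" using S(1) finE finite_subset by blast
 have fK: "finite K" using fS S(3) finite_subset by blast
 have KE: "K <= E" "r K + 3 = r E" using S by auto
 have cS: "cut S g" using cut_subset[OF cutg S(1)] .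
 have gS: "g S" using cut_down[OF cutg S(1) order_refl] S(2) gE by simp
 obtain e where e: "e : S" "e ~: C K" "conn S (e+:K)" "\<not> g (e+:K)"
  using exists_conn_point[OF fS S(3) con _ cS False] S(4) by auto
 have re: "r (e+:K) + 2 = r S" "r (e+:K) + 2 = r E" using r_notin[OF e(2)] S by auto
 have eK: "e+:K <= S" "e+:K <= E" using e S by auto
 have te: "tri S (e+:K)" by (rule conn_tri[OF fS eK(1) re(1) e(3)])
 obtain x0 where x0: "x0 : S" "x0 ~: C (e+:K)" "\<not> g (x0+:e+:K)"
 proof -
  have "r (e+:K) + 2 \<le> r S" using re by simp
  from ex_pair_notin_C[OF fS eK(1) this] obtain x y
   where xy: "x : S" "y : S" "x ~: C (e+:K)" "y ~: C (x+:e+:K)" by blast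
  have "y ~: C (e+:K)" using notin_sym[OF xy(3,4)] by blast
  moreover have "\<not> g (x+:e+:K) \<or> \<not> g (y+:e+:K)" using cut_point[OF cS eK(1) xy(1,2,4)] e(4) by blast
  ultimately show thesis using that xy by blast
 qed
 define X0 where "X0 = x0+:e+:K"
 define W where "W x = x+:e+:K" for x
 \<comment> \<open>\<open>x\<close> is a point of the line \<open>X\<close> at which one may turn
   from \<open>X\<close> into the line \<open>W x\<close> joining \<open>x\<close> to
   \<open>e\<close>.\<close>
 define good where "good X x \<longleftrightarrow> x : S \<and> x : C X \<and> x ~: C K \<and> e ~: C (x+:K) \<and> \<not> g (W x) \<and> tri S (x+:K)" for X x
 define f where "f X = (if e : C X then a X0 X else (let x = (SOME x. good X x) in a X0 (W x) + a (W x) X))" for X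
 have f_inv: "f X = f Y" if c: "C X = C Y" for X Y
 proof -
  have "good X = good Y" unfolding good_def using c by auto
  thus ?thesis unfolding f_def Let_def using c a_inv[OF refl c] by simp
 qed
 have tE: "tri S L \<Longrightarrow> tri E L" for L using tri_mono S(1) by blast
 have lineE: "a X0 (W x) + a (W x) (W y) = a X0 (W y)"
  if "x : S" "y : S" "x ~: C (e+:K)" "y ~: C (e+:K)" "\<not> g (W x)" "\<not> g (W y)" for x y
  unfolding X0_def W_def by (rule a_line[OF eK(2) re(2)]) (use that x0 S(1) in \<open>auto simp: W_def\<close>)
 have sym: "x ~: C (e+:K)" if "x ~: C K" "e ~: C (x+:K)" for x using notin_sym[OF that] by blast
 have hypX: "C X = C (u+:v+:K)"
  if "finite X" "K <= C X" "Suc (r X) = r S" "u : C X" "v : C X" "v ~: C K" "u ~: C (v+:K)" for X u v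
  by (rule C_eq_sub[symmetric]) (use that S(4) r_insert2[OF that(6,7)] fK in auto)
 \<comment> \<open>The value does not depend on the turning point: two of them form a triangle with
   \<open>e\<close>.\<close>
 have F: "f X = a X0 (W x) + a (W x) X"
  if X: "X <= S" "K <= C X" "Suc (r X) = r S" "\<not> g X" and gx: "good X x" for X x
 proof -
  have fX: "finite X" using X(1) fS finite_subset by blast
  have x: "x : S" "x : C X" "x ~: C K" "e ~: C (x+:K)" "\<not> g (W x)" "tri S (x+:K)" using gx unfolding good_def by auto
  show ?thesis
  proof (cases "e : C X")
   case True
   hence "C X = C (W x)" unfolding W_def insert_commute[of x e] using hypX[OF fX X(2,3) True x(2,3,4)] by simp
   thus ?thesis using True a_inv[OF refl, of X "W x" X0] a_zero[of "W x" X] unfolding f_def by simp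
  next
   case False
   define x' where "x' = (SOME x. good X x)"
   have gx': "good X x'" unfolding x'_def using gx by (rule someI)
   have x': "x' : S" "x' : C X" "x' ~: C K" "e ~: C (x'+:K)" "\<not> g (W x')" "tri S (x'+:K)" using gx' unfolding good_def by auto
   have fe: "f X = a X0 (W x') + a (W x') X" unfolding f_def Let_def x'_def using False by simp
   show ?thesis
   proof (cases "x' : C (x+:K)")
    case True
    have "C (x+:K) = C (x'+:K)" by (rule C_point[OF x(3) x'(3) True])
    hence "C (e+:x+:K) = C (e+:x'+:K)" by (intro C_insert_cong) (use fK in auto)
    hence c: "C (W x) = C (W x')" unfolding W_def by (simp add: insert_commute)
    show ?thesis using fe a_inv[OF refl c, of X0] a_inv[OF c refl, of X] by simp
   next
    case False
    have cX: "C X = C (x'+:x+:K)" by (rule hypX[OF fX X(2,3) x'(2) x(2,3) False])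
    have nx: "\<not> g (x'+:x+:K)" using g_cong[OF _ _ cX] X(1,4) x(1) x'(1) S by auto
    have rk: "r (e+:x+:x'+:K) = r E"
    proof -
     have "e ~: C (x'+:x+:K)" using \<open>e ~: C X\<close> cX by simp
     from r_notin[OF this] r_notin[OF False] r_notin[OF x(3)] show ?thesis using KE by (simp add: insert_commute)
    qed
    have "a (e+:x+:K) (e+:x'+:K) + a (e+:x'+:K) (x+:x'+:K)
      = a (e+:x+:K) (x+:x'+:K)" by (rule class_2b[OF KE _ _ _ rk])
      (use e x x' S(1) te tE nx in \<open>auto simp: W_def insert_commute\<close>)
    hence "a (W x) (W x') + a (W x') X = a (W x) X" using a_inv[OF refl cX] unfolding W_def by (simp add: insert_commute)
    moreover have "a X0 (W x) + a (W x) (W x') = a X0 (W x')"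
     by (rule lineE[OF x(1) x'(1) sym[OF x(3,4)] sym[OF x'(3,4)] x(5) x'(5)])
    ultimately show ?thesis using fe by (metis add.assoc)
   qed
  qed
 qed
 have ex_good: "\<exists>x. good X x" if X: "X <= S" "K <= C X" "Suc (r X) = r S" "\<not> g X" "e ~: C X" for X
 proof -
  define H where "H = S Int C X"
  have XH: "X <= H" using X subset_C H_def by blast
  have fH: "finite H" using fS H_def by blast
  have rH: "r H = r X" using r_between_C[OF fH XH] H_def by blast
  have CH: "C H = C X" using C_eqI[OF XH rH] .
  have "K <= H" "H <= S" "Suc (r H) = r S" "S Int C H <= H" "e ~: C H" using X S(3) H_def rH CH by auto
  from good_corank2[OF fS con cS gS this(1-4) e(1) this(5) e(4)] obtain L
   where L: "K <= L" "L <= H" "r L + 2 = r S" "\<not> g (e+:L)" "tri S L" by blast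
  have fL: "finite L" using fH L(2) finite_subset by blast
  have "r L = Suc (r K)" using L(3) S(4) by simp
  from point_of[OF fL L(1) this] obtain p where p: "p : L" "p ~: C K" "C (p+:K) = C L" .
  have f1: "finite (p+:K)" using fK by simp
  have "tri S (p+:K)" using tri_cong[OF p(3) f1 fL] L(5) by simp
  moreover have "C (p+:K) <= C X" using p(3) C_mono[OF L(2)] CH by simp
  hence "e ~: C (p+:K)" using X(5) by blast
  moreover have "\<not> g (W p)"
  proof -
   have "W p <= e+:L" "e+:L <= E" using p L e S H_def unfolding W_def by auto
   thus ?thesis using g_mono L(4) by blast
  qed
  ultimately have "good X p" unfolding good_def using p L(2) H_def by auto
  thus ?thesis by blast
 qed
 \<comment> \<open>Two lines through \<open>p\<close>. If \<open>p\<close> is parallel to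
   \<open>e\<close> they belong to the pencil; if the line \<open>ep\<close> is off the cut,
   \<open>p\<close> is a turning point of both; otherwise turning points \<open>x1\<close>,
   \<open>y1\<close> other than \<open>p\<close> are needed.\<close>
 have edge: "f (y+:p+:K) = f (x+:p+:K) + a (x+:p+:K) (y+:p+:K)"
  if p: "p : S" "p ~: C K" "tri S (p+:K)" and xy: "x : S" "y : S" "x ~: C (p+:K)" "y ~: C (p+:K)"
   "y ~: C (x+:p+:K)" and ng: "\<not> g (x+:p+:K)" "\<not> g (y+:p+:K)" for p x y
 proof -
  let ?X = "x+:p+:K" and ?Y = "y+:p+:K"
  have X: "?X <= S" "K <= C ?X" "Suc (r ?X) = r S" and Y: "?Y <= S" "K <= C ?Y" "Suc (r ?Y) = r S"
   using p xy S r_notin[OF p(2)] r_notin[OF xy(3)] r_notin[OF xy(4)] subset_C[of ?X] subset_C[of ?Y] by auto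
  have fXY: "finite ?X" "finite ?Y" using fK by auto
  have pK: "p+:K <= E" "r (p+:K) + 2 = r E" using p S r_notin[OF p(2)] by auto
  show ?thesis
  proof (cases "e : C (p+:K)")
   case True
   have c: "C (p+:K) = C (e+:K)" by (rule C_point[OF p(2) e(2) True])
   have eX: "e : C ?X" "e : C ?Y" using True C_mono[of "p+:K" ?X] C_mono[of "p+:K" ?Y] by auto
   have cc: "C (u+:p+:K) = C (W u)" for u unfolding W_def by (rule C_insert_cong[OF _ _ c]) (use fK in auto)
   have n: "\<not> g (W x)" "\<not> g (W y)" using g_cong[OF _ _ cc] ng xy p e S unfolding W_def by auto
   have "a X0 (W x) + a (W x) (W y) = a X0 (W y)" by (rule lineE) (use xy c n in auto)
   thus ?thesis unfolding f_def using eX a_inv[OF refl cc] a_inv[OF cc cc] by simp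
  next
   case eP: False
   have peK: "p ~: C (e+:K)" using sym p eP by blast
   show ?thesis
   proof (cases "g (W p)")
    case False
    have "good ?X p" "good ?Y p" unfolding good_def using p eP False subset_C[of ?X] subset_C[of ?Y] by auto
    hence fX: "f ?X = a X0 (W p) + a (W p) ?X" and fY: "f ?Y = a X0 (W p) + a (W p) ?Y" using F X Y ng by blast+
    have ce: "W p = e+:p+:K" unfolding W_def by (rule insert_commute)
    have "a (e+:p+:K) ?X + a ?X ?Y = a (e+:p+:K) ?Y" by (rule a_line[OF pK]) (use e xy p S eP ng False ce in auto)
    thus ?thesis using fX fY ce by (metis add.assoc)
   next
    case True
    have neX: "e ~: C V" if "V <= S" "finite V" "K <= C V" "Suc (r V) = r S" "\<not> g V" "p : C V" for V
    proof
     assume "e : C V"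
     hence c: "C V = C (e+:p+:K)" using hypX[OF that(2-4) _ that(6) p(2) eP] by blast
     have "g V = g (e+:p+:K)" by (rule g_cong[OF _ _ c]) (use that(1) S e p in auto)
     moreover have "e+:p+:K = W p" unfolding W_def by (rule insert_commute)
     ultimately show False using True that(5) by simp
    qed
    have pX: "p : C ?X" "p : C ?Y" using subset_C[of ?X] subset_C[of ?Y] by auto
    have eX: "e ~: C ?X" "e ~: C ?Y" using neX X Y fXY ng pX by blast+
    obtain x1 where x1: "good ?X x1" using ex_good[OF X ng(1) eX(1)] by blast
    obtain y1 where y1: "good ?Y y1" using ex_good[OF Y ng(2) eX(2)] by blast
    have x1': "x1 : S" "x1 : C ?X" "x1 ~: C K" "e ~: C (x1+:K)" "\<not> g (W x1)" "tri S (x1+:K)" using x1 unfolding good_def by auto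
    have y1': "y1 : S" "y1 : C ?Y" "y1 ~: C K" "e ~: C (y1+:K)" "\<not> g (W y1)" "tri S (y1+:K)" using y1 unfolding good_def by auto
    have notp: "u ~: C (p+:K)" if "u ~: C K" "u : S" "\<not> g (W u)" for u
    proof
     assume "u : C (p+:K)"
     hence "C (p+:K) = C (u+:K)" using C_point p(2) that(1) by blast
     hence "C (e+:p+:K) = C (e+:u+:K)" by (intro C_insert_cong) (use fK in auto)
     hence c: "C (W p) = C (W u)" unfolding W_def by (simp add: insert_commute)
     have "g (W p) = g (W u)" by (rule g_cong[OF _ _ c]) (use that(2) p e S in \<open>auto simp: W_def\<close>)
     thus False using True that(3) by blast
    qed
    have cX: "C ?X = C (x1+:p+:K)" by (rule hypX[OF fXY(1) X(2,3) x1'(2) pX(1) p(2) notp[OF x1'(3,1,5)]])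
    have cY: "C ?Y = C (y1+:p+:K)" by (rule hypX[OF fXY(2) Y(2,3) y1'(2) pX(2) p(2) notp[OF y1'(3,1,5)]])
    have fX: "f ?X = a X0 (W x1) + a (W x1) (x1+:p+:K)" using F[OF X ng(1) x1] a_inv[OF refl cX] by simp
    have fY: "f ?Y = a X0 (W y1) + a (W y1) (y1+:p+:K)" using F[OF Y ng(2) y1] a_inv[OF refl cY] by simp
    have aXY: "a ?X ?Y = a (x1+:p+:K) (y1+:p+:K)" by (rule a_inv[OF cX cY])
    have n1: "\<not> g (x1+:p+:K)" "\<not> g (y1+:p+:K)" using g_cong[OF _ _ cX] g_cong[OF _ _ cY] ng p xy x1' y1' S by auto
    have yX: "y ~: C (x1+:p+:K)" using xy(5) cX by simp
    have y1X: "y1 ~: C (x1+:p+:K)"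
    proof
     assume "y1 : C (x1+:p+:K)"
     hence "C (x1+:p+:K) = C (y1+:p+:K)" using C_point notp[OF x1'(3,1,5)] notp[OF y1'(3,1,5)] by blast
     thus False using yX cY subset_C[of ?Y] by auto
    qed
    have rk1: "r (p+:x1+:y1+:K) = r E" using indep3I[OF p(2) notp[OF x1'(3,1,5)] y1X] KE(2) by simp
    have lin: "a X0 (W x1) + a (W x1) (W y1) = a X0 (W y1)"
     by (rule lineE[OF x1'(1) y1'(1) sym[OF x1'(3,4)] sym[OF y1'(3,4)] x1'(5) y1'(5)])
    have goal: "a X0 (W y1) + a (W y1) (y1+:p+:K) = a X0 (W x1) + a (W x1) (x1+:p+:K) + a (x1+:p+:K) (y1+:p+:K)"
     if h: "a (W x1) (W y1) + a (W y1) (y1+:p+:K) = a (W x1) (x1+:p+:K) + a (x1+:p+:K) (y1+:p+:K)"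
     using lin h by (metis add.assoc)
    have eX1: "e ~: C (x1+:p+:K)" "e ~: C (y1+:p+:K)" using eX cX cY by auto
    show ?thesis
    \<comment> \<open>If \<open>e\<close>, \<open>x1\<close>, \<open>y1\<close> are collinear, the
      lines form a triangle with corners \<open>p\<close>, \<open>x1\<close>, \<open>y1\<close>.
      Otherwise \<open>e\<close>, \<open>p\<close>, \<open>x1\<close>, \<open>y1\<close> are in
      general position and give a square.\<close>
    proof (cases "y1 : C (W x1)")
     case True
     have c: "C (W x1) = C (W y1)" unfolding W_def by (rule C_point) (use True sym x1' y1' in \<open>auto simp: W_def\<close>)
     have c2: "C (W x1) = C (y1+:x1+:K)"
     proof (rule hypX)
      show "finite (W x1)" using fK W_def by simp
      show "K <= C (W x1)" "x1 : C (W x1)" using subset_C[of "W x1"] W_def by auto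
      show "Suc (r (W x1)) = r S" using r_notin[OF sym[OF x1'(3,4)]] re unfolding W_def by simp
      show "y1 : C (W x1)" by (rule True)
      show "x1 ~: C K" by (rule x1')
      show "y1 ~: C (x1+:K)" using y1X C_mono[of "x1+:K" "x1+:p+:K"] by auto
     qed
     have n2: "\<not> g (y1+:x1+:K)" using g_cong[OF _ _ c2] x1' y1' S e by (auto simp: W_def)
     have "a (p+:x1+:K) (p+:y1+:K) + a (p+:y1+:K) (x1+:y1+:K)
      = a (p+:x1+:K) (x1+:y1+:K)"
      by (rule class_2b[OF KE _ _ _ rk1]) (use p x1' y1' S tE n1 n2 in \<open>auto simp: insert_commute\<close>)
     hence h: "a (x1+:p+:K) (y1+:p+:K) + a (y1+:p+:K) (W x1) = a (x1+:p+:K) (W x1)"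
      using a_inv[OF refl c2] by (simp add: insert_commute)
     have "a (W y1) (y1+:p+:K) = a (W x1) (x1+:p+:K) + a (x1+:p+:K) (y1+:p+:K)"
      using a_cyc[OF h] a_inv[OF c refl, of "y1+:p+:K"] by simp
     hence "a (W x1) (W y1) + a (W y1) (y1+:p+:K) = a (W x1) (x1+:p+:K) + a (x1+:p+:K) (y1+:p+:K)" using a_zero[OF c] by simp
     from goal[OF this] show ?thesis using fX fY aXY by simp
    next
     case False
     have r1: "r (e+:p+:x1+:K) = r E" "r (e+:p+:y1+:K) = r E"
      using indep3I[OF p(2) notp[OF x1'(3,1,5)] eX1(1)] indep3I[OF p(2) notp[OF y1'(3,1,5)] eX1(2)] KE(2) by (simp_all add: insert_commute)
     have r2: "r (e+:x1+:y1+:K) = r E" using indep3I[OF e(2) sym[OF x1'(3,4)] False[unfolded W_def]] KE(2) by simp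
     have "a (e+:x1+:K) (e+:y1+:K) + a (e+:y1+:K) (p+:y1+:K)
      + a (p+:y1+:K) (p+:x1+:K) + a (p+:x1+:K) (e+:x1+:K) = 0"
      by (rule square[OF KE]) (use e p x1' y1' S r1 r2 rk1 n1 in \<open>auto simp: insert_commute W_def\<close>)
     hence h: "a (W x1) (W y1) + a (W y1) (y1+:p+:K) + a (y1+:p+:K) (x1+:p+:K) + a (x1+:p+:K) (W x1) = 0"
      unfolding W_def by (simp add: insert_commute)
     hence "a (W x1) (W y1) + a (W y1) (y1+:p+:K) = a (W x1) (x1+:p+:K) + a (x1+:p+:K) (y1+:p+:K)"
      unfolding a_anti[of "y1+:p+:K" "x1+:p+:K"] a_anti[of "x1+:p+:K" "W x1"] by (simp add: algebra_simps)
     from goal[OF this] show ?thesis using fX fY aXY by simp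
    qed
   qed
  qed
 qed
 have "pot S K f"
 proof (rule potI[OF f_inv])
  fix L x y assume h: "K <= L" "L <= S" "r L + 2 = r S" "tri S L" "x : S" "y : S" "x ~: C L" "y ~: C L" "y ~: C (x+:L)"
    "\<not> g (x+:L)" "\<not> g (y+:L)"
  have fL: "finite L" using fS h(2) finite_subset by blast
  have "r L = Suc (r K)" using h(3) S(4) by simp
  from point_of[OF fL h(1) this] obtain p where p: "p : L" "p ~: C K" "C (p+:K) = C L" .
  have f1: "finite (p+:K)" using fK by simp
  have cc: "C (u+:p+:K) = C (u+:L)" for u by (rule C_insert_cong[OF f1 fL p(3)])
  have sE: "p : E" "K <= E" "L <= E" "x : E" "y : E" using h(1,2,5,6) p(1) S(1) by blast+
  hence n: "\<not> g (x+:p+:K)" "\<not> g (y+:p+:K)" using g_cong[OF _ _ cc[of x]] g_cong[OF _ _ cc[of y]] h(10,11) by simp_all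
  have "f (y+:p+:K) = f (x+:p+:K) + a (x+:p+:K) (y+:p+:K)" by (rule edge) (use h p cc n tri_cong[OF p(3) f1 fL] in auto)
  thus "f (y+:L) = f (x+:L) + a (x+:L) (y+:L)" using f_inv[OF cc] a_inv[OF cc cc] by simp
 qed
 thus ?thesis by blast
qed

end

section \<open>Extending a potential over a deleted element\<close>

context rank_fun begin

text \<open>In rank 3 a proper separation consists of a point and a line. If the point belongs to
  one of the given lines, the separating line is the other one and the first line has no room; if it
  belongs to neither, both given lines would be the separating line.\<close>

lemma two_lines_conn:
 assumes S: "r S = r J + 3" "U <= S" "V <= S" "finite S"
  and rU: "r J + 2 \<le> r (J Un U)" and rV: "r J + 2 \<le> r (J Un V)"
  and J: "J Int U = {}" "J Int V = {}"
  and uV: "\<And>u. u : U \<Longrightarrow> u ~: C (J Un V)" and vU: "\<And>v. v : V \<Longrightarrow> v ~: C (J Un U)"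
 shows "conn S J"
proof -
 have no: False if AB: "J <= A" "J <= B" "A Un B = S" "r A = r J + 1" "r B = r J + 2"
  and UV: "U <= S" "V <= S" "r J + 2 \<le> r (J Un U)" "r J + 2 \<le> r (J Un V)"
   "\<And>u. u : U \<Longrightarrow> u ~: C (J Un V)" "\<And>v. v : V \<Longrightarrow> v ~: C (J Un U)"
  and u: "u : U" "u : A" for A B U V u
 proof -
  have uJ: "u ~: C J" using UV(5)[OF u(1)] C_mono[of J "J Un V"] by blast
  have fA: "finite A" "finite B" using AB(3) S(4) by auto
  have "C A = C (u+:J)" by (rule C_eqI) (use AB u r_notin[OF uJ] in auto)
  hence "A <= C (J Un U)" using subset_C[of A] C_mono[of "u+:J" "J Un U"] u by blast
  hence VB: "V <= B" using UV(2,6) AB(3) by blast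
  hence "r (J Un V) = r B" using mono[of "J Un V" B] AB UV(4) by auto
  hence "C B = C (J Un V)" by (intro C_eqI) (use VB AB in auto)
  hence "U Int B = {}" using UV(5) subset_C[of B] by blast
  hence "J Un U <= A" using UV(1) AB by blast
  hence "r (J Un U) \<le> r A" by (rule mono)
  thus False using UV(3) AB(4) by linarith
 qed
 have no': False if AB: "J <= A" "J <= B" "A Un B = S" "r A = r J + 1" "r B = r J + 2" for A B
 proof (cases "U Int A = {} \<and> V Int A = {}")
  case True
  hence UB: "J Un U <= B" "V <= B" using AB S by blast+
  have "r (J Un U) = r B" using mono[OF UB(1)] rU AB by linarith
  hence "C B = C (J Un U)" by (intro C_eqI) (use UB in auto)
  hence "V = {}" using vU UB(2) subset_C[of B] by blast
  thus False using rV by simp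
 next
  case False
  then obtain u where "(u : U \<and> u : A) \<or> (u : V \<and> u : A)" by blast
  thus False
  proof
   assume "u : U \<and> u : A" thus False using no[OF AB S(2,3) rU rV uV vU] by blast
  next
   assume "u : V \<and> u : A" thus False using no[OF AB S(3,2) rV rU vU uV] by blast
  qed
 qed
 show ?thesis unfolding conn_def
 proof (intro allI impI)
  fix A B assume AB: "J <= A" "J <= B" "A Un B = S" "r A + r B = r S + r J"
  show "r A = r J \<or> r B = r J"
  proof (rule ccontr)
   assume n: "\<not> ?thesis"
   have "r J \<le> r A" "r J \<le> r B" using mono[OF AB(1)] mono[OF AB(2)] .
   with n have "(r A = r J + 1 \<and> r B = r J + 2) \<or> (r B = r J + 1 \<and> r A = r J + 2)" using AB(4) S(1) by linarith
   thus False using no'[OF AB(1-3)] no'[OF AB(2,1)] AB(3) by (auto simp: Un_commute)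
  qed
 qed
qed

end

context tutte_cochain begin

text \<open>The cochain cancels in the difference of two potentials, which is therefore constant
  along edges; the path theorem does the rest.\<close>

lemma pot_compare:
 assumes T: "T <= E" "r T = r E" "K <= T" "conn T K"
  and 1: "pot S1 K1 f1" "T <= S1" "S1 <= E" "K1 <= S1" "K1 <= C K"
  and 2: "pot S2 K2 f2" "T <= S2" "S2 <= E" "K2 <= S2" "K2 <= C K"
  and X: "K <= X" "X <= T" "Suc (r X) = r E" "\<not> g X" and Y: "K <= Y" "Y <= T" "Suc (r Y) = r E" "\<not> g Y"
 shows "f1 X - f2 X = f1 Y - f2 Y"
proof (rule hyperplanes_connected[where S = T and g = g and K = K and h = "\<lambda>X. f1 X - f2 X"])
 show "finite T" using T finE finite_subset by blast
 show "cut T g" using cut_subset[OF cutg T(1)] .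
 show "g T" using cut_down[OF cutg T(1) order_refl] T(2) gE by simp
 show "f1 X - f2 X = f1 Y - f2 Y" if "C X = C Y" for X Y using pot_inv[OF 1(1) that] pot_inv[OF 2(1) that] by simp
 fix L x y assume h: "K <= L" "L <= T" "r L + 2 = r T" "tri T L" "x : T" "y : T" "x ~: C L" "y ~: C (x+:L)"
   "\<not> g (x+:L)" "\<not> g (y+:L)"
 have y: "y ~: C L" using h(8) C_mono[of L "x+:L"] by blast
 have k: "K1 <= C L" "K2 <= C L" using 1(5) 2(5) C_mono[OF h(1)] by blast+
 have rS: "r S1 = r E" "r S2 = r E" using mono[OF 1(2)] mono[OF 1(3)] mono[OF 2(2)] mono[OF 2(3)] T(2) by linarith+
 have LS: "L <= S1" "L <= S2" "x : S1" "y : S1" "x : S2" "y : S2" "r L + 2 = r S1" "r L + 2 = r S2"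
  using h(2,3,5,6) 1(2) 2(2) rS T(2) by auto
 have "f1 (y+:L) = f1 (x+:L) + a (x+:L) (y+:L)"
  by (rule pot_edge[OF 1(1,3,4) k(1)]) (use h LS y tri_mono[OF h(4) 1(2)] in simp_all)
 moreover have "f2 (y+:L) = f2 (x+:L) + a (x+:L) (y+:L)"
  by (rule pot_edge[OF 2(1,3,4) k(2)]) (use h LS y tri_mono[OF h(4) 2(2)] in simp_all)
 ultimately show "f1 (x+:L) - f2 (x+:L) = f1 (y+:L) - f2 (y+:L)" by simp
qed (use T X Y in auto)

text \<open>Edges at corank 2 flats that become indecomposable, or appear at all, only through
  \<open>e\<close> are checked by comparison with a potential over a larger set \<open>J\<close>,
  which \<open>IH2\<close> provides.\<close>

theorem pot_delete:
 assumes S: "S <= E" "r S = r E" "K0 <= S" "r K0 + 4 \<le> r S" "conn S K0"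
  and e: "e : S" "e ~: K0" "r (S - {e}) = r S" "conn (S - {e}) K0"
  and IH1: "\<exists>f. pot (S - {e}) K0 f"
  and IH2: "\<And>K. \<lbrakk>K0 <= K; K <= S; r K0 < r K; conn S K\<rbrakk> \<Longrightarrow> \<exists>f. pot S K f"
 shows "\<exists>f. pot S K0 f"
proof -
 define S' where "S' = S - {e}"
 have S': "S' <= S" "S' <= E" "r S' = r E" "K0 <= S'" "conn S' K0" "e ~: S'" using S e S'_def by auto
 have inS': "z : S'" if "z : S" "z \<noteq> e" for z using that S'_def by blast
 have fS: "finite S" "finite S'" using S S' finE finite_subset by blast+
 obtain f' where f': "pot S' K0 f'" using IH1 S'_def by blast
 have sep: "u : C L" if "u : C (x+:L)" "u : C (y+:L)" "x ~: C L" "y ~: C (x+:L)" for u x y L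
 proof (rule ccontr)
  assume n: "u ~: C L"
  have "x : C (u+:L)" using exch[OF that(1) n] .
  moreover have "y ~: C L" using that(4) C_mono[of L "x+:L"] by blast
  hence "C (y+:L) = C (u+:L)" using C_point[OF _ n that(2)] by blast
  ultimately have "x : C (y+:L)" by simp
  thus False using notin_sym[OF that(3,4)] by blast
 qed
 have step1: "f' (y+:L) = f' (x+:L) + a (x+:L) (y+:L)"
  if L: "K0 <= L" "L <= S'" "r L + 2 = r E" "tri S L" and flat: "S' Int C L <= L"
  and x: "x : S'" "y : S'" "x ~: C L" "y ~: C (x+:L)" "\<not> g (x+:L)" "\<not> g (y+:L)" for L x y
 proof (cases "tri S' L")
  case True
  have y: "y ~: C L" using x(4) C_mono[of L "x+:L"] by blast
  show ?thesis by (rule pot_step[OF f']) (use L x y True S'(3) in auto)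
 next
  case False
  have y: "y ~: C L" using x(4) C_mono[of L "x+:L"] by blast
  \<comment> \<open>In \<open>S'\<close> only two hyperplanes pass through \<open>L\<close>;
    \<open>U\<close> and \<open>V\<close> are their parts outside \<open>L\<close>.\<close>
  define U where "U = S' Int C (x+:L) - C L"
  define V where "V = S' Int C (y+:L) - C L"
  have cov: "S' = L Un U Un V"
  proof
   show "L Un U Un V <= S'" using L U_def V_def by blast
   show "S' <= L Un U Un V"
   proof
    fix z assume z: "z : S'"
    have "z : C (x+:L) \<or> z : C (y+:L)" using False triI[OF x(1,2) z x(3,4)] by blast
    thus "z : L Un U Un V" using z flat unfolding U_def V_def by blast
   qed
  qed
  have fL: "finite L" "finite U" "finite V" using L(2) fS U_def V_def finite_subset by auto
  have xU: "x : U" "y : V" unfolding U_def V_def using x y subset_C[of "x+:L"] subset_C[of "y+:L"] by auto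
  have n1: "r X + 1 \<le> r (X Un W)" if "X <= L" "w : W" "w ~: C L" for X w W
  proof -
   have "w ~: C X" using that C_mono by blast
   hence "r (w+:X) = r X + 1" using r_notin by simp
   thus ?thesis using mono[of "w+:X" "X Un W"] that by auto
  qed
  have c1: "cut L (\<lambda>X. r (X Un U) \<le> r X + 1)" by (rule cut_span[OF n1]) (use xU x in auto)
  have c2: "cut L (\<lambda>X. r (X Un V) \<le> r X + 1)" by (rule cut_span[OF n1]) (use xU y in auto)
  have rU: "r (L Un U) \<le> r L + 1"
  proof -
   have "L Un U <= C (x+:L)" using U_def subset_C[of "x+:L"] by blast
   thus ?thesis using r_le_C[of "L Un U" "x+:L"] fL r_notin[OF x(3)] by simp
  qed
  have rV: "r (L Un V) \<le> r L + 1"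
  proof -
   have "L Un V <= C (y+:L)" using V_def subset_C[of "y+:L"] by blast
   thus ?thesis using r_le_C[of "L Un V" "y+:L"] fL r_notin[OF y] by simp
  qed
  \<comment> \<open>If every hyperplane \<open>J\<close> of \<open>L\<close> saw \<open>U\<close> or
    \<open>V\<close> as a single point, uncrossing would produce a separation of \<open>S'\<close>
    over \<open>K0\<close>.\<close>
  have "\<exists>J. K0 <= J \<and> J <= L \<and> Suc (r J) = r L \<and> r J + 2 \<le> r (J Un U) \<and> r J + 2 \<le> r (J Un V)"
  proof (rule ccontr)
   assume n: "\<not> ?thesis"
   have cov2: "r (J Un U) \<le> r J + 1 \<or> r (J Un V) \<le> r J + 1" if "K0 <= J" "J <= L" "Suc (r J) = r L" for J
   proof (rule ccontr)
    assume "\<not> ?thesis"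
    hence "r J + 2 \<le> r (J Un U)" "r J + 2 \<le> r (J Un V)" by auto
    thus False using n that by blast
   qed
   from two_cuts[OF fL(1) L(1) c1 c2 rU rV cov2] obtain A B where
    AB: "K0 <= A" "K0 <= B" "A Un B = L" "r A + r B = r L + r K0" "r (A Un U) \<le> r A + 1" "r (B Un V) \<le> r B + 1" by blast
   have un: "(A Un U) Un (B Un V) = S'" using AB(3) cov by blast
   have "r (A Un U) = r K0 \<or> r (B Un V) = r K0" by (rule connD[OF S'(5) _ _ un]) (use AB L(3) S'(3) in auto)
   moreover have "r A + 1 \<le> r (A Un U)" "r B + 1 \<le> r (B Un V)" using n1[of A x U] n1[of B y V] AB(3) xU x y by auto
   moreover have "r K0 \<le> r A" "r K0 \<le> r B" using mono AB by auto
   ultimately show False by linarith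
  qed
  then obtain J where J: "K0 <= J" "J <= L" "Suc (r J) = r L" "r J + 2 \<le> r (J Un U)" "r J + 2 \<le> r (J Un V)" by blast
  have JU: "C (J Un U) <= C (x+:L)" by (rule C_subset_C) (use J fL U_def subset_C[of "x+:L"] finite_subset in auto)
  have JV: "C (J Un V) <= C (y+:L)" by (rule C_subset_C) (use J fL V_def subset_C[of "y+:L"] finite_subset in auto)
  have "conn S' J"
  proof (rule two_lines_conn[where U = U and V = V])
   show "r S' = r J + 3" using J(3) L(3) S'(3) by simp
   show "U <= S'" "V <= S'" using U_def V_def by auto
   show "J Int U = {}" "J Int V = {}" using J(2) subset_C[of L] U_def V_def by auto
   show "u ~: C (J Un V)" if "u : U" for u using that JV sep[OF _ _ x(3,4)] U_def by blast
   show "v ~: C (J Un U)" if "v : V" for v using that JU sep[OF _ _ x(3,4)] V_def by blast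
  qed (use fS J in auto)
  have JS: "J <= S'" "J <= S" using J L S' by auto
  have "conn S J" by (rule conn_superset[OF \<open>conn S' J\<close> S'(1) _ JS(1)]) (use S S' in simp)
  moreover have "r K0 < r J" using J(3) L(3) S(2,4) by linarith
  ultimately obtain fJ where fJ: "pot S J fJ" using IH2[OF J(1) JS(2)] by blast
  have X: "J <= x+:L" "x+:L <= S'" "Suc (r (x+:L)) = r E" "\<not> g (x+:L)"
   and Y: "J <= y+:L" "y+:L <= S'" "Suc (r (y+:L)) = r E" "\<not> g (y+:L)" using J L x r_notin[OF x(3)] r_notin[OF y] by auto
  have k: "K0 <= C J" "J <= C J" using J(1) subset_C[of J] by auto
  have "f' (x+:L) - fJ (x+:L) = f' (y+:L) - fJ (y+:L)"
   by (rule pot_compare[OF S'(2,3) JS(1) \<open>conn S' J\<close> f' order_refl S'(2,4) k(1) fJ S'(1) S(1) JS(2) k(2) X Y])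
  moreover have "fJ (y+:L) = fJ (x+:L) + a (x+:L) (y+:L)" by (rule pot_step[OF fJ J(2)]) (use L x y S S' in auto)
  ultimately show ?thesis by (simp add: algebra_simps)
 qed
 have step1': "f' (y+:L) = f' (x+:L) + a (x+:L) (y+:L)"
  if L: "K0 <= L" "L <= S'" "r L + 2 = r E" "tri S L"
  and x: "x : S'" "y : S'" "x ~: C L" "y ~: C L" "\<not> g (x+:L)" "\<not> g (y+:L)" for L x y
 proof (cases "y : C (x+:L)")
  case True
  hence e: "C (x+:L) = C (y+:L)" using C_point x by blast
  show ?thesis using pot_inv[OF f' e] a_zero[OF e] by simp
 next
  case False
  define L1 where "L1 = S' Int C L"
  have f1: "finite L1" "finite L" using L1_def fS L(2) finite_subset by auto
  have LL: "L <= L1" "L1 <= C L" using L1_def L(2) subset_C[of L] by auto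
  have cL: "C L1 = C L" by (rule C_between[OF f1(1) LL])
  have rL: "r L1 = r L" by (rule r_between_C[OF f1(1) LL])
  have cc: "C (u+:L1) = C (u+:L)" for u by (rule C_insert_cong[OF f1 cL])
  have ng: "\<not> g (u+:L1)" if "u : S'" "\<not> g (u+:L)" for u
  proof -
   have "u+:L1 <= E" "u+:L <= E" using that(1) L1_def S'(2) L(2) by auto
   from g_cong[OF this cc] show ?thesis using that(2) by blast
  qed
  have "f' (y+:L1) = f' (x+:L1) + a (x+:L1) (y+:L1)"
   by (rule step1) (use L LL cL rL x ng cc False L1_def tri_cong[OF cL f1] in auto)
  thus ?thesis using pot_inv[OF f' cc] a_inv[OF cc cc] by simp
 qed
 \<comment> \<open>The trace on \<open>S'\<close>. When it is not a hyperplane of \<open>S'\<close>,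
   the value at \<open>X\<close> is obtained by one edge from a hyperplane \<open>h+:(P X)\<close>
   off the cut.\<close>
 define P where "P X = C X Int S'" for X
 define ok where "ok X h \<longleftrightarrow> h : S' \<and> h ~: C (P X) \<and> \<not> g (h+:(P X))" for X h
 define f where "f X = (if Suc (r (P X)) = r E then f' (P X)
   else f' ((SOME h. ok X h)+:(P X)) + a ((SOME h. ok X h)+:(P X)) X)" for X
 have f_inv: "f X = f Y" if c: "C X = C Y" for X Y
 proof -
  have p: "P X = P Y" unfolding P_def c ..
  hence "ok X = ok Y" unfolding ok_def by simp
  thus ?thesis unfolding f_def p using a_inv[OF refl c] by simp
 qed
 have old: "f X = f' X" if "X <= S'" "Suc (r X) = r E" for X
 proof -
  have fP: "finite (P X)" "X <= P X" "P X <= C X" unfolding P_def using fS that(1) subset_C[of X] by auto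
  have "Suc (r (P X)) = r E" using r_between_C[OF fP] that(2) by simp
  thus ?thesis unfolding f_def using pot_inv[OF f' C_between[OF fP]] by simp
 qed
 have ex_off: "\<exists>h\<in>S'. h ~: C L \<and> \<not> g (h+:L)" if L: "L <= S'" "r L + 2 = r E" "\<not> g L" for L
 proof -
  have "r L + 2 \<le> r S'" using L S' by simp
  from ex_pair_notin_C[OF fS(2) L(1) this] obtain x y where xy: "x : S'" "y : S'" "x ~: C L" "y ~: C (x+:L)" by blast
  have "y ~: C L" using notin_sym[OF xy(3,4)] by blast
  moreover have "\<not> g (x+:L) \<or> \<not> g (y+:L)" using cut_point[OF cutg _ _ _ xy(4), of] L(1) L(3) xy(1,2) S'(2) by blast
  ultimately show ?thesis using xy by blast
 qed
 \<comment> \<open>Any other \<open>h\<close> gives the same value: two non-parallel choices and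
   \<open>e\<close> span three hyperplanes through \<open>L\<close>, so \<open>L\<close> is
   indecomposable.\<close>
 have new: "f (e+:L) = f' (h+:L) + a (h+:L) (e+:L) \<and> e ~: C (h+:L)"
  if L: "K0 <= L" "L <= S'" "r L + 2 = r E" "e ~: C L" "\<not> g (e+:L)" "Suc (r (P (e+:L))) \<noteq> r E"
   and h: "h : S'" "h ~: C L" "\<not> g (h+:L)" for L h
 proof -
  let ?X = "e+:L"
  have fP: "finite (P ?X)" "L <= P ?X" "P ?X <= C ?X" unfolding P_def using fS L(2) subset_C[of ?X] by auto
  have fL: "finite L" using L(2) fS finite_subset by blast
  have "r (P ?X) \<le> r ?X" using r_le_C[OF fP(1,3)] .
  hence rP: "r (P ?X) = r L" using mono[OF fP(2)] r_notin[OF L(4)] L(3,6) by linarith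
  have cP: "C (P ?X) = C L" by (rule C_eqI[OF fP(2) rP])
  have cc: "C (u+:(P ?X)) = C (u+:L)" for u by (rule C_insert_cong[OF fP(1) fL cP])
  have LE: "L <= E" "e+:L <= E" "P ?X <= E" using L S' S e P_def by auto
  have ngu: "g (u+:(P ?X)) = g (u+:L)" if "u : S'" for u
  proof -
   have "u+:(P ?X) <= E" "u+:L <= E" using that LE S' by auto
   thus ?thesis using g_cong[OF _ _ cc] by blast
  qed
  have eh: "e ~: C (u+:L)" if "u : S'" "u ~: C L" for u
  proof
   assume "e : C (u+:L)"
   hence "u : C ?X" using exch L(4) by blast
   hence "u : P ?X" using that P_def by blast
   thus False using subset_C[of "P ?X"] cP that(2) by blast
  qed
  define h0 where "h0 = (SOME h. ok ?X h)"
  have "ok ?X h" unfolding ok_def using h cP ngu by simp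
  hence "ok ?X h0" unfolding h0_def by (rule someI)
  hence h0: "h0 : S'" "h0 ~: C L" "\<not> g (h0+:L)" unfolding ok_def using cP ngu by auto
  have fX: "f ?X = f' (h0+:L) + a (h0+:L) ?X"
   unfolding f_def h0_def[symmetric] using L(6) pot_inv[OF f' cc] a_inv[OF cc refl] by simp
  have "f' (h0+:L) + a (h0+:L) ?X = f' (h+:L) + a (h+:L) ?X"
  proof (cases "h0 : C (h+:L)")
   case True
   have c: "C (h+:L) = C (h0+:L)" by (rule C_point[OF h(2) h0(2) True])
   show ?thesis using pot_inv[OF f' c] a_inv[OF c refl] by simp
  next
   case False
   have "tri S L" by (rule triI[of h S h0 e]) (use h h0 S' e False eh[OF h(1,2)] eh[OF h0(1,2)] in auto)
   hence "f' (h+:L) = f' (h0+:L) + a (h0+:L) (h+:L)" by (intro step1') (use L h h0 in auto)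
   moreover have "a (h0+:L) (h+:L) + a (h+:L) ?X = a (h0+:L) ?X" by (rule a_line[OF LE(1) L(3)]) (use h h0 L S' S e in auto)
   ultimately show ?thesis by (metis add.assoc)
  qed
  thus ?thesis using fX eh[OF h(1,2)] by simp
 qed
 have edge1: "f (y+:L) = f (x+:L) + a (x+:L) (y+:L)"
  if L: "K0 <= L" "L <= S'" "r L + 2 = r E" "tri S L"
  and x: "x : S" "y : S" "x ~: C L" "y ~: C L" "\<not> g (x+:L)" "\<not> g (y+:L)" for L x y
 proof -
  have fL: "finite L" using L(2) fS finite_subset by blast
  have rep: "\<exists>z'\<in>S'. z' ~: C L \<and> C (z+:L) = C (z'+:L) \<and> \<not> g (z'+:L)"
   if z: "z : S" "z ~: C L" "\<not> g (z+:L)" "z \<noteq> e \<or> Suc (r (P (e+:L))) = r E" for z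
  proof (cases "z = e")
   case True
   hence "r L < r (P (e+:L))" using z(4) L(3) by auto
   then obtain z' where z': "z' : P (e+:L)" "z' ~: C L" using C_Diff_nonempty[of "P (e+:L)" L] P_def fS by auto
   have c: "C (e+:L) = C (z'+:L)" by (rule C_point) (use z' z True P_def in auto)
   have "g (e+:L) = g (z'+:L)" by (rule g_cong[OF _ _ c]) (use z z' True L S S' P_def in auto)
   thus ?thesis using z z' c True P_def by auto
  next
   case False
   thus ?thesis using z inS' by blast
  qed
  have both: "f (y+:L) = f (x+:L) + a (x+:L) (y+:L)"
   if x: "x' : S'" "x' ~: C L" "C (x+:L) = C (x'+:L)" "\<not> g (x'+:L)"
    and y: "y' : S'" "y' ~: C L" "C (y+:L) = C (y'+:L)" "\<not> g (y'+:L)" for x' y'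
  proof -
   have "f' (y'+:L) = f' (x'+:L) + a (x'+:L) (y'+:L)" by (rule step1') (use L x y in auto)
   moreover have "f (x+:L) = f' (x'+:L)" "f (y+:L) = f' (y'+:L)"
    using f_inv[OF x(3)] f_inv[OF y(3)] old[of "x'+:L"] old[of "y'+:L"] x y L r_notin by auto
   ultimately show ?thesis using a_inv[OF x(3) y(3)] by simp
  qed
  show ?thesis
  proof (cases "Suc (r (P (e+:L))) = r E \<or> (x \<noteq> e \<and> y \<noteq> e)")
   case True
   thus ?thesis using rep[of x] rep[of y] both x by blast
  next
   case False
   then consider "x = e" "y = e" | "x = e" "y : S'" | "x : S'" "y = e" using x(1,2) inS' by blast
   thus ?thesis
   proof cases
    case 1 thus ?thesis using a_refl by simp
   next
    case 2
    have "f (e+:L) = f' (y+:L) + a (y+:L) (e+:L)" using new[OF L(1-3)] x 2 False by blast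
    moreover have "f (y+:L) = f' (y+:L)" using old 2 L x r_notin by auto
    ultimately show ?thesis using 2 a_anti[of "y+:L" "e+:L"] by simp
   next
    case 3
    have "f (e+:L) = f' (x+:L) + a (x+:L) (e+:L)" using new[OF L(1-3)] x 3 False by blast
    moreover have "f (x+:L) = f' (x+:L)" using old 3 L x r_notin by auto
    ultimately show ?thesis using 3 by simp
   qed
  qed
 qed
 have edge2: "f (y+:L) = f (x+:L) + a (x+:L) (y+:L)"
  if L: "K0 <= L" "L <= S" "r L + 2 = r E" "tri S L" and L': "L' <= S'" "K0 <= L'" "C L' = C L"
  and x: "x : S" "y : S" "x ~: C L" "y ~: C L" "\<not> g (x+:L)" "\<not> g (y+:L)" for L L' x y
 proof -
  have f1: "finite L'" "finite L" using fS L L' finite_subset by auto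
  have cc: "C (u+:L') = C (u+:L)" for u by (rule C_insert_cong[OF f1 L'(3)])
  have rL: "r L' = r L" by (rule r_cong_C[OF f1 L'(3)])
  have ng: "\<not> g (u+:L')" if "u : S" "\<not> g (u+:L)" for u
  proof -
   have "u+:L' <= E" "u+:L <= E" using that(1) L(2) L'(1) S(1) S'(2) by auto
   from g_cong[OF this cc] show ?thesis using that(2) by blast
  qed
  have "f (y+:L') = f (x+:L') + a (x+:L') (y+:L')"
   by (rule edge1[OF L'(2,1)]) (use L(3,4) L'(3) rL x ng tri_cong[OF L'(3) f1] in simp_all)
  thus ?thesis using f_inv[OF cc] a_inv[OF cc cc] by simp
 qed
 \<comment> \<open>The remaining flats cannot be spanned inside \<open>S'\<close>: over
   \<open>J\<close> no element of \<open>S'\<close> is parallel to \<open>e\<close>.\<close>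
 have edge3: "f (y+:L) = f (x+:L) + a (x+:L) (y+:L)"
  if L: "K0 <= L" "L <= S" "r L + 2 = r E" "tri S L"
  and J: "L = e+:J" "e ~: C J" "J <= S'" "K0 <= J" and np: "\<And>c. c : S' \<Longrightarrow> c : C (e+:J) \<Longrightarrow> c : C J"
  and x: "x : S" "y : S" "x ~: C L" "y ~: C (x+:L)" "\<not> g (x+:L)" "\<not> g (y+:L)" for L J x y
 proof -
  have y: "y ~: C L" using x(4) C_mono[of L "x+:L"] by blast
  have rJ: "r J + 3 = r E" "r (e+:J) = r J + 1" using r_notin[OF J(2)] L(3) J(1) by auto
  have JS: "J <= S" "finite J" using J(3) S'(1) fS finite_subset by auto
  have xy: "x : S'" "y : S'" using x(1-3) y J(1) inS' subset_C[of L] by blast+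
  have conL: "conn S (e+:J)" using tri_conn[OF _ L(4)] L(3) S(2) J(1) by simp
  \<comment> \<open>Inherited from the connectedness over \<open>e+:J\<close>, because
    \<open>e\<close> has no parallel element over \<open>J\<close>.\<close>
  have cJ: "conn S J" unfolding conn_def
  proof (intro allI impI)
   have main: "r A = r J \<or> r B = r J" if AB: "J <= A" "J <= B" "A Un B = S" "r A + r B = r S + r J" "e : A" for A B
   proof (rule ccontr)
    assume n: "\<not> ?thesis"
    have ge: "r J \<le> r A" "r J \<le> r B" using mono[OF AB(1)] mono[OF AB(2)] .
    have fA: "finite A" "finite B" using AB(3) fS by auto
    have "r A = r (e+:J) \<or> r (e+:B) = r (e+:J)" by (rule connD[OF conL]) (use AB e(1) rJ unit[of e B] in auto)
    thus False
    proof
     assume 1: "r A = r (e+:J)"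
     have "C A = C (e+:J)" by (rule C_eqI) (use AB 1 in auto)
     hence "A Int S' <= C B" using np subset_C[of A] C_mono[OF AB(2)] by blast
     hence "S' <= C B" using AB(3) S'(1) subset_C[of B] by blast
     hence "r S' \<le> r B" using r_le_C fS by blast
     thus False using S' S AB(4) 1 rJ by linarith
    next
     assume 1: "r (e+:B) = r (e+:J)"
     have 2: "C (e+:B) = C (e+:J)" by (rule C_eqI) (use AB 1 in auto)
     hence BJ: "B Int S' <= C J" using np subset_C[of "e+:B"] by blast
     hence "S' <= C A" using AB(3) S'(1) subset_C[of A] C_mono[OF AB(1)] by blast
     hence "r S' \<le> r A" using r_le_C fS by blast
     thus False using S' S AB(4) n ge by linarith
    qed
   qed
   fix A B assume AB: "J <= A" "J <= B" "A Un B = S" "r A + r B = r S + r J"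
   have "e : A \<or> e : B" using AB(3) e(1) by blast
   thus "r A = r J \<or> r B = r J" using main[OF AB] main[OF AB(2,1)] AB(3,4) by (auto simp: Un_commute add.commute)
  qed
  have "r K0 < r J" using rJ S(2,4) by linarith
  then obtain fJ where fJ: "pot S J fJ" using IH2[OF J(4) JS(1) _ cJ] by blast
  define h where "h X = f X - fJ X" for X
  have h_inv: "h X = h Y" if "C X = C Y" for X Y unfolding h_def using f_inv[OF that] pot_inv[OF fJ that] by simp
  have H1: "h (u+:L') = h (v+:L')"
   if "J <= L'" "L' <= S'" "r L' + 2 = r E" "tri S L'" "u : S" "v : S" "u ~: C L'" "v ~: C L'"
    "\<not> g (u+:L')" "\<not> g (v+:L')" for L' u v
  proof -
   have "f (v+:L') = f (u+:L') + a (u+:L') (v+:L')" by (rule edge1) (use that J in auto)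
   moreover have "fJ (v+:L') = fJ (u+:L') + a (u+:L') (v+:L')" by (rule pot_step[OF fJ]) (use that S S'(1) in auto)
   ultimately show ?thesis unfolding h_def by simp
  qed
  have hxy: "h (x+:L) = h (y+:L)"
  proof (cases "conn S' J")
   case True
   \<comment> \<open>A hyperplane through \<open>e\<close> is replaced by one spanned in
     \<open>S'\<close> with the same value of \<open>h\<close>: by its trace if that is large
     enough, else by a neighbour.\<close>
   have move: "\<exists>X'. J <= X' \<and> X' <= S' \<and> Suc (r X') = r E \<and> \<not> g X' \<and> h X = h X'"
    if X: "X = e+:W" "J <= W" "W <= S'" "r W + 2 = r E" "e ~: C W" "\<not> g X" for X W
   proof -
    define Q where "Q = C X Int S'"
    have XE: "X <= S" "finite X" using X(1,3) S' e fS finite_subset by auto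
    have Q: "W <= Q" "Q <= C X" "Q <= S'" "finite Q" using X subset_C[of X] fS Q_def by auto
    have rX: "Suc (r X) = r E" using r_notin[OF X(5)] X(1,4) by simp
    have rQ: "r W \<le> r Q" "r Q \<le> r X" using mono[OF Q(1)] r_le_C[OF Q(4,2)] .
    show ?thesis
    proof (cases "r Q = r X")
     case True
     have c: "C Q = C X" by (rule C_eq_sub[OF XE(2) Q(4,2) True])
     have "g Q = g X" by (rule g_cong[OF _ _ c]) (use Q S' XE S in auto)
     thus ?thesis using Q X(2,6) True rX h_inv[OF c] by (intro exI[of _ Q]) auto
    next
     case False
     hence rQW: "r Q = r W" using rQ rX X(4) by linarith
     have "W <= X" "X <= E" using X(1) XE(1) S(1) by blast+
     hence "\<not> g W" using g_mono X(6) by blast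
     then obtain u where u: "u : S'" "u ~: C W" "\<not> g (u+:W)" using ex_off[OF X(3,4)] by blast
     have "K0 <= W" using J(4) X(2) by blast
     have neP: "Suc (r (P (e+:W))) \<noteq> r E" using False rX rQW rQ X(1) unfolding P_def Q_def[symmetric] by (metis Q_def X(4) add_2_eq_Suc' n_not_Suc_n)
     have "tri S W"
     proof -
      have "\<not> g W" by fact
      have "r W + 2 \<le> r S'" using X(4) S' by simp
      from ex_pair_notin_C[OF fS(2) X(3) this] obtain p q where pq: "p : S'" "q : S'" "p ~: C W" "q ~: C (p+:W)" by blast
      have eu: "e ~: C (v+:W)" if "v : S'" "v ~: C W" for v
      proof
       assume "e : C (v+:W)"
       hence "v : C X" using exch X(1,5) by blast
       hence "v : Q" using that Q_def by blast
       moreover have "C Q = C W" by (rule C_eqI[OF Q(1) rQW])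
       ultimately show False using that(2) subset_C[of Q] by blast
      qed
      have "q ~: C W" using notin_sym[OF pq(3,4)] by blast
      thus ?thesis using pq eu S' e by (intro triI[of p S q e]) auto
     qed
     have "h (e+:W) = h (u+:W)" by (rule H1[OF X(2,3,4) \<open>tri S W\<close>]) (use X u e S' in auto)
     thus ?thesis using X u r_notin[OF u(2)] by (intro exI[of _ "u+:W"]) auto
    qed
   qed
   have eW: "e ~: C (u+:J)" if "u : S'" "u ~: C L" for u
   proof
    assume "e : C (u+:J)"
    hence "u : C (e+:J)" using exch J(2) by blast
    thus False using that(2) J(1) by simp
   qed
   have uJ: "r (u+:J) = r J + 1" if "u ~: C L" for u using r_notin[of u J] that C_mono[of J L] J(1) by auto
   obtain X' where X': "J <= X'" "X' <= S'" "Suc (r X') = r E" "\<not> g X'" "h (x+:L) = h X'"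
    using move[of "x+:L" "x+:J"] J xy x rJ uJ[OF x(3)] eW[OF xy(1) x(3)] by (auto simp: insert_commute)
   obtain Y' where Y': "J <= Y'" "Y' <= S'" "Suc (r Y') = r E" "\<not> g Y'" "h (y+:L) = h Y'"
    using move[of "y+:L" "y+:J"] J xy x rJ uJ[OF y] eW[OF xy(2) y] by (auto simp: insert_commute)
   have "h X' = h Y'"
   proof (rule hyperplanes_connected[where S = S' and g = g and K = J and h = h])
    show "cut S' g" using cut_subset[OF cutg S'(2)] .
    show "g S'" using cut_down[OF cutg S'(2) order_refl] S'(3) gE by simp
    show "h (u+:L') = h (v+:L')"
     if "J <= L'" "L' <= S'" "r L' + 2 = r S'" "tri S' L'" "u : S'" "v : S'" "u ~: C L'" "v ~: C (u+:L')"
      "\<not> g (u+:L')" "\<not> g (v+:L')" for L' u v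
    proof -
     have "v ~: C L'" using that(8) C_mono[of L' "u+:L'"] by blast
     moreover have "u : S" "v : S" using that S'(1) by blast+
     moreover have "r L' + 2 = r E" using that(3) S'(3) by simp
     ultimately show ?thesis by (intro H1[OF that(1,2) _ tri_mono[OF that(4) S'(1)] _ _ that(7) _ that(9,10)])
    qed
    show "h U = h V" if "C U = C V" for U V by (rule h_inv[OF that])
    show "Suc (r X') = r S'" "Suc (r Y') = r S'" using X' Y' S'(3) by simp_all
   qed (fact fS J True X' Y')+
   thus ?thesis using X' Y' by simp
  next
   case False
   then obtain A0 B0 where AB0: "J <= A0" "J <= B0" "A0 Un B0 = S'" "r A0 + r B0 = r S' + r J" "r A0 \<noteq> r J" "r B0 \<noteq> r J"
    unfolding conn_def by blast
   \<comment> \<open>In corank 3 a separation of \<open>S'\<close> splits it into a point,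
     represented by \<open>b\<close> below, and a line \<open>B\<close>.\<close>
   obtain A B where AB: "J <= A" "J <= B" "A Un B = S'" "r A = r J + 1" "r B = r J + 2"
   proof -
    have ge: "r J \<le> r A0" "r J \<le> r B0" using mono[OF AB0(1)] mono[OF AB0(2)] .
    hence "(r A0 = r J + 1 \<and> r B0 = r J + 2) \<or> (r B0 = r J + 1 \<and> r A0 = r J + 2)" using AB0(4-6) S'(3) rJ(1) by linarith
    thus thesis
    proof
     assume "r A0 = r J + 1 \<and> r B0 = r J + 2" thus thesis using that AB0 by blast
    next
     assume "r B0 = r J + 1 \<and> r A0 = r J + 2" thus thesis using that[of B0 A0] AB0 by (simp add: Un_commute)
    qed
   qed
   have fAB: "finite A" "finite B" using AB(3) fS(2) by auto
   obtain b where b: "b : A" "b ~: C J" using C_Diff_nonempty[OF fAB(1), of J] AB(4) by auto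
   have cA: "C A = C (b+:J)" by (rule C_eqI) (use AB b r_notin[OF b(2)] in auto)
   have bS: "b : S'" "b : S" using b AB S' by auto
   have bB: "b ~: C B"
   proof
    assume "b : C B"
    hence "b+:J <= C B" using AB(2) subset_C[of B] by blast
    hence "C (b+:J) <= C B" using C_subset_C JS(2) by simp
    hence "S' <= C B" using cA AB(3) subset_C[of A] subset_C[of B] by blast
    hence "r S' \<le> r B" using r_le_C fS by blast
    thus False using S'(3) rJ(1) AB(5) by linarith
   qed
   have eB: "e ~: C B"
   proof
    assume "e : C B"
    hence "r (e+:B) = r B" by (rule r_in)
    moreover have "A Un e+:B = S" using AB(3) S'_def e(1) by blast
    moreover have "J <= e+:B" using AB(2) by blast
    ultimately have "r A = r J \<or> r (e+:B) = r J" using connD[OF cJ AB(1), of "e+:B"] AB(4,5) rJ(1) S(2) by simp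
    thus False using AB \<open>r (insert e B) = r B\<close> by linarith
   qed
   have eb: "e ~: C (b+:J)"
   proof
    assume "e : C (b+:J)"
    hence "b : C (e+:J)" using exch J(2) by blast
    thus False using np[OF bS(1)] b(2) by blast
   qed
   have epar: "e ~: C (u+:J)" if "u : S'" "u ~: C J" for u
   proof
    assume "e : C (u+:J)"
    hence "u : C (e+:J)" using exch J(2) by blast
    thus False using np[OF that(1)] that(2) by blast
   qed
   \<comment> \<open>The points of the line \<open>B\<close> that are not on the line joining
     \<open>e\<close> to \<open>b\<close>.\<close>
   define gen where "gen p \<longleftrightarrow> p : B \<and> p ~: C J \<and> e ~: C (p+:b+:J)" for p
   have BC: "C (p+:q+:J) <= C B" if "p : B" "q : B" for p q by (rule C_mono) (use that AB in auto)
   have BC1: "C (p+:J) <= C B" if "p : B" for p by (rule C_mono) (use that AB in auto)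
   have pb: "b ~: C (p+:J)" "p ~: C (b+:J)" if "p : B" "p ~: C J" for p
   proof -
    show 1: "b ~: C (p+:J)" using BC1[OF that(1)] bB by blast
    show "p ~: C (b+:J)" using notin_sym[OF that(2) 1] by blast
   qed
   have rk1: "u+:J <= S'" "J <= u+:J" "r (u+:J) + 2 = r E" if "u : S'" "u ~: C J" for u
    using that J(3) r_notin[OF that(2)] rJ(1) by auto
   have trip: "tri S (p+:J)" if "gen p" for p
   proof -
    have p: "p : B" "p ~: C J" "e ~: C (p+:b+:J)" "p : S'" using that AB unfolding gen_def by auto
    have "r (p+:J) < r B" using r_notin[OF p(2)] AB(5) by simp
    then obtain q where q: "q : B" "q ~: C (p+:J)" using C_Diff_nonempty[OF fAB(2)] by blast
    have "b ~: C (q+:p+:J)" using BC[OF q(1) p(1)] bB by blast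
    moreover have "e ~: C (q+:p+:J)" using BC[OF q(1) p(1)] eB by blast
    moreover have "e ~: C (b+:p+:J)" using p(3) by (simp add: insert_commute)
    ultimately show ?thesis using q bS e AB S' by (intro triI[of q S b e]) auto
   qed
   have trib: "tri S (b+:J)" if "gen p" "gen q" "q ~: C (p+:J)" for p q
   proof -
    have p: "p : B" "p ~: C J" "e ~: C (p+:b+:J)" "p : S'" and q: "q : B" "q ~: C J" "e ~: C (q+:b+:J)" "q : S'"
     using that AB unfolding gen_def by auto
    have "b ~: C (q+:p+:J)" using BC[OF q(1) p(1)] bB by blast
    hence "q ~: C (b+:p+:J)" using notin_sym[OF that(3)] by blast
    thus ?thesis using p q pb[OF p(1,2)] e S'(1) by (intro triI[of p S q e]) (auto simp: insert_commute)
   qed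
   have Hu: "h (v+:u+:J) = h (w+:u+:J)"
    if "u : S'" "u ~: C J" "tri S (u+:J)" "v : S" "w : S" "v ~: C (u+:J)" "w ~: C (u+:J)"
     "\<not> g (v+:u+:J)" "\<not> g (w+:u+:J)" for u v w by (rule H1[OF rk1(2)]) (use that rk1[OF that(1,2)] in auto)
   \<comment> \<open>From the line \<open>ep\<close> to the line \<open>eq\<close>: through
     \<open>B\<close> if it is off the cut, else through the lines \<open>bp\<close> and
     \<open>bq\<close>, which are then off the cut.\<close>
   have caseI: "h (p+:L) = h (q+:L)"
    if p: "gen p" and q: "gen q" and pq: "q ~: C (p+:J)" and n: "\<not> g (p+:L)" "\<not> g (q+:L)" for p q
   proof -
    have p': "p : B" "p ~: C J" "e ~: C (p+:b+:J)" "p : S'" "p : S" and q': "q : B" "q ~: C J" "e ~: C (q+:b+:J)" "q : S'" "q : S"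
     using p q AB S'(1) unfolding gen_def by auto
    have qp: "p ~: C (q+:J)" using notin_sym[OF p'(2) pq] by blast
    have n': "\<not> g (e+:p+:J)" "\<not> g (e+:q+:J)" using n J(1) by (simp_all add: insert_commute)
    have LE: "p+:q+:J <= E" "p+:J <= E" "q+:J <= E" "e+:p+:J <= E" "e+:q+:J <= E" using p' q' JS S e by auto
    have c: "p+:q+:J = q+:p+:J" by (rule insert_commute)
    have bE: "b : E" "p : E" "q : E" using bS p' q' S by auto
    show ?thesis
    proof (cases "g (q+:p+:J)")
     case False
     have "h (e+:p+:J) = h (q+:p+:J)" by (rule Hu[OF p'(4,2) trip[OF p] e(1) q'(5)]) (use epar p' pq n' False in auto)
     moreover have "\<not> g (p+:q+:J)" using False c by simp
     hence "h (p+:q+:J) = h (e+:q+:J)" by (intro Hu[OF q'(4,2) trip[OF q] p'(5) e(1) qp epar[OF q'(4,2)] _ n'(2)])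
     ultimately show ?thesis using J(1) by (simp add: insert_commute)
    next
     case True
     have ngp: "\<not> g (p+:J)" "\<not> g (q+:J)" using g_mono[OF _ LE(4)] g_mono[OF _ LE(5)] n' by blast+
     have "b ~: C (q+:p+:J)" "b ~: C (p+:q+:J)" using BC[OF q'(1) p'(1)] BC[OF p'(1) q'(1)] bB by blast+
     hence nb: "\<not> g (b+:p+:J)" "\<not> g (b+:q+:J)"
      using cut_point[OF cutg LE(2) bE(3,1) _ True] cut_point[OF cutg LE(3) bE(2,1) _ True[folded c]] ngp by blast+
     have "h (e+:p+:J) = h (b+:p+:J)" by (rule Hu[OF p'(4,2) trip[OF p] e(1) bS(2)]) (use epar p' pb n' nb in auto)
     moreover have "h (p+:b+:J) = h (q+:b+:J)"
      by (rule Hu[OF bS(1) b(2) trib[OF p q pq] p'(5) q'(5)]) (use pb p' q' nb in \<open>auto simp: insert_commute\<close>)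
     moreover have "h (b+:q+:J) = h (e+:q+:J)" by (rule Hu[OF q'(4,2) trip[OF q] bS(2) e(1)]) (use epar q' pb n' nb in auto)
     ultimately show ?thesis using J(1) by (simp add: insert_commute)
    qed
   qed
   \<comment> \<open>From the line \<open>ep\<close> to the line \<open>eb\<close>: through
     \<open>bp\<close> if it is off the cut, else through \<open>zp\<close> and \<open>zb\<close>
     for a further point \<open>z\<close> of \<open>B\<close>.\<close>
   have caseII: "h (p+:L) = h (b+:L)"
    if p: "gen p" and n: "\<not> g (p+:L)" "\<not> g (b+:L)" for p
   proof -
    have p': "p : B" "p ~: C J" "e ~: C (p+:b+:J)" "p : S'" "p : S" using p AB S'(1) unfolding gen_def by auto
    have ep: "p ~: C (e+:J)" "b ~: C (e+:J)" using np p' bS b by blast+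
    have ebp: "b ~: C (p+:e+:J)"
     using notin_sym[of e "p+:J" b] exch[of b e "p+:J"] p'(3) epar[OF p'(4,2)] pb[OF p'(1,2)] by (auto simp: insert_commute)
    \<comment> \<open>At least three lines pass through the point \<open>L\<close>, so one of them
      differs from both lines in question.\<close>
    obtain z where z: "z : S" "z ~: C (p+:L)" "z ~: C (b+:L)"
    proof -
     obtain t1 t2 t3 where t: "t1 : S" "t2 : S" "t3 : S" "t1 ~: C L" "t2 ~: C (t1+:L)" "t3 ~: C (t1+:L)" "t3 ~: C (t2+:L)"
      using L(4) unfolding tri_def by blast
     have tL: "t2 ~: C L" "t3 ~: C L" using notin_sym t by blast+
     have pL: "p ~: C L" "b ~: C L" using ep J(1) by auto
     have one: "\<not> (u : C (w+:L) \<and> v : C (w+:L))" if "w ~: C L" "u ~: C L" "v ~: C (u+:L)" for u v w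
      using C_point[OF that(1,2)] that(3) by auto
     show thesis using that one[OF pL(1) t(4,5)] one[OF pL(1) t(4,6)] one[OF pL(1) tL(1) t(7)]
      one[OF pL(2) t(4,5)] one[OF pL(2) t(4,6)] one[OF pL(2) tL(1) t(7)] t(1-3) by blast
    qed
    have zL: "z ~: C L" using z(2) C_mono[of L "p+:L"] by blast
    have zJ: "z ~: C J" using zL C_mono[of J L] J(1) by blast
    have zS: "z : S'" using z(1) zL inS' J(1) subset_C[of L] by blast
    have zA: "z ~: A"
    proof
     assume "z : A"
     hence "z : C (b+:J)" using cA subset_C[of A] by blast
     thus False using z(3) J(1) C_mono[of "b+:J" "b+:L"] by auto
    qed
    hence zB: "z : B" using zS AB by blast
    have "e ~: C (z+:b+:J)"
    proof
     assume "e : C (z+:b+:J)"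
     hence "z : C (e+:b+:J)" using exch eb by blast
     thus False using z(3) J(1) by (simp add: insert_commute)
    qed
    hence gz: "gen z" unfolding gen_def using zB zJ by blast
    have zp: "z ~: C (p+:J)" using z(2) J(1) C_mono[of "p+:J" "p+:L"] by auto
    have pz: "p ~: C (z+:J)" using notin_sym[OF p'(2) zp] by blast
    have n': "\<not> g (e+:p+:J)" "\<not> g (e+:b+:J)" using n J(1) by (simp_all add: insert_commute)
    have LE: "p+:J <= E" "b+:J <= E" "e+:p+:J <= E" "e+:b+:J <= E" "b : E" "p : E" "z : E" using p' bS z JS S e by auto
    note tb = trib[OF p gz zp]
    show ?thesis
    proof (cases "g (b+:p+:J)")
     case False
     have "h (e+:p+:J) = h (b+:p+:J)" by (rule Hu[OF p'(4,2) trip[OF p] e(1) bS(2)]) (use epar p' pb n' False in auto)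
     moreover have "h (p+:b+:J) = h (e+:b+:J)"
      by (rule Hu[OF bS(1) b(2) tb p'(5) e(1)]) (use eb p' pb n' False in \<open>auto simp: insert_commute\<close>)
     ultimately show ?thesis using J(1) by (simp add: insert_commute)
    next
     case True
     have ngp: "\<not> g (p+:J)" "\<not> g (b+:J)" using g_mono[OF _ LE(3)] g_mono[OF _ LE(4)] n' by blast+
     have bzp: "b ~: C (z+:p+:J)" using BC[OF zB p'(1)] bB by blast
     have zbp: "z ~: C (b+:p+:J)" using notin_sym[OF zp bzp] by blast
     have zpb: "z ~: C (p+:b+:J)" using zbp by (simp add: insert_commute)
     have nz: "\<not> g (z+:p+:J)" "\<not> g (z+:b+:J)"
      using cut_point[OF cutg LE(1,5,7) zbp True] cut_point[OF cutg LE(2,6,7) zpb] True ngp by (auto simp: insert_commute)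
     have "h (e+:b+:J) = h (z+:b+:J)" by (rule Hu[OF bS(1) b(2) tb e(1) z(1)]) (use eb pb[OF zB zJ] n' nz in auto)
     moreover have "h (b+:z+:J) = h (p+:z+:J)"
      by (rule Hu[OF zS zJ trip[OF gz] bS(2) p'(5)]) (use pz pb[OF zB zJ] nz in \<open>auto simp: insert_commute\<close>)
     moreover have "h (z+:p+:J) = h (e+:p+:J)" by (rule Hu[OF p'(4,2) trip[OF p] z(1) e(1)]) (use epar p' zp n' nz in auto)
     ultimately show ?thesis using J(1) by (simp add: insert_commute)
    qed
   qed
   \<comment> \<open>Every line off the cut from \<open>e\<close> to a point of \<open>S'\<close> is
     the line \<open>eb\<close> or contains a point satisfying \<open>gen\<close>.\<close>
   have norm: "\<exists>u'. (gen u' \<or> u' = b) \<and> C (u+:L) = C (u'+:L) \<and> \<not> g (u'+:L) \<and> u' ~: C L"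
    if u: "u : S'" "u ~: C L" "\<not> g (u+:L)" for u
   proof -
    have uJ: "u ~: C J" using u(2) C_mono[of J L] J(1) by blast
    have bL: "b ~: C L" using np[OF bS(1)] b(2) J(1) by blast
    have "(gen u) \<or> C (u+:L) = C (b+:L)"
    proof (cases "u : B \<and> e ~: C (u+:b+:J)")
     case True thus ?thesis using uJ gen_def by blast
    next
     case False
     have "u : C (b+:L)"
     proof (cases "u : B")
      case True
      hence "e : C (u+:b+:J)" using False by blast
      hence "u : C (e+:b+:J)" using exch eb by blast
      thus ?thesis using J(1) by (simp add: insert_commute)
     next
      case False
      hence "u : C (b+:J)" using u(1) AB(3) cA subset_C[of A] by blast
      thus ?thesis using C_mono[of "b+:J" "b+:L"] J(1) by auto
     qed
     thus ?thesis using C_point[OF bL u(2)] by simp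
    qed
    thus ?thesis
    proof
     assume "gen u" thus ?thesis using u by blast
    next
     assume c: "C (u+:L) = C (b+:L)"
     have "g (u+:L) = g (b+:L)" by (rule g_cong[OF _ _ c]) (use u(1) S'(2) L(2) S(1) bS in auto)
     thus ?thesis using c u(3) bL by blast
    qed
   qed
   obtain x' where x': "gen x' \<or> x' = b" "C (x+:L) = C (x'+:L)" "\<not> g (x'+:L)" "x' ~: C L" using norm[OF xy(1) x(3,5)] by blast
   obtain y' where y': "gen y' \<or> y' = b" "C (y+:L) = C (y'+:L)" "\<not> g (y'+:L)" "y' ~: C L" using norm[OF xy(2) y x(6)] by blast
   have "h (x'+:L) = h (y'+:L)"
   proof (cases "gen x' \<and> gen y'")
    case True
    have "y' ~: C (x'+:J)"
    proof
     assume "y' : C (x'+:J)"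
     hence "y' : C (x'+:L)" using C_mono[of "x'+:J" "x'+:L"] J(1) by auto
     hence "C (x'+:L) = C (y'+:L)" using C_point x'(4) y'(4) by blast
     thus False using x'(2) y'(2) x(4) subset_C[of "y+:L"] by auto
    qed
    thus ?thesis using caseI True x' y' by blast
   next
    case False
    thus ?thesis using caseII[of x'] caseII[of y'] x' y' by auto
   qed
   thus ?thesis using h_inv[OF x'(2)] h_inv[OF y'(2)] by simp
  qed
  have "fJ (y+:L) = fJ (x+:L) + a (x+:L) (y+:L)" by (rule pot_step[OF fJ]) (use L x y J(1) S(2) in auto)
  thus ?thesis using hxy unfolding h_def by (simp add: algebra_simps)
 qed
 have "pot S K0 f"
 proof (rule potI[OF f_inv])
  fix L x y assume h: "K0 <= L" "L <= S" "r L + 2 = r S" "tri S L" "x : S" "y : S" "x ~: C L" "y ~: C L" "y ~: C (x+:L)"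
    "\<not> g (x+:L)" "\<not> g (y+:L)"
  have rL: "r L + 2 = r E" using h(3) S(2) by simp
  define J where "J = L - {e}"
  have J: "J <= S'" "K0 <= J" "J <= L" using h(1,2) e(2) S'_def J_def by auto
  show "f (y+:L) = f (x+:L) + a (x+:L) (y+:L)"
  proof (cases "r J = r L")
   case True
   have c: "C J = C L" using C_eqI[OF J(3)] True by simp
   show ?thesis by (rule edge2[OF h(1,2) rL h(4) J(1,2) c h(5-8,10,11)])
  next
   case False
   hence "L \<noteq> J" by blast
   hence L: "L = e+:J" using J_def by blast
   hence eJ: "e ~: C J" using False r_in[of e J] by auto
   show ?thesis
   proof (cases "\<exists>c\<in>S'. c : C (e+:J) \<and> c ~: C J")
    case True
    then obtain c where c: "c : S'" "c : C (e+:J)" "c ~: C J" by blast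
    have "C (e+:J) = C (c+:J)" by (rule C_point[OF eJ c(3,2)])
    hence cc: "C (c+:J) = C L" using L by simp
    have "c+:J <= S'" "K0 <= c+:J" using c J by auto
    from edge2[OF h(1,2) rL h(4) this cc h(5-8,10,11)] show ?thesis .
   next
    case False
    thus ?thesis using edge3[OF h(1,2) rL h(4) L eJ J(1,2) _ h(5-7,9-11)] by blast
   qed
  qed
 qed
 thus ?thesis by blast
qed

end

section \<open>Series pairs and components\<close>

context rank_fun begin

text \<open>Take a smallest side \<open>A\<close> of a separation left by deleting some
  \<open>e\<close>, and any \<open>x\<close> in it. Crossing with a separation left by deleting
  \<open>x\<close> shows that \<open>S - {e,x}\<close> loses rank: a minimally connected matroid has
  a cocircuit of two elements.\<close>

theorem exists_series_pair:
 assumes fin: "finite S" and K: "K <= S" and con: "conn S K" and rk2: "r K + 2 \<le> r S"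
  and nodel: "\<And>e. e : S - K \<Longrightarrow> r (S - {e}) = r S \<Longrightarrow> \<not> conn (S - {e}) K"
 shows "\<exists>s t. s : S \<and> t : S \<and> s ~: K \<and> t ~: K \<and> s \<noteq> t \<and> r (S - {s}) = r S \<and> r (S - {t}) = r S
  \<and> Suc (r (S - {s,t})) = r S"
proof -
 have ins: "e+:(S - {e}) = S" if "e : S" for e using that by blast
 \<comment> \<open>A loop could be deleted without losing connectedness.\<close>
 have nl: "e ~: C K" if e: "e : S - K" for e
 proof
  assume l: "e : C K"
  have "K <= S - {e}" using K e by blast
  hence "e : C (S - {e})" using l C_mono by blast
  hence r1: "r (S - {e}) = r S" using r_in[of e "S - {e}"] ins e by simp
  have "conn (S - {e}) K" unfolding conn_def
  proof (intro allI impI)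
   fix A B assume AB: "K <= A" "K <= B" "A Un B = S - {e}" "r A + r B = r (S - {e}) + r K"
   have rA: "r (e+:A) = r A" using r_in l C_mono[OF AB(1)] by blast
   have un: "e+:A Un B = S" and k: "K <= e+:A" using AB e by blast+
   have "r (e+:A) = r K \<or> r B = r K" by (rule connD[OF con k AB(2) un]) (use rA AB(4) r1 in simp)
   thus "r A = r K \<or> r B = r K" using rA by simp
  qed
  thus False using nodel[OF e r1] by blast
 qed
 \<comment> \<open>A coloop would split off as a component.\<close>
 have rfull: "r (S - {e}) = r S" if e: "e : S - K" for e
 proof (rule ccontr)
  assume n: "r (S - {e}) \<noteq> r S"
  have m: "r (S - {e}) \<le> r S" by (rule mono) blast
  have u: "r S \<le> Suc (r (S - {e}))" using unit[of e "S - {e}"] ins e by simp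
  have 1: "r (e+:K) = Suc (r K)" using r_notin[OF nl[OF e]] .
  have un: "e+:K Un (S - {e}) = S" and k: "K <= S - {e}" using e K by blast+
  have "r (e+:K) = r K \<or> r (S - {e}) = r K" by (rule connD[OF con subset_insertI k un]) (use 1 n m u in linarith)
  thus False using 1 n m u rk2 by linarith
 qed
 define sep where "sep e A B \<longleftrightarrow> e : S - K \<and> K <= A \<and> K <= B \<and> A Un B = S - {e} \<and> r A + r B = r S + r K \<and> r K < r A \<and> r K < r B" for e A B
 have ex_sep: "\<exists>A B. sep e A B" if e: "e : S - K" for e
 proof -
  obtain A B where AB: "K <= A" "K <= B" "A Un B = S - {e}" "r A + r B = r (S - {e}) + r K" "r A \<noteq> r K" "r B \<noteq> r K"
   using nodel[OF e rfull[OF e]] unfolding conn_def by blast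
  have "r K < r A" "r K < r B" using mono[OF AB(1)] mono[OF AB(2)] AB(5,6) by linarith+
  hence "sep e A B" unfolding sep_def using AB(1-4) rfull[OF e] e by simp
  thus ?thesis by blast
 qed
 have sep_sym: "sep e A B \<Longrightarrow> sep e B A" for e A B unfolding sep_def by (simp add: Un_commute add.commute)
 \<comment> \<open>Without loops, a further common element would raise the rank of the intersection
   and thus the rank sum.\<close>
 have disj: "A Int B = K" if "sep e A B" for e A B
 proof -
  have AB: "e : S - K" "K <= A" "K <= B" "A Un B = S - {e}" "r A + r B = r S + r K" using that unfolding sep_def by auto
  have "r (S - {e}) + r (A Int B) \<le> r A + r B" by (rule cover_ge[OF AB(4)]) auto
  hence le: "r (A Int B) \<le> r K" using rfull[OF AB(1)] AB(5) by linarith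
  have "A Int B <= K"
  proof
   fix z assume z: "z : A Int B"
   show "z : K"
   proof (rule ccontr)
    assume "z ~: K"
    hence "z : S - K" using z AB(4) by blast
    hence "r (z+:K) = Suc (r K)" using r_notin nl by blast
    moreover have "r (z+:K) \<le> r (A Int B)" by (rule mono) (use z AB in blast)
    ultimately show False using le by linarith
   qed
  qed
  thus ?thesis using AB by blast
 qed
 obtain e0 where "e0 : S - K"
 proof -
  have "S \<noteq> K" using rk2 by auto
  thus thesis using that K by blast
 qed
 hence "\<exists>A. \<exists>e B. sep e A B" using ex_sep by blast
 then obtain A where "\<exists>e B. sep e A B" and minA: "\<And>A'. (\<exists>e B. sep e A' B) \<Longrightarrow> card A \<le> card A'"
  using ex_has_least_nat[of "\<lambda>A. \<exists>e B. sep e A B" _ card] by blast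
 then obtain e B where s: "sep e A B" by blast
 have AB: "e : S - K" "K <= A" "K <= B" "A Un B = S - {e}" "r A + r B = r S + r K" "r K < r A" "r K < r B"
  using s unfolding sep_def by auto
 have fA: "finite A" using AB(4) fin by (metis finite_Diff finite_Un)
 have "A \<noteq> K" using AB(6) by blast
 then obtain x where x: "x : A" "x ~: K" using AB(2) by blast
 have xS: "x : S - K" "x \<noteq> e" using x AB(4) by blast+
 have key: "Suc (r (S - {e,x})) = r S" if s': "sep x C' D" and eD: "e : D" for C' D
 proof -
  have CD: "K <= C'" "K <= D" "C' Un D = S - {x}" "r C' + r D = r S + r K" "r K < r C'" "r K < r D"
   using s' unfolding sep_def by auto
  have eC: "e ~: C'" using disj[OF s'] eD AB(1) by blast
  have xB: "x ~: B" using disj[OF s] x by blast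
  have sub: "r (A Un C') + r (A Int C') \<le> r A + r C'" "r (B Un D) + r (B Int D) \<le> r B + r D"
   "r (A Un D) + r (A Int D) \<le> r A + r D" "r (B Un C') + r (B Int C') \<le> r B + r C'" using submod by auto
  have m1: "z : A Un B \<longleftrightarrow> z : S \<and> z \<noteq> e" for z using AB(4) by blast
  have m2: "z : C' Un D \<longleftrightarrow> z : S \<and> z \<noteq> x" for z using CD(3) by blast
  have u1: "(A Int C') Un (B Un D) = S - {x}" using m1 m2 eD xB by blast
  have u2: "(A Un C') Un (B Int D) = S - {e}" using m1 m2 eC x by blast
  have u3: "(A Int D) Un (B Un C') = S - {e,x}" using m1 m2 eC xB by blast
  have u4: "(A Un D) Un (B Int C') = S" using m1 m2 eD x AB(1) by blast
  have 1: "r (S - {x}) + r K \<le> r (A Int C') + r (B Un D)" by (rule cover_ge[OF u1]) (use AB CD in blast)+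
  have 2: "r (S - {e}) + r K \<le> r (A Un C') + r (B Int D)" by (rule cover_ge[OF u2]) (use AB CD in blast)+
  \<comment> \<open>Otherwise \<open>A Int C'\<close> would be a smaller side than
    \<open>A\<close>.\<close>
  have rAC: "r (A Int C') = r K"
  proof (rule ccontr)
   assume "r (A Int C') \<noteq> r K"
   moreover have "r K \<le> r (A Int C')" by (rule mono) (use AB CD in blast)
   ultimately have big: "r K < r (A Int C')" by linarith
   have "r (A Int C') + r (B Un D) = r S + r K" using 1 2 sub(1,2) AB(5) CD(4) rfull[OF xS(1)] rfull[OF AB(1)] by linarith
   moreover have "r K < r (B Un D)" using mono[of D "B Un D"] CD(6) by auto
   ultimately have "sep x (A Int C') (B Un D)" unfolding sep_def using u1 xS big AB(2,3) CD(1,2) by blast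
   hence "card A \<le> card (A Int C')" using minA by blast
   moreover have "A Int C' \<subset> A" using x(1) CD(3) by blast
   ultimately show False using psubset_card_mono[OF fA, of "A Int C'"] by simp
  qed
  have k4: "K <= A Un D" "K <= B Int C'" using AB CD by blast+
  have rAD: "r A \<le> r (A Un D)" by (rule mono) blast
  have "r C' + r K \<le> r (A Int C') + r (B Int C')"
  proof (rule cover_ge)
   show "A Int C' Un B Int C' = C'" using m1 m2 eC by blast
  qed (use AB CD in blast)+
  hence "r K < r (B Int C')" using rAC CD(5) by linarith
  \<comment> \<open>By connectedness this cover of \<open>S\<close> has positive excess. The other
    cover, of \<open>S - {e,x}\<close>, has to make up for it by a smaller rank.\<close>
  hence "\<not> r (A Un D) + r (B Int C') \<le> r S + r K" using connD[OF con k4 u4] rAD AB(6) by linarith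
  moreover have "r (S - {e,x}) + r K \<le> r (A Int D) + r (B Un C')" by (rule cover_ge[OF u3]) (use AB CD in blast)+
  ultimately have "r (S - {e,x}) + 1 \<le> r S" using sub(3,4) AB(5) CD(4) by linarith
  moreover have "r S \<le> Suc (r (S - {e,x}))"
  proof -
   have "x+:(S - {e,x}) = S - {e}" using xS by blast
   thus ?thesis using unit[of x "S - {e,x}"] rfull[OF AB(1)] by simp
  qed
  ultimately show ?thesis by linarith
 qed
 obtain C' D where s': "sep x C' D" using ex_sep[OF xS(1)] by blast
 have "e : C' \<or> e : D" using s' AB(1) xS(2) unfolding sep_def by blast
 hence "Suc (r (S - {e,x})) = r S" using key[OF s'] key[OF sep_sym[OF s']] by blast
 thus ?thesis using AB(1) xS rfull[OF AB(1)] rfull[OF xS(1)] by (intro exI[of _ e] exI[of _ x]) auto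
qed

text \<open>A hyperplane has rank one less than \<open>S\<close>, and its rank is at most the sum of
  what the two sides contribute; hence only one side can lose rank in it.\<close>

lemma hyperplane_separation:
 assumes "finite S" and A: "B <= A" "B <= A'" "A Un A' = S" "r A + r A' = r S + r B"
  and X: "B <= C X" "X <= S" "Suc (r X) = r S"
 shows "A <= C X \<or> A' <= C X"
proof -
 define X1 where "X1 = S Int C X"
 have f: "finite X1" "finite A" "finite A'" using assms(1) A(3) X1_def by auto
 have X1: "X <= X1" "X1 <= C X" using X subset_C[of X] X1_def by auto
 have rX: "r X1 = r X" by (rule r_between_C[OF f(1) X1])
 have cX: "C X1 = C X" by (rule C_between[OF f(1) X1])
 have "r X1 + r B \<le> r (X1 Int A) + r (X1 Int A')" by (rule cover_ge) (use A X X1_def in blast)+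
 moreover have m: "r (X1 Int A) \<le> r A" "r (X1 Int A') \<le> r A'" by (auto intro: mono)
 ultimately have "r (X1 Int A) = r A \<or> r (X1 Int A') = r A'" using A(4) X(3) rX by linarith
 thus ?thesis
 proof
  assume "r (X1 Int A) = r A"
  hence "C A = C (X1 Int A)" by (intro C_eqI) auto
  thus ?thesis using subset_C[of A] C_mono[of "X1 Int A" X1] cX by auto
 next
  assume "r (X1 Int A') = r A'"
  hence "C A' = C (X1 Int A')" by (intro C_eqI) auto
  thus ?thesis using subset_C[of A'] C_mono[of "X1 Int A'" X1] cX by auto
 qed
qed

text \<open>Among the sides of separations between \<open>D\<close> and \<open>C X\<close> take a
  largest one. A separation over it would, by \<open>hyperplane_separation\<close>, have a larger
  side inside \<open>C X\<close>. In terms of components, \<open>A\<close> collects all of them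
  except the one that \<open>X\<close> does not contain.\<close>

lemma exists_component:
 assumes fin: "finite S" and B: "B <= D" "B <= D'" "D Un D' = S" "r D + r D' = r S + r B"
  and X: "D <= C X" "X <= S" "Suc (r X) = r S"
 shows "\<exists>A A'. D <= A \<and> B <= A' \<and> A Un A' = S \<and> r A + r A' = r S + r B \<and> A <= C X \<and> conn S A"
proof -
 define V where "V = {A. D <= A \<and> A <= C X \<and> (\<exists>A'. B <= A' \<and> A Un A' = S \<and> r A + r A' = r S + r B)}"
 have "D : V" using B X V_def by blast
 have "V <= Pow S" using V_def by blast
 hence fV: "finite V" using fin finite_subset by blast
 obtain A where A: "A : V" and maxA: "\<And>A'. A' : V \<Longrightarrow> card A' \<le> card A"
 proof -
  have "Max (card ` V) : card ` V" using fV \<open>D : V\<close> by (intro Max_in) auto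
  then obtain A where "A : V" "card A = Max (card ` V)" by auto
  thus thesis using that Max_ge[of "card ` V"] fV by (metis finite_imageI image_eqI)
 qed
 obtain A' where A': "D <= A" "A <= C X" "B <= A'" "A Un A' = S" "r A + r A' = r S + r B" using A V_def by blast
 have "conn S A" unfolding conn_def
 proof (intro allI impI)
  have main: False if F: "A <= F" "A <= F'" "F Un F' = S" "r F + r F' = r S + r A" "r F \<noteq> r A" "F <= C X" for F F'
  proof -
   have un: "F Un (F' Int A') = S" using F(1,3) A'(4) by blast
   have k: "B <= F" "B <= F' Int A'" using B(1) A'(1,3) F(1,2) by blast+
   have "r S + r (F' Int A') \<le> r F' + r A'" by (rule cover_ge) (use A'(4) F(2,3) in blast)+
   moreover have "r S + r B \<le> r F + r (F' Int A')" by (rule cover_ge[OF un k])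
   ultimately have "r F + r (F' Int A') = r S + r B" using F(4) A'(5) by linarith
   hence "F : V" unfolding V_def using F(1,6) A'(1) un k by blast
   moreover have "A \<subset> F" using F(1,5) by blast
   hence "card A < card F" using F(3) fin by (intro psubset_card_mono) auto
   ultimately show False using maxA[of F] by simp
  qed
  fix F F' assume F: "A <= F" "A <= F'" "F Un F' = S" "r F + r F' = r S + r A"
  have "F <= C X \<or> F' <= C X" by (rule hyperplane_separation[OF fin F A'(2) X(2,3)])
  moreover have "F' Un F = S" "r F' + r F = r S + r A" using F(3,4) by auto
  ultimately show "r F = r A \<or> r F' = r A" using main[OF F] main[OF F(2,1)] by blast
 qed
 thus ?thesis using A' by blast
qed

text \<open>Points off the cut are added one at a time; of two non-parallel ones at least one is
  available.\<close>

lemma exists_off_hyperplane: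
 assumes "finite S" "cut S g" "B <= S" "r B < r S" "\<not> g B"
 shows "\<exists>X. B <= X \<and> X <= S \<and> Suc (r X) = r S \<and> \<not> g X" using assms(3-)
proof (induction "r S - r B" arbitrary: B rule: less_induct)
 case less
 show ?case
 proof (cases "Suc (r B) = r S")
  case True thus ?thesis using less.prems by blast
 next
  case False
  hence "r B + 2 \<le> r S" using less.prems by linarith
  then obtain x y where xy: "x : S" "y : S" "x ~: C B" "y ~: C (x+:B)"
   using ex_pair_notin_C[OF assms(1) less.prems(1)] by blast
  have "y ~: C B" using notin_sym xy by blast
  moreover have "\<not> g (x+:B) \<or> \<not> g (y+:B)" using cut_point[OF assms(2) less.prems(1) xy(1,2,4)] less.prems(3) by blast
  ultimately obtain w where w: "w : S" "w ~: C B" "\<not> g (w+:B)" using xy by blast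
  have "\<exists>X. w+:B <= X \<and> X <= S \<and> Suc (r X) = r S \<and> \<not> g X" by (rule less.hyps) (use w less.prems False r_notin[OF w(2)] in auto)
  thus ?thesis by blast
 qed
qed

end

text \<open>The rest \<open>Z\<close> of \<open>S\<close> is a hyperplane of \<open>S\<close>, while
  omitting only one of \<open>s\<close>, \<open>t\<close> keeps the rank. So every hyperplane over
  \<open>K\<close> contains \<open>s\<close>, contains \<open>t\<close> or is
  \<open>Z\<close>.\<close>

locale series_pair = tutte_cochain r E g a
 for r :: "'a set \<Rightarrow> nat" and E g and a :: "'a set \<Rightarrow> 'a set \<Rightarrow> 'b::ab_group_add" +
 fixes S K :: "'a set" and s t :: 'a
 assumes S: "S <= E" "r S = r E" and K: "K <= S" "conn S K" "r K + 3 \<le> r E"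
  and st: "s : S" "t : S" "s ~: K" "t ~: K" "s \<noteq> t"
  and ser: "r (S - {s}) = r S" "r (S - {t}) = r S" "Suc (r (S - {s,t})) = r S"
begin

lemma swap: "series_pair r E g a S K t s"
 using series_pair_axioms st(5) unfolding series_pair_def series_pair_axioms_def by (simp add: insert_commute)

definition "Z = S - {s,t}"

lemma fS: "finite S" using S finE finite_subset by blast

lemma Z: "Z <= S" "s ~: Z" "t ~: Z" "K <= Z" "Suc (r Z) = r E" "S = s+:t+:Z" "finite Z"
 using st K ser(3) S(2) fS unfolding Z_def by auto

lemma s_notin: "s ~: C Z" "t ~: C Z"
proof -
 have "s+:Z = S - {t}" "t+:Z = S - {s}" using st unfolding Z_def by auto
 hence "r (s+:Z) = r E" "r (t+:Z) = r E" using ser S by simp_all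
 thus "s ~: C Z" "t ~: C Z" using Z(5) by (auto simp: C_iff)
qed

lemma r_s: "P <= Z \<Longrightarrow> r (s+:P) = r P + 1" "P <= Z \<Longrightarrow> r (t+:P) = r P + 1"
 using s_notin C_mono[of P Z] r_notin[of s P] r_notin[of t P] by auto

lemma sP_notin: "P <= Z \<Longrightarrow> s ~: C P" "P <= Z \<Longrightarrow> t ~: C P" using s_notin C_mono[of P Z] by auto

lemma C_Z: assumes "P <= Z" "Suc (r P) = r E" shows "C P = C Z" using C_eqI[OF assms(1)] assms(2) Z(5) by simp

text \<open>If \<open>t\<close> lies in \<open>A\<close>, then \<open>B\<close> loses one rank when
  \<open>s\<close> is taken out of it, and what remains forms with \<open>A\<close> a separation
  over \<open>K\<close>.\<close>

lemma conn_s: "conn S (s+:K)" unfolding conn_def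
proof (intro allI impI)
 have r1: "r (s+:K) = r K + 1" using r_s Z by blast
 have main: "r A = r (s+:K) \<or> r B = r (s+:K)"
  if AB: "s+:K <= A" "s+:K <= B" "A Un B = S" "r A + r B = r S + r (s+:K)" and t: "t : A" for A B
 proof (rule ccontr)
  assume n: "\<not> ?thesis"
  have ge: "r K + 1 \<le> r A" "r K + 1 \<le> r B" using mono[OF AB(1)] mono[OF AB(2)] r1 by simp_all
  define B' where "B' = B - {s,t}"
  have B': "B' <= Z" "K <= B'" "A Un B' = S" using AB t st unfolding B'_def Z_def by auto
  have "s+:B' <= B" using AB(2) B'_def by blast
  hence rB: "r B' + 1 \<le> r B" using mono[of "s+:B'" B] r_s(1)[OF B'(1)] by simp
  have KA: "K <= A" using AB by blast
  have "r A = r K \<or> r B' = r K" by (rule connD[OF K(2) KA B'(2,3)]) (use AB(4) rB r1 in linarith)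
  hence 1: "r B' = r K" using ge by linarith
  have 2: "r S + r K \<le> r A + r B'" by (rule cover_ge[OF B'(3) KA B'(2)])
  hence "r B = r K + 1" using AB(4) r1 1 ge by linarith
  thus False using n r1 by simp
 qed
 fix A B assume AB: "s+:K <= A" "s+:K <= B" "A Un B = S" "r A + r B = r S + r (s+:K)"
 have "t : A \<or> t : B" using AB(3) st by blast
 moreover have "B Un A = S" "r B + r A = r S + r (s+:K)" using AB(3,4) by auto
 ultimately show "r A = r (s+:K) \<or> r B = r (s+:K)" using main[OF AB] main[OF AB(2,1)] by blast
qed

text \<open>The sets in \<open>Z\<close> of corank 2 through which the hyperplanes spanned with
  \<open>s\<close> and with \<open>t\<close> are different. An edge from a hyperplane through
  \<open>s\<close> only to one through \<open>t\<close> only passes such a set.\<close>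

definition transv :: "'a set \<Rightarrow> bool" where
 "transv P \<longleftrightarrow> K <= P \<and> P <= Z \<and> r P + 2 = r E \<and> r (s+:t+:P) = r E"

lemma r_stK: "r (s+:t+:K) = r K + 2"
proof (rule ccontr)
 assume n: "\<not> ?thesis"
 have 1: "r (t+:K) = r K + 1" using r_s Z by blast
 hence 2: "r (s+:t+:K) = r K + 1" using n unit[of s "t+:K"] mono_insert[of "t+:K" s] by linarith
 have "s+:t+:K Un Z = S" using Z by blast
 hence "r (s+:t+:K) = r K \<or> r Z = r K" using connD[OF K(2), of "s+:t+:K" Z] 2 Z(4,5) S(2) by auto
 thus False using 2 Z(5) K(3) by linarith
qed

text \<open>\<open>K\<close> has rank 2 less than \<open>s+:t+:K\<close>; this gap is kept by adding
  elements of \<open>Z\<close> outside the span of \<open>s+:t+:P\<close>.\<close>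

lemma exists_transv: "\<exists>P. transv P"
proof -
 have "\<exists>P. K <= P \<and> P <= Z \<and> r P = n \<and> r (s+:t+:P) = n + 2" if "r K \<le> n" "n + 2 \<le> r E" for n using that
 proof (induction n)
  case 0 thus ?case using r_stK Z by (intro exI[of _ K]) auto
 next
  case (Suc n)
  show ?case
  proof (cases "r K = Suc n")
   case True thus ?thesis using r_stK Z by (intro exI[of _ K]) auto
  next
   case False
   then obtain P where P: "K <= P" "P <= Z" "r P = n" "r (s+:t+:P) = n + 2" using Suc by auto
   have "r (s+:t+:P) < r S" using P Suc.prems S by simp
   then obtain z where z: "z : S" "z ~: C (s+:t+:P)" using C_Diff_nonempty[OF fS] by blast
   have zZ: "z : Z" using z Z(6) subset_C[of "s+:t+:P"] by blast
   have "z ~: C P" using z(2) C_mono[of P "s+:t+:P"] by auto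
   hence "r (z+:P) = Suc n" using r_notin P(3) by simp
   moreover have "r (s+:t+:z+:P) = Suc n + 2" using r_notin[OF z(2)] P(4) by (simp add: insert_commute)
   ultimately show ?thesis using P(1,2) zZ by (intro exI[of _ "z+:P"]) auto
  qed
 qed
 note * = this
 have le: "r K \<le> r E - 2" and e: "r E - 2 + 2 = r E" using K(3) by linarith+
 obtain P where "K <= P" "P <= Z" "r P = r E - 2" "r (s+:t+:P) = r E - 2 + 2" using *[OF le eq_refl[OF e]] by blast
 hence "transv P" unfolding transv_def using e by simp
 thus ?thesis by blast
qed

end

section \<open>Transversals of a series pair and gluing of potentials\<close>

context series_pair begin

lemma transv_r:
 assumes "transv P"
 shows "Suc (r (s+:P)) = r E" "Suc (r (t+:P)) = r E" "t ~: C (s+:P)" "s ~: C (t+:P)"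
  "s+:P <= S" "t+:P <= S" "P <= Z" "K <= P" "finite P" "P <= S" "r P + 2 = r E" "r (s+:t+:P) = r E"
proof -
 have P: "K <= P" "P <= Z" "r P + 2 = r E" "r (s+:t+:P) = r E" using assms unfolding transv_def by auto
 show 1: "Suc (r (s+:P)) = r E" "Suc (r (t+:P)) = r E" using r_s P by simp_all
 show "t ~: C (s+:P)" "s ~: C (t+:P)" using 1 P(4) by (auto simp: C_iff insert_commute)
 show "s+:P <= S" "t+:P <= S" "P <= S" using P Z st by auto
 show "finite P" using P Z(7) finite_subset by blast
qed (use assms in \<open>auto simp: transv_def\<close>)

lemma tri_transv:
 assumes P: "transv P" and z: "z : Z" "z ~: C P" shows "tri S P" "z ~: C (s+:P)" "z ~: C (t+:P)"
proof -
 have zP: "z+:P <= Z" using z transv_r[OF P] by auto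
 have "r (s+:z+:P) = r P + 2" "r (t+:z+:P) = r P + 2" using r_s[OF zP] r_notin[OF z(2)] by simp_all
 thus z': "z ~: C (s+:P)" "z ~: C (t+:P)" using indep2[of s z P] indep2[of t z P] by auto
 show "tri S P" by (rule triI[of s S t z]) (use z' z Z st transv_r[OF P] sP_notin[of P] in auto)
qed

lemma exists_off_transv:
 assumes "transv P" shows "\<exists>z\<in>Z. z ~: C P" using C_Diff_nonempty[OF Z(7), of P] transv_r(11)[OF assms] Z(5) by auto

text \<open>Two transversals over a common \<open>J\<close> of corank 3. Then \<open>s\<close>,
  \<open>t\<close>, \<open>x\<close>, \<open>y\<close> are in general position over
  \<open>J\<close>, and \<open>x+:y+:J\<close> spans \<open>Z\<close>.\<close>

definition plane where
 "plane J x y \<longleftrightarrow> K <= J \<and> J <= Z \<and> r J + 3 = r E \<and> x : Z \<and> y : Z \<and> transv (x+:J) \<and> transv (y+:J) \<and> y ~: C (x+:J)"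

lemma planeD:
 assumes "plane J x y"
 shows "J <= E" "r J + 3 = r E" "x : E" "y : E" "s : E" "t : E" "x : S" "y : S" "J <= S"
  "C (x+:y+:J) = C Z" "x+:y+:J <= Z"
  "r (s+:x+:y+:J) = r E" "r (t+:x+:y+:J) = r E"
  "r (s+:t+:x+:J) = r E" "r (s+:t+:y+:J) = r E"
  "tri S (x+:J)" "tri S (y+:J)" "tri S (s+:J)" "tri S (t+:J)"
proof -
 have J: "K <= J" "J <= Z" "r J + 3 = r E" "x : Z" "y : Z" "transv (x+:J)" "transv (y+:J)" "y ~: C (x+:J)"
  using assms unfolding plane_def by auto
 thus "J <= E" "r J + 3 = r E" "x : E" "y : E" "s : E" "t : E" "x : S" "y : S" "J <= S" using Z S st by auto
 have rx: "r (x+:J) = r J + 1" using transv_r(11)[OF J(6)] J(3) by simp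
 have xJ: "x ~: C J" using rx by (auto simp: C_iff)
 have rxy: "r (x+:y+:J) = r J + 2" using r_insert2[OF xJ J(8)] by (simp add: insert_commute)
 show sub: "x+:y+:J <= Z" using J by blast
 show "C (x+:y+:J) = C Z" by (rule C_Z[OF sub]) (use rxy J(3) in simp)
 show r1: "r (s+:x+:y+:J) = r E" "r (t+:x+:y+:J) = r E" using r_s[OF sub] rxy J(3) by simp_all
 show r2: "r (s+:t+:x+:J) = r E" "r (s+:t+:y+:J) = r E" using transv_r(12) J by blast+
 have r1': "r (s+:x+:y+:J) = r J + 3" "r (t+:x+:y+:J) = r J + 3"
  "r (s+:t+:x+:J) = r J + 3" "r (s+:t+:y+:J) = r J + 3" using r1 r2 J(3) by simp_all
 note i = indep3[OF r1'(1)] and j = indep3[OF r1'(2)] and k = indep3[OF r1'(3)] and l = indep3[OF r1'(4)]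
 have m: "x : S" "y : S" "s : S" "t : S" using J Z st by auto
 show "tri S (x+:J)" by (rule triI[of s S t y]) (use m i j k in \<open>simp_all add: insert_commute\<close>)
 show "tri S (y+:J)" by (rule triI[of s S t x]) (use m i j l in \<open>simp_all add: insert_commute\<close>)
 show "tri S (s+:J)" by (rule triI[of x S y t]) (use m i k l in \<open>simp_all add: insert_commute\<close>)
 show "tri S (t+:J)" by (rule triI[of x S y s]) (use m j k l in \<open>simp_all add: insert_commute\<close>)
qed

lemma plane_sym: assumes "plane J x y" shows "plane J y x"
proof -
 have J: "r J + 3 = r E" "transv (x+:J)" "y ~: C (x+:J)" using assms unfolding plane_def by auto
 have "r (x+:J) = r J + 1" using transv_r(11)[OF J(2)] J(1) by simp
 hence "x ~: C J" by (auto simp: C_iff)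
 hence "x ~: C (y+:J)" using notin_sym J(3) by blast
 thus ?thesis using assms unfolding plane_def by blast
qed

lemma Z_hyp: assumes "plane J x y" shows "g (x+:y+:J) = g Z"
proof -
 have "x+:y+:J <= E" "Z <= E" using planeD(11)[OF assms] Z S by auto
 thus ?thesis using g_cong planeD(10)[OF assms] by blast
qed

lemma plane_edge:
 assumes p: "plane J x y" and f: "pot S (u+:K) f" and u: "u : {s,t}" and v: "v : {x,y,s,t}" "w : {x,y,s,t}" "v \<noteq> u" "w \<noteq> u"
  and n: "\<not> g (u+:v+:J)" "\<not> g (u+:w+:J)"
 shows "f (u+:w+:J) = f (u+:v+:J) + a (u+:v+:J) (u+:w+:J)"
proof -
 note d = planeD[OF p]
 have 3: "r (s+:x+:y+:J) = r J + 3" "r (t+:x+:y+:J) = r J + 3"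
  "r (s+:t+:x+:J) = r J + 3" "r (s+:t+:y+:J) = r J + 3" using d(2,12-15) by simp_all
 have uJ: "u+:J <= S" "r (u+:J) + 2 = r S" "tri S (u+:J)" "u+:K <= u+:J" using u d r_s[of J] S p st unfolding plane_def by auto
 have vw: "v ~: C (u+:J)" "w ~: C (u+:J)" using u v indep3[OF 3(1)] indep3[OF 3(2)] indep3[OF 3(3)] indep3[OF 3(4)] by auto
 have m: "v : S" "w : S" using v d st by auto
 have "f (w+:u+:J) = f (v+:u+:J) + a (v+:u+:J) (w+:u+:J)"
  by (rule pot_step[OF f uJ(4,1-3) m vw]) (use n in \<open>simp_all add: insert_commute\<close>)
 thus ?thesis by (simp add: insert_commute)
qed

text \<open>A triangle of class 2b with corners \<open>u\<close>, \<open>x\<close>,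
  \<open>y\<close>, one of whose sides is \<open>Z\<close>. The value \<open>f X + a X Z\<close>
  that \<open>f\<close> predicts at \<open>Z\<close> is thus constant along such edges.\<close>

lemma plane_Z:
 assumes p: "plane J x y" and f: "pot S (u+:K) f" and u: "u : {s,t}"
  and n: "\<not> g (u+:x+:J)" "\<not> g (u+:y+:J)" "\<not> g Z"
 shows "f (u+:x+:J) + a (u+:x+:J) Z = f (u+:y+:J) + a (u+:y+:J) Z"
proof -
 note d = planeD[OF p]
 have xy: "x : {x,y,s,t}" "y : {x,y,s,t}" "x \<noteq> u" "y \<noteq> u" using p u Z unfolding plane_def by auto
 have 1: "f (u+:y+:J) = f (u+:x+:J) + a (u+:x+:J) (u+:y+:J)" by (rule plane_edge[OF p f u xy n(1,2)])
 have uE: "u : E" and rk: "r (u+:x+:y+:J) = r E" and tr: "tri E (u+:J)" "tri E (x+:J)" "tri E (y+:J)"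
  using u d tri_mono S(1) by auto
 have "a (u+:x+:J) (u+:y+:J) + a (u+:y+:J) (x+:y+:J)
   = a (u+:x+:J) (x+:y+:J)" by (rule class_2b[OF d(1,2) uE d(3,4) rk tr n(1,2)]) (use Z_hyp[OF p] n(3) in simp)
 hence "a (u+:x+:J) (u+:y+:J) + a (u+:y+:J) Z = a (u+:x+:J) Z" using a_inv[OF refl d(10)] by simp
 thus ?thesis using 1 by (simp add: add.assoc)
qed

lemma adjacent_plane:
 assumes L: "s+:K <= L" "L <= S" "r L + 2 = r S" and x: "x : S" "y : S" "x ~: C L" "y ~: C (x+:L)"
  and t: "t ~: C (x+:L)" "t ~: C (y+:L)"
 shows "\<exists>J. L = s+:J \<and> plane J x y"
proof -
 define J where "J = L - {s}"
 have tL: "t ~: L" using t(1) subset_C[of "x+:L"] by blast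
 have J: "L = s+:J" "J <= Z" "K <= J" using L tL st unfolding J_def Z_def by auto
 have rJ: "r J + 3 = r E" using r_s[OF J(2)] L(3) J(1) S(2) by simp
 have y: "y ~: C L" using notin_sym[OF x(3,4)] by blast
 have xy: "x : Z" "y : Z" using x y t L J(1) subset_C[of L] subset_C[of "x+:L"] subset_C[of "y+:L"] unfolding Z_def by auto
 have tr: "transv (v+:J)" if "v : Z" "v ~: C L" "t ~: C (v+:L)" for v
 proof -
  have vJ: "v ~: C J" using that(2) C_mono[of J L] J(1) by auto
  have 1: "r (v+:J) + 2 = r E" using r_notin[OF vJ] rJ by simp
  have "r (t+:v+:L) = r E" using r_notin[OF that(3)] r_notin[OF that(2)] L(3) S(2) by simp
  hence "r (s+:t+:v+:J) = r E" using J(1) by (simp add: insert_commute)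
  thus ?thesis unfolding transv_def using 1 J that by auto
 qed
 have "y ~: C (x+:J)" using x(4) C_mono[of "x+:J" "x+:L"] J(1) by auto
 hence "plane J x y" unfolding plane_def using tr[OF xy(1) x(3) t(1)] tr[OF xy(2) y t(2)] rJ J xy by blast
 thus ?thesis using J by blast
qed

text \<open>The hyperplane \<open>s+:P\<close> determines \<open>P\<close> up to closure, so
  quantities depending on a transversal can be written as functions of the hyperplane.\<close>

lemma trace:
 assumes "transv P" shows "C (u+:(C (s+:P) Int Z)) = C (u+:P)"
proof -
 let ?Q = "C (s+:P) Int Z"
 note P = transv_r[OF assms]
 have Q: "P <= ?Q" "?Q <= Z" "finite ?Q" using P(7) subset_C[of "s+:P"] Z(7) by auto
 have "s+:?Q <= C (s+:P)" using subset_C[of "s+:P"] by auto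
 hence "r (s+:?Q) \<le> r (s+:P)" using r_le_C[of "s+:?Q"] Q by simp
 hence "r ?Q \<le> r P" using r_s(1)[OF Q(2)] r_s(1)[OF P(7)] by simp
 hence "r ?Q = r P" using mono[OF Q(1)] by simp
 hence "C ?Q = C P" by (rule C_eqI[OF Q(1)])
 thus ?thesis using C_insert_cong[OF Q(3) P(9)] by blast
qed

lemma square_plane:
 assumes p: "plane J x y" and n: "\<not> g (s+:x+:J)" "\<not> g (s+:y+:J)" "\<not> g (t+:x+:J)" "\<not> g (t+:y+:J)"
 shows "a (s+:x+:J) (s+:y+:J) + a (s+:y+:J) (t+:y+:J)
  + a (t+:y+:J) (t+:x+:J) + a (t+:x+:J) (s+:x+:J) = 0"
 by (rule square[OF planeD(1,2,5,6,3,4)[OF p]]) (use planeD(12-15)[OF p] n in simp_all)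

text \<open>The path theorem over \<open>s+:K\<close>, confined to hyperplanes without
  \<open>t\<close>, whose edges are the planes. It is used for \<open>q\<close> the cut
  \<open>g\<close> itself and for \<open>q\<close> the sets spanning \<open>t\<close>.\<close>

lemma connect_s:
 assumes inv: "\<And>X Y. X <= S \<Longrightarrow> Y <= S \<Longrightarrow> C X = C Y \<Longrightarrow> h X = h Y"
  and q: "cut S q" "q S" "\<And>X. X <= S \<Longrightarrow> s+:K <= X \<Longrightarrow> t : C X \<Longrightarrow> Suc (r X) = r E \<Longrightarrow> q X"
  and step: "\<And>J x y. plane J x y \<Longrightarrow> \<not> q (s+:x+:J) \<Longrightarrow> \<not> q (s+:y+:J) \<Longrightarrow>
    h (s+:x+:J) = h (s+:y+:J)"
  and P: "transv P" "\<not> q (s+:P)" and P': "transv P'" "\<not> q (s+:P')"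
 shows "h (s+:P) = h (s+:P')"
proof (rule hyperplanes_connected[OF fS q(1,2) inv _ conn_s])
 show "s+:K <= S" using K st by blast
 fix L x y assume h: "s+:K <= L" "L <= S" "r L + 2 = r S" "tri S L" "x : S" "y : S" "x ~: C L" "y ~: C (x+:L)"
  "\<not> q (x+:L)" "\<not> q (y+:L)"
 have y: "y ~: C L" using notin_sym[OF h(7,8)] by blast
 have t: "t ~: C (v+:L)" if v: "v : S" "v ~: C L" "\<not> q (v+:L)" for v
 proof
  assume "t : C (v+:L)"
  moreover have "Suc (r (v+:L)) = r E" using r_notin[OF v(2)] h(3) S(2) by simp
  moreover have "v+:L <= S" "s+:K <= v+:L" using v h by auto
  ultimately show False using q(3) v(3) by blast
 qed
 obtain J where J: "L = s+:J" "plane J x y" using adjacent_plane[OF h(1-3,5-8) t[OF h(5,7,9)] t[OF h(6) y h(10)]] by blast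
 have "h (s+:x+:J) = h (s+:y+:J)" by (rule step[OF J(2)]) (use h(9,10) J(1) in \<open>simp_all add: insert_commute\<close>)
 thus "h (x+:L) = h (y+:L)" using J(1) by (simp add: insert_commute)
qed (use transv_r[OF P(1)] transv_r[OF P'(1)] P P' S in auto)

text \<open>Only the value at \<open>Z\<close> has to be invented. Each transversal predicts it,
  from \<open>s+:P\<close> or from \<open>t+:P\<close>, and connectedness over \<open>s+:K\<close>
  makes all predictions equal.\<close>

lemma glue_pot:
 assumes fs: "pot S (s+:K) fs" and ft: "pot S (t+:K) ft"
  and i: "\<And>X. X <= S \<Longrightarrow> s+:t+:K <= X \<Longrightarrow> Suc (r X) = r E \<Longrightarrow> \<not> g X \<Longrightarrow> fs X = ft X"
  and ii: "\<And>P. transv P \<Longrightarrow> \<not> g (s+:P) \<Longrightarrow> \<not> g (t+:P) \<Longrightarrow> ft (t+:P) = fs (s+:P) + a (s+:P) (t+:P)"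
 shows "\<exists>f. pot S K f"
proof -
 have EE: "X <= S \<Longrightarrow> X <= E" for X using S by blast
 have down: "\<not> g (s+:P) \<or> \<not> g (t+:P)" if P: "transv P" "\<not> g Z" for P
 proof (rule ccontr)
  assume "\<not> ?thesis"
  hence gg: "g (s+:P)" "g (t+:P)" by blast+
  have "g P" by (rule cut_point[OF cutg EE[OF transv_r(10)[OF P(1)]] _ _ transv_r(3)[OF P(1)] gg]) (use st S in auto)
  thus False using g_mono[of P Z] transv_r(7)[OF P(1)] EE[OF Z(1)] P(2) by blast
 qed
 have sum: "fs (s+:P) + a (s+:P) Z = ft (t+:P) + a (t+:P) Z"
  if P: "transv P" "\<not> g Z" "\<not> g (s+:P)" "\<not> g (t+:P)" for P
 proof -
  obtain z where z: "z : Z" "z ~: C P" using exists_off_transv[OF P(1)] by blast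
  have zP: "z+:P <= Z" using z transv_r(7)[OF P(1)] by blast
  have c: "C (z+:P) = C Z" by (rule C_Z[OF zP]) (use r_notin[OF z(2)] transv_r(11)[OF P(1)] in simp)
  have ng: "\<not> g (z+:P)" using g_cong[OF _ _ c] EE Z(1) zP P(2) by blast
  have "a (s+:P) (t+:P) + a (t+:P) (z+:P) = a (s+:P) (z+:P)"
  proof (rule a_line)
   show "P <= E" "r P + 2 = r E" using transv_r(10,11)[OF P(1)] EE by blast+
   show "s : E" "t : E" "z : E" using st S z Z(1) by auto
   show "s ~: C P" "t ~: C P" using sP_notin transv_r(7)[OF P(1)] by blast+
  qed (use P ng z in auto)
  hence "a (s+:P) (t+:P) + a (t+:P) Z = a (s+:P) Z" using a_inv[OF refl c] by simp
  thus ?thesis using ii[OF P(1,3,4)] by (simp add: add.assoc)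
 qed
 \<comment> \<open>The prediction at \<open>Z\<close> attached to a hyperplane \<open>s+:P\<close>,
   taken from the side of \<open>t\<close> when \<open>s+:P\<close> lies in the cut.\<close>
 define z where "z X = (if \<not> g X then fs X + a X Z else ft (t+:(C X Int Z)) + a (t+:(C X Int Z)) Z)" for X
 have zP: "z (s+:P) = (if \<not> g (s+:P) then fs (s+:P) + a (s+:P) Z else ft (t+:P) + a (t+:P) Z)" if "transv P" for P
  unfolding z_def using pot_inv[OF ft trace[OF that]] a_inv[OF trace[OF that] refl] by simp
 have zt: "z (s+:P) = ft (t+:P) + a (t+:P) Z" if "transv P" "\<not> g Z" "\<not> g (t+:P)" for P
  using zP[OF that(1)] sum[OF that(1,2) _ that(3)] by simp
 \<comment> \<open>The prediction changes sides through the hyperplane \<open>s+:t+:J\<close>, which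
   is off the cut here and on which the two potentials agree.\<close>
 have mix: "ft (t+:x+:J) + a (t+:x+:J) Z = fs (s+:y+:J) + a (s+:y+:J) Z"
  if p: "plane J x y" and nZ: "\<not> g Z" and gx: "g (s+:x+:J)" and gy: "\<not> g (s+:y+:J)" for J x y
 proof -
  have tv: "transv (x+:J)" "transv (y+:J)" "x : Z" "y : Z" using p unfolding plane_def by blast+
  note rk = planeD(12-15)[OF p]
  note J = planeD(1,2,9)[OF p]
  have e: "s : E" "t : E" "x : E" "y : E" using st tv Z S by auto
  have tx: "\<not> g (t+:x+:J)" using down[OF tv(1) nZ] gx by blast
  note cz = planeD(10)[OF p]
  have nxy: "\<not> g (x+:y+:J)" using Z_hyp[OF p] nZ by simp
  have nst: "\<not> g (s+:t+:J)"
  proof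
   assume gst: "g (s+:t+:J)"
   have "t ~: C (x+:s+:J)" using transv_r(3)[OF tv(1)] by (simp add: insert_commute)
   hence "g (s+:J)" using cut_point[OF cutg, of "s+:J" x t] gx gst e J by (auto simp: insert_commute)
   moreover have "s+:J <= s+:y+:J" "s+:y+:J <= E" using e J by auto
   ultimately show False using g_mono gy by blast
  qed
  have "a (x+:y+:J) (x+:t+:J) + a (x+:t+:J) (s+:t+:J)
   + a (s+:t+:J) (s+:y+:J) + a (s+:y+:J) (x+:y+:J) = 0"
   by (rule square[OF J(1,2) e(3,1,4,2)]) (use rk nxy tx nst gy in \<open>simp_all add: insert_commute\<close>)
  hence sq: "a Z (t+:x+:J) + a (t+:x+:J) (s+:t+:J)
   + a (s+:t+:J) (s+:y+:J) + a (s+:y+:J) Z = 0" using a_inv[OF cz refl] a_inv[OF refl cz] by (simp add: insert_commute)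
  have stJ: "s+:t+:J <= S" "s+:t+:K <= s+:t+:J" "Suc (r (s+:t+:J)) = r E"
  proof -
   show "s+:t+:J <= S" using J st by auto
   show "s+:t+:K <= s+:t+:J" using p unfolding plane_def by blast
   have "r (s+:t+:x+:J) = r J + 3" using rk J by simp
   from indep3(13)[OF this] show "Suc (r (s+:t+:J)) = r E" using J by simp
  qed
  have eq: "fs (s+:t+:J) = ft (s+:t+:J)" by (rule i[OF stJ nst])
  have ne: "x \<noteq> s" "y \<noteq> s" "x \<noteq> t" "y \<noteq> t" using tv Z(2,3) by blast+
  have E1: "fs (s+:y+:J) = fs (s+:t+:J) + a (s+:t+:J) (s+:y+:J)"
   by (rule plane_edge[OF p fs]) (use nst gy st(5) ne in simp_all)
  have nts: "\<not> g (t+:s+:J)" using nst by (simp add: insert_commute)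
  have E2: "ft (t+:x+:J) = ft (t+:s+:J) + a (t+:s+:J) (t+:x+:J)"
   by (rule plane_edge[OF p ft]) (use nts tx st(5) ne in simp_all)
  have E2': "ft (t+:x+:J) = ft (s+:t+:J) + a (s+:t+:J) (t+:x+:J)" using E2 by (simp add: insert_commute)
  have sq': "a (s+:t+:J) (s+:y+:J) + a (s+:y+:J) Z
    = a (s+:t+:J) (t+:x+:J) + a (t+:x+:J) Z" using sq unfolding a_anti[of Z "t+:x+:J"] a_anti[of "t+:x+:J" "s+:t+:J"]
   by (simp add: algebra_simps)
  show ?thesis unfolding E1 E2' eq using sq' by (simp add: add.assoc)
 qed
 have c2: "cut S (\<lambda>X. r (X Un {t}) \<le> r X + 0)" by (rule cut_span) (simp add: mono_insert)
 have tC: "r (X Un {t}) \<le> r X + 0 \<longleftrightarrow> t : C X" for X using r_notin[of t X] r_in[of t X] by (cases "t : C X") auto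
 have zinv: "z X = z Y" if "X <= S" "Y <= S" "C X = C Y" for X Y
  unfolding z_def using g_cong[OF EE[OF that(1)] EE[OF that(2)] that(3)] pot_inv[OF fs that(3)] a_inv[OF that(3) refl, of Z] that(3) by simp
 \<comment> \<open>With the sets spanning \<open>t\<close> as cut, the path may run through
   hyperplanes that belong to \<open>g\<close>.\<close>
 have zconst: "z (s+:P) = z (s+:P')" if nZ: "\<not> g Z" and P: "transv P" and P': "transv P'" for P P'
 proof (rule connect_s[where q = "\<lambda>X. r (X Un {t}) \<le> r X + 0"])
  show "z X = z Y" if "X <= S" "Y <= S" "C X = C Y" for X Y by (rule zinv[OF that])
  show "cut S (\<lambda>X. r (X Un {t}) \<le> r X + 0)" by (rule c2)
  show "r (S Un {t}) \<le> r S + 0" using st by (simp add: insert_absorb)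
  show "r (X Un {t}) \<le> r X + 0" if "t : C X" for X using tC that by blast
  show "transv P" "transv P'" by fact+
  show "\<not> r (s+:P Un {t}) \<le> r (s+:P) + 0" "\<not> r (s+:P' Un {t}) \<le> r (s+:P') + 0" using tC transv_r(3) P P' by blast+
  fix J x y assume p: "plane J x y"
  have tv: "transv (x+:J)" "transv (y+:J)" using p unfolding plane_def by blast+
  show "z (s+:x+:J) = z (s+:y+:J)"
  proof (cases "g (s+:x+:J)")
   case gx: True
   show ?thesis
   proof (cases "g (s+:y+:J)")
    case True
    have n: "\<not> g (t+:x+:J)" "\<not> g (t+:y+:J)" using down[OF tv(1) nZ] down[OF tv(2) nZ] gx True by blast+
    show ?thesis using zt[OF tv(1) nZ n(1)] zt[OF tv(2) nZ n(2)] plane_Z[OF p ft _ n nZ] by simp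
   next
    case False
    show ?thesis using zP[OF tv(1)] zP[OF tv(2)] gx False mix[OF p nZ gx False] by simp
   qed
  next
   case gx: False
   show ?thesis
   proof (cases "g (s+:y+:J)")
    case True
    show ?thesis using zP[OF tv(1)] zP[OF tv(2)] gx True mix[OF plane_sym[OF p] nZ True gx] by simp
   next
    case False
    show ?thesis using zP[OF tv(1)] zP[OF tv(2)] gx False plane_Z[OF p fs _ gx False nZ] by simp
   qed
  qed
 qed
 obtain zc where zc: "\<And>P. transv P \<Longrightarrow> \<not> g Z \<Longrightarrow> z (s+:P) = zc" using exists_transv zconst by metis
 have zs': "zc = fs (s+:P) + a (s+:P) Z" if "transv P" "\<not> g Z" "\<not> g (s+:P)" for P
  using zc[OF that(1,2)] zP[OF that(1)] that(3) by simp
 have zt': "zc = ft (t+:P) + a (t+:P) Z" if "transv P" "\<not> g Z" "\<not> g (t+:P)" for P using zc[OF that(1,2)] zt[OF that] by simp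
 \<comment> \<open>The last case concerns \<open>Z\<close>, the only hyperplane over
   \<open>K\<close> with neither \<open>s\<close> nor \<open>t\<close>.\<close>
 define f where "f X = (if s : C X then fs X else if t : C X then ft X else zc)" for X
 have "pot S K f"
 proof (rule potI)
  show "f X = f Y" if "C X = C Y" for X Y unfolding f_def that using pot_inv[OF fs that] pot_inv[OF ft that] by simp
  fix L x y assume h: "K <= L" "L <= S" "r L + 2 = r S" "tri S L" "x : S" "y : S" "x ~: C L" "y ~: C L" "y ~: C (x+:L)"
   "\<not> g (x+:L)" "\<not> g (y+:L)"
  have fL: "finite L" using h(2) fS finite_subset by blast
  have rx: "Suc (r (v+:L)) = r E" if "v ~: C L" for v using r_notin[OF that] h(3) S(2) by simp
  have KL: "K <= C L" using h(1) subset_C[of L] by blast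
  have sK: "s+:K <= S" "t+:K <= S" using K st by auto
  show "f (y+:L) = f (x+:L) + a (x+:L) (y+:L)"
  proof (cases "s : C L")
   case True
   hence "s : C (x+:L)" "s : C (y+:L)" using C_mono[of L "x+:L"] C_mono[of L "y+:L"] by auto
   moreover have "fs (y+:L) = fs (x+:L) + a (x+:L) (y+:L)" by (rule pot_edge[OF fs S(1) sK(1)]) (use h S(2) True KL in auto)
   ultimately show ?thesis unfolding f_def by simp
  next
   case sL: False
   show ?thesis
   proof (cases "t : C L")
    case True
    have ft_eq: "f (v+:L) = ft (v+:L)" if v: "v : S" "v ~: C L" "\<not> g (v+:L)" for v
    proof -
     have tv: "t : C (v+:L)" using True C_mono[of L "v+:L"] by auto
     have "fs (v+:L) = ft (v+:L)" if sv: "s : C (v+:L)"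
     proof -
      let ?X = "s+:t+:v+:L"
      have X: "?X <= S" "finite ?X" "v+:L <= ?X" "?X <= C (v+:L)" using v h st fL sv tv subset_C[of "v+:L"] by auto
      have c: "C ?X = C (v+:L)" by (rule C_between[OF X(2-4)])
      have "r ?X = r (v+:L)" by (rule r_between_C[OF X(2-4)])
      moreover have "g ?X = g (v+:L)" by (rule g_cong[OF EE[OF X(1)] EE[OF subset_trans[OF X(3,1)]] c])
      ultimately have "fs ?X = ft ?X" using i[OF X(1)] h(1) v(3) rx[OF v(2)] by auto
      thus ?thesis using pot_inv[OF fs c] pot_inv[OF ft c] by simp
     qed
     thus ?thesis unfolding f_def using tv by simp
    qed
    have "ft (y+:L) = ft (x+:L) + a (x+:L) (y+:L)" by (rule pot_edge[OF ft S(1) sK(2)]) (use h S(2) True KL in auto)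
    thus ?thesis using ft_eq[OF h(5,7,10)] ft_eq[OF h(6,8,11)] by simp
   next
    case tL: False
    have LZ: "L <= Z" using h(2) sL tL subset_C[of L] unfolding Z_def by blast
    \<comment> \<open>Otherwise \<open>s+:t+:L\<close> and \<open>Z\<close> would separate
      \<open>S\<close> over the indecomposable \<open>L\<close>.\<close>
    have "r (s+:t+:L) = r E"
    proof (rule ccontr)
     assume n: "r (s+:t+:L) \<noteq> r E"
     have tt: "r (t+:L) = r L + 1" using r_s(2)[OF LZ] .
     have "r (s+:t+:L) \<le> r L + 2" "r L + 1 \<le> r (s+:t+:L)" using unit[of s "t+:L"] mono_insert[of "t+:L" s] tt by simp_all
     hence 1: "r (s+:t+:L) = r L + 1" using n h(3) S(2) by linarith
     have un: "s+:t+:L Un Z = S" and LL: "L <= s+:t+:L" using LZ Z(6) by blast+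
     have "r (s+:t+:L) = r L \<or> r Z = r L" by (rule connD[OF tri_conn[OF h(3,4)] LL LZ un]) (use 1 Z(5) h(3) S(2) in linarith)
     thus False using 1 Z(5) h(3) S(2) by linarith
    qed
    hence tv: "transv L" unfolding transv_def using h(1,3) LZ S(2) by simp
    note tL' = transv_r[OF tv]
    have fsL: "f (s+:L) = fs (s+:L)" unfolding f_def using subset_C[of "s+:L"] by auto
    have ftL: "f (t+:L) = ft (t+:L)" unfolding f_def using tL'(4) subset_C[of "t+:L"] by auto
    have cz: "C (v+:L) = C Z" if "v : Z" "v ~: C L" for v by (rule C_Z) (use that LZ rx in auto)
    have fz: "f (v+:L) = zc" if "v : Z" "v ~: C L" for v unfolding f_def cz[OF that] using s_notin by simp
    have nz: "\<not> g Z" if "v : Z" "v ~: C L" "\<not> g (v+:L)" for v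
    proof -
     have "v+:L <= E" "Z <= E" using that LZ Z S by auto
     thus ?thesis using g_cong cz[OF that(1,2)] that(3) by blast
    qed
    have az: "a (v+:L) Y = a Z Y" "a Y (v+:L) = a Y Z" if "v : Z" "v ~: C L" for v Y
     using a_inv[OF cz[OF that] refl] a_inv[OF refl cz[OF that]] by blast+
    have xne: "y \<noteq> x" using h(9) subset_C[of "x+:L"] by blast
    consider "x = s" "y = t" | "x = t" "y = s" | "x = s" "y : Z" | "y = s" "x : Z" | "x = t" "y : Z" | "y = t" "x : Z"
     | "x : Z" "y : Z" using h(5,6) xne unfolding Z_def by blast
    thus ?thesis
    proof cases
     case 1 thus ?thesis using ii[OF tv] h(10,11) fsL ftL by simp
    next
     case 2 thus ?thesis using ii[OF tv] h(10,11) fsL ftL a_anti[of "t+:L" "s+:L"] by simp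
    next
     case 3 thus ?thesis using zs'[OF tv nz] h fsL fz az by simp
    next
     case 4 thus ?thesis using zs'[OF tv nz] h fsL fz az a_anti[of Z "s+:L"] by simp
    next
     case 5 thus ?thesis using zt'[OF tv nz] h ftL fz az by simp
    next
     case 6 thus ?thesis using zt'[OF tv nz] h ftL fz az a_anti[of Z "t+:L"] by simp
    next
     case 7 thus ?thesis using cz h subset_C[of "y+:L"] by auto
    qed
   qed
  qed
 qed
 thus ?thesis by blast
qed

end

context tutte_cochain begin

lemma pot_shift: "pot S K f \<Longrightarrow> pot S K (\<lambda>X. f X + c)"
proof (rule potI)
 assume p: "pot S K f"
 show "f X + c = f Y + c" if "C X = C Y" for X Y using pot_inv[OF p that] by simp
 fix L x y assume h: "K <= L" "L <= S" "r L + 2 = r S" "tri S L" "x : S" "y : S" "x ~: C L" "y ~: C L" "\<not> g (x+:L)" "\<not> g (y+:L)"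
 show "f (y+:L) + c = f (x+:L) + c + a (x+:L) (y+:L)" using pot_step[OF p h] by (simp add: algebra_simps)
qed

end

section \<open>Comparison of the two potentials of a series pair\<close>

context series_pair begin

lemma EE: "X <= S \<Longrightarrow> X <= E" using S by blast

lemma flat_transv:
 assumes P: "transv P" shows "transv (Z Int C P)" "C (Z Int C P) = C P" "Z Int C (Z Int C P) <= Z Int C P"
  "C (u+:(Z Int C P)) = C (u+:P)" "C (u+:v+:(Z Int C P)) = C (u+:v+:P)"
proof -
 let ?Q = "Z Int C P"
 note p = transv_r[OF P]
 have Q: "finite ?Q" "P <= ?Q" "?Q <= C P" using Z(7) p(7) subset_C[of P] by auto
 show c: "C ?Q = C P" by (rule C_between[OF Q])
 thus "Z Int C ?Q <= ?Q" by simp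
 show cu: "C (u+:?Q) = C (u+:P)" for u by (rule C_insert_cong[OF Q(1) p(9) c])
 show cc: "C (u+:v+:?Q) = C (u+:v+:P)" for u v by (rule C_insert_cong[OF _ _ cu]) (use Q(1) p(9) in auto)
 have "r (s+:t+:?Q) = r (s+:t+:P)" by (rule r_cong_C[OF _ _ cc]) (use Q(1) p(9) in auto)
 moreover have "r ?Q = r P" by (rule r_between_C[OF Q])
 ultimately show "transv ?Q" unfolding transv_def using p Q(2) by auto
qed

lemma r_st: assumes "transv P" "F <= P" shows "r (s+:t+:F) = r F + 2"
proof -
 have "r (P Un {s,t}) = r P + card {s,t}" using transv_r(11,12)[OF assms(1)] st(5) by simp
 from r_free[OF _ this assms(2)] show ?thesis using st(5) by simp
qed

text \<open>Leads from the off hyperplane \<open>X\<close> to one of the form \<open>s+:t+:J\<close>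
  with \<open>J\<close> inside the transversal \<open>P\<close>, while staying over
  \<open>C1\<close>, where the two potentials differ by a constant. If no \<open>J\<close> were
  suitable, uncrossing inside \<open>P\<close> and connectedness over \<open>C1\<close> would put
  \<open>X\<close> in the cut or separate \<open>S\<close> over \<open>K\<close>.\<close>

lemma local_component:
 assumes X: "X <= S" "Suc (r X) = r E" "\<not> g X"
  and D: "s+:t+:K <= D" "s+:t+:K <= D'" "D Un D' = S" "r D + r D' = r S + r (s+:t+:K)" "D <= C X"
  and P: "transv P" "Z Int C P <= P"
 shows "\<exists>C1 C2 J z. D <= C1 \<and> s+:t+:K <= C2 \<and> C1 Un C2 = S \<and> r C1 + r C2 = r S + r (s+:t+:K) \<and> C1 <= C X \<and> conn S C1 \<and>
  P Int C1 <= J \<and> J <= P \<and> r J + 3 = r E \<and> \<not> g (s+:t+:J) \<and> C1 <= C (s+:t+:J) \<and>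
  z : Z \<and> z ~: C (s+:t+:J) \<and> z ~: C P \<and> z : C2 \<and> r (P Int C1) + r (P Int C2) = r P + r K"
proof -
 note p = transv_r[OF P(1)]
 have XS: "Suc (r X) = r S" using X(2) S by simp
 obtain C1 C2 where C12: "D <= C1" "s+:t+:K <= C2" "C1 Un C2 = S" "r C1 + r C2 = r S + r (s+:t+:K)"
  "C1 <= C X" "conn S C1" using exists_component[OF fS D X(1) XS] by blast
 have k1: "s+:t+:K <= C1" using D C12 by blast
 have fC: "finite C1" "finite C2" using C12(3) fS by auto
 define P1 where "P1 = P Int C1"
 define P2 where "P2 = P Int C2"
 have PP: "P1 <= P" "P2 <= P" "P1 Un P2 = P" "K <= P1" "K <= P2" "P1 <= C1" "P2 <= C2"
  using P1_def P2_def k1 C12(2,3) p(8,10) by blast+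
 have fP: "finite P1" "finite P2" using PP p(9) finite_subset by blast+
 have st1: "s+:t+:P1 <= C1" "s+:t+:P2 <= C2" using PP k1 C12(2) by auto
 have le: "r P1 + 2 \<le> r C1" "r P2 + 2 \<le> r C2" using mono[OF st1(1)] mono[OF st1(2)] r_st[OF P(1) PP(1)] r_st[OF P(1) PP(2)] by simp_all
 have ge: "r P + r K \<le> r P1 + r P2" by (rule cover_ge[OF PP(3-5)])
 have sum: "r C1 + r C2 = r E + r K + 2" using C12(4) r_stK S by simp
 have e1: "r C1 = r P1 + 2" "r C2 = r P2 + 2" "r P1 + r P2 = r P + r K" using le ge sum p(11) by linarith+
 have cC1: "C C1 = C (s+:t+:P1)" by (rule C_eqI[OF st1(1)]) (use e1 r_st[OF P(1) PP(1)] in simp)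
 have rC1: "r C1 < r E" using r_le_C[OF fC(1) C12(5)] X(2) by simp
 \<comment> \<open>The cut built from \<open>W\<close> collects the sets \<open>J\<close> for which
   no element \<open>z\<close> of \<open>Z - P\<close> lies outside the span of
   \<open>s+:t+:J\<close>.\<close>
 define W where "W = {s,t} Un (Z - P)"
 have rF: "r (F Un {s,t}) = r F + 2" if "F <= P" for F using r_st[OF P(1) that] by simp
 have rW: "r F + 2 \<le> r (F Un W)" if "F <= P" for F using rF[OF that] mono[of "F Un {s,t}" "F Un W"] W_def by auto
 have c1: "cut P (\<lambda>F. g (F Un {s,t}))" by (rule cut_shift[OF cutg EE[OF p(10)] _ rF]) (use st S in auto)
 have c2: "cut P (\<lambda>F. r (F Un W) \<le> r F + 2)" by (rule cut_span[OF rW])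
 have PWS: "P Un W = S" using p(7) Z(6) W_def by blast
 have "P Un {s,t} <= E" using EE[OF p(10)] st S by auto
 moreover have "r (P Un {s,t}) = r E" using p(12) by simp
 ultimately have g1P: "g (P Un {s,t})" using cut_down[OF cutg _ order_refl _ gE] by simp
 have g2P: "r (P Un W) \<le> r P + 2" using PWS S p(11) by simp
 have "\<exists>J. P1 <= J \<and> J <= P \<and> Suc (r J) = r P \<and> \<not> g (J Un {s,t}) \<and> r J + 2 < r (J Un W)"
 proof (rule ccontr)
  assume n: "\<not> ?thesis"
  have cov: "g (J Un {s,t}) \<or> r (J Un W) \<le> r J + 2" if "P1 <= J" "J <= P" "Suc (r J) = r P" for J using n that not_le by blast
  from two_cuts[OF p(9) PP(1) c1 c2 g1P g2P cov] obtain F1 F2 where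
   F: "P1 <= F1" "P1 <= F2" "F1 Un F2 = P" "r F1 + r F2 = r P + r P1" "g (F1 Un {s,t})" "r (F2 Un W) \<le> r F2 + 2" by blast
  have FP: "F1 <= P" "F2 <= P" using F(3) by blast+
  have ff: "finite F1" "finite F2" "finite (F2 Un W)" using FP p(9) finite_subset W_def Z(7) by auto
  have C1F: "C1 <= C (F1 Un {s,t})" "C1 <= C (F2 Un W)"
  proof -
   have 1: "s+:t+:P1 <= F1 Un {s,t}" using F(1) by blast
   have 2: "s+:t+:P1 <= F2 Un W" using F(2) W_def by blast
   show "C1 <= C (F1 Un {s,t})" "C1 <= C (F2 Un W)" using C_mono[OF 1] C_mono[OF 2] cC1 subset_C[of C1] by blast+
  qed
  have rA: "r (F1 Un {s,t} Un C1) = r F1 + 2" using r_Un_C[OF fC(1) C1F(1)] rF[OF FP(1)] by simp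
  have rB: "r (F2 Un W Un C1) = r (F2 Un W)" using r_Un_C[OF fC(1) C1F(2)] by simp
  have un: "(F1 Un {s,t} Un C1) Un (F2 Un W Un C1) = S" using PWS F(3) C12(3) W_def by blast
  have "r (F1 Un {s,t} Un C1) = r C1 \<or> r (F2 Un W Un C1) = r C1"
   by (rule connD[OF C12(6) Un_upper2 Un_upper2 un]) (use rA rB F(4,6) e1 p(11) S(2) in linarith)
  thus False
  proof
   assume h: "r (F1 Un {s,t} Un C1) = r C1"
   have sub: "F1 Un {s,t} Un C1 <= E" using un EE by blast
   have "g (F1 Un {s,t} Un C1)" by (rule cut_mono[OF cutg _ sub F(5)]) blast
   hence "g C1" using cut_down[OF cutg _ sub h] by blast
   moreover have XC: "X Un C1 <= E" using sub EE[OF X(1)] by blast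
   ultimately have "g (X Un C1)" using g_mono[OF Un_upper2] by blast
   moreover have "C (X Un C1) = C X" by (rule C_between) (use fC finite_subset[OF X(1) fS] C12(5) subset_C[of X] in auto)
   ultimately show False using g_cong[OF XC EE[OF X(1)]] X(3) by blast
  next
   assume h: "r (F2 Un W Un C1) = r C1"
   have un2: "(F2 Un W Un C1) Un P2 = S" using PWS PP(3) F(3) C12(3) p(10) P1_def P2_def W_def PP(6) by blast
   have "K <= F2 Un W Un C1" using k1 by blast
   hence "r (F2 Un W Un C1) = r K \<or> r P2 = r K" by (rule connD[OF K(2) _ PP(5) un2]) (use h e1 p(11) S(2) in linarith)
   thus False
   proof
    assume "r (F2 Un W Un C1) = r K"
    thus False using h e1(1) mono[OF PP(4)] by linarith
   next
    assume "r P2 = r K"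
    hence "r C1 = r E" using e1 p(11) by linarith
    thus False using rC1 by simp
   qed
  qed
 qed
 then obtain J where J: "P1 <= J" "J <= P" "Suc (r J) = r P" "\<not> g (J Un {s,t})" "r J + 2 < r (J Un W)" by blast
 have rJ: "r (s+:t+:J) = r J + 2" using r_st[OF P(1) J(2)] .
 have "finite (J Un W)" using J(2) p(9) finite_subset W_def Z(7) by auto
 then obtain z where z: "z : J Un W" "z ~: C (s+:t+:J)" using C_Diff_nonempty[of "J Un W" "s+:t+:J"] J(5) rJ by auto
 have zZP: "z : Z - P" using z subset_C[of "s+:t+:J"] W_def by blast
 have C1J: "C1 <= C (s+:t+:J)" using C_mono[of "s+:t+:P1" "s+:t+:J"] cC1 subset_C[of C1] J(1) by auto
 have "z : C2" using zZP z(2) C1J C12(3) Z(1) by blast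
 moreover have "z ~: C P" using zZP P(2) by blast
 moreover have "\<not> g (s+:t+:J)" using J(4) by simp
 moreover have "r J + 3 = r E" using J(3) p(11) by simp
 ultimately show ?thesis using C12 J(1,2) C1J z(2) zZP e1(3) unfolding P1_def P2_def by blast
qed

text \<open>Both functions are potentials over \<open>C1\<close>, over which \<open>S\<close> is
  connected.\<close>

lemma d_const:
 assumes fs: "pot S (s+:K) fs" and ft: "pot S (t+:K) ft"
  and C1: "conn S C1" "s+:t+:K <= C1" "C1 <= S"
  and X: "X <= S" "Suc (r X) = r E" "\<not> g X" "C1 <= C X" and Y: "Y <= S" "Suc (r Y) = r E" "\<not> g Y" "C1 <= C Y"
 shows "fs X - ft X = fs Y - ft Y"
proof -
 have fC: "finite C1" using C1(3) fS finite_subset by blast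
 have ext: "C (X Un C1) = C X \<and> r (X Un C1) = r X \<and> X Un C1 <= S \<and> (\<not> g X \<longrightarrow> \<not> g (X Un C1))" if X: "X <= S" "C1 <= C X" for X
 proof -
  have f: "finite (X Un C1)" "X <= X Un C1" "X Un C1 <= C X" using X fC fS finite_subset subset_C[of X] by auto
  have c: "C (X Un C1) = C X" by (rule C_between[OF f])
  have sub: "X Un C1 <= S" using X(1) C1(3) by blast
  show ?thesis using c r_between_C[OF f] sub g_cong[OF EE[OF sub] EE[OF X(1)] c] by blast
 qed
 note x = ext[OF X(1,4)] and y = ext[OF Y(1,4)]
 have sub: "s+:K <= S" "t+:K <= S" "s+:K <= C C1" "t+:K <= C C1" using K st C1(2) subset_C[of C1] by auto
 have "fs (X Un C1) - ft (X Un C1) = fs (Y Un C1) - ft (Y Un C1)"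
  by (rule pot_compare[OF S C1(3,1) fs order_refl S(1) sub(1,3) ft order_refl S(1) sub(2,4)]) (use x y X Y in auto)
 moreover have "fs (X Un C1) = fs X" "ft (X Un C1) = ft X" using pot_inv[OF fs] pot_inv[OF ft] x by blast+
 moreover have "fs (Y Un C1) = fs Y" "ft (Y Un C1) = ft Y" using pot_inv[OF fs] pot_inv[OF ft] y by blast+
 ultimately show ?thesis by simp
qed

text \<open>Ties the two gluing conditions together: over \<open>J\<close> the elements
  \<open>s\<close>, \<open>t\<close>, \<open>x\<close> span a triangle of class 2b, and
  \<open>z\<close> provides the third hyperplane through \<open>s+:J\<close> and through
  \<open>t+:J\<close>.\<close>

lemma delta_eq:
 assumes fs: "pot S (s+:K) fs" and ft: "pot S (t+:K) ft"
  and P: "transv P" "\<not> g (s+:P)" "\<not> g (t+:P)"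
  and J: "K <= J" "J <= P" "r J + 3 = r E" "\<not> g (s+:t+:J)" and z: "z : Z" "z ~: C (s+:t+:J)" "z ~: C P"
 shows "fs (s+:P) + a (s+:P) (t+:P) - ft (t+:P) = fs (s+:t+:J) - ft (s+:t+:J)"
proof -
 note p = transv_r[OF P(1)]
 obtain x where x: "x : P" "x ~: C J" using C_Diff_nonempty[OF p(9), of J] J(3) p(11) by auto
 have fJ: "finite J" using J(2) p(9) finite_subset by blast
 have xJ: "C P = C (x+:J)" by (rule C_eqI) (use x J r_notin[OF x(2)] p(11) in auto)
 have cu: "C (u+:P) = C (u+:x+:J)" for u by (rule C_insert_cong[OF p(9) _ xJ]) (use fJ in auto)
 have JZ: "J <= Z" "x : Z" using J(2) x p(7) by blast+
 have m: "J <= E" "x : E" "s : E" "t : E" "z : E" "J <= S" "x : S" "z : S" using JZ z Z(1) S st by auto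
 have ng: "\<not> g (s+:x+:J)" "\<not> g (t+:x+:J)"
 proof -
  have "g (s+:x+:J) = g (s+:P)" by (rule g_cong[OF _ _ cu[symmetric]]) (use m p(5) EE in auto)
  moreover have "g (t+:x+:J) = g (t+:P)" by (rule g_cong[OF _ _ cu[symmetric]]) (use m p(6) EE in auto)
  ultimately show "\<not> g (s+:x+:J)" "\<not> g (t+:x+:J)" using P by blast+
 qed
 have tx: "transv (x+:J)"
 proof -
  have "x+:J <= P" using x J by blast
  moreover have "r (x+:J) = r P" using r_notin[OF x(2)] J(3) p(11) by simp
  ultimately show ?thesis unfolding transv_def using J(1) p r_st[OF P(1), of "x+:J"] by auto
 qed
 have rst: "r (s+:t+:x+:J) = r E" using transv_r(12)[OF tx] .
 hence rst3: "r (s+:t+:x+:J) = r J + 3" using J(3) by simp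
 note i = indep3[OF rst3]
 have zx: "z ~: C (x+:J)" using z(3) xJ by simp
 note zz = tri_transv[OF tx z(1) zx]
 have tri1: "tri S (s+:J)" by (rule triI[of x S t z]) (use m st i zz z(2) in \<open>simp_all add: insert_commute\<close>)
 have tri2: "tri S (t+:J)" by (rule triI[of x S s z]) (use m st i zz z(2) in \<open>simp_all add: insert_commute\<close>)
 have uE: "tri E (s+:J)" "tri E (t+:J)" "tri E (x+:J)" using tri1 tri2 zz(1) tri_mono S(1) by blast+
 have 2: "a (s+:t+:J) (s+:x+:J) + a (s+:x+:J) (t+:x+:J) = a (s+:t+:J) (t+:x+:J)"
  by (rule class_2b[OF m(1) J(3) m(3,4,2) rst uE J(4) ng])
 have L: "r (s+:J) + 2 = r S" "r (t+:J) + 2 = r S" using r_s[OF JZ(1)] J(3) S(2) by simp_all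
 have 3: "fs (x+:s+:J) = fs (t+:s+:J) + a (t+:s+:J) (x+:s+:J)"
  by (rule pot_step[OF fs _ _ L(1) tri1]) (use m st J i ng in \<open>auto simp: insert_commute\<close>)
 have 4: "ft (x+:t+:J) = ft (s+:t+:J) + a (s+:t+:J) (x+:t+:J)"
  by (rule pot_step[OF ft _ _ L(2) tri2]) (use m st J i ng in \<open>auto simp: insert_commute\<close>)
 have c: "x+:s+:J = s+:x+:J" "t+:s+:J = s+:t+:J" "x+:t+:J = t+:x+:J" by (rule insert_commute)+
 have "fs (s+:P) = fs (s+:x+:J)" "ft (t+:P) = ft (t+:x+:J)"
  "a (s+:P) (t+:P) = a (s+:x+:J) (t+:x+:J)" using pot_inv[OF fs cu] pot_inv[OF ft cu] a_inv[OF cu cu] by auto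
 thus ?thesis using 3 4 2[symmetric] unfolding c by (simp add: algebra_simps)
qed

end

context rank_fun begin

text \<open>The remaining independent sets arise by exchange: over two of \<open>s\<close>,
  \<open>t\<close>, \<open>x\<close> the element \<open>x'\<close> may replace the third, and
  similarly \<open>y'\<close> where needed.\<close>

lemma k23I:
 assumes 1: "r (s+:t+:x+:y+:B) = r B + 4"
  and x': "x' ~: C (s+:t+:y+:B)" "x' : C (s+:t+:x+:B)"
  and y': "y' ~: C (s+:t+:x+:B)" "y' : C (s+:t+:y+:B)"
  and n: "x' ~: C (s+:x+:y+:B)" "x' ~: C (t+:x+:y+:B)"
   "y' ~: C (s+:x+:y+:B)" "y' ~: C (t+:x+:y+:B)"
  and Z: "r (x+:x'+:y+:y'+:B) = r B + 3"
 shows "k23 B s t x x' y y'"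
proof -
 have r2: "r (y+:B) = r B + 1" "r (x+:y+:B) = r B + 2" "r (t+:x+:y+:B) = r B + 3"
  "r (s+:x+:y+:B) = r B + 3" "r (s+:t+:y+:B) = r B + 3" "r (s+:t+:x+:B) = r B + 3"
  "r (s+:t+:B) = r B + 2" "r (s+:x+:B) = r B + 2" "r (t+:x+:B) = r B + 2" "r (s+:y+:B) = r B + 2" "r (t+:y+:B) = r B + 2"
  using 1 unit[of s "t+:x+:y+:B"] unit[of t "x+:y+:B"] unit[of x "y+:B"] unit[of y B]
   unit[of t "s+:x+:y+:B"] unit[of s "x+:y+:B"] unit[of x "s+:t+:y+:B"]
   unit[of y "s+:t+:x+:B"] unit[of s "t+:y+:B"] unit[of t "y+:B"]
   unit[of s "t+:x+:B"] unit[of t "s+:x+:B"] unit[of x "s+:t+:B"] unit[of s "t+:B"] unit[of t B]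
   unit[of s "x+:B"] unit[of x B] unit[of t "x+:B"] unit[of t "s+:y+:B"] unit[of s "y+:B"] by (simp_all add: insert_commute)
 have sub: "C (s+:x+:B) <= C (s+:x+:y+:B)" "C (t+:x+:B) <= C (t+:x+:y+:B)"
  "C (s+:y+:B) <= C (s+:x+:y+:B)" "C (t+:y+:B) <= C (t+:x+:y+:B)"
  "C (s+:t+:B) <= C (s+:t+:y+:B)" "C (s+:t+:B) <= C (s+:t+:x+:B)" by (rule C_mono; blast)+
 have ni: "u ~: C L" if "r (u+:L) = Suc (r L)" for u L using that by (auto simp: C_iff)
 have c1: "C (x+:s+:t+:B) = C (x'+:s+:t+:B)" by (rule C_point) (use ni x' sub r2 in \<open>auto simp: insert_commute\<close>)
 have c2: "C (t+:s+:x+:B) = C (x'+:s+:x+:B)" by (rule C_point) (use ni x' n sub r2 in \<open>auto simp: insert_commute\<close>)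
 have c3: "C (s+:t+:x+:B) = C (x'+:t+:x+:B)" by (rule C_point) (use ni x' n sub r2 in \<open>auto simp: insert_commute\<close>)
 have c4: "C (t+:s+:y+:B) = C (y'+:s+:y+:B)" by (rule C_point) (use ni y' n sub r2 in \<open>auto simp: insert_commute\<close>)
 have c5: "C (s+:t+:y+:B) = C (y'+:t+:y+:B)" by (rule C_point) (use ni y' n sub r2 in \<open>auto simp: insert_commute\<close>)
 have rc: "r (x'+:s+:t+:B) = r B + 3" "r (x'+:s+:x+:B) = r B + 3"
  "r (x'+:t+:x+:B) = r B + 3" "r (y'+:s+:y+:B) = r B + 3" "r (y'+:t+:y+:B) = r B + 3"
 proof -
  have "x' ~: C (s+:t+:B)" "x' ~: C (s+:x+:B)" "x' ~: C (t+:x+:B)"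
   "y' ~: C (s+:y+:B)" "y' ~: C (t+:y+:B)" using x' n sub by blast+
  note a = r_notin[OF this(1)] r_notin[OF this(2)] r_notin[OF this(3)] r_notin[OF this(4)] r_notin[OF this(5)]
  show "r (x'+:s+:t+:B) = r B + 3" "r (x'+:s+:x+:B) = r B + 3"
  "r (x'+:t+:x+:B) = r B + 3" "r (y'+:s+:y+:B) = r B + 3" "r (y'+:t+:y+:B) = r B + 3" using a r2 by simp_all
 qed
 have "r (x'+:s+:t+:x+:B) = r B + 3" "r (y'+:s+:t+:y+:B) = r B + 3" using r_in[OF x'(2)] r_in[OF y'(2)] r2 by auto
 moreover have "r (x'+:s+:t+:y+:B) = r B + 4" "r (y'+:s+:t+:x+:B) = r B + 4"
  using r_notin[OF x'(1)] r_notin[OF y'(1)] r2 by auto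
 moreover have "r (y'+:x'+:s+:t+:B) = r B + 4" "r (y'+:x'+:s+:x+:B) = r B + 4"
  "r (y'+:x'+:t+:x+:B) = r B + 4" "r (x'+:y'+:s+:y+:B) = r B + 4"
  "r (x'+:y'+:t+:y+:B) = r B + 4"
  using r_notin[of y' "x'+:s+:t+:B"] r_notin[of y' "x'+:s+:x+:B"] r_notin[of y' "x'+:t+:x+:B"]
   r_notin[of x' "y'+:s+:y+:B"] r_notin[of x' "y'+:t+:y+:B"] rc c1 c2 c3 c4 c5 x' y' by (auto simp: insert_commute)
 moreover have "r (x'+:s+:x+:y+:B) = r B + 4" "r (x'+:t+:x+:y+:B) = r B + 4"
  "r (y'+:s+:x+:y+:B) = r B + 4" "r (y'+:t+:x+:y+:B) = r B + 4"
  using r_notin[OF n(1)] r_notin[OF n(2)] r_notin[OF n(3)] r_notin[OF n(4)] r2 by auto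
 ultimately show ?thesis unfolding k23_def using 1 Z by (auto simp: insert_commute)
qed

lemma k23_swap: "k23 B s t x x' y y' \<Longrightarrow> k23 B s t x' x y y'" unfolding k23_def by (auto simp: insert_commute)

lemma three_lines:
 assumes "r (p+:q+:L) = r L + 2" "r (p+:w+:L) = r L + 2" "r (q+:w+:L) = r L + 2"
  "p : S" "q : S" "w : S"
 shows "tri S L"
 using indep2[OF assms(1)] indep2[OF assms(2)] indep2[OF assms(3)] assms(4-6) by (intro triI[of p S q w]) auto

lemma k23_rank2:
 assumes "r (p+:q+:u+:v+:B) = r B + 4"
 shows "r (u+:v+:B) = r B + 2" "r (q+:u+:v+:B) = r B + 3"
 using assms unit[of p "q+:u+:v+:B"] unit[of q "u+:v+:B"] unit[of u "v+:B"] unit[of v B] by auto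

end

context series_pair begin

text \<open>Both potentials can be followed from \<open>P\<close> to \<open>Q\<close>,
  \<open>fs\<close> through \<open>T1\<close> and \<open>ft\<close> through \<open>T3\<close>; class
  2d says that the cochain has the same sum on both ways.\<close>

lemma k23_cycle:
 assumes fs: "pot S (s+:K) fs" and ft: "pot S (t+:K) ft"
  and B: "K <= B" "B <= Z" "r B + 4 = r E" and e: "x : Z" "x' : Z" "y : Z" "y' : Z" and k: "k23 B s t x x' y y'"
  and gg: "g (s+:x+:y+:B)" "g (s+:x'+:y'+:B)"
    "g (t+:x+:y'+:B)" "g (t+:x'+:y+:B)"
  and ng: "\<not> g (s+:x+:y'+:B)" "\<not> g (s+:x'+:y+:B)"
    "\<not> g (t+:x+:y+:B)" "\<not> g (t+:x'+:y'+:B)"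
    "\<not> g (s+:t+:x+:x'+:B)" "\<not> g (s+:t+:y+:y'+:B)"
    "\<not> g (x+:x'+:y+:y'+:B)"
 shows "fs (s+:t+:x+:B) - ft (s+:t+:x+:B)
    = fs (s+:t+:y+:B) - ft (s+:t+:y+:B)"
proof -
 define P where "P = s+:t+:x+:x'+:B"
 define Q where "Q = s+:t+:y+:y'+:B"
 define T1 where "T1 = s+:x+:y'+:B"
 define T3 where "T3 = t+:x+:y+:B"
 have m: "x : S" "x' : S" "y : S" "y' : S" "s : S" "t : S" "B <= S" using e B Z(1) st by auto
 have PQ: "P <= S" "Q <= S" unfolding P_def Q_def using m by auto
 have cyc: "a P T1 + a T1 Q + a Q T3 + a T3 P = 0" unfolding P_def Q_def T1_def T3_def
  by (rule class_2d_tri[OF _ B(3) _ k gg ng]) (use m S in auto)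
 have k1: "r (s+:t+:p+:q+:B) = r B + 4" if "p : {x,x'}" "q : {y,y'}" for p q using k that unfolding k23_def by blast
 have k2: "r (p+:x+:x'+:q+:B) = r B + 4" if "p : {s,t}" "q : {y,y'}" for p q using k that unfolding k23_def by blast
 have k3: "r (p+:q+:y+:y'+:B) = r B + 4" if "p : {s,t}" "q : {x,x'}" for p q using k that unfolding k23_def by blast
 have kk: "r P = r B + 3" "r Q = r B + 3" using k unfolding k23_def P_def Q_def by blast+
 have q: "r (s+:t+:x+:y+:B) = r B + 4" "r (s+:t+:x+:y'+:B) = r B + 4"
  "r (s+:t+:x'+:y+:B) = r B + 4" "r (s+:t+:x'+:y'+:B) = r B + 4"
  "r (s+:x+:x'+:y'+:B) = r B + 4" "r (t+:x+:x'+:y+:B) = r B + 4"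
  "r (s+:x+:y+:y'+:B) = r B + 4" "r (t+:x+:y+:y'+:B) = r B + 4" using k1 k2 k3 by auto
 define L1 where "L1 = s+:x+:B"
 define L2 where "L2 = s+:y'+:B"
 define L3 where "L3 = t+:x+:B"
 define L4 where "L4 = t+:y+:B"
 note Ld = L1_def L2_def L3_def L4_def
 have rL: "r L1 = r B + 2" "r L2 = r B + 2" "r L3 = r B + 2" "r L4 = r B + 2"
  unfolding Ld using k23_rank2(1)[of t y s x B] k23_rank2(1)[of t x s y' B] k23_rank2(1)[of s y t x B] k23_rank2(1)[of s x t y B] q
  by (simp_all add: insert_commute)
 have tr: "tri S L1" "tri S L2" "tri S L3" "tri S L4"
 proof -
  show "tri S L1" by (rule three_lines[of t y _ y']) (use rL q m in \<open>simp_all add: Ld insert_commute\<close>)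
  show "tri S L2" by (rule three_lines[of t x _ x']) (use rL q m in \<open>simp_all add: Ld insert_commute\<close>)
  show "tri S L3" by (rule three_lines[of s y _ y']) (use rL q m in \<open>simp_all add: Ld insert_commute\<close>)
  show "tri S L4" by (rule three_lines[of s x _ x']) (use rL q m in \<open>simp_all add: Ld insert_commute\<close>)
 qed
 have r3: "r (t+:L1) = r B + 3" "r (y'+:L1) = r B + 3" "r (x+:L2) = r B + 3" "r (t+:L2) = r B + 3"
  "r (s+:L3) = r B + 3" "r (y+:L3) = r B + 3" "r (x+:L4) = r B + 3" "r (s+:L4) = r B + 3"
  "r (s+:t+:x+:B) = r B + 3" "r (s+:t+:y+:B) = r B + 3" "r (s+:t+:y'+:B) = r B + 3"
  unfolding Ld using k23_rank2(2)[of y t s x B] k23_rank2(2)[of t y' s x B] k23_rank2(2)[of t x s y' B] k23_rank2(2)[of x t s y' B]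
   k23_rank2(2)[of y s t x B] k23_rank2(2)[of s y t x B] k23_rank2(2)[of s x t y B] k23_rank2(2)[of x s t y B] q
  by (simp_all add: insert_commute)
 have ni: "u ~: C L" if "r (u+:L) = r B + 3" "r L = r B + 2" for u L using that by (auto simp: C_iff)
 have cA: "C (s+:t+:x+:B) = C P" unfolding P_def[symmetric] by (rule C_eqI[symmetric]) (use r3 kk P_def in auto)
 have cQ: "C (s+:t+:y+:B) = C Q" by (rule C_eqI[symmetric]) (use r3 kk Q_def in auto)
 have cQ': "C (s+:t+:y'+:B) = C Q" by (rule C_eqI[symmetric]) (use r3 kk Q_def in auto)
 have ngP: "\<not> g P" "\<not> g Q" using ng unfolding P_def Q_def by blast+
 have nn: "\<not> g (s+:t+:x+:B)" "\<not> g (s+:t+:y+:B)" "\<not> g (s+:t+:y'+:B)"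
 proof -
  have "s+:t+:v+:B <= E" if "v : S" for v using that m S by auto
  thus "\<not> g (s+:t+:x+:B)" "\<not> g (s+:t+:y+:B)" "\<not> g (s+:t+:y'+:B)"
   using g_cong[OF _ EE[OF PQ(1)] cA] g_cong[OF _ EE[OF PQ(2)] cQ] g_cong[OF _ EE[OF PQ(2)] cQ'] ngP m by blast+
 qed
 have LS: "L1 <= S" "L2 <= S" "L3 <= S" "L4 <= S" "s+:K <= L1" "s+:K <= L2" "t+:K <= L3" "t+:K <= L4" using m B unfolding Ld by auto
 have rS: "r L1 + 2 = r S" "r L2 + 2 = r S" "r L3 + 2 = r S" "r L4 + 2 = r S" using rL B S by auto
 have 1: "fs (y'+:L1) = fs (t+:L1) + a (t+:L1) (y'+:L1)"
  by (rule pot_step[OF fs LS(5,1) rS(1) tr(1)]) (use m ni r3 rL nn ng in \<open>auto simp: Ld insert_commute\<close>)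
 have 2: "fs (t+:L2) = fs (x+:L2) + a (x+:L2) (t+:L2)"
  by (rule pot_step[OF fs LS(6,2) rS(2) tr(2)]) (use m ni r3 rL nn ng in \<open>auto simp: Ld insert_commute\<close>)
 have 3: "ft (y+:L3) = ft (s+:L3) + a (s+:L3) (y+:L3)"
  by (rule pot_step[OF ft LS(7,3) rS(3) tr(3)]) (use m ni r3 rL nn ng in \<open>auto simp: Ld insert_commute\<close>)
 have 4: "ft (s+:L4) = ft (x+:L4) + a (x+:L4) (s+:L4)"
  by (rule pot_step[OF ft LS(8,4) rS(4) tr(4)]) (use m ni r3 rL nn ng in \<open>auto simp: Ld insert_commute\<close>)
 have eqs: "y'+:L1 = T1" "x+:L2 = T1" "y+:L3 = T3" "x+:L4 = T3"
  "t+:L1 = s+:t+:x+:B" "t+:L2 = s+:t+:y'+:B"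
  "s+:L3 = s+:t+:x+:B" "s+:L4 = s+:t+:y+:B" unfolding Ld T1_def T3_def by blast+
 have f1: "fs T1 = fs P + a P T1" using 1 pot_inv[OF fs cA] a_inv[OF cA refl] unfolding eqs by simp
 have f2: "fs Q = fs T1 + a T1 Q" using 2 pot_inv[OF fs cQ'] a_inv[OF refl cQ'] unfolding eqs by simp
 have f3: "ft T3 = ft P + a P T3" using 3 pot_inv[OF ft cA] a_inv[OF cA refl] unfolding eqs by simp
 have f4: "ft Q = ft T3 + a T3 Q" using 4 pot_inv[OF ft cQ] a_inv[OF refl cQ] unfolding eqs by simp
 have "a P T1 + a T1 Q = a P T3 + a T3 Q" using cyc unfolding a_anti[of Q T3] a_anti[of T3 P] by (simp add: algebra_simps)
 hence "fs Q - ft Q = fs P - ft P" unfolding f2 f1 f4 f3 by (simp add: algebra_simps)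
 thus ?thesis using pot_inv[OF fs cA] pot_inv[OF ft cA] pot_inv[OF fs cQ] pot_inv[OF ft cQ] by simp
qed

text \<open>Here the cut blocks every passage from \<open>s\<close> to \<open>t\<close>. When
  \<open>X\<close> and \<open>Y\<close> contain opposite sides of a separation over
  \<open>s+:t+:K\<close>, the blocked transversals force the cut pattern of class 2d on six
  elements.\<close>

lemma no_transversal_case:
 assumes fs: "pot S (s+:K) fs" and ft: "pot S (t+:K) ft"
  and noD: "\<And>P. transv P \<Longrightarrow> g (s+:P) \<or> g (t+:P)"
  and X: "X <= S" "Suc (r X) = r E" "\<not> g X" "s+:t+:K <= X"
  and Y: "Y <= S" "Suc (r Y) = r E" "\<not> g Y" "s+:t+:K <= Y"
 shows "fs X - ft X = fs Y - ft Y"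
proof -
 obtain P where P: "transv P" "Z Int C P <= P" using exists_transv flat_transv(1,3) by meson
 note p = transv_r[OF P(1)]
 have stS: "s+:t+:K <= S" using K st by auto
 have XC: "s+:t+:K <= C X" and YC: "s+:t+:K <= C Y" using X(4) Y(4) subset_C by blast+
 have unS: "s+:t+:K Un S = S" using stS by blast
 obtain C1 C2 J1 z1 where c: "s+:t+:K <= C1" "s+:t+:K <= C2" "C1 Un C2 = S"
   "r C1 + r C2 = r S + r (s+:t+:K)" "C1 <= C X" "conn S C1"
  and J1: "P Int C1 <= J1" "J1 <= P" "r J1 + 3 = r E" "\<not> g (s+:t+:J1)" "C1 <= C (s+:t+:J1)"
  and z1: "z1 : Z" "z1 ~: C (s+:t+:J1)" "z1 ~: C P" "z1 : C2" and dir: "r (P Int C1) + r (P Int C2) = r P + r K"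
  using local_component[OF X(1-3) order_refl stS unS _ XC P] by (auto simp: add.commute)
 have C1S: "C1 <= S" "C2 <= S" using c(3) by blast+
 show ?thesis
 proof (cases "C1 <= C Y")
  case True
  show ?thesis by (rule d_const[OF fs ft c(6,1) C1S(1) X(1-3) c(5) Y(1-3) True])
 next
  case False
  have "Suc (r Y) = r S" using Y(2) S by simp
  hence C2Y: "C2 <= C Y" using hyperplane_separation[OF fS c(1-4) YC Y(1)] False by blast
  have c': "C2 Un C1 = S" "r C2 + r C1 = r S + r (s+:t+:K)" using c(3,4) by auto
  obtain A1 J2 z2 where A: "C2 <= A1" "A1 <= C Y" "conn S A1" "A1 <= S"
   and J2: "P Int A1 <= J2" "J2 <= P" "r J2 + 3 = r E" "\<not> g (s+:t+:J2)" "A1 <= C (s+:t+:J2)"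
   and z2: "z2 : Z" "z2 ~: C (s+:t+:J2)" "z2 ~: C P" using local_component[OF Y(1-3) c(2,1) c' C2Y P] by blast
  have stJ: "s+:t+:J <= S" "Suc (r (s+:t+:J)) = r E" if "J <= P" "r J + 3 = r E" for J
   using that p(10) st r_st[OF P(1) that(1)] by auto
  have dX: "fs X - ft X = fs (s+:t+:J1) - ft (s+:t+:J1)"
   by (rule d_const[OF fs ft c(6,1) C1S(1) X(1-3) c(5) stJ[OF J1(2,3)] J1(4,5)])
  have stA: "s+:t+:K <= A1" using c(2) A(1) by blast
  have dY: "fs Y - ft Y = fs (s+:t+:J2) - ft (s+:t+:J2)"
   by (rule d_const[OF fs ft A(3) stA A(4) Y(1-3) A(2) stJ[OF J2(2,3)] J2(4,5)])
  have rJ: "r J1 + 1 = r P" "r J2 + 1 = r P" using J1(3) J2(3) p(11) by simp_all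
  \<comment> \<open>\<open>J1\<close> and \<open>J2\<close> come from opposite sides of a direct sum
    decomposition of \<open>P\<close> over \<open>K\<close>. They meet in corank 2 of
    \<open>P\<close>, hence in corank 4 of \<open>E\<close>.\<close>
  define B where "B = J1 Int J2"
  define P1 where "P1 = P Int C1"
  define P2 where "P2 = P Int C2"
  have PP: "P1 Un P2 = P" "K <= P1" "K <= P2" "P1 <= J1" "P2 <= J2" using P1_def P2_def c(1-3) p(8,10) J1(1) J2(1) A(1) by blast+
  have dir': "r P1 + r P2 = r P + r K" using dir P1_def P2_def by simp
  define U where "U = J1 Int C2"
  define V where "V = J2 Int C1"
  have KJ: "K <= J1" "K <= J2" "K <= C1" "K <= C2" using PP(2-5) c(1,2) by blast+
  have PS: "z : C1 \<or> z : C2" if "z : P" for z using that p(10) c(3) by blast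
  have UV: "K <= U" "K <= V" "U <= P2" "V <= P1" "P1 Un U = J1" "P2 Un V = J2" "U Un V <= B"
  proof -
   show "K <= U" "K <= V" using KJ U_def V_def by auto
   show UP: "U <= P2" "V <= P1" using J1(2) J2(2) unfolding U_def V_def P1_def P2_def by blast+
   show "P1 Un U = J1" using PP(4) J1(2) PS unfolding U_def P1_def by blast
   show "P2 Un V = J2" using PP(5) J2(2) PS unfolding V_def P2_def by blast
   have "U <= J2" "V <= J1" using UP PP(4,5) by blast+
   thus "U Un V <= B" unfolding B_def U_def V_def by blast
  qed
  have u1: "r J1 + r K \<le> r P1 + r U" by (rule cover_ge[OF UV(5) PP(2) UV(1)])
  have u2: "r J2 + r K \<le> r P2 + r V" by (rule cover_ge[OF UV(6) PP(3) UV(2)])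
  have u3: "r P + r U \<le> r P2 + r (U Un P1)" by (rule cover_ge) (use PP(1) UV(3) in blast)+
  have u4: "r (U Un P1) + r V \<le> r P1 + r (U Un V)" by (rule cover_ge) (use UV(3,4) in blast)+
  have u5: "r (U Un V) \<le> r B" by (rule mono[OF UV(7)])
  have "J1 Un J2 = P" using PP(1,4,5) J1(2) J2(2) by blast
  hence u6: "r P + r B \<le> r J1 + r J2" by (rule cover_ge) (auto simp: B_def)
  have rB: "r B + 2 = r P" using u1 u2 u3 u4 u5 u6 dir' rJ by linarith
  hence rB4: "r B + 4 = r E" using p(11) by linarith
  have fJ: "finite J1" "finite J2" "finite B"
   using finite_subset[OF J1(2) p(9)] finite_subset[OF J2(2) p(9)] unfolding B_def by simp_all
  have KB: "K <= B" "B <= Z" using KJ(1,2) J1(2) p(7) unfolding B_def by blast+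
  obtain x where x: "x : P" "x ~: C J1" using C_Diff_nonempty[OF p(9), of J1] rJ by auto
  obtain y where y: "y : P" "y ~: C J2" using C_Diff_nonempty[OF p(9), of J2] rJ by auto
  have xJ: "x : J2" using x PP(1,4,5) subset_C[of J1] by blast
  have yJ: "y : J1" using y PP(1,4,5) subset_C[of J2] by blast
  have BJ: "B <= J1" "B <= J2" using B_def by auto
  have xB: "x ~: C B" "y ~: C B" using C_mono[OF BJ(1)] C_mono[OF BJ(2)] x y by blast+
  have cJ2: "C J2 = C (x+:B)" by (rule C_eqI) (use xJ BJ r_notin[OF xB(1)] rB rJ in auto)
  have cJ1: "C J1 = C (y+:B)" by (rule C_eqI) (use yJ BJ r_notin[OF xB(2)] rB rJ in auto)
  have cst1: "C (s+:t+:J1) = C (s+:t+:y+:B)" by (intro C_insert_cong cJ1) (use fJ in auto)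
  have cst2: "C (s+:t+:J2) = C (s+:t+:x+:B)" by (intro C_insert_cong cJ2) (use fJ in auto)
  have yx: "y ~: C (x+:B)" using y(2) cJ2 by simp
  have rxy: "r (x+:y+:B) = r P" using r_insert2[OF xB(1) yx] rB by (simp add: insert_commute)
  have cP: "C P = C (x+:y+:B)" by (rule C_eqI) (use x y xJ yJ BJ J1(2) J2(2) rxy in auto)
  have xyZ: "x : Z" "y : Z" using x y p(7) by blast+
  have subP: "x+:y+:B <= P" using x y BJ J1(2) by blast
  have tvxy: "transv (x+:y+:B)" unfolding transv_def using KB xyZ rxy p(11) r_st[OF P(1) subP] by auto
  have z1': "z1 ~: C (s+:t+:y+:B)" "z1 : C (s+:t+:x+:B)" using z1(2) cst1 z1(4) A(1) J2(5) cst2 by auto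
  have z2': "z2 ~: C (s+:t+:x+:B)" "z2 : C (s+:t+:y+:B)"
  proof -
   show "z2 ~: C (s+:t+:x+:B)" using z2(2) cst2 by simp
   have "z2 ~: C2" using z2(2) J2(5) A(1) by blast
   hence "z2 : C1" using z2(1) Z(1) c(3) by blast
   thus "z2 : C (s+:t+:y+:B)" using J1(5) cst1 by blast
  qed
  have zP: "z1 ~: C (x+:y+:B)" "z2 ~: C (x+:y+:B)" using z1(3) z2(3) cP by auto
  note w1 = tri_transv(2,3)[OF tvxy z1(1) zP(1)] and w2 = tri_transv(2,3)[OF tvxy z2(1) zP(2)]
  have rst: "r (s+:t+:x+:y+:B) = r B + 4" using transv_r(12)[OF tvxy] rB4 by simp
  have rZ: "r (x+:z1+:y+:z2+:B) = r B + 3"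
  proof -
   have "x+:z1+:y+:z2+:B <= Z" using xyZ z1(1) z2(1) KB by auto
   from mono[OF this] have "r (x+:z1+:y+:z2+:B) \<le> r B + 3" using Z(5) rB4 by simp
   moreover have "r (z1+:x+:y+:B) = r B + 3" using r_notin[OF zP(1)] rxy rB by simp
   moreover have "r (z1+:x+:y+:B) \<le> r (x+:z1+:y+:z2+:B)" by (rule mono) blast
   ultimately show ?thesis by linarith
  qed
  \<comment> \<open>The series pairs are \<open>s,t\<close>, then \<open>x,z1\<close> and
    \<open>y,z2\<close>. The three circuits span the hyperplanes of \<open>s+:t+:J2\<close>, of
    \<open>s+:t+:J1\<close> and of \<open>Z\<close>.\<close>
  have k: "k23 B s t x z1 y z2" by (rule k23I[OF rst z1' z2' w1 w2 rZ])
  have k1: "r (s+:t+:p'+:q+:B) = r B + 4" if "p' : {x,z1}" "q : {y,z2}" for p' q using k that unfolding k23_def by blast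
  have k2: "r (p'+:x+:z1+:q+:B) = r B + 4" if "p' : {s,t}" "q : {y,z2}" for p' q using k that unfolding k23_def by blast
  have k3: "r (p'+:q+:y+:z2+:B) = r B + 4" if "p' : {s,t}" "q : {x,z1}" for p' q using k that unfolding k23_def by blast
  have kk: "r (s+:t+:x+:z1+:B) = r B + 3" "r (s+:t+:y+:z2+:B) = r B + 3" using k unfolding k23_def by blast+
  have m: "B <= E" "s : E" "t : E" "x : E" "y : E" "z1 : E" "z2 : E" using KB xyZ z1(1) z2(1) Z(1) st S by auto
  have pq: "g (s+:p'+:q+:B) \<or> g (t+:p'+:q+:B)" if "p' : {x,z1}" "q : {y,z2}" for p' q
  proof -
   have "transv (p'+:q+:B)"
    unfolding transv_def using k1[OF that] KB xyZ z1(1) z2(1) that rB4 k23_rank2(1)[of s t p' q B] by auto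
   thus ?thesis using noD by blast
  qed
  have r3: "r (s+:t+:v+:B) = r B + 3" if "v : {x,y,z1,z2}" for v using that k1[of x y] k1[of x z2] k1[of z1 y] k1[of z1 z2]
    unit[of v "s+:t+:x+:B"]
    k23_rank2(2)[of x s t y B] k23_rank2(2)[of y s t x B] k23_rank2(2)[of y s t z1 B] k23_rank2(2)[of x s t z2 B]
   by (auto simp: insert_commute)
  have offA: "\<not> g (s+:t+:x+:z1+:B)" "\<not> g (s+:t+:y+:z2+:B)"
  proof -
   have "C (s+:t+:x+:z1+:B) = C (s+:t+:x+:B)" by (rule C_eqI) (use kk r3 in auto)
   hence e: "C (s+:t+:x+:z1+:B) = C (s+:t+:J2)" using cst2 by simp
   show "\<not> g (s+:t+:x+:z1+:B)" using g_cong[OF _ EE[OF stJ(1)[OF J2(2,3)]] e] m J2(4) by auto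
   have "C (s+:t+:y+:z2+:B) = C (s+:t+:y+:B)" by (rule C_eqI) (use kk r3 in auto)
   hence e: "C (s+:t+:y+:z2+:B) = C (s+:t+:J1)" using cst1 by simp
   show "\<not> g (s+:t+:y+:z2+:B)" using g_cong[OF _ EE[OF stJ(1)[OF J1(2,3)]] e] m J1(4) by auto
  qed
  have offst: "\<not> g (s+:t+:v+:B)" if v: "v : {x,y,z1,z2}" for v
  proof
   assume h: "g (s+:t+:v+:B)"
   have sE: "s+:t+:x+:z1+:B <= E" "s+:t+:y+:z2+:B <= E" using m by auto
   show False
   proof (cases "v : {x,z1}")
    case True
    hence "s+:t+:v+:B <= s+:t+:x+:z1+:B" by blast
    from g_mono[OF this sE(1) h] show False using offA(1) by simp
   next
    case False
    hence "s+:t+:v+:B <= s+:t+:y+:z2+:B" using v by blast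
    from g_mono[OF this sE(2) h] show False using offA(2) by simp
   qed
  qed
  \<comment> \<open>Two of these hyperplanes over a common corank 2 set \<open>u+:q+:B\<close>
    cannot both be in the cut: that set would be, and with it \<open>s+:t+:q+:B\<close>.\<close>
  have excl: "\<not> (g (u+:v+:q+:B) \<and> g (u+:w+:q+:B))"
   if u: "u : {s,t}" and q: "q : {x,y,z1,z2}" and vw: "v : E" "w : E" and rk: "r (u+:v+:w+:q+:B) = r B + 4" for u v w q
  proof
   assume h: "g (u+:v+:q+:B) \<and> g (u+:w+:q+:B)"
   let ?L = "u+:q+:B"
   have "r (v+:?L) = r B + 3" using k23_rank2(2)[of w v u q B] rk by (simp add: insert_commute)
   hence "w ~: C (v+:?L)" using rk by (auto simp: C_iff insert_commute)
   moreover have "?L <= E" using u q m by auto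
   ultimately have "g ?L" using cut_point[OF cutg, of ?L v w] vw h by (auto simp: insert_commute)
   moreover have "?L <= s+:t+:q+:B" "s+:t+:q+:B <= E" using u q m by auto
   ultimately show False using offst[OF q] g_mono[of ?L "s+:t+:q+:B"] by blast
  qed
  have exx: "\<not> (g (u+:x+:q+:B) \<and> g (u+:z1+:q+:B))" if "u : {s,t}" "q : {y,z2}" for u q
   by (rule excl[OF that(1) _ m(4,6) k2[OF that]]) (use that in blast)
  have exy: "\<not> (g (u+:q+:y+:B) \<and> g (u+:q+:z2+:B))" if "u : {s,t}" "q : {x,z1}" for u q
  proof -
   have "\<not> (g (u+:y+:q+:B) \<and> g (u+:z2+:q+:B))"
    by (rule excl[OF that(1) _ m(5,7)]) (use that k3[OF that] in \<open>auto simp: insert_commute\<close>)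
   thus ?thesis by (simp add: insert_commute)
  qed
  \<comment> \<open>If \<open>Z\<close> were in the cut, so would be \<open>x+:y+:B\<close> and both
    hyperplanes over it. Then \<open>excl\<close> would leave the transversal of \<open>z1\<close>
    and \<open>y\<close> unblocked.\<close>
  have offZ: "\<not> g (x+:z1+:y+:z2+:B)"
  proof
   assume gZ: "g (x+:z1+:y+:z2+:B)"
   obtain u v where uv: "(u = s \<and> v = t) \<or> (u = t \<and> v = s)" "g (u+:x+:y+:B)" using pq[of x y] by blast
   let ?Z = "x+:z1+:y+:z2+:B" and ?T = "u+:x+:y+:B"
   have sub: "?Z <= E" "?T <= E" using m uv by auto
   have "u+:x+:z1+:y+:B <= ?T Un ?Z" by blast
   moreover have "r (u+:x+:z1+:y+:B) = r B + 4" using k2[of u y] uv by blast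
   ultimately have "r B + 4 \<le> r (?T Un ?Z)" using mono by metis
   moreover have "r ?T = r B + 3" using k1[of x y] uv k23_rank2(2)[of t s x y B] k23_rank2(2)[of s t x y B] by (auto simp: insert_commute)
   ultimately have "g (x+:y+:B)" using rxy rB rZ by (intro cut_meet[OF cutg sub(2,1) uv(2) gZ]) auto
   moreover have "v+:x+:y+:B <= E" using m uv by auto
   ultimately have "g (v+:x+:y+:B)" using g_mono[OF subset_insertI] by blast
   hence "g (s+:x+:y+:B)" "g (t+:x+:y+:B)" using uv by auto
   moreover have "t ~: C (s+:x+:y+:B)" using transv_r(3)[OF tvxy] .
   have "transv (x+:y+:B)" by fact
   have "\<not> (g (s+:x+:y+:B) \<and> g (t+:x+:y+:B) )"
   proof
    assume "g (s+:x+:y+:B) \<and> g (t+:x+:y+:B)"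
    hence n: "\<not> g (s+:z1+:y+:B)" "\<not> g (t+:z1+:y+:B)" using exx[of s y] exx[of t y] by blast+
    thus False using pq[of z1 y] by blast
   qed
   ultimately show False by blast
  qed
  have res: "fs (s+:t+:x+:B) - ft (s+:t+:x+:B)
    = fs (s+:t+:y+:B) - ft (s+:t+:y+:B)"
  \<comment> \<open>The facts \<open>pq\<close> and \<open>excl\<close> determine the cut up to
    exchanging \<open>x\<close> and \<open>z1\<close>.\<close>
  proof (cases "g (s+:x+:y+:B)")
   case True
   have 1: "\<not> g (s+:z1+:y+:B)" "\<not> g (s+:x+:z2+:B)" using exx[of s y] exy[of s x] True by blast+
   hence 2: "g (t+:z1+:y+:B)" "g (t+:x+:z2+:B)" using pq[of z1 y] pq[of x z2] by blast+
   hence 3: "\<not> g (t+:x+:y+:B)" "\<not> g (t+:z1+:z2+:B)" using exx[of t y] exx[of t z2] by blast+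
   hence 4: "g (s+:z1+:z2+:B)" using pq[of z1 z2] by blast
   show ?thesis by (rule k23_cycle[OF fs ft KB rB4 xyZ(1) z1(1) xyZ(2) z2(1) k True 4 2(2,1) 1(2,1) 3 offA offZ])
  next
   case False
   hence 0: "g (t+:x+:y+:B)" using pq[of x y] by blast
   have 1: "\<not> g (t+:z1+:y+:B)" "\<not> g (t+:x+:z2+:B)" using exx[of t y] exy[of t x] 0 by blast+
   hence 2: "g (s+:z1+:y+:B)" "g (s+:x+:z2+:B)" using pq[of z1 y] pq[of x z2] by blast+
   hence 3: "\<not> g (s+:z1+:z2+:B)" using exx[of s z2] by blast
   hence 4: "g (t+:z1+:z2+:B)" using pq[of z1 z2] by blast
   have cx: "C (s+:t+:z1+:B) = C (s+:t+:x+:B)"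
   proof -
    have "C (s+:t+:x+:z1+:B) = C (s+:t+:x+:B)"
     "C (s+:t+:x+:z1+:B) = C (s+:t+:z1+:B)" by (rule C_eqI; use kk r3 in auto)+
    thus ?thesis by simp
   qed
   have "fs (s+:t+:z1+:B) - ft (s+:t+:z1+:B)
    = fs (s+:t+:y+:B) - ft (s+:t+:y+:B)"
    by (rule k23_cycle[OF fs ft KB rB4 z1(1) xyZ(1) xyZ(2) z2(1) k23_swap[OF k] 2 4 0 3 False 1(1,2)])
     (use offA offZ in \<open>simp_all add: insert_commute\<close>)
   thus ?thesis using pot_inv[OF fs cx] pot_inv[OF ft cx] by simp
  qed
  show ?thesis unfolding dX dY using res pot_inv[OF fs cst1] pot_inv[OF ft cst1] pot_inv[OF fs cst2] pot_inv[OF ft cst2] by simp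
 qed
qed

end

context series_pair begin

text \<open>After adding a constant to \<open>ft\<close>, two conditions remain: one on the
  hyperplanes through both \<open>s\<close> and \<open>t\<close>, one on the transversals. The cases
  differ in which of them are vacuous.\<close>

theorem pot_series:
 assumes fs: "pot S (s+:K) fs" and ft: "pot S (t+:K) ft"
 shows "\<exists>f. pot S K f"
proof -
 have gmS: "g Y" if "X <= Y" "Y <= S" "g X" for X Y using g_mono[OF that(1) EE[OF that(2)] that(3)] .
 have cS: "cut S g" using cut_subset[OF cutg S(1)] .
 have gS: "g S" using cut_down[OF cutg S(1) order_refl] S(2) gE by simp
 have shift: "\<exists>f. pot S K f"
  if i: "\<And>X. X <= S \<Longrightarrow> s+:t+:K <= X \<Longrightarrow> Suc (r X) = r E \<Longrightarrow> \<not> g X \<Longrightarrow> fs X - ft X = c"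
  and ii: "\<And>P. transv P \<Longrightarrow> \<not> g (s+:P) \<Longrightarrow> \<not> g (t+:P) \<Longrightarrow> fs (s+:P) + a (s+:P) (t+:P) - ft (t+:P) = c" for c
 proof (rule glue_pot[OF fs pot_shift[OF ft, of c]])
  show "fs X = ft X + c" if "X <= S" "s+:t+:K <= X" "Suc (r X) = r E" "\<not> g X" for X
   using i[OF that] by (simp add: algebra_simps diff_eq_eq)
  show "ft (t+:P) + c = fs (s+:P) + a (s+:P) (t+:P)"
   if "transv P" "\<not> g (s+:P)" "\<not> g (t+:P)" for P using ii[OF that] by (simp add: algebra_simps diff_eq_eq)
 qed
 consider "g (s+:K) \<or> g (t+:K)" | "\<not> g (s+:K)" "\<not> g (t+:K)" "g (s+:t+:K)"
  | "\<not> g (s+:t+:K)" by blast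
 thus ?thesis
 proof cases
  case 1
  show ?thesis
  proof (rule glue_pot[OF fs ft])
   show "fs X = ft X" if "X <= S" "s+:t+:K <= X" "\<not> g X" for X using 1 gmS[of "s+:K" X] gmS[of "t+:K" X] that by blast
   show "ft (t+:P) = fs (s+:P) + a (s+:P) (t+:P)"
    if "transv P" "\<not> g (s+:P)" "\<not> g (t+:P)" for P
    using 1 gmS[of "s+:K" "s+:P"] gmS[of "t+:K" "t+:P"] that transv_r[OF that(1)] by blast
  qed
 next
  case 2
  have gX: "g X" if "X <= S" "u+:K <= X" "w : C X" "(u = s \<and> w = t) \<or> (u = t \<and> w = s)" for X u w
  proof -
   have X: "w+:X <= S" using that st by auto
   have "s+:t+:K <= w+:X" using that by blast
   hence "g (w+:X)" using gmS X 2(3) by blast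
   thus ?thesis using cut_down[OF cS subset_insertI X] r_in[OF that(3)] by simp
  qed
  define D where "D = {P. transv P \<and> \<not> g (s+:P) \<and> \<not> g (t+:P)}"
  \<comment> \<open>No hyperplane through both \<open>s\<close> and \<open>t\<close> is off the cut
    here, so only this discrepancy at transversals has to be constant.\<close>
  define de where "de P = fs (s+:P) + a (s+:P) (t+:P) - ft (t+:P)" for P
  have "de P = de P'" if P: "P : D" and P': "P' : D" for P P'
  proof (cases "g Z")
   case False
   have p: "transv P" "\<not> g (s+:P)" "\<not> g (t+:P)" "transv P'" "\<not> g (s+:P')" "\<not> g (t+:P')" using P P' D_def by auto
   have s_const: "fs (s+:P) + a (s+:P) Z = fs (s+:P') + a (s+:P') Z"
   proof (rule connect_s[where q = g and h = "\<lambda>X. fs X + a X Z"])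
    show "fs X + a X Z = fs Y + a Y Z" if "C X = C Y" for X Y using pot_inv[OF fs that] a_inv[OF that refl] by simp
    show "g X" if "X <= S" "s+:K <= X" "t : C X" for X using gX[OF that] by simp
    show "fs (s+:x+:J) + a (s+:x+:J) Z = fs (s+:y+:J) + a (s+:y+:J) Z"
     if "plane J x y" "\<not> g (s+:x+:J)" "\<not> g (s+:y+:J)" for J x y by (rule plane_Z[OF that(1) fs _ that(2,3) False]) simp
   qed (use cS gS p in simp_all)
   interpret sw: series_pair r E g a S K t s by (rule swap)
   have swZ: "sw.Z = Z" unfolding sw.Z_def Z_def by auto
   have swt: "sw.transv Q = transv Q" for Q unfolding sw.transv_def transv_def swZ by (simp add: insert_commute)
   have swp: "sw.plane J x y = plane J x y" for J x y unfolding sw.plane_def plane_def swZ swt ..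
   have t_const: "ft (t+:P) + a (t+:P) Z = ft (t+:P') + a (t+:P') Z"
   proof (rule sw.connect_s[where q = g and h = "\<lambda>X. ft X + a X Z"])
    show "ft X + a X Z = ft Y + a Y Z" if "C X = C Y" for X Y using pot_inv[OF ft that] a_inv[OF that refl] by simp
    show "g X" if "X <= S" "t+:K <= X" "s : C X" for X using gX[OF that] by simp
    show "ft (t+:x+:J) + a (t+:x+:J) Z = ft (t+:y+:J) + a (t+:y+:J) Z"
     if "sw.plane J x y" "\<not> g (t+:x+:J)" "\<not> g (t+:y+:J)" for J x y
     by (rule plane_Z[OF that(1)[unfolded swp] ft _ that(2,3) False]) simp
   qed (use cS gS p swt in simp_all)
   \<comment> \<open>With \<open>Z\<close> off the cut, the discrepancy is the difference of the
     predictions at \<open>Z\<close>, each of which is constant.\<close>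
   have de_Z: "de Q = (fs (s+:Q) + a (s+:Q) Z) - (ft (t+:Q) + a (t+:Q) Z)"
    if q: "transv Q" "\<not> g (s+:Q)" "\<not> g (t+:Q)" for Q
   proof -
    obtain z where z: "z : Z" "z ~: C Q" using exists_off_transv[OF q(1)] by blast
    have zQ: "z+:Q <= Z" using z transv_r(7)[OF q(1)] by blast
    have c: "C (z+:Q) = C Z" by (rule C_Z[OF zQ]) (use r_notin[OF z(2)] transv_r(11)[OF q(1)] in simp)
    have ng: "\<not> g (z+:Q)" using g_cong[OF EE EE c] Z(1) zQ False by blast
    have "a (s+:Q) (t+:Q) + a (t+:Q) (z+:Q) = a (s+:Q) (z+:Q)"
    proof (rule a_line)
     show "Q <= E" "r Q + 2 = r E" using transv_r(10,11)[OF q(1)] EE by blast+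
     show "s : E" "t : E" "z : E" using st S z Z(1) by auto
     show "s ~: C Q" "t ~: C Q" using sP_notin transv_r(7)[OF q(1)] by blast+
    qed (use q ng z in auto)
    hence "a (s+:Q) (t+:Q) + a (t+:Q) Z = a (s+:Q) Z" using a_inv[OF refl c] by simp
    thus ?thesis unfolding de_def by (simp add: algebra_simps)
   qed
   show ?thesis using de_Z p s_const t_const by simp
  next
   case True
   \<comment> \<open>With \<open>Z\<close> in the cut, \<open>t+:Q\<close> and \<open>Z\<close>
     would force \<open>Q\<close> into it. So a path of hyperplanes through \<open>s\<close> can be
     followed by one through \<open>t\<close>, square by square.\<close>
   have off: "\<not> g (t+:Q)" if q: "transv Q" "\<not> g (s+:Q)" for Q
   proof
    assume h: "g (t+:Q)"
    note tq = transv_r[OF q(1)]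
    have "t+:Q Un Z = t+:Z" using tq(7) by blast
    moreover have "r (t+:Z) = r E" using r_s(2)[of Z] Z(5) by simp
    ultimately have "g Q" by (intro cut_meet[OF cS tq(6) Z(1) h True _ tq(7)]) (use r_s(2)[OF tq(7)] tq(11) Z(5) in auto)
    thus False using gmS[of Q "s+:Q"] tq(5) q(2) by blast
   qed
   define h where "h X = fs X + a X (t+:(C X Int Z)) - ft (t+:(C X Int Z))" for X
   have hP: "h (s+:Q) = de Q" if "transv Q" for Q
    unfolding h_def de_def using pot_inv[OF ft trace[OF that]] a_inv[OF refl trace[OF that]] by simp
   have "h (s+:P) = h (s+:P')"
   proof (rule connect_s[where q = g])
    show "h X = h Y" if "C X = C Y" for X Y unfolding h_def using pot_inv[OF fs that] a_inv[OF that refl] that by simp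
    show "g X" if "X <= S" "s+:K <= X" "t : C X" for X using gX[OF that] by simp
    show "h (s+:x+:J) = h (s+:y+:J)"
     if p: "plane J x y" and n: "\<not> g (s+:x+:J)" "\<not> g (s+:y+:J)" for J x y
    proof -
     have tv: "transv (x+:J)" "transv (y+:J)" "x : Z" "y : Z" using p unfolding plane_def by blast+
     have nt: "\<not> g (t+:x+:J)" "\<not> g (t+:y+:J)" using off tv n by blast+
     have ne: "x \<noteq> s" "y \<noteq> s" "x \<noteq> t" "y \<noteq> t" using tv Z(2,3) by blast+
     have 1: "fs (s+:y+:J) = fs (s+:x+:J) + a (s+:x+:J) (s+:y+:J)" by (rule plane_edge[OF p fs]) (use n ne in simp_all)
     have 2: "ft (t+:y+:J) = ft (t+:x+:J) + a (t+:x+:J) (t+:y+:J)" by (rule plane_edge[OF p ft]) (use nt ne in simp_all)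
     have "a (s+:x+:J) (s+:y+:J) + a (s+:y+:J) (t+:y+:J)
      = a (s+:x+:J) (t+:x+:J) + a (t+:x+:J) (t+:y+:J)"
      using square_plane[OF p n nt] unfolding a_anti[of "t+:y+:J" "t+:x+:J"] a_anti[of "t+:x+:J" "s+:x+:J"]
      by (simp add: algebra_simps)
     thus ?thesis unfolding hP[OF tv(1)] hP[OF tv(2)] de_def 1 2 by (simp add: algebra_simps)
    qed
   qed (use cS gS P P' D_def in auto)
   thus ?thesis using hP P P' D_def by simp
  qed
  then obtain c where c: "\<And>P. P : D \<Longrightarrow> de P = c" by metis
  show ?thesis
  proof (rule shift[of c])
   show "fs X - ft X = c" if "X <= S" "s+:t+:K <= X" "\<not> g X" for X using gmS[OF that(2,1) 2(3)] that by blast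
   show "fs (s+:P) + a (s+:P) (t+:P) - ft (t+:P) = c" if "transv P" "\<not> g (s+:P)" "\<not> g (t+:P)" for P
    using c[of P] that unfolding D_def de_def by blast
  qed
 next
  case 3
  have stS: "s+:t+:K <= S" using K st by auto
  have "r (s+:t+:K) < r S" using r_stK K(3) S by simp
  from exists_off_hyperplane[OF fS cS stS this 3] obtain X0 where
   X0: "s+:t+:K <= X0" "X0 <= S" "Suc (r X0) = r E" "\<not> g X0" using S by auto
  show ?thesis
  proof (cases "\<exists>P. transv P \<and> \<not> g (s+:P) \<and> \<not> g (t+:P)")
   case False
   hence noD: "g (s+:P) \<or> g (t+:P)" if "transv P" for P using that by blast
   show ?thesis
   proof (rule shift[of "fs X0 - ft X0"])
    show "fs X - ft X = fs X0 - ft X0" if "X <= S" "s+:t+:K <= X" "Suc (r X) = r E" "\<not> g X" for X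
     by (rule no_transversal_case[OF fs ft noD that(1,3,4,2) X0(2,3,4,1)])
    show "fs (s+:P) + a (s+:P) (t+:P) - ft (t+:P) = fs X0 - ft X0"
     if "transv P" "\<not> g (s+:P)" "\<not> g (t+:P)" for P using noD that by blast
   qed
  next
   case True
   then obtain P0 where P0: "transv P0" "\<not> g (s+:P0)" "\<not> g (t+:P0)" by blast
   \<comment> \<open>An unblocked transversal links all classes of hyperplanes through
     \<open>s\<close> and \<open>t\<close>, since it is reached from any off
     \<open>X\<close>.\<close>
   have dP: "fs (s+:P) + a (s+:P) (t+:P) - ft (t+:P) = fs X - ft X"
    if P: "transv P" "\<not> g (s+:P)" "\<not> g (t+:P)" and X: "X <= S" "s+:t+:K <= X" "Suc (r X) = r E" "\<not> g X" for P X
   proof -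
    define Q where "Q = Z Int C P"
    have Q: "transv Q" "Z Int C Q <= Q" unfolding Q_def by (rule flat_transv[OF P(1)])+
    have cu: "C (u+:Q) = C (u+:P)" for u unfolding Q_def by (rule flat_transv(4)[OF P(1)])
    have nQ: "\<not> g (s+:Q)" "\<not> g (t+:Q)"
     using g_cong[OF EE EE cu] transv_r(5,6)[OF Q(1)] transv_r(5,6)[OF P(1)] P(2,3) by blast+
    have XC: "s+:t+:K <= C X" using X(2) subset_C by blast
    have unS: "s+:t+:K Un S = S" using stS by blast
    obtain C1 J z where c: "s+:t+:K <= C1" "C1 <= S" "C1 <= C X" "conn S C1"
     and J: "Q Int C1 <= J" "J <= Q" "r J + 3 = r E" "\<not> g (s+:t+:J)" "C1 <= C (s+:t+:J)"
     and z: "z : Z" "z ~: C (s+:t+:J)" "z ~: C Q"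
     using local_component[OF X(1,3,4) order_refl stS unS _ XC Q] by (auto simp: add.commute)
    have KJ: "K <= J" using J(1) c(1) transv_r(8)[OF Q(1)] by blast
    have stJ: "s+:t+:J <= S" "Suc (r (s+:t+:J)) = r E" using J(2,3) transv_r(10)[OF Q(1)] st r_st[OF Q(1) J(2)] by auto
    have "fs X - ft X = fs (s+:t+:J) - ft (s+:t+:J)" by (rule d_const[OF fs ft c(4,1,2) X(1,3,4) c(3) stJ J(4,5)])
    also have "\<dots> = fs (s+:Q) + a (s+:Q) (t+:Q) - ft (t+:Q)" by (rule delta_eq[OF fs ft Q(1) nQ KJ J(2,3,4) z, symmetric])
    also have "\<dots> = fs (s+:P) + a (s+:P) (t+:P) - ft (t+:P)" using pot_inv[OF fs cu] pot_inv[OF ft cu] a_inv[OF cu cu] by simp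
    finally show ?thesis by simp
   qed
   show ?thesis
   proof (rule shift[of "fs X0 - ft X0"])
    show "fs X - ft X = fs X0 - ft X0" if "X <= S" "s+:t+:K <= X" "Suc (r X) = r E" "\<not> g X" for X
     using dP[OF P0 that] dP[OF P0 X0(2,1,3,4)] by simp
    show "fs (s+:P) + a (s+:P) (t+:P) - ft (t+:P) = fs X0 - ft X0"
     if "transv P" "\<not> g (s+:P)" "\<not> g (t+:P)" for P by (rule dP[OF that X0(2,1,3,4)])
   qed
  qed
 qed
qed

end

section \<open>Existence of potentials\<close>

context tutte_cochain begin

text \<open>The induction is on \<open>card (S - K)\<close>, which decreases both when
  \<open>S\<close> shrinks and when \<open>K\<close> grows.\<close>

theorem pot_conn:
 assumes "S <= E" "r S = r E" "K <= S" "conn S K"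
 shows "\<exists>f. pot S K f" using assms
proof (induction "card (S - K)" arbitrary: S K rule: less_induct)
 case less
 note hyp = less.prems
 have fS: "finite S" using hyp(1) finE finite_subset by blast
 have smaller: "card (S - K') < card (S - K)" if "K <= K'" "K' <= S" "K' \<noteq> K" for K'
  by (rule psubset_card_mono) (use fS that hyp(3) in auto)
 have IH: "\<exists>f. pot S K' f" if "K <= K'" "K' <= S" "K' \<noteq> K" "conn S K'" for K'
  by (rule less.hyps[OF smaller[OF that(1-3)] hyp(1,2) that(2,4)])
 show ?case
 proof (cases "r K + 4 \<le> r S")
  case False
  show ?thesis
  proof (cases "r S \<le> r K + 2")
   case True thus ?thesis by (rule pot_le2[OF hyp(1-3)])
  next
   case F: False
   hence "r K + 3 = r S" using False by linarith
   thus ?thesis by (rule pot_corank3[OF hyp(1-3) _ hyp(4)])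
  qed
 next
  case True
  show ?thesis
  proof (cases "\<exists>e\<in>S - K. r (S - {e}) = r S \<and> conn (S - {e}) K")
   case del: True
   then obtain e where e: "e : S" "e ~: K" "r (S - {e}) = r S" "conn (S - {e}) K" by blast
   have "card (S - {e} - K) < card (S - K)" by (rule psubset_card_mono) (use fS e in auto)
   hence IH1: "\<exists>f. pot (S - {e}) K f" by (rule less.hyps) (use hyp e in auto)
   show ?thesis
   proof (rule pot_delete[OF hyp(1-3) True hyp(4) e IH1])
    fix K' assume h: "K <= K'" "K' <= S" "r K < r K'" "conn S K'"
    thus "\<exists>f. pot S K' f" by (intro IH) auto
   qed
  next
   case False
   have "r K + 2 \<le> r S" using True by linarith
   from exists_series_pair[OF fS hyp(3,4) this] False obtain s t where
    st: "s : S" "t : S" "s ~: K" "t ~: K" "s \<noteq> t" "r (S - {s}) = r S" "r (S - {t}) = r S" "Suc (r (S - {s,t})) = r S" by blast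
   interpret series_pair r E g a S K s t by unfold_locales (use hyp True st in auto)
   interpret sw: series_pair r E g a S K t s by (rule swap)
   obtain fs where fs: "pot S (s+:K) fs" using IH[of "s+:K"] conn_s hyp(3) st by blast
   obtain ft where ft: "pot S (t+:K) ft" using IH[of "t+:K"] sw.conn_s hyp(3) st by blast
   show ?thesis by (rule pot_series[OF fs ft])
  qed
 qed
qed

text \<open>An indecomposable corank 2 set over a separated \<open>K\<close> spans one of the two
  sides, and no hyperplane spans both, so the potentials over the sides do not interact.\<close>

theorem exists_pot:
 assumes "S <= E" "r S = r E" "K <= S"
 shows "\<exists>f. pot S K f" using assms(3)
proof (induction "r S - r K" arbitrary: K rule: less_induct)
 case less
 note K = less.prems
 show ?case
 proof (cases "conn S K")
  case True thus ?thesis using pot_conn assms K by blast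
 next
  case False
  then obtain A B where AB: "K <= A" "K <= B" "A Un B = S" "r A + r B = r S + r K" "r A \<noteq> r K" "r B \<noteq> r K"
   unfolding conn_def by blast
  have fS: "finite S" using assms finE finite_subset by blast
  have lt: "r K < r A" "r K < r B" using mono[OF AB(1)] mono[OF AB(2)] AB(5,6) by linarith+
  have le: "r A \<le> r S" "r B \<le> r S" using AB(3) by (auto intro!: mono)
  obtain fA where fA: "pot S A fA" using less.hyps[of A] AB(3) lt le by force
  obtain fB where fB: "pot S B fB" using less.hyps[of B] AB(3) lt le by force
  have AS: "A <= S" "B <= S" using AB(3) by auto
  define f where "f X = (if A <= C X then fA X else fB X)" for X
  have "pot S K f"
  proof (rule potI)
   show "f X = f Y" if "C X = C Y" for X Y unfolding f_def that using pot_inv[OF fA that] pot_inv[OF fB that] by simp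
   fix L x y assume h: "K <= L" "L <= S" "r L + 2 = r S" "tri S L" "x : S" "y : S" "x ~: C L" "y ~: C L"
    "\<not> g (x+:L)" "\<not> g (y+:L)"
   have cL: "conn S L" by (rule tri_conn[OF h(3,4)])
   have fL: "finite L" "finite A" "finite B" using h(2) AS fS finite_subset by blast+
   show "f (y+:L) = f (x+:L) + a (x+:L) (y+:L)"
   proof -
    define L1 where "L1 = S Int C L"
    have f1: "finite L1" "L <= L1" "L1 <= C L" using fS h(2) subset_C[of L] L1_def by auto
    have rL1: "r L1 = r L" by (rule r_between_C[OF f1])
    have cL1: "C L1 = C L" by (rule C_between[OF f1])
    have 1: "r L1 + r K \<le> r (L1 Int A) + r (L1 Int B)" by (rule cover_ge) (use AB h(1) f1(2) L1_def in blast)+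
    have 2: "r (L1 Un A) + r (L1 Int A) \<le> r L1 + r A" "r (L1 Un B) + r (L1 Int B) \<le> r L1 + r B" using submod by auto
    have un: "(L1 Un A) Un (L1 Un B) = S" using AB(3) L1_def by blast
    have k: "L <= L1 Un A" "L <= L1 Un B" using f1 by auto
    have "r (L1 Un A) = r L \<or> r (L1 Un B) = r L" by (rule connD[OF cL k un]) (use 1 2 AB(4) rL1 in linarith)
    hence "A <= C L \<or> B <= C L"
    proof
     assume "r (L1 Un A) = r L"
     hence "C (L1 Un A) = C L" by (intro C_eqI k)
     thus ?thesis using subset_C[of "L1 Un A"] by blast
    next
     assume "r (L1 Un B) = r L"
     hence "C (L1 Un B) = C L" by (intro C_eqI k)
     thus ?thesis using subset_C[of "L1 Un B"] by blast
    qed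
    moreover have mm: "C L <= C (x+:L)" "C L <= C (y+:L)" by (auto intro!: C_mono)
    moreover have notboth: "\<not> (A <= C X \<and> B <= C X)" if "X <= S" "r X < r S" for X
    proof
     assume "A <= C X \<and> B <= C X"
     hence "S <= C X" using AB(3) by blast
     hence "r S \<le> r X" using r_le_C fS by blast
     thus False using that by simp
    qed
    have lt2: "r (v+:L) < r S" "v+:L <= S" if "v : S" for v using unit[of v L] h(2,3) that by auto
    show ?thesis
    proof (cases "A <= C L")
     case True
     have "fA (y+:L) = fA (x+:L) + a (x+:L) (y+:L)" by (rule pot_edge[OF fA assms(1) AS(1) True h(2-10)])
     moreover have "A <= C (x+:L)" "A <= C (y+:L)" using True mm by blast+
     ultimately show ?thesis unfolding f_def by simp
    next
     case False
     hence BL: "B <= C L" using calculation by blast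
     have "fB (y+:L) = fB (x+:L) + a (x+:L) (y+:L)" by (rule pot_edge[OF fB assms(1) AS(2) BL h(2-10)])
     moreover have "\<not> A <= C (x+:L)" "\<not> A <= C (y+:L)" using notboth[OF lt2(2,1)] h(5,6) BL mm by blast+
     ultimately show ?thesis unfolding f_def by simp
    qed
   qed
  qed
  thus ?thesis by blast
 qed
qed

end

section \<open>Upper sublattices of a matroid\<close>

locale mat =
 fixes M :: "'a matroid"
 assumes M: "matroid M"
begin

abbreviation E where "E \<equiv> ground M"

lemma fin_ground: "finite E" using M by (simp add: matroid_def)

lemma indep_sub: "I : indep M \<Longrightarrow> I <= E" using M by (auto simp: matroid_def)

lemma indep_fin: "I : indep M \<Longrightarrow> finite I" using indep_sub fin_ground finite_subset by blast

lemma indep_down: "I : indep M \<Longrightarrow> J <= I \<Longrightarrow> J : indep M" using M by (auto simp: matroid_def)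

lemma indep_empty: "{} : indep M" using M by (simp add: matroid_def)

lemma augment: "I : indep M \<Longrightarrow> J : indep M \<Longrightarrow> card I < card J \<Longrightarrow> \<exists>x\<in>J - I. x+:I : indep M" using M by (simp add: matroid_def)

lemma fin_indep: "finite {I : indep M. I <= S}" by (rule finite_subset[of _ "Pow E"]) (use indep_sub fin_ground in auto)

lemma card_le_rk: "I : indep M \<Longrightarrow> I <= S \<Longrightarrow> card I \<le> rk M S" unfolding rk_def using fin_indep[of S] by (intro Max_ge) auto

lemma ex_basis: "\<exists>B\<in>indep M. B <= S \<and> card B = rk M S"
proof -
 have "card ` {I : indep M. I <= S} \<noteq> {}" using indep_empty by blast
 from Max_in[OF finite_imageI[OF fin_indep] this] have "rk M S : card ` {I : indep M. I <= S}" by (simp only: rk_def)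
 then obtain B where "B : {I : indep M. I <= S}" "rk M S = card B" by (rule imageE)
 thus ?thesis by (intro bexI[of _ B]) simp_all
qed

lemma extend_basis:
 assumes I: "I : indep M" "I <= S"
 shows "\<exists>B\<in>indep M. I <= B \<and> B <= S \<and> card B = rk M S"
proof -
 let ?P = "\<lambda>B. B : indep M \<and> I <= B \<and> B <= S"
 have "\<exists>B. ?P B \<and> (\<forall>B'. ?P B' \<longrightarrow> card B' \<le> card B)"
 proof (rule ex_has_greatest_nat[of ?P I card "Suc (rk M S)"])
  show "?P I" using I by blast
  show "\<forall>B. ?P B \<longrightarrow> card B < Suc (rk M S)" using card_le_rk less_Suc_eq_le by blast
 qed
 then obtain B where B: "?P B" and max: "\<And>B'. ?P B' \<Longrightarrow> card B' \<le> card B" by blast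
 obtain J where J: "J : indep M" "J <= S" "card J = rk M S" using ex_basis by blast
 have "\<not> card B < card J"
 proof
  assume "card B < card J"
  then obtain x where x: "x : J - B" "x+:B : indep M" using augment[of B J] B J by blast
  hence "card (x+:B) \<le> card B" by (intro max) (use B J in blast)
  moreover have "finite B" using indep_fin B by blast
  ultimately show False using x(1) by simp
 qed
 moreover have "card B \<le> rk M S" using B card_le_rk by blast
 ultimately have "card B = rk M S" using J(3) by linarith
 thus ?thesis using B by blast
qed

lemma rk_le_card: "finite X \<Longrightarrow> rk M X \<le> card X"
proof -
 assume "finite X"
 obtain B where "B <= X" "card B = rk M X" using ex_basis by blast
 thus ?thesis using card_mono[OF \<open>finite X\<close>, of B] by simp
qed

lemma rk_indep: "I : indep M \<Longrightarrow> rk M I = card I" using rk_le_card[OF indep_fin, of I] card_le_rk[of I I] by simp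

lemma rk_mono: "X <= Y \<Longrightarrow> rk M X \<le> rk M Y"
proof -
 assume XY: "X <= Y"
 obtain B where B: "B : indep M" "B <= X" "card B = rk M X" using ex_basis by blast
 show ?thesis using card_le_rk[OF B(1) order_trans[OF B(2) XY]] B(3) by simp
qed

sublocale rank_fun "rk M"
proof
 show "X <= Y \<Longrightarrow> rk M X \<le> rk M Y" for X Y by (rule rk_mono)
 show "rk M (x+:X) \<le> Suc (rk M X)" for x X
 proof -
  obtain B where B: "B : indep M" "B <= x+:X" "card B = rk M (x+:X)" using ex_basis by blast
  have "B - {x} : indep M" using indep_down[OF B(1)] by blast
  hence "card (B - {x}) \<le> rk M X" using B(2) by (intro card_le_rk) auto
  thus ?thesis using B(3) card_Diff_singleton_if[of B x] by (auto split: if_splits)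
 qed
 show "rk M (X Un Y) + rk M (X Int Y) \<le> rk M X + rk M Y" for X Y
 proof -
  obtain B where B: "B : indep M" "B <= X Int Y" "card B = rk M (X Int Y)" using ex_basis by blast
  obtain D where D: "D : indep M" "B <= D" "D <= X Un Y" "card D = rk M (X Un Y)"
   using extend_basis[OF B(1), of "X Un Y"] B(2) by blast
  have fin: "finite D" using D indep_fin by blast
  have "card (D Int X) + card (D Int Y) = card (D Int X Un D Int Y) + card ((D Int X) Int (D Int Y))" using fin by (intro card_Un_Int) auto
  moreover have "D Int X Un D Int Y = D" using D by blast
  moreover have "card B \<le> card ((D Int X) Int (D Int Y))" using B D fin by (intro card_mono) auto
  moreover have "card (D Int X) \<le> rk M X" "card (D Int Y) \<le> rk M Y" using indep_down[OF D(1)] by (intro card_le_rk; blast)+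
  ultimately show ?thesis using B D by simp
 qed
qed

lemma cl_C: "cl M S = C S Int E" by (auto simp: cl_def C_def)

lemma rk_Int: "rk M (X Int E) = rk M X"
proof -
 have "{I : indep M. I <= X Int E} = {I : indep M. I <= X}" using indep_sub by blast
 thus ?thesis by (simp add: rk_def)
qed

text \<open>Independent sets lie in the ground set, so everything else behaves as a loop.\<close>

lemma C_outside: "x ~: E \<Longrightarrow> x : C S" using rk_Int[of "x+:S"] rk_Int[of S] by (simp add: C_def)

lemma cl_eq_iff: "cl M X = cl M Y \<longleftrightarrow> C X = C Y" using C_outside by (auto simp: cl_C)

lemma cl_sub: "cl M S <= E" by (auto simp: cl_def)

lemma fin_sub: "S <= E \<Longrightarrow> finite S" using fin_ground finite_subset by blast

lemma fin_cl: "finite (cl M S)" using fin_sub[OF cl_sub] .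

lemma sub_cl: "S <= E \<Longrightarrow> S <= cl M S" using subset_C by (auto simp: cl_C)

lemma cl_mono: "X <= Y \<Longrightarrow> cl M X <= cl M Y" using C_mono[of X Y] by (auto simp: cl_C)

lemma rk_cl: assumes "S <= E" shows "rk M (cl M S) = rk M S"
 by (rule r_between_C[OF fin_cl sub_cl[OF assms]]) (simp add: cl_C)

lemma C_cl: assumes "S <= E" shows "C (cl M S) = C S" by (rule C_between[OF fin_cl sub_cl[OF assms]]) (simp add: cl_C)

lemma cl_cl: "S <= E \<Longrightarrow> cl M (cl M S) = cl M S" by (simp add: cl_eq_iff C_cl)

lemma cl_flat: "S <= E \<Longrightarrow> cl M S : flats M" by (simp add: flats_def cl_sub cl_cl)

lemma flatD: "F : flats M \<Longrightarrow> F <= E" "F : flats M \<Longrightarrow> cl M F = F" by (auto simp: flats_def)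

lemma cl_least: "S <= F \<Longrightarrow> F : flats M \<Longrightarrow> cl M S <= F" using cl_mono flatD(2) by blast

lemma cl_rank_eq: "X <= Y \<Longrightarrow> rk M Y = rk M X \<Longrightarrow> cl M Y = cl M X" unfolding cl_eq_iff by (rule C_eqI)

lemma flat_eqI: assumes "F : flats M" "G : flats M" "F <= G" "rk M G \<le> rk M F" shows "F = G"
 using cl_rank_eq[OF assms(3)] rk_mono[OF assms(3)] assms(4) flatD(2) assms(1,2) by fastforce

lemma flat_psubset: "F : flats M \<Longrightarrow> G : flats M \<Longrightarrow> F \<subset> G \<Longrightarrow> rk M F < rk M G" using flat_eqI[of F G] by force

lemma ground_flat: "E : flats M" using sub_cl[of E] cl_sub[of E] by (auto simp: flats_def)

lemma flat_Int: assumes "F : flats M" "G : flats M" shows "F Int G : flats M"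
proof -
 have "cl M (F Int G) <= F Int G" using cl_least[of "F Int G"] assms by blast
 thus ?thesis using sub_cl[of "F Int G"] flatD(1)[OF assms(1)] unfolding flats_def by blast
qed

lemma cl_Un_cl: "X <= E \<Longrightarrow> Y <= E \<Longrightarrow> cl M (cl M X Un Y) = cl M (X Un Y)"
 unfolding cl_eq_iff by (rule C_Un_cong) (simp_all add: fin_cl fin_sub C_cl)

lemma cl_ground_iff: assumes "S <= E" shows "cl M S = E \<longleftrightarrow> rk M S = rk M E"
proof
 show "cl M S = E \<Longrightarrow> rk M S = rk M E" using rk_cl[OF assms] by simp
 show "rk M S = rk M E \<Longrightarrow> cl M S = E" using cl_rank_eq[OF assms] flatD(2)[OF ground_flat] by simp
qed

lemma basis_of: assumes "J <= E" shows "\<exists>I\<in>indep M. I <= J \<and> card I = rk M J \<and> C I = C J"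
 using ex_basis[of J] C_eqI rk_indep by metis

text \<open>In place of the omitted set \<open>J\<close>, its complement \<open>U\<close> is carried
  along.\<close>

definition usub :: "'a set \<Rightarrow> 'a set \<Rightarrow> 'a set set" where
 "usub I U = {cl M S |S. I <= S \<and> S <= U}"

definition ups :: "'a set \<Rightarrow> 'a set \<Rightarrow> bool" where
 "ups I U \<longleftrightarrow> I : indep M \<and> I <= U \<and> U <= E \<and> cl M U = E"

lemma upper_sublattice_iff: "upper_sublattice M L \<longleftrightarrow> (\<exists>I U. ups I U \<and> L = usub I U)"
proof
 assume "upper_sublattice M L"
 then obtain I J where IJ: "I <= E" "J <= E" "I Int J = {}" "I : indep M" "spanning M (E - J)"
  "L = {cl M S |S. I <= S \<and> S <= E - J}" unfolding upper_sublattice_def by blast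
 hence "ups I (E - J)" "L = usub I (E - J)" unfolding ups_def usub_def spanning_def by blast+
 thus "\<exists>I U. ups I U \<and> L = usub I U" by blast
next
 assume "\<exists>I U. ups I U \<and> L = usub I U"
 then obtain I U where IU: "ups I U" "L = usub I U" by blast
 hence "E - (E - U) = U" unfolding ups_def by blast
 thus "upper_sublattice M L" unfolding upper_sublattice_def
  by (intro exI[of _ I] exI[of _ "E - U"]) (use IU in \<open>auto simp: ups_def usub_def spanning_def\<close>)
qed

lemma flats_usub: "flats M = usub {} E" "ups {} E"
 using cl_flat flatD indep_empty ground_flat unfolding usub_def ups_def by blast+

context
 fixes I U assumes IU: "ups I U"
begin

lemma I_indep: "I : indep M" and I_sub: "I <= U" and U_sub: "U <= E" and cl_U: "cl M U = E" using IU by (auto simp: ups_def)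

lemma I_E: "I <= E" using I_sub U_sub by blast

lemma usub_iff: "F : usub I U \<longleftrightarrow> F : flats M \<and> I <= F \<and> cl M (F Int U) = F"
proof
 assume "F : usub I U"
 then obtain S where S: "F = cl M S" "I <= S" "S <= U" by (auto simp: usub_def)
 hence sE: "S <= E" using U_sub by blast
 hence F: "F : flats M" "S <= F Int U" using cl_flat sub_cl S by auto
 hence "cl M (F Int U) = F" using cl_mono[OF F(2)] cl_least[of "F Int U" F] S(1) by blast
 thus "F : flats M \<and> I <= F \<and> cl M (F Int U) = F" using F S by blast
next
 assume "F : flats M \<and> I <= F \<and> cl M (F Int U) = F"
 thus "F : usub I U" unfolding usub_def using I_sub by blast
qed

lemma usubI: "I <= S \<Longrightarrow> S <= U \<Longrightarrow> cl M S : usub I U" by (auto simp: usub_def)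

lemma usub_flat: "F : usub I U \<Longrightarrow> F : flats M" by (simp add: usub_iff)

lemma fin_usub: "finite (usub I U)" by (rule finite_subset[of _ "Pow E"]) (use usub_flat flatD fin_ground in auto)

lemma card_I_le: "F : usub I U \<Longrightarrow> card I \<le> rk M F" using card_le_rk I_indep usub_iff by blast

lemma usub_top: "E : usub I U" using usubI[of U] I_sub cl_U by simp

lemma usub_bot: "cl M I : usub I U" using usubI[of I] I_sub by simp

lemma Union_usub: "\<Union>(usub I U) = E" using usub_top usub_flat flatD(1) by blast

lemma Inter_usub: "\<Inter>(usub I U) = cl M I" using usub_bot cl_least[of I] usub_iff by blast

text \<open>A basis of the flat inside \<open>U\<close> that extends \<open>I\<close> is
  truncated.\<close>

lemma usub_below:
 assumes F: "F : usub I U" and n: "card I \<le> n" "n \<le> rk M F"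
 shows "\<exists>G\<in>usub I U. G <= F \<and> rk M G = n"
proof -
 have FU: "I <= F Int U" "F Int U <= E" "cl M (F Int U) = F" using F I_sub U_sub usub_iff by blast+
 hence rFU: "rk M (F Int U) = rk M F" using rk_cl[of "F Int U"] by simp
 obtain B where B: "B : indep M" "I <= B" "B <= F Int U" "card B = rk M F" using extend_basis[OF I_indep FU(1)] rFU by metis
 obtain D where D: "I <= D" "D <= B" "card D = n" using exists_subset_between[of I n B] n B indep_fin by metis
 have "D <= E" using D B FU by blast
 hence "rk M (cl M D) = n" using rk_cl rk_indep[OF indep_down[OF B(1) D(2)]] D(3) by simp
 moreover have "cl M D : usub I U" using usubI D B by blast
 moreover have "cl M D <= F" using cl_least[of D F] D B usub_flat[OF F] by blast
 ultimately show ?thesis by blast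
qed

text \<open>Along a chain the rank in \<open>M\<close> increases strictly from at least
  \<open>card I\<close>, which bounds its length; descending one rank at a time gives a chain that
  attains the bound.\<close>

lemma usub_rank: assumes F: "F : usub I U" shows "lat_rank (usub I U) F = rk M F - card I"
proof -
 let ?L = "usub I U" and ?ch = "Complete_Partial_Order.chain (\<subseteq>)"
 let ?Q = "{C. C <= {G : ?L. G \<subset> F} \<and> ?ch C}"
 have finQ: "finite ?Q" by (rule finite_subset[of _ "Pow ?L"]) (use fin_usub in auto)
 have up: "card Q \<le> rk M F - card I" if "Q : ?Q" for Q
 proof -
  have Q: "\<And>G. G : Q \<Longrightarrow> G : ?L \<and> G \<subset> F" "?ch Q" using that by auto
  have inj: "inj_on (rk M) Q"
  proof (rule inj_onI)
   fix G H assume GH: "G : Q" "H : Q" "rk M G = rk M H"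
   hence "G <= H \<or> H <= G" using Q(2) by (auto simp: Complete_Partial_Order.chain_def)
   thus "G = H" using flat_eqI[of G H] flat_eqI[of H G] GH Q usub_flat by auto
  qed
  have "rk M ` Q <= {card I ..< rk M F}" using Q(1) card_I_le flat_psubset usub_flat F by fastforce
  hence "card (rk M ` Q) \<le> card {card I ..< rk M F}" by (intro card_mono) auto
  thus ?thesis using card_image[OF inj] by simp
 qed
 have low: "\<exists>Q\<in>?Q. card Q = rk M F - card I" using F
 proof (induction "rk M F - card I" arbitrary: F)
  case 0
  thus ?case by (intro bexI[of _ "{}"]) (auto simp: chain_empty)
 next
  case (Suc n)
  have le: "card I \<le> rk M F - 1" "rk M F - 1 \<le> rk M F" using Suc.hyps(2) by linarith+
  obtain G where G: "G : ?L" "G <= F" "rk M G = rk M F - 1" using usub_below[OF Suc.prems le] by blast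
  have "rk M G \<noteq> rk M F" using G(3) Suc.hyps(2) by linarith
  hence "G \<subset> F" using G(2) by blast
  have "n = rk M G - card I" using G(3) Suc.hyps(2) by linarith
  from Suc.hyps(1)[OF this G(1)]
  obtain Q where Q: "Q <= {H : ?L. H \<subset> G}" "?ch Q" "card Q = rk M G - card I" by blast
  have "?ch (G+:Q)" using Q by (auto simp: Complete_Partial_Order.chain_def)
  moreover have "G+:Q <= {H : ?L. H \<subset> F}" using Q G \<open>G \<subset> F\<close> by auto
  moreover have "finite Q" using Q(1) finite_subset[OF _ fin_usub, of Q] by blast
  moreover have "G ~: Q" using Q(1) by blast
  ultimately show ?case using Q(3) G(3) Suc.hyps(2) by (intro bexI[of _ "G+:Q"]) auto
 qed
 show ?thesis unfolding lat_rank_def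
 proof (rule Max_eqI)
  show "finite (card ` ?Q)" using finQ by blast
  show "\<And>y. y : card ` ?Q \<Longrightarrow> y \<le> rk M F - card I" using up by blast
  obtain Q where Q: "Q : ?Q" and card: "card Q = rk M F - card I" using low by blast
  show "rk M F - card I : card ` ?Q" unfolding card[symmetric] by (rule imageI[OF Q])
 qed
qed

lemma usub_corank: "F : usub I U \<Longrightarrow> lat_corank (usub I U) F = rk M E - rk M F"
 unfolding lat_corank_def Union_usub using usub_rank usub_top card_I_le[of F] by simp

lemma usub_Join: assumes "\<A> <= usub I U" shows "lat_Join (usub I U) \<A> = cl M (I Un \<Union>\<A>)"
proof
 let ?S = "I Un (\<Union>\<A> Int U)"
 have A: "A <= cl M ?S" if "A : \<A>" for A
 proof -
  have "cl M (A Int U) = A" using that assms usub_iff[of A] by blast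
  moreover have "cl M (A Int U) <= cl M ?S" by (rule cl_mono) (use that in blast)
  ultimately show ?thesis by simp
 qed
 have S: "?S <= E" "I <= ?S" "?S <= U" using I_sub U_sub by auto
 have "cl M ?S : {C : usub I U. \<Union>\<A> <= C}" using A usubI[OF S(2,3)] by (simp add: Sup_le_iff)
 hence "lat_Join (usub I U) \<A> <= cl M ?S" unfolding lat_Join_def by (rule Inter_lower)
 moreover have "cl M ?S <= cl M (I Un \<Union>\<A>)" by (rule cl_mono) blast
 ultimately show "lat_Join (usub I U) \<A> <= cl M (I Un \<Union>\<A>)" by (rule order_trans)
 show "cl M (I Un \<Union>\<A>) <= lat_Join (usub I U) \<A>" unfolding lat_Join_def
 proof (rule Inter_greatest)
  fix F assume "F : {C : usub I U. \<Union>\<A> <= C}"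
  hence "I Un \<Union>\<A> <= F" "F : flats M" using usub_iff[of F] by simp_all
  thus "cl M (I Un \<Union>\<A>) <= F" by (rule cl_least)
 qed
qed

lemma usub_atoms: "atoms (usub I U) = {A : usub I U. rk M A = Suc (card I)}"
proof -
 have "lat_rank (usub I U) A = 1 \<longleftrightarrow> rk M A = Suc (card I)" if "A : usub I U" for A
  using usub_rank[OF that] card_I_le[OF that] by linarith
 thus ?thesis unfolding atoms_def by blast
qed

lemma usub_hyperplanes: "hyperplanes (usub I U) = {H : usub I U. Suc (rk M H) = rk M E}"
proof -
 have "lat_corank (usub I U) H = 1 \<longleftrightarrow> Suc (rk M H) = rk M E" if "H : usub I U" for H using usub_corank[OF that] by linarith
 thus ?thesis unfolding hyperplanes_def by blast
qed

lemma usub_atom: assumes x: "x : U" "x ~: C I" shows "cl M (x+:I) : atoms (usub I U)"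
proof -
 have "I <= x+:I" "x+:I <= U" using x I_sub by auto
 moreover have "rk M (cl M (x+:I)) = Suc (card I)"
  using rk_cl[of "x+:I"] r_notin[OF x(2)] rk_indep[OF I_indep] I_E U_sub x(1) by auto
 ultimately show ?thesis using usubI by (simp add: usub_atoms)
qed

lemma usub_atomE:
 assumes "A : atoms (usub I U)"
 shows "\<exists>x\<in>U. x ~: C I \<and> A = cl M (x+:I)"
proof -
 have A0: "A : usub I U" "rk M A = Suc (card I)" using assms by (simp_all add: usub_atoms)
 hence A: "A : flats M" "I <= A" "cl M (A Int U) = A" using usub_iff by blast+
 have AU: "A Int U <= E" using U_sub by blast
 have "rk M I < rk M (A Int U)" using rk_cl[OF AU] A(3) A0(2) rk_indep[OF I_indep] by simp
 then obtain x where x: "x : A" "x : U" "x ~: C I" using C_Diff_nonempty[OF fin_sub[OF AU]] by blast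
 have sub: "x+:I <= A" "x+:I <= E" using x A I_E U_sub by blast+
 have "rk M A \<le> rk M (cl M (x+:I))" using rk_cl[OF sub(2)] r_notin[OF x(3)] rk_indep[OF I_indep] A0(2) by simp
 hence "cl M (x+:I) = A" by (rule flat_eqI[OF cl_flat[OF sub(2)] A(1) cl_least[OF sub(1) A(1)]])
 thus ?thesis using x by blast
qed

end

end

section \<open>The matroid of an upper sublattice and indecomposability\<close>

context mat
begin

context
 fixes I U assumes IU: "ups I U"
begin

abbreviation "latU \<equiv> usub I U"

text \<open>A representative element, through which ranks in the matroid on atoms are computed in
  \<open>M\<close>.\<close>

definition atom_pt :: "'a set \<Rightarrow> 'a" where
 "atom_pt A = (SOME x. x : U \<and> x ~: C I \<and> A = cl M (x+:I))"

lemma atom_pt: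
 assumes "A : atoms latU" shows "atom_pt A : U" "atom_pt A ~: C I" "cl M ((atom_pt A)+:I) = A"
proof -
 have "\<exists>x. x : U \<and> x ~: C I \<and> A = cl M (x+:I)" using usub_atomE[OF IU assms] by blast
 from someI_ex[OF this] show "atom_pt A : U" "atom_pt A ~: C I" "cl M ((atom_pt A)+:I) = A" unfolding atom_pt_def by auto
qed

lemma atom_pt_in: "A : atoms latU \<Longrightarrow> atom_pt A : A"
 using atom_pt[of A] sub_cl[of "(atom_pt A)+:I"] I_E[OF IU] U_sub[OF IU] by auto

lemma atoms_sub: "atoms latU <= latU" by (simp add: atoms_def)

lemma atoms_E: assumes "\<S> <= atoms latU" shows "I Un \<Union>\<S> <= E"
proof -
 have "A <= E" if "A : \<S>" for A using flatD(1)[OF usub_flat[OF IU, of A]] that assms atoms_sub by blast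
 thus ?thesis using I_E[OF IU] by blast
qed

lemma atom_pts:
 assumes \<S>: "\<S> <= atoms latU" and X: "I <= X" "X <= E"
 shows "C (X Un \<Union>\<S>) = C (X Un atom_pt ` \<S>)" "rk M (X Un \<Union>\<S>) = rk M (X Un atom_pt ` \<S>)"
proof -
 have sub: "X Un atom_pt ` \<S> <= X Un \<Union>\<S>" using atom_pt_in \<S> by blast
 have "A <= C (X Un atom_pt ` \<S>)" if "A : \<S>" for A
 proof -
  have "C ((atom_pt A)+:I) <= C (X Un atom_pt ` \<S>)" by (rule C_mono) (use X that in blast)
  moreover have "A = C ((atom_pt A)+:I) Int E" using atom_pt(3)[of A] that \<S> cl_C by blast
  ultimately show ?thesis by blast
 qed
 hence sup: "X Un \<Union>\<S> <= C (X Un atom_pt ` \<S>)" using subset_C[of "X Un atom_pt ` \<S>"] by blast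
 have "finite (X Un \<Union>\<S>)" using atoms_E[OF \<S>] X fin_sub[of "X Un \<Union>\<S>"] by blast
 from C_between[OF this sub sup] r_between_C[OF this sub sup]
 show "C (X Un \<Union>\<S>) = C (X Un atom_pt ` \<S>)" "rk M (X Un \<Union>\<S>) = rk M (X Un atom_pt ` \<S>)" by auto
qed

lemma lat_matroid_indep:
 "\<A> : indep (lat_matroid latU) \<longleftrightarrow> \<A> <= atoms latU \<and> rk M (I Un \<Union>\<A>) = card I + card \<A>"
proof (cases "\<A> <= atoms latU")
 case True
 hence 1: "\<A> <= latU" using atoms_sub by blast
 have "C (I Un \<Union>\<A>) = C (I Un atom_pt ` \<A>)" by (rule atom_pts(1)[OF True order_refl I_E[OF IU]])
 moreover have "I Un atom_pt ` \<A> <= U" using I_sub[OF IU] atom_pt(1) True by blast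
 ultimately have "cl M (I Un \<Union>\<A>) : latU"
  using usubI[OF IU, of "I Un atom_pt ` \<A>"] cl_eq_iff[of "I Un \<Union>\<A>" "I Un atom_pt ` \<A>"] by simp
 moreover have "rk M (cl M (I Un \<Union>\<A>)) = rk M (I Un \<Union>\<A>)" using rk_cl[OF atoms_E[OF True]] .
 moreover have "card I \<le> rk M (I Un \<Union>\<A>)" using card_le_rk[OF I_indep[OF IU]] by blast
 ultimately have "lat_rank latU (lat_Join latU \<A>) = rk M (I Un \<Union>\<A>) - card I" "card I \<le> rk M (I Un \<Union>\<A>)"
  by (simp_all add: usub_rank[OF IU] usub_Join[OF IU 1])
 hence "lat_rank latU (lat_Join latU \<A>) = card \<A> \<longleftrightarrow> rk M (I Un \<Union>\<A>) = card I + card \<A>" by linarith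
 thus ?thesis using True by (simp add: lat_matroid_def)
qed (simp add: lat_matroid_def)

text \<open>Via representatives, the matroid on the atoms is a restriction of the contraction of
  \<open>M\<close> by \<open>I\<close>; a basis extending \<open>I\<close> realizes the
  rank.\<close>

lemma lat_matroid_rk:
 assumes \<S>: "\<S> <= atoms latU"
 shows "rk (lat_matroid latU) \<S> = rk M (I Un \<Union>\<S>) - card I"
proof -
 let ?conF = "lat_matroid latU"
 have fin: "finite (atoms latU)" using fin_usub[OF IU] by (simp add: atoms_def)
 have fT: "finite {\<T> : indep ?conF. \<T> <= \<S>}" using \<S> fin by (simp add: finite_subset)
 have up: "card \<T> \<le> rk M (I Un \<Union>\<S>) - card I" if "\<T> : indep ?conF" "\<T> <= \<S>" for \<T>
 proof -
  have "rk M (I Un \<Union>\<T>) \<le> rk M (I Un \<Union>\<S>)" by (rule rk_mono) (use that in blast)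
  thus ?thesis using that(1) unfolding lat_matroid_indep by linarith
 qed
 have ex: "\<exists>\<T>\<in>indep ?conF. \<T> <= \<S> \<and> card \<T> = rk M (I Un \<Union>\<S>) - card I"
 proof -
  obtain B where B: "B : indep M" "I <= B" "B <= I Un atom_pt ` \<S>" "card B = rk M (I Un atom_pt ` \<S>)"
   using extend_basis[OF I_indep[OF IU]] by blast
  define \<T> where "\<T> = {A : \<S>. atom_pt A : B}"
  have T: "\<T> <= \<S>" "\<T> <= atoms latU" using \<S> by (auto simp: \<T>_def)
  have Beq: "B = I Un atom_pt ` \<T>" using B by (auto simp: \<T>_def)
  have "inj_on atom_pt \<T>"
  proof (rule inj_onI)
   fix A B assume "A : \<T>" "B : \<T>" "atom_pt A = atom_pt B"
   thus "A = B" using atom_pt(3)[of A] atom_pt(3)[of B] T by auto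
  qed
  moreover have "I Int atom_pt ` \<T> = {}" using atom_pt(2) T subset_C[of I] by blast
  moreover have "finite B" using indep_fin[OF B(1)] .
  hence "finite I" "finite (atom_pt ` \<T>)" unfolding Beq by simp_all
  ultimately have cB: "card B = card I + card \<T>" unfolding Beq by (simp add: card_Un_disjoint card_image)
  have "rk M (I Un \<Union>\<T>) = card B" using atom_pts(2)[OF T(2) order_refl I_E[OF IU]] rk_indep[OF B(1)] Beq by simp
  hence "\<T> : indep ?conF" using T(2) cB by (simp add: lat_matroid_indep)
  moreover have "card \<T> = rk M (I Un \<Union>\<S>) - card I" using atom_pts(2)[OF \<S> order_refl I_E[OF IU]] B(4) cB by simp
  ultimately show ?thesis using T(1) by blast
 qed
 show ?thesis unfolding rk_def[of ?conF]
 proof (intro Max_eqI)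
  fix y assume "y : card ` {\<T> : indep ?conF. \<T> <= \<S>}"
  thus "y \<le> rk M (I Un \<Union>\<S>) - card I" using up by blast
 next
  obtain \<T> where T: "\<T> : {\<T> : indep ?conF. \<T> <= \<S>}" "card \<T> = rk M (I Un \<Union>\<S>) - card I" using ex by blast
  show "rk M (I Un \<Union>\<S>) - card I : card ` {\<T> : indep ?conF. \<T> <= \<S>}" unfolding T(2)[symmetric] by (rule imageI[OF T(1)])
 qed (rule finite_imageI[OF fT])
qed

context
 fixes F assumes F: "F : latU"
begin

lemma F_props: "F <= E" "I <= F" "F : flats M" "cl M F = F" "C (F Int U) = C F" "rk M (F Int U) = rk M F"
proof -
 have F': "F : flats M" "I <= F" "cl M (F Int U) = F" using F usub_iff[OF IU] by blast+
 thus "F <= E" "I <= F" "F : flats M" "cl M F = F" using flatD by blast+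
 have "F Int U <= E" using U_sub[OF IU] by blast
 thus "C (F Int U) = C F" "rk M (F Int U) = rk M F" using rk_cl[of "F Int U"] C_cl[of "F Int U"] F'(3) by simp_all
qed

abbreviation "belowF \<equiv> {A : atoms latU. A <= F}"
abbreviation "conF \<equiv> contract (lat_matroid latU) belowF"

lemma F_span: "C (I Un \<Union>belowF) = C F" "rk M (I Un \<Union>belowF) = rk M F"
proof -
 have sub: "I Un \<Union>belowF <= F" using F_props by blast
 have "F Int U <= C (I Un \<Union>belowF)"
 proof
  fix x assume x: "x : F Int U"
  show "x : C (I Un \<Union>belowF)"
  proof (cases "x : C I")
   case True
   thus ?thesis using C_mono[of I "I Un \<Union>belowF"] by blast
  next
   case False
   hence "cl M (x+:I) : atoms latU" using usub_atom[OF IU] x by blast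
   moreover have "x+:I <= F" using x F_props(2) by blast
   hence "cl M (x+:I) <= F" "x : cl M (x+:I)" using cl_least[OF _ F_props(3)] sub_cl[of "x+:I"] F_props(1) by blast+
   ultimately show ?thesis using subset_C[of "I Un \<Union>belowF"] by blast
  qed
 qed
 hence "C (F Int U) <= C (I Un \<Union>belowF)" using C_subset_C F_props fin_sub[of "F Int U"] by blast
 hence "F <= C (I Un \<Union>belowF)" using F_props subset_C[of F] by blast
 from C_between[OF fin_sub[OF F_props(1)] sub this] r_between_C[OF fin_sub[OF F_props(1)] sub this]
 show "C (I Un \<Union>belowF) = C F" "rk M (I Un \<Union>belowF) = rk M F" by auto
qed

lemma N_ground: "ground conF = {A : atoms latU. \<not> A <= F}" by (auto simp: contract_def lat_matroid_def)

text \<open>The atoms below \<open>F\<close> span \<open>F\<close> over \<open>I\<close>, so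
  contracting them amounts to contracting \<open>F\<close> in \<open>M\<close>.\<close>

lemma N_indep: "\<S> : indep conF \<longleftrightarrow> \<S> <= ground conF \<and> rk M (F Un atom_pt ` \<S>) = rk M F + card \<S>"
proof (cases "\<S> <= ground conF")
 case True
 hence sub: "\<S> <= atoms latU" "\<S> Un belowF <= atoms latU" "belowF <= atoms latU" by (auto simp: N_ground)
 have "rk M (I Un \<Union>(\<S> Un belowF)) = rk M ((I Un \<Union>belowF) Un \<Union>\<S>)" by (rule arg_cong[where f="rk M"]) blast
 also have "\<dots> = rk M (F Un \<Union>\<S>)"
 proof -
  have f: "finite (I Un \<Union>belowF)" "finite F" "finite (\<Union>\<S>)"
   using fin_sub[OF atoms_E[OF sub(3)]] fin_sub[OF F_props(1)] fin_sub[OF atoms_E[OF sub(1)]] by simp_all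
  show ?thesis by (rule r_cong_C[OF _ _ C_Un_cong[OF f(1,2) F_span(1)]]) (use f in simp_all)
 qed
 also have "\<dots> = rk M (F Un atom_pt ` \<S>)" by (rule atom_pts(2)[OF sub(1) F_props(2,1)])
 finally have 1: "rk M (I Un \<Union>(\<S> Un belowF)) = rk M (F Un atom_pt ` \<S>)" .
 have "card I \<le> rk M (I Un \<Union>belowF)" "card I \<le> rk M (I Un \<Union>(\<S> Un belowF))" using card_le_rk[OF I_indep[OF IU]] by blast+
 hence "rk (lat_matroid latU) (\<S> Un belowF) = card \<S> + rk (lat_matroid latU) belowF \<longleftrightarrow> rk M (F Un atom_pt ` \<S>) = rk M F + card \<S>"
  unfolding lat_matroid_rk[OF sub(2)] lat_matroid_rk[OF sub(3)] F_span(2) 1[symmetric] by linarith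
 thus ?thesis using True by (simp add: contract_def)
qed (simp add: contract_def)

lemma pt_notin: "A : ground conF \<Longrightarrow> atom_pt A ~: C F"
proof
 assume A: "A : ground conF" "atom_pt A : C F"
 hence at: "A : atoms latU" by (simp add: N_ground)
 have "atom_pt A : F" using A(2) F_props(4) atom_pt(1)[OF at] U_sub[OF IU] by (auto simp: cl_C)
 hence "A <= F" using cl_least[of "(atom_pt A)+:I" F] F_props atom_pt(3)[OF at] by blast
 thus False using A by (simp add: N_ground)
qed

lemma N_small: "{} : indep conF" "A : ground conF \<Longrightarrow> {A} : indep conF"
 using pt_notin[of A] r_notin[of "atom_pt A" F] unfolding N_indep by simp_all

lemma N_pair: "A : ground conF \<Longrightarrow> B : ground conF \<Longrightarrow> A \<noteq> B \<Longrightarrow> {A, B} : indep conF \<longleftrightarrow> atom_pt B ~: C ((atom_pt A)+:F)"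
proof -
 assume AB: "A : ground conF" "B : ground conF" "A \<noteq> B"
 have "F Un atom_pt ` {A, B} = (atom_pt B)+:(atom_pt A)+:F" by blast
 thus ?thesis using AB r_notin[OF pt_notin[OF AB(1)]] r_notin[of "atom_pt B" "(atom_pt A)+:F"]
   r_in[of "atom_pt B" "(atom_pt A)+:F"] unfolding N_indep by (cases "atom_pt B : C ((atom_pt A)+:F)") simp_all
qed

context
 assumes corank: "rk M F + 2 = rk M E"
begin

lemma N_big: "\<S> : indep conF \<Longrightarrow> card \<S> \<le> 2"
proof -
 assume S: "\<S> : indep conF"
 hence "atom_pt ` \<S> <= U" using atom_pt(1) by (auto simp: N_indep N_ground)
 hence "rk M (F Un atom_pt ` \<S>) \<le> rk M E" using F_props(1) U_sub[OF IU] by (intro rk_mono) auto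
 thus ?thesis using S corank by (auto simp: N_indep)
qed

lemma ex_atom: assumes "x : U" "x ~: C F"
 shows "\<exists>A\<in>ground conF. C ((atom_pt A)+:F) = C (x+:F)"
proof -
 have xI: "x ~: C I" using assms C_mono F_props(2) by blast
 define A where "A = cl M (x+:I)"
 have A: "A : atoms latU" using usub_atom[OF IU] assms xI by (simp add: A_def)
 have xA: "x : A" using sub_cl[of "x+:I"] assms U_sub[OF IU] I_E[OF IU] by (auto simp: A_def)
 hence g: "A : ground conF" using A assms subset_C by (auto simp: N_ground)
 have "atom_pt A : C (x+:F)" using atom_pt_in[OF A] C_mono[of "x+:I" "x+:F"] F_props(2) by (auto simp: A_def cl_C)
 hence "C ((atom_pt A)+:x+:F) = C (x+:F)" by (rule C_insert_in)
 moreover have "x : C ((atom_pt A)+:F)"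
  using xA atom_pt(3)[OF A] C_mono[of "(atom_pt A)+:I" "(atom_pt A)+:F"] F_props(2) by (auto simp: cl_C)
 hence "C (x+:(atom_pt A)+:F) = C ((atom_pt A)+:F)" by (rule C_insert_in)
 ultimately have "C ((atom_pt A)+:F) = C (x+:F)" using insert_commute[of x "atom_pt A" F] by simp
 thus ?thesis using g by blast
qed

lemma subset_two: "D <= {a, b} \<Longrightarrow> D = {} \<or> D = {a} \<or> D = {b} \<or> D = {a, b}" for D :: "'x set"
 by (cases "a : D"; cases "b : D"; auto)

text \<open>In rank 2 without loops, circuits are parallel pairs and triples of pairwise
  non-parallel points. A circuit through two independent points has a third member; conversely, one
  of three non-parallel points is parallel to neither of two given ones.\<close>

theorem indecomposable_iff: "indecomposable latU F \<longleftrightarrow> tri U F"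
proof
 assume con: "indecomposable latU F"
 have rU: "rk M U = rk M E" using cl_ground_iff[OF U_sub[OF IU]] cl_U[OF IU] by blast
 have "rk M (F Int U) + 2 \<le> rk M U" using rU corank F_props(6) by simp
 from ex_pair_notin_C[OF fin_sub[OF U_sub[OF IU]] _ this]
 obtain x y where xy: "x : U" "y : U" "x ~: C (F Int U)" "y ~: C (x+:(F Int U))" by blast
 have x: "x ~: C F" using xy F_props(5) by blast
 have "C (x+:(F Int U)) = C (x+:F)"
  using C_Un_cong[OF _ fin_sub[OF F_props(1)] F_props(5), of "{x}"] fin_sub[OF F_props(1)] by simp
 hence yx: "y ~: C (x+:F)" using xy by blast
 hence y: "y ~: C F" using C_mono[of F "x+:F"] by blast
 obtain A where A: "A : ground conF" "C ((atom_pt A)+:F) = C (x+:F)" using ex_atom[OF xy(1) x] by blast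
 obtain B where B: "B : ground conF" "C ((atom_pt B)+:F) = C (y+:F)" using ex_atom[OF xy(2) y] by blast
 have yy: "y : C (y+:F)" using subset_C[of "y+:F"] by blast
 have AB: "A \<noteq> B" using A(2) B(2) yx yy by auto
 have nBA: "atom_pt B ~: C ((atom_pt A)+:F)"
 proof
  assume "atom_pt B : C ((atom_pt A)+:F)"
  hence "C ((atom_pt B)+:F) <= C ((atom_pt A)+:F)"
   using C_subset_C[of "(atom_pt B)+:F" "(atom_pt A)+:F"] fin_sub[OF F_props(1)] subset_C[of "(atom_pt A)+:F"] by simp
  thus False using A(2) B(2) yx yy by blast
 qed
 hence ABi: "{A, B} : indep conF" using N_pair[OF A(1) B(1) AB] by simp
 obtain D where D: "circuit conF D" "A : D" "B : D"
  using con[unfolded indecomposable_def connected_matroid_def] A(1) B(1) AB by blast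
 hence Dg: "D <= ground conF" "D ~: indep conF" "\<And>D'. D' \<subset> D \<Longrightarrow> D' : indep conF" unfolding circuit_def by simp_all
 hence "D \<noteq> {A, B}" using ABi by blast
 then obtain H where H: "H : D" "H \<noteq> A" "H \<noteq> B" using D by blast
 have Hg: "H : ground conF" using H Dg(1) by blast
 have "{A, H} : indep conF" "{B, H} : indep conF" by (rule Dg(3); use D H AB in blast)+
 hence "atom_pt H ~: C ((atom_pt A)+:F)" "atom_pt H ~: C ((atom_pt B)+:F)"
  using N_pair[OF A(1) Hg] N_pair[OF B(1) Hg] H by simp_all
 moreover have "atom_pt A : U" "atom_pt B : U" "atom_pt H : U" using A(1) B(1) Hg atom_pt(1) by (simp_all add: N_ground)
 ultimately show "tri U F" using nBA pt_notin[OF A(1)] unfolding tri_def by blast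
next
 assume "tri U F"
 then obtain x y z where xyz: "x : U" "y : U" "z : U" "x ~: C F" "y ~: C (x+:F)"
  "z ~: C (x+:F)" "z ~: C (y+:F)" unfolding tri_def by blast
 show "indecomposable latU F" unfolding indecomposable_def connected_matroid_def
 proof (intro ballI impI)
  fix A B assume AB: "A : ground conF" "B : ground conF" "A \<noteq> B"
  show "\<exists>D. circuit conF D \<and> A : D \<and> B : D"
  proof (cases "{A, B} : indep conF")
   case False
   have "circuit conF {A, B}" unfolding circuit_def using False AB N_small subset_two[of _ A B] by blast
   thus ?thesis by blast
  next
   case True
   have par: "w' : C (w+:F)" if "w : C (b+:F)" "w' : C (b+:F)" "w ~: C F" for b w w'
   proof -
    have "b : C (w+:F)" using exch[OF that(1,3)] .
    hence "C (b+:w+:F) = C (w+:F)" by (rule C_insert_in)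
    thus ?thesis using that(2) C_mono[of "b+:F" "b+:w+:F"] by blast
   qed
   have yz: "y ~: C F" "z ~: C F" using xyz C_mono[of F "x+:F"] by blast+
   let ?ok = "\<lambda>w. w ~: C ((atom_pt A)+:F) \<and> w ~: C ((atom_pt B)+:F)"
   have "?ok x \<or> ?ok y \<or> ?ok z" using par xyz yz by blast
   then obtain w where w: "w : U" "w ~: C F" "?ok w" using xyz yz by blast
   obtain H where H: "H : ground conF" "C ((atom_pt H)+:F) = C (w+:F)" using ex_atom[OF w(1,2)] by blast
   have ok: "?ok (atom_pt H)"
   proof -
    have "atom_pt H ~: C (b+:F)" if "w ~: C (b+:F)" for b
    proof
     assume h: "atom_pt H : C (b+:F)"
     have "b : C ((atom_pt H)+:F)" using exch[OF h pt_notin[OF H(1)]] .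
     hence "b : C (w+:F)" using H by blast
     moreover have "b ~: C F" using h pt_notin[OF H(1)] C_insert_in by blast
     ultimately show False using exch that by blast
    qed
    thus ?thesis using w by blast
   qed
   have HAB: "H \<noteq> A" "H \<noteq> B" using ok subset_C by blast+
   have i: "{A, H} : indep conF" "{B, H} : indep conF" using N_pair ok AB H HAB by blast+
   have "{A, B, H} ~: indep conF" using N_big[of "{A, B, H}"] HAB AB by auto
   moreover have two: "D' : indep conF" if "D' <= {a, b}" "{a, b} : indep conF" "a : ground conF" "b : ground conF" for D' a b
    using subset_two[OF that(1)] N_small(1) N_small(2)[OF that(3)] N_small(2)[OF that(4)] that(2) by (elim disjE) simp_all
   have "D' : indep conF" if "D' \<subset> {A, B, H}" for D'
   proof -
    have "D' <= {A, B} \<or> D' <= {A, H} \<or> D' <= {B, H}" using that by blast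
    thus ?thesis using two[OF _ True AB(1,2)] two[OF _ i(1) AB(1) H(1)] two[OF _ i(2) AB(2) H(1)] by blast
   qed
   ultimately have "circuit conF {A, B, H}" unfolding circuit_def using AB H by blast
   thus ?thesis by blast
  qed
 qed
qed

end

end

end

end

section \<open>Representations of sublattices of a given type\<close>

definition simple_mat :: "'b matroid \<Rightarrow> bool" where
 "simple_mat N \<longleftrightarrow> finite (ground N) \<and> (\<forall>a\<in>ground N. \<forall>b\<in>ground N. {a, b} : indep N)"

context mat
begin

text \<open>\<open>L\<close> is represented by elements \<open>x n\<close> of \<open>M\<close> whose contraction by \<open>J\<close> is a copy of \<open>N\<close>.\<close>

definition rep :: "'a set \<Rightarrow> ('b \<Rightarrow> 'a) \<Rightarrow> 'b matroid \<Rightarrow> 'a set set \<Rightarrow> bool" where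
 "rep J x N L \<longleftrightarrow> J <= E \<and> x ` ground N <= E \<and>
   (\<forall>X. X <= ground N \<longrightarrow> (X : indep N \<longleftrightarrow> rk M (J Un x ` X) = rk M J + card X)) \<and>
   rk M (J Un x ` ground N) = rk M E \<and> L = (\<lambda>X. cl M (J Un x ` X)) ` Pow (ground N)"

text \<open>\<open>x\<close> sends an element of \<open>N\<close> to a representative of the atom
  that corresponds to it under the isomorphism.\<close>

lemma rep_ex:
 assumes IU: "ups I U" and L: "L = usub I U" and ty: "has_type L N"
 shows "\<exists>x. rep I x N L"
proof -
 obtain f where f: "bij_betw f (atoms L) (ground N)"
  "\<And>\<A>. \<A> <= atoms L \<Longrightarrow> \<A> : indep (lat_matroid L) \<longleftrightarrow> f ` \<A> : indep N"
  using ty unfolding has_type_def matroid_isomorphic_def by (auto simp: lat_matroid_def)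
 define g where "g = inv_into (atoms L) f"
 define x where "x n = atom_pt I U (g n)" for n
 have g: "bij_betw g (ground N) (atoms L)" unfolding g_def by (rule bij_betw_inv_into[OF f(1)])
 have fg: "f ` g ` X = X" if "X <= ground N" for X
  unfolding g_def using image_inv_into_cancel[of f "atoms L" "ground N" X] f(1) that by (simp add: bij_betw_def)
 have gf: "g ` f ` \<A> = \<A>" if "\<A> <= atoms L" for \<A>
  unfolding g_def using inv_into_image_cancel[of f "atoms L" \<A>] f(1) that by (simp add: bij_betw_def)
 have gX: "g ` X <= atoms (usub I U)" if "X <= ground N" for X using g that L unfolding bij_betw_def by blast
 have xU: "x n : U" if "n : ground N" for n unfolding x_def using atom_pt(1)[OF IU] gX[of "{n}"] that by simp
 have IE: "I <= E" "I <= U" "U <= E" using I_E[OF IU] I_sub[OF IU] U_sub[OF IU] by blast+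
 have im: "atom_pt I U ` g ` X = x ` X" for X unfolding x_def by (simp add: image_image)
 have span: "C (I Un \<Union>(g ` X)) = C (I Un x ` X)" "rk M (I Un \<Union>(g ` X)) = rk M (I Un x ` X)"
  if "X <= ground N" for X using atom_pts[OF IU gX[OF that] order_refl IE(1)] im[of X] by simp_all
 have L_eq: "\<exists>X\<subseteq>ground N. F = cl M (I Un x ` X)" if F: "F : L" for F
 proof -
  let ?A = "{A : atoms (usub I U). A <= F}"
  have A: "?A <= atoms L" using L by blast
  hence X: "f ` ?A <= ground N" using f(1) unfolding bij_betw_def by blast
  have "C (I Un x ` f ` ?A) = C F" using span(1)[OF X] gf[OF A] F_span(1)[OF IU, of F] F L by simp
  moreover have "cl M F = F" using F_props(4)[OF IU, of F] F L by simp
  ultimately have "cl M (I Un x ` f ` ?A) = F" using cl_eq_iff[of "I Un x ` f ` ?A" F] by simp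
  thus ?thesis using X by blast
 qed
 have "rep I x N L" unfolding rep_def
 proof (intro conjI allI impI)
  show "I <= E" by (rule IE(1))
  show xE: "x ` ground N <= E" using xU IE by blast
  show "X : indep N \<longleftrightarrow> rk M (I Un x ` X) = rk M I + card X" if X: "X <= ground N" for X
  proof -
   have "card (g ` X) = card X" using card_image[OF inj_on_subset[OF bij_betw_imp_inj_on[OF g] X]] .
   moreover have "X : indep N \<longleftrightarrow> g ` X : indep (lat_matroid (usub I U))" using f(2)[of "g ` X"] gX[OF X] fg[OF X] L by simp
   ultimately show ?thesis using lat_matroid_indep[OF IU, of "g ` X"] gX[OF X] span(2)[OF X] rk_indep[OF I_indep[OF IU]]
    by simp
  qed
  have "E : L" using usub_top[OF IU] L by simp
  then obtain X where X: "X <= ground N" "E = cl M (I Un x ` X)" using L_eq by blast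
  have sub: "I Un x ` X <= I Un x ` ground N" "I Un x ` ground N <= E" using X IE xE by blast+
  have "rk M E = rk M (I Un x ` X)" using rk_cl[OF order_trans[OF sub]] unfolding X(2)[symmetric] .
  thus "rk M (I Un x ` ground N) = rk M E" using rk_mono[OF sub(1)] rk_mono[OF sub(2)] by linarith
  show "L = (\<lambda>X. cl M (I Un x ` X)) ` Pow (ground N)"
  proof
   show "L <= (\<lambda>X. cl M (I Un x ` X)) ` Pow (ground N)" using L_eq by blast
   have "cl M (I Un x ` X) : L" if "X <= ground N" for X unfolding L by (rule usubI[OF IU]) (use that xU IE in blast)+
   thus "(\<lambda>X. cl M (I Un x ` X)) ` Pow (ground N) <= L" by blast
  qed
 qed
 thus ?thesis by blast
qed

context
 fixes J x and N :: "'b matroid" and L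
 assumes rep: "rep J x N L" and simple: "simple_mat N"
begin

lemma J_E: "J <= E" and x_E: "n : ground N \<Longrightarrow> x n : E"
 and rep_indep: "X <= ground N \<Longrightarrow> X : indep N \<longleftrightarrow> rk M (J Un x ` X) = rk M J + card X"
 and rep_span: "rk M (J Un x ` ground N) = rk M E" and L_eq: "L = (\<lambda>X. cl M (J Un x ` X)) ` Pow (ground N)"
 using rep unfolding rep_def by blast+

text \<open>The base \<open>J\<close> of a representation may be dependent, while an upper
  sublattice starts from an independent set; a basis of \<open>J\<close> has the same
  closure.\<close>

lemma rep_ups:
 obtains I where "ups I (I Un x ` ground N)" "L = usub I (I Un x ` ground N)" "card I = rk M J" "C I = C J" "I <= E"
proof -
 obtain I where I: "I : indep M" "I <= J" "card I = rk M J" "C I = C J" using basis_of[OF J_E] by blast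
 let ?U = "I Un x ` ground N"
 have xE: "x ` X <= E" if "X <= ground N" for X using x_E that by blast
 have IE: "I <= E" using I J_E by blast
 have eqC: "C (I Un x ` X) = C (J Un x ` X)" for X by (rule C_Un_cong[OF fin_sub[OF IE] fin_sub[OF J_E] I(4)])
 have "rk M ?U = rk M E"
  using r_cong_C[OF _ _ eqC[of "ground N"]] fin_sub[OF IE] fin_sub[OF J_E] fin_sub[OF xE[OF order_refl]] rep_span by simp
 hence "cl M ?U = E" using cl_ground_iff[of ?U] IE xE[OF order_refl] by simp
 hence ups: "ups I ?U" unfolding ups_def using I(1) IE xE[OF order_refl] by blast
 have "L = usub I ?U"
 proof
  show "L <= usub I ?U"
  proof
   fix F assume "F : L"
   then obtain X where X: "X <= ground N" "F = cl M (J Un x ` X)" unfolding L_eq by blast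
   hence "F = cl M (I Un x ` X)" using eqC cl_eq_iff by blast
   thus "F : usub I ?U" using X(1) unfolding usub_def by blast
  qed
  show "usub I ?U <= L"
  proof
   fix F assume "F : usub I ?U"
   then obtain S where S: "F = cl M S" "I <= S" "S <= ?U" unfolding usub_def by blast
   let ?X = "{n : ground N. x n : S}"
   have "S = I Un x ` ?X" using S by blast
   hence "F = cl M (J Un x ` ?X)" using S(1) eqC[of ?X] cl_eq_iff[of "I Un x ` ?X" "J Un x ` ?X"] by simp
   thus "F : L" unfolding L_eq by blast
  qed
 qed
 thus thesis using that ups I IE by blast
qed

lemma rep_upper: "upper_sublattice M L"
proof -
 obtain I where I: "ups I (I Un x ` ground N)" "L = usub I (I Un x ` ground N)" by (rule rep_ups)
 show ?thesis unfolding upper_sublattice_iff by (rule exI[of _ I], rule exI[of _ "I Un x ` ground N"], rule conjI[OF I])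
qed

lemma rep_mem: "X <= ground N \<Longrightarrow> cl M (J Un x ` X) : L" unfolding L_eq by blast

lemma rep_sub: "X <= ground N \<Longrightarrow> J Un x ` X <= E" using J_E x_E by blast

lemma rep_flat: "F : L \<Longrightarrow> F : flats M" unfolding L_eq using cl_flat rep_sub by blast

lemma rep_rank: "X <= ground N \<Longrightarrow> rk M (cl M (J Un x ` X)) = rk M (J Un x ` X)" using rk_cl rep_sub by blast

lemma rep_Inter: "\<Inter>L = cl M J"
proof -
 obtain I where I: "ups I (I Un x ` ground N)" "L = usub I (I Un x ` ground N)" "C I = C J" by (rule rep_ups)
 thus ?thesis using Inter_usub[OF I(1)] cl_eq_iff[of I J] by simp
qed

lemma rep_corank: assumes "F : L" shows "lat_corank L F = rk M E - rk M F"
proof -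
 obtain I where I: "ups I (I Un x ` ground N)" "L = usub I (I Un x ` ground N)" "C I = C J" by (rule rep_ups)
 thus ?thesis using usub_corank[OF I(1)] assms by simp
qed

lemma rep_hyperplanes: "hyperplanes L = {H : L. Suc (rk M H) = rk M E}"
proof -
 obtain I where I: "ups I (I Un x ` ground N)" "L = usub I (I Un x ` ground N)" "C I = C J" by (rule rep_ups)
 thus ?thesis using usub_hyperplanes[OF I(1)] by simp
qed

lemma rep_atoms: "atoms L = {A : L. rk M A = Suc (rk M J)}"
proof -
 obtain I where I: "ups I (I Un x ` ground N)" "L = usub I (I Un x ` ground N)" "card I = rk M J" by (rule rep_ups)
 thus ?thesis using usub_atoms[OF I(1)] by simp
qed

text \<open>The elements of the independent base are loops over \<open>F\<close> and cannot belong
  to a triple of points.\<close>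

lemma rep_indecomposable:
 assumes F: "F : L" "rk M F + 2 = rk M E"
 shows "indecomposable L F \<longleftrightarrow> tri (x ` ground N) F"
proof -
 obtain I where I: "ups I (I Un x ` ground N)" "L = usub I (I Un x ` ground N)" by (rule rep_ups)
 have "I <= F" using F(1) usub_iff[OF I(1)] I(2) by blast
 hence IC: "I <= C F" using subset_C by blast
 have "F : usub I (I Un x ` ground N)" using F(1) I(2) by simp
 note ind = indecomposable_iff[OF I(1) this F(2)]
 have "tri (I Un x ` ground N) F \<longleftrightarrow> tri (x ` ground N) F"
 proof
  assume "tri (I Un x ` ground N) F"
  then obtain u v w where t: "u : I Un x ` ground N" "v : I Un x ` ground N" "w : I Un x ` ground N"
   "u ~: C F" "v ~: C (u+:F)" "w ~: C (u+:F)" "w ~: C (v+:F)" unfolding tri_def by blast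
  hence "v ~: C F" "w ~: C F" using C_mono[of F "u+:F"] by blast+
  hence "u : x ` ground N" "v : x ` ground N" "w : x ` ground N" using t IC by blast+
  thus "tri (x ` ground N) F" by (rule triI[OF _ _ _ t(4-7)])
 qed (erule tri_mono, rule Un_upper2)
 thus ?thesis using ind I(2) by simp
qed

lemma rep_basis:
 assumes F: "F : L"
 shows "\<exists>X. X <= ground N \<and> X : indep N \<and> F = cl M (J Un x ` X) \<and> rk M F = rk M J + card X"
proof -
 obtain Y where Y: "Y <= ground N" "F = cl M (J Un x ` Y)" using F unfolding L_eq by blast
 have finY: "finite Y" using Y(1) simple finite_subset unfolding simple_mat_def by blast
 have "\<exists>X\<subseteq>Y. rk M (J Un x ` X) = rk M J + card X \<and> C (J Un x ` X) = C (J Un x ` Y)" using finY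
 proof (induction Y rule: finite_induct)
  case (insert y Y)
  then obtain X where X: "X <= Y" "rk M (J Un x ` X) = rk M J + card X" "C (J Un x ` X) = C (J Un x ` Y)" by blast
  have fin: "finite X" using X(1) insert finite_subset by blast
  have "C ((J Un x ` X) Un {x y}) = C ((J Un x ` Y) Un {x y})"
   by (rule C_Un_cong[OF _ _ X(3)]) (use fin insert.hyps(1) fin_sub[OF J_E] in simp_all)
  hence eq: "C ((x y)+:(J Un x ` X)) = C ((x y)+:(J Un x ` Y))" by simp
  show ?case
  proof (cases "x y : C (J Un x ` X)")
   case True
   hence "C (J Un x ` X) = C (J Un x ` y+:Y)" using C_insert_in eq by simp
   thus ?thesis using X by blast
  next
   case False
   have "y ~: X" using X(1) insert.hyps(2) by blast
   hence "rk M (J Un x ` y+:X) = rk M J + card (y+:X)" using r_notin[OF False] X(2) fin by simp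
   moreover have "C (J Un x ` y+:X) = C (J Un x ` y+:Y)" using eq by simp
   moreover have "y+:X <= y+:Y" using X(1) by blast
   ultimately show ?thesis by blast
  qed
 qed simp
 then obtain X where X: "X <= Y" "rk M (J Un x ` X) = rk M J + card X" "C (J Un x ` X) = C (J Un x ` Y)" by blast
 have XN: "X <= ground N" using X Y by blast
 have "F = cl M (J Un x ` X)" using X(3) Y(2) cl_eq_iff by blast
 moreover have "X : indep N" using X(2) rep_indep[OF XN] by simp
 moreover have "rk M (cl M (J Un x ` X)) = rk M J + card X" using X(2) rep_rank[OF XN] by simp
 ultimately show ?thesis by (intro exI[of _ X] conjI XN) simp_all
qed

text \<open>\<open>h\<close> sends an element of \<open>N\<close> to the atom it spans. Simplicity
  of \<open>N\<close> keeps these atoms from degenerating and from coinciding.\<close>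

lemma rep_type: "has_type L N"
proof -
 obtain I where I: "ups I (I Un x ` ground N)" "L = usub I (I Un x ` ground N)" "card I = rk M J" "C I = C J" "I <= E" by (rule rep_ups)
 define h where "h n = cl M ((x n)+:I)" for n
 have eqC: "C (I Un x ` X) = C (J Un x ` X)" for X by (rule C_Un_cong[OF fin_sub[OF I(5)] fin_sub[OF J_E] I(4)])
 have hsub: "(x n)+:I <= E" if "n : ground N" for n using x_E[OF that] I(5) by blast
 have notin: "x m ~: C ((x n)+:I)" if mn: "m : ground N" "n : ground N" "m \<noteq> n" for m n
 proof
  assume "x m : C ((x n)+:I)"
  hence "x m : C (J Un {x n})" using eqC[of "{n}"] by simp
  hence "rk M (J Un x ` {m, n}) = rk M (J Un x ` {n})" using r_in by simp
  moreover have "{m, n} : indep N" "{n} : indep N" using simple mn unfolding simple_mat_def by force+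
  ultimately show False using rep_indep[of "{m, n}"] rep_indep[of "{n}"] mn by simp
 qed
 have notin0: "x n ~: C I" if n: "n : ground N" for n
 proof
  assume "x n : C I"
  hence "x n : C J" using I(4) by simp
  hence "rk M (J Un x ` {n}) = rk M J" using r_in by simp
  moreover have "{n} : indep N" using simple n unfolding simple_mat_def by force
  ultimately show False using rep_indep[of "{n}"] n by simp
 qed
 have bij: "bij_betw h (ground N) (atoms L)" unfolding bij_betw_def
 proof
  show "inj_on h (ground N)"
  proof (rule inj_onI, rule ccontr)
   fix m n assume mn: "m : ground N" "n : ground N" "h m = h n" "m \<noteq> n"
   have "x m : h m" unfolding h_def using sub_cl[OF hsub[OF mn(1)]] by blast
   hence "x m : C ((x n)+:I)" using mn(3) unfolding h_def cl_C by blast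
   thus False using notin mn by blast
  qed
  show "h ` ground N = atoms L"
  proof
   show "h ` ground N <= atoms L" unfolding h_def I(2) using usub_atom[OF I(1)] notin0 by blast
   show "atoms L <= h ` ground N"
   proof
    fix A assume "A : atoms L"
    then obtain y where y: "y : I Un x ` ground N" "y ~: C I" "A = cl M (y+:I)" using usub_atomE[OF I(1)] I(2) by blast
    hence "y : x ` ground N" using subset_C by blast
    thus "A : h ` ground N" using y(3) unfolding h_def by blast
   qed
  qed
 qed
 let ?f = "inv_into (ground N) h"
 have ind: "\<A> : indep (lat_matroid L) \<longleftrightarrow> ?f ` \<A> : indep N" if \<A>: "\<A> <= atoms L" for \<A>
 proof -
  let ?X = "?f ` \<A>"
  have hX: "h ` ?X = \<A>" using image_inv_into_cancel[of h "ground N" "atoms L" \<A>] bij \<A> by (simp add: bij_betw_def)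
  have XN: "?X <= ground N" using bij_betw_inv_into[OF bij] \<A> unfolding bij_betw_def by blast
  have "card \<A> = card ?X" using card_image[of h ?X] inj_on_subset[of h "ground N" ?X] bij XN hX unfolding bij_betw_def by simp
  moreover have "rk M (I Un \<Union>(h ` ?X)) = rk M (I Un x ` ?X)"
  proof (rule r_between_C)
   have "h n <= E" for n unfolding h_def by (rule cl_sub)
   thus "finite (I Un \<Union>(h ` ?X))" by (intro fin_sub) (use I(5) in blast)
   have "x n : h n" if "n : ground N" for n unfolding h_def using sub_cl[OF hsub[OF that]] by blast
   thus "I Un x ` ?X <= I Un \<Union>(h ` ?X)" using XN by blast
   have "h n <= C (I Un x ` ?X)" if "n : ?X" for n
   proof -
    have "C ((x n)+:I) <= C (I Un x ` ?X)" by (rule C_mono) (use that in blast)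
    thus ?thesis unfolding h_def cl_C by blast
   qed
   thus "I Un \<Union>(h ` ?X) <= C (I Un x ` ?X)" using subset_C[of "I Un x ` ?X"] by blast
  qed
  moreover have "rk M (I Un x ` ?X) = rk M (J Un x ` ?X)"
   by (rule r_cong_C[OF _ _ eqC]) (use fin_sub[OF rep_sub[OF XN]] fin_sub[OF I(5)] in simp_all)
  ultimately show ?thesis using lat_matroid_indep[OF I(1), of \<A>] rep_indep[OF XN] hX I(2,3) \<A> by simp
 qed
 have gr: "ground (lat_matroid L) = atoms L" by (simp add: lat_matroid_def)
 show ?thesis unfolding has_type_def matroid_isomorphic_def gr
  by (intro exI[of _ ?f] conjI bij_betw_inv_into[OF bij] allI impI ind)
qed

end

end

section \<open>Uniform matroids and the matroid of \<open>K_{2,3}\<close>\<close>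

lemma ground_uniform: "ground (uniform_matroid r n) = {..<n}"
 and indep_uniform: "X : indep (uniform_matroid r n) \<longleftrightarrow> X <= {..<n} \<and> card X \<le> r" by (simp_all add: uniform_matroid_def)

lemma simple_uniform: "2 \<le> r \<or> n = 1 \<and> r = 1 \<Longrightarrow> simple_mat (uniform_matroid r n)"
 by (auto simp: simple_mat_def ground_uniform indep_uniform card_insert_if)

text \<open>The edges of \<open>K\<^sub>2\<^sub>,\<^sub>3\<close> are numbered so that \<open>2k\<close> and \<open>2k+1\<close> are in series. The circuits
 are the unions of two of the three serial pairs.\<close>

definition ed :: "nat \<Rightarrow> nat set" where
 "ed i = {i mod 2, 2 + i div 2}"

definition K6 :: "nat matroid" where
 "K6 = \<lparr>ground = {..<6}, indep = {X. X <= {..<6} \<and> \<not> {0,1,2,3} <= X \<and> \<not> {0,1,4,5} <= X \<and> \<not> {2,3,4,5} <= X}\<rparr>"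

lemma lt6: "{..<6::nat} = {0,1,2,3,4,5}" by auto

lemma ed_simps: "ed 0 = {0,2}" "ed 1 = {1,2}" "ed (Suc 0) = {1,2}" "ed 2 = {0,3}" "ed 3 = {1,3}" "ed 4 = {0,4}" "ed 5 = {1,4}"
 by (simp_all add: ed_def)

lemma inj_ed: "inj_on ed {..<6}" unfolding lt6 by (simp add: inj_on_def ed_simps doubleton_eq_iff)

lemma K23_ground: "ground matroid_K23 = ed ` {..<6}"
proof -
 have "complete_bipartite_edges {0, 1} {2, 3, 4::nat} = (\<lambda>(a, b). {a, b}) ` ({0, 1} \<times> {2, 3, 4})"
  unfolding complete_bipartite_edges_def by blast
 also have "{0, 1::nat} \<times> {2, 3, 4::nat} = {(0,2),(0,3),(0,4),(1,2),(1,3),(1,4)}" by auto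
 also have "(\<lambda>(a, b). {a, b}) ` {(0,2),(0,3),(0,4),(1,2),(1,3),(1,4::nat)} = ed ` {..<6}"
  unfolding lt6 by (simp add: ed_simps insert_commute)
 finally show ?thesis by (simp add: matroid_K23_def graphic_matroid_def)
qed

lemma K23_edge:
 assumes "{a, b} : ed ` {..<6}" shows "(a < 2) \<noteq> (b < 2)" "a < 5"
proof -
 obtain i where i: "i < 6" "{a, b} = ed i" using assms by blast
 have "i mod 2 < 2" "i div 2 < 3" using i(1) by auto
 moreover have "a = i mod 2 \<and> b = 2 + i div 2 \<or> a = 2 + i div 2 \<and> b = i mod 2" using i(2) unfolding ed_def doubleton_eq_iff .
 ultimately show "(a < 2) \<noteq> (b < 2)" "a < 5" by linarith+
qed

lemma four_cycle:
 assumes F: "{0, b} : F" "{1, b} : F" "{0, d} : F" "{1, d} : F" and ne: "b \<noteq> d" and bd: "2 \<le> b" "b < 5" "2 \<le> d" "d < 5"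
 shows "ed ` {0,1,2,3} <= F \<or> ed ` {0,1,4,5} <= F \<or> ed ` {2,3,4,5} <= F"
proof -
 have "b = 2 \<or> b = 3 \<or> b = 4" "d = 2 \<or> d = 3 \<or> d = 4" using bd by auto
 thus ?thesis using F ne by (elim disjE) (simp_all add: ed_simps)
qed

text \<open>The graph is bipartite on five vertices, so a cycle has length 4; two opposite vertices
  of it are \<open>0\<close> and \<open>1\<close>.\<close>

lemma cycle_contains:
 assumes F: "F <= ed ` {..<6}" and cyc: "is_cycle F vs"
 shows "ed ` {0,1,2,3} <= F \<or> ed ` {0,1,4,5} <= F \<or> ed ` {2,3,4,5} <= F"
proof -
 let ?n = "length vs"
 have vs: "distinct vs" "3 \<le> ?n" and e: "\<And>i. i < ?n \<Longrightarrow> {vs ! i, vs ! (Suc i mod ?n)} : F"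
  using cyc unfolding is_cycle_def by blast+
 have alt: "(vs ! i < 2) \<noteq> (vs ! (Suc i mod ?n) < 2)" "vs ! i < 5" if "i < ?n" for i
 proof -
  have "{vs ! i, vs ! (Suc i mod ?n)} : ed ` {..<6}" using e[OF that] F by blast
  from K23_edge[OF this] show "(vs ! i < 2) \<noteq> (vs ! (Suc i mod ?n) < 2)" "vs ! i < 5" .
 qed
 define c where "c i = (vs ! i < 2)" for i
 have alt': "c i \<noteq> c j" if "i < ?n" "j = Suc i mod ?n" for i j using alt(1)[OF that(1)] that(2) by (simp add: c_def)
 have "set vs <= {..<5}" using alt(2) by (auto simp: in_set_conv_nth)
 hence "card (set vs) \<le> 5" using card_mono[of "{..<5::nat}" "set vs"] by simp
 hence "?n \<le> 5" using distinct_card[OF vs(1)] by simp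
 then consider "?n = 3" | "?n = 4" | "?n = 5" using vs(2) by linarith
 thus ?thesis
 proof cases
  case 1
  have "c 0 \<noteq> c 1" "c 1 \<noteq> c 2" "c 2 \<noteq> c 0" by (rule alt'; simp add: 1)+
  thus ?thesis by blast
 next
  case 3
  have "c 0 \<noteq> c 1" "c 1 \<noteq> c 2" "c 2 \<noteq> c 3" "c 3 \<noteq> c 4" "c 4 \<noteq> c 0" by (rule alt'; simp add: 3)+
  thus ?thesis by blast
 next
  case 2
  then obtain p q u v where v: "vs = [p, q, u, v]" by (auto simp: numeral_eq_Suc length_Suc_conv)
  have d: "p \<noteq> u" "q \<noteq> v" using vs(1) v by auto
  have e': "{vs ! i, vs ! j} : F" if "i < ?n" "j = Suc i mod ?n" for i j using e[OF that(1)] that(2) by simp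
  have "{vs ! 0, vs ! 1} : F" "{vs ! 1, vs ! 2} : F" "{vs ! 2, vs ! 3} : F" "{vs ! 3, vs ! 0} : F" by (rule e'; simp add: 2)+
  hence ee: "{p, q} : F" "{q, u} : F" "{u, v} : F" "{v, p} : F" by (simp_all add: v numeral_3_eq_3)
  have "vs ! 0 < 5" "vs ! 1 < 5" "vs ! 2 < 5" "vs ! 3 < 5" by (rule alt(2); simp add: 2)+
  hence lt: "p < 5" "q < 5" "u < 5" "v < 5" by (simp_all add: v numeral_3_eq_3)
  have "c 0 \<noteq> c 1" "c 1 \<noteq> c 2" "c 2 \<noteq> c 3" by (rule alt'; simp add: 2)+
  hence al: "(p < 2) \<noteq> (q < 2)" "(q < 2) \<noteq> (u < 2)" "(u < 2) \<noteq> (v < 2)" by (simp_all add: c_def v numeral_3_eq_3)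
  show ?thesis
  proof (cases "p < 2")
   case True
   hence "p = 0 \<and> u = 1 \<or> p = 1 \<and> u = 0" using al d by auto
   thus ?thesis using four_cycle[of q F v] ee d lt al True by (auto simp: insert_commute)
  next
   case False
   hence "q = 0 \<and> v = 1 \<or> q = 1 \<and> v = 0" using al d by auto
   thus ?thesis using four_cycle[of p F u] ee d lt al False by (auto simp: insert_commute)
  qed
 qed
qed

lemma is_cycle4:
 assumes "distinct [p, q, u, v]" "{p, q} : F" "{q, u} : F" "{u, v} : F" "{v, p} : F"
 shows "is_cycle F [p, q, u, v]" unfolding is_cycle_def
proof (intro conjI allI impI)
 fix i assume "i < length [p, q, u, v]"
 hence i: "i = 0 \<or> i = 1 \<or> i = 2 \<or> i = 3" by fastforce
 have n: "[p, q, u, v] ! 0 = p" "[p, q, u, v] ! 1 = q" "[p, q, u, v] ! 2 = u" "[p, q, u, v] ! 3 = v"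
  by (simp_all add: numeral_3_eq_3 numeral_2_eq_2)
 have l: "length [p, q, u, v] = 4" by simp
 have m: "Suc 0 mod 4 = 1" "Suc 1 mod 4 = 2" "Suc 2 mod 4 = 3" "Suc 3 mod 4 = 0" by simp_all
 show "{[p, q, u, v] ! i, [p, q, u, v] ! (Suc i mod length [p, q, u, v])} : F"
  unfolding l using i by (elim disjE) (simp_all only: n m assms)
qed (use assms(1) in simp_all)

lemma K23_indep: assumes X: "X <= {..<6}" shows "ed ` X : indep matroid_K23 \<longleftrightarrow> X : indep K6"
proof -
 have sub: "ed ` X <= ed ` {..<6}" using X by blast
 have im: "ed ` Q <= ed ` X \<longleftrightarrow> Q <= X" if "Q <= {..<6}" for Q using inj_on_image_mem_iff[OF inj_ed _ X] that by blast
 have Q: "{0,1,2,3} <= {..<6::nat}" "{0,1,4,5} <= {..<6::nat}" "{2,3,4,5} <= {..<6::nat}" by auto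
 have "(\<exists>vs. is_cycle (ed ` X) vs) \<longleftrightarrow> {0,1,2,3} <= X \<or> {0,1,4,5} <= X \<or> {2,3,4,5} <= X"
 proof
  assume "\<exists>vs. is_cycle (ed ` X) vs"
  then obtain vs where "is_cycle (ed ` X) vs" by (rule exE)
  from cycle_contains[OF sub this] show "{0,1,2,3} <= X \<or> {0,1,4,5} <= X \<or> {2,3,4,5} <= X"
   by (simp only: im[OF Q(1)] im[OF Q(2)] im[OF Q(3)])
 next
  have c: "\<exists>vs. is_cycle (ed ` X) vs"
   if e: "{0, b} : ed ` X" "{1, b} : ed ` X" "{0, d} : ed ` X" "{1, d} : ed ` X" and d: "distinct [0, b, 1, d]" for b d
  proof (rule exI, rule is_cycle4[OF d e(1)])
   show "{b, 1} : ed ` X" "{d, 0} : ed ` X" using e(2,3) by (simp_all only: insert_commute)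
  qed (rule e)
  assume "{0,1,2,3} <= X \<or> {0,1,4,5} <= X \<or> {2,3,4,5} <= X"
  thus "\<exists>vs. is_cycle (ed ` X) vs"
  proof (elim disjE)
   assume "{0,1,2,3} <= X"
   hence "ed 0 : ed ` X" "ed 1 : ed ` X" "ed 2 : ed ` X" "ed 3 : ed ` X" by blast+
   from this[unfolded ed_simps] show ?thesis by (rule c) simp
  next
   assume "{0,1,4,5} <= X"
   hence "ed 0 : ed ` X" "ed 1 : ed ` X" "ed 4 : ed ` X" "ed 5 : ed ` X" by blast+
   from this[unfolded ed_simps] show ?thesis by (rule c) simp
  next
   assume "{2,3,4,5} <= X"
   hence "ed 2 : ed ` X" "ed 3 : ed ` X" "ed 4 : ed ` X" "ed 5 : ed ` X" by blast+
   from this[unfolded ed_simps] show ?thesis by (rule c) simp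
  qed
 qed
 moreover have "ed ` X : indep matroid_K23 \<longleftrightarrow> ed ` X <= ground matroid_K23 \<and> \<not> (\<exists>vs. is_cycle (ed ` X) vs)"
  by (simp add: matroid_K23_def graphic_matroid_def)
 ultimately show ?thesis using sub X unfolding K23_ground by (simp add: K6_def)
qed

lemma matroid_isomorphic_trans:
 assumes "matroid_isomorphic A B" "matroid_isomorphic B C"
 shows "matroid_isomorphic A C"
proof -
 obtain f where f: "bij_betw f (ground A) (ground B)" "\<And>I. I <= ground A \<Longrightarrow> I : indep A \<longleftrightarrow> f ` I : indep B"
  using assms(1) unfolding matroid_isomorphic_def by blast
 obtain g where g: "bij_betw g (ground B) (ground C)" "\<And>I. I <= ground B \<Longrightarrow> I : indep B \<longleftrightarrow> g ` I : indep C"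
  using assms(2) unfolding matroid_isomorphic_def by blast
 show ?thesis unfolding matroid_isomorphic_def
 proof (intro exI[of _ "g \<circ> f"] conjI allI impI)
  show "bij_betw (g \<circ> f) (ground A) (ground C)" using bij_betw_trans f(1) g(1) by blast
  fix I assume I: "I <= ground A"
  hence "f ` I <= ground B" using f(1) unfolding bij_betw_def by blast
  thus "I : indep A \<longleftrightarrow> (g \<circ> f) ` I : indep C" using f(2)[OF I] g(2) by (simp add: image_comp)
 qed
qed

lemma matroid_isomorphic_sym:
 assumes "matroid_isomorphic A B"
 shows "matroid_isomorphic B A"
proof -
 obtain f where f: "bij_betw f (ground A) (ground B)" "\<And>I. I <= ground A \<Longrightarrow> I : indep A \<longleftrightarrow> f ` I : indep B"
  using assms(1) unfolding matroid_isomorphic_def by blast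
 let ?g = "inv_into (ground A) f"
 have g: "bij_betw ?g (ground B) (ground A)" by (rule bij_betw_inv_into[OF f(1)])
 show ?thesis unfolding matroid_isomorphic_def
 proof (intro exI[of _ ?g] conjI allI impI g)
  fix I assume I: "I <= ground B"
  have "?g ` I <= ground A" using g I unfolding bij_betw_def by blast
  moreover have "f ` ?g ` I = I" using image_inv_into_cancel[of f "ground A" "ground B" I] f(1) I by (simp add: bij_betw_def)
  ultimately show "I : indep B \<longleftrightarrow> ?g ` I : indep A" using f(2)[of "?g ` I"] by simp
 qed
qed

lemma iso_K6: "matroid_isomorphic K6 matroid_K23" unfolding matroid_isomorphic_def K23_ground
 using inj_ed K23_indep by (intro exI[of _ ed]) (auto simp: K6_def bij_betw_def)

lemma has_type_K23: "has_type L matroid_K23 \<longleftrightarrow> has_type L K6" unfolding has_type_def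
 using matroid_isomorphic_trans[OF _ iso_K6, of "lat_matroid L"]
  matroid_isomorphic_trans[OF _ matroid_isomorphic_sym[OF iso_K6], of "lat_matroid L"] by blast

lemma ground_K6: "ground K6 = {..<6}" by (simp add: K6_def)

lemma simple_K6: "simple_mat K6"
proof -
 have "\<not> Q <= {a, b}" if "card Q = 4" for Q and a b :: nat
 proof
  assume "Q <= {a, b}"
  hence "card Q \<le> card {a, b}" by (intro card_mono) simp_all
  thus False using that card_insert_le_m1[of 2 "{b}" a] by simp
 qed
 from this[of "{0,1,2,3}"] this[of "{0,1,4,5}"] this[of "{2,3,4,5}"]
 show ?thesis by (simp add: simple_mat_def K6_def)
qed

section \<open>Recognizing representations; hyperplanes and meets\<close>

context mat
begin

lemma rk_add: "finite Z \<Longrightarrow> rk M (A Un x ` Z) \<le> rk M A + card Z"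
proof (induction Z rule: finite_induct)
 case (insert z Z)
 thus ?case using unit[of "x z" "A Un x ` Z"] by simp
qed simp

lemma rk_free_down:
 assumes "X <= Y" "finite Y" "rk M (J Un x ` Y) = rk M J + card Y"
 shows "rk M (J Un x ` X) = rk M J + card X"
proof -
 have Y: "J Un x ` Y = (J Un x ` X) Un x ` (Y - X)" using assms(1) by blast
 have "rk M (J Un x ` Y) \<le> rk M (J Un x ` X) + card (Y - X)" unfolding Y using rk_add assms(2) by blast
 moreover have "card Y = card X + card (Y - X)"
  using assms(1,2) card_Diff_subset[of X Y] card_mono[of Y X] finite_subset by fastforce
 moreover have "rk M (J Un x ` X) \<le> rk M J + card X" using rk_add assms finite_subset by blast
 ultimately show ?thesis using assms(3) by linarith
qed

text \<open>Once all \<open>d\<close>-element index sets give bases, smaller ones are independent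
  and larger ones exceed the rank.\<close>

lemma uniform_repI:
 assumes J: "J <= E" "x ` {..<n} <= E" and rE: "rk M E = rk M J + d" and dn: "d \<le> n"
  and base: "\<And>X. X <= {..<n} \<Longrightarrow> card X = d \<Longrightarrow> rk M (J Un x ` X) = rk M E"
 shows "rep J x (uniform_matroid d n) ((\<lambda>X. cl M (J Un x ` X)) ` Pow {..<n})" unfolding rep_def ground_uniform
proof (intro conjI allI impI J refl)
 have le: "rk M (J Un x ` X) \<le> rk M E" if "X <= {..<n}" for X by (rule rk_mono) (use J that in blast)
 obtain B where B: "B <= {..<n}" "card B = d" using obtain_subset_with_card_n[of d "{..<n}"] dn by auto
 have "rk M (J Un x ` B) \<le> rk M (J Un x ` {..<n})" by (rule rk_mono) (use B in blast)
 thus "rk M (J Un x ` {..<n}) = rk M E" using base[OF B] le[OF order_refl] by simp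
 fix X assume X: "X <= {..<n}"
 have fX: "finite X" using X finite_subset by blast
 show "X : indep (uniform_matroid d n) \<longleftrightarrow> rk M (J Un x ` X) = rk M J + card X"
 proof
  assume "X : indep (uniform_matroid d n)"
  hence "card X \<le> d" by (simp add: indep_uniform)
  then obtain Y where Y: "X <= Y" "Y <= {..<n}" "card Y = d" using exists_subset_between[of X d "{..<n}"] X dn by auto
  show "rk M (J Un x ` X) = rk M J + card X"
   using rk_free_down[OF Y(1)] base[OF Y(2,3)] rE Y(3) finite_subset[OF Y(2)] by simp
 next
  assume "rk M (J Un x ` X) = rk M J + card X"
  thus "X : indep (uniform_matroid d n)" using le[OF X] rE X by (simp add: indep_uniform)
 qed
qed

text \<open>A set containing no circuit misses an element from each of two serial pairs, so it lies
  in one of the twelve bases.\<close>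

lemma K6_repI:
 assumes J: "J <= E" "x ` {..<6} <= E" and rE: "rk M E = rk M J + 4"
  and cyc: "\<And>Q. Q : {{0,1,2,3},{0,1,4,5},{2,3,4,5}} \<Longrightarrow> rk M (J Un x ` Q) = rk M J + 3"
  and base: "\<And>p q. p : {2,3} \<Longrightarrow> q : {4,5} \<Longrightarrow> rk M (J Un x ` {0,1,p,q}) = rk M E"
   "\<And>p q. p : {0,1} \<Longrightarrow> q : {4,5} \<Longrightarrow> rk M (J Un x ` {2,3,p,q}) = rk M E"
   "\<And>p q. p : {0,1} \<Longrightarrow> q : {2,3} \<Longrightarrow> rk M (J Un x ` {4,5,p,q}) = rk M E"
 shows "rep J x K6 ((\<lambda>X. cl M (J Un x ` X)) ` Pow {..<6})" unfolding rep_def ground_K6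
proof (intro conjI allI impI J refl)
 have "rk M (J Un x ` {0,1,2,4}) \<le> rk M (J Un x ` {..<6})" by (rule rk_mono) (auto simp: lt6)
 moreover have "rk M (J Un x ` {..<6}) \<le> rk M E" by (rule rk_mono) (use J in blast)
 ultimately show "rk M (J Un x ` {..<6}) = rk M E" using base(1)[of 2 4] by simp
 fix X :: "nat set" assume X: "X <= {..<6}"
 have fX: "finite X" using X finite_subset by blast
 show "X : indep K6 \<longleftrightarrow> rk M (J Un x ` X) = rk M J + card X"
 proof
  assume r: "rk M (J Un x ` X) = rk M J + card X"
  have no: "\<not> Q <= X" if "Q : {{0,1,2,3},{0,1,4,5},{2,3,4,5}}" for Q
  proof
   assume "Q <= X"
   moreover have "card Q = 4" using that by auto
   ultimately show False using rk_free_down[OF _ fX r] cyc[OF that] by simp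
  qed
  from no[of "{0,1,2,3}"] no[of "{0,1,4,5}"] no[of "{2,3,4,5}"] show "X : indep K6" using X by (simp add: K6_def)
 next
  assume "X : indep K6"
  hence nc: "\<not> {0,1,2,3} <= X" "\<not> {0,1,4,5} <= X" "\<not> {2,3,4,5} <= X" by (simp_all add: K6_def)
  have down: "rk M (J Un x ` X) = rk M J + card X"
   if "X <= {a, b, p, q}" "card {a, b, p, q} = 4" "rk M (J Un x ` {a, b, p, q}) = rk M E" for a b p q :: nat
   by (rule rk_free_down[OF that(1)]) (use that(2,3) rE in simp_all)
  have pick: "\<exists>p\<in>{a, b}. X Int {a, b} <= {p}" if "\<not> {a, b} <= X" for a b using that by auto
  have X6: "X <= {0,1,2,3,4,5}" using X lt6 by blast
  consider "\<not> {2,3} <= X \<and> \<not> {4,5} <= X" | "\<not> {0,1} <= X \<and> \<not> {4,5} <= X" | "\<not> {0,1} <= X \<and> \<not> {2,3} <= X" using nc by blast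
  thus "rk M (J Un x ` X) = rk M J + card X"
  proof cases
   case 1
   then obtain p q where pq: "p : {2,3}" "X Int {2,3} <= {p}" "q : {4,5}" "X Int {4,5} <= {q}" using pick by meson
   have "X <= {0,1,p,q}" using X6 pq(2,4) by blast
   thus ?thesis using base(1)[OF pq(1,3)] pq(1,3) by (intro down[of 0 1 p q]) auto
  next
   case 2
   then obtain p q where pq: "p : {0,1}" "X Int {0,1} <= {p}" "q : {4,5}" "X Int {4,5} <= {q}" using pick by meson
   have "X <= {2,3,p,q}" using X6 pq(2,4) by blast
   thus ?thesis using base(2)[OF pq(1,3)] pq(1,3) by (intro down[of 2 3 p q]) auto
  next
   case 3
   then obtain p q where pq: "p : {0,1}" "X Int {0,1} <= {p}" "q : {2,3}" "X Int {2,3} <= {q}" using pick by meson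
   have "X <= {4,5,p,q}" using X6 pq(2,4) by blast
   thus ?thesis using base(3)[OF pq(1,3)] pq(1,3) by (intro down[of 4 5 p q]) auto
  qed
 qed
qed

context
 fixes J x and N :: "'b matroid" and L
 assumes rep: "rep J x N L" and simple: "simple_mat N"
begin

text \<open>A largest index set of rank below that of \<open>E\<close> becomes spanning with one
  more index, so it spans a hyperplane.\<close>

lemma rep_above:
 assumes F: "F : L" "rk M F < rk M E"
 shows "\<exists>H\<in>L. F <= H \<and> Suc (rk M H) = rk M E"
proof -
 obtain X where X: "X <= ground N" "F = cl M (J Un x ` X)" using F(1) unfolding L_eq[OF rep simple] by blast
 have fin: "finite Y" if "Y <= ground N" for Y using simple that finite_subset unfolding simple_mat_def by blast
 have rX: "rk M (J Un x ` X) < rk M E" using F(2) X rep_rank[OF rep simple X(1)] by simp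
 let ?P = "\<lambda>Y. X <= Y \<and> Y <= ground N \<and> rk M (J Un x ` Y) < rk M E"
 have "\<exists>Y. ?P Y \<and> (\<forall>Z. ?P Z \<longrightarrow> card Z \<le> card Y)"
 proof (rule ex_has_greatest_nat[of ?P X card "Suc (card (ground N))"])
  show "?P X" using X rX by blast
  show "\<forall>Z. ?P Z \<longrightarrow> card Z < Suc (card (ground N))" using card_mono[OF fin[OF order_refl]] less_Suc_eq_le by blast
 qed
 then obtain Y where Y: "X <= Y" "Y <= ground N" "rk M (J Un x ` Y) < rk M E" and max: "\<And>Z. ?P Z \<Longrightarrow> card Z \<le> card Y" by blast
 have "Y \<noteq> ground N" using Y(3) rep_span[OF rep simple] by auto
 then obtain n where n: "n : ground N" "n ~: Y" using Y(2) by blast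
 have "\<not> card (n+:Y) \<le> card Y" using n fin[OF Y(2)] by simp
 hence "\<not> ?P (n+:Y)" using max by blast
 hence "\<not> rk M (J Un x ` n+:Y) < rk M E" using Y n by blast
 hence "Suc (rk M (J Un x ` Y)) = rk M E" using Y(3) unit[of "x n" "J Un x ` Y"] by simp
 hence "Suc (rk M (cl M (J Un x ` Y))) = rk M E" using rep_rank[OF rep simple Y(2)] by simp
 moreover have "F <= cl M (J Un x ` Y)" unfolding X(2) by (rule cl_mono) (use Y(1) in blast)
 ultimately show ?thesis using rep_mem[OF rep simple Y(2)] by blast
qed

definition closedN :: "'b set \<Rightarrow> bool" where
 "closedN Y \<longleftrightarrow> Y <= ground N \<and> (\<forall>n\<in>ground N - Y. x n ~: C (J Un x ` Y))"

text \<open>Members of \<open>L\<close> are spanned by index sets, so the meet in \<open>L\<close>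
  is governed by the common indices; it may be smaller than the intersection of the flats.\<close>

lemma rep_meet:
 assumes Y: "closedN Y" "closedN Z"
 shows "lat_meet L (cl M (J Un x ` Y)) (cl M (J Un x ` Z)) = cl M (J Un x ` (Y Int Z))"
proof
 have YZ: "Y <= ground N" "Z <= ground N" using Y by (simp_all add: closedN_def)
 have sub: "X <= Y" if "closedN Y" "X <= ground N" "cl M (J Un x ` X) <= cl M (J Un x ` Y)" for X Y
 proof
  fix n assume n: "n : X"
  have "x n : cl M (J Un x ` X)" using sub_cl[OF rep_sub[OF rep simple that(2)]] n by blast
  hence "x n : C (J Un x ` Y)" using that(3) unfolding cl_C by blast
  thus "n : Y" using that(1,2) n unfolding closedN_def by blast
 qed
 show "lat_meet L (cl M (J Un x ` Y)) (cl M (J Un x ` Z)) <= cl M (J Un x ` (Y Int Z))" unfolding lat_meet_def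
 proof (rule Union_least)
  fix D assume "D : {D : L. D <= cl M (J Un x ` Y) Int cl M (J Un x ` Z)}"
  then obtain X where X: "X <= ground N" "D = cl M (J Un x ` X)" "D <= cl M (J Un x ` Y)" "D <= cl M (J Un x ` Z)"
   unfolding L_eq[OF rep simple] by blast
  have "X <= Y Int Z" using sub[OF Y(1) X(1)] sub[OF Y(2) X(1)] X(2-4) by blast
  thus "D <= cl M (J Un x ` (Y Int Z))" unfolding X(2) by (intro cl_mono) blast
 qed
 have "cl M (J Un x ` (Y Int Z)) : L" by (rule rep_mem[OF rep simple]) (use YZ in blast)
 moreover have "cl M (J Un x ` (Y Int Z)) <= cl M (J Un x ` Y)" "cl M (J Un x ` (Y Int Z)) <= cl M (J Un x ` Z)"
  by (rule cl_mono; blast)+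
 ultimately show "cl M (J Un x ` (Y Int Z)) <= lat_meet L (cl M (J Un x ` Y)) (cl M (J Un x ` Z))" unfolding lat_meet_def by blast
qed

end

end

context mat
begin

context
 fixes J x and N :: "'b matroid" and L
 assumes rep: "rep J x N L" and simple: "simple_mat N"
begin

abbreviation spn where "spn X \<equiv> cl M (J Un x ` X)"

lemma fin_N: "X <= ground N \<Longrightarrow> finite X" using simple finite_subset unfolding simple_mat_def by blast

lemma C_spn: "X <= ground N \<Longrightarrow> C (spn X) = C (J Un x ` X)" by (rule C_cl[OF rep_sub[OF rep simple]])

lemma rep_notin:
 assumes n: "n+:X <= ground N" "n+:X : indep N" "n ~: X"
 shows "x n ~: C (J Un x ` X)"
proof
 assume "x n : C (J Un x ` X)"
 hence "rk M (J Un x ` n+:X) = rk M (J Un x ` X)" using r_in by simp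
 moreover have fX: "finite X" using fin_N[OF n(1)] by simp
 have "rk M (J Un x ` X) \<le> rk M J + card X" by (rule rk_add[OF fX])
 moreover have "rk M (J Un x ` n+:X) = rk M J + card (n+:X)" using rep_indep[OF rep simple n(1)] n(2) by simp
 moreover have "card (n+:X) = Suc (card X)" using fX n(3) by simp
 ultimately show False by linarith
qed

lemma rep_tri:
 assumes sub: "X <= ground N" "u : ground N" "v : ground N" "w : ground N"
  and ind: "u+:v+:X : indep N" "u+:w+:X : indep N" "v+:w+:X : indep N"
  and ne: "u ~: X" "v ~: X" "w ~: X" "u \<noteq> v" "u \<noteq> w" "v \<noteq> w"
 shows "tri (x ` ground N) (spn X)"
proof -
 have fin: "finite (J Un x ` X)" "finite (spn X)" using fin_sub[OF rep_sub[OF rep simple sub(1)]] fin_cl by blast+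
 have ins: "C ((x n)+:(spn X)) = C (J Un x ` n+:X)" for n using C_Un_cong[OF fin(2,1) C_spn[OF sub(1)], of "{x n}"] by simp
 have "x v ~: C (J Un x ` u+:X)" by (rule rep_notin) (use sub ind(1) ne in \<open>auto simp: insert_commute\<close>)
 moreover have "x w ~: C (J Un x ` u+:X)" by (rule rep_notin) (use sub ind(2) ne in \<open>auto simp: insert_commute\<close>)
 moreover have "x w ~: C (J Un x ` v+:X)" by (rule rep_notin) (use sub ind(3) ne in \<open>auto simp: insert_commute\<close>)
 moreover have "x u ~: C (J Un x ` v+:X)" by (rule rep_notin) (use sub ind(1) ne in auto)
 hence "x u ~: C (spn X)" using C_spn[OF sub(1)] C_mono[of "J Un x ` X" "J Un x ` v+:X"] by blast
 ultimately show ?thesis using sub by (intro triI[of "x u" _ "x v" "x w"]) (simp_all only: ins imageI not_False_eq_True)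
qed

lemma rep_tri_E:
 assumes "tri (x ` ground N) F" shows "tri E F" by (rule tri_mono[OF assms]) (use x_E[OF rep simple] in blast)

lemma rep_rank_indep: "X <= ground N \<Longrightarrow> X : indep N \<Longrightarrow> rk M (spn X) = rk M J + card X"
 using rep_indep[OF rep simple] rep_rank[OF rep simple] by simp

lemma rep_hyp:
 assumes d: "rk M E = Suc (rk M J + d)" and H: "H : L" "Suc (rk M H) = rk M E"
 shows "\<exists>X. X <= ground N \<and> X : indep N \<and> card X = d \<and> H = spn X"
proof -
 obtain X where X: "X <= ground N" "X : indep N" "H = spn X" "rk M H = rk M J + card X"
  using rep_basis[OF rep simple H(1)] by blast
 have "card X = d" using X(4) d H(2) by linarith
 thus ?thesis using X by blast
qed

lemma E_in_L: "E : L"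
proof -
 have "spn (ground N) = E" using cl_ground_iff[OF rep_sub[OF rep simple order_refl]] rep_span[OF rep simple] by blast
 thus ?thesis using rep_mem[OF rep simple order_refl] by simp
qed

end

end

section \<open>Cocycles on subconstellations\<close>

text \<open>\<open>E_cut\<close> singles out the case with a nonempty poset to consider: each class
  requires the top to lie in the cut.\<close>

locale cocycle = mat M for M :: "'a matroid" +
 fixes \<Gamma> :: "'a set set" and a :: "'a constellation \<Rightarrow> 'a constellation \<Rightarrow> 'b::ab_group_add"
 assumes mcut: "modular_cut M \<Gamma>" and E_cut: "E : \<Gamma>"
  and cocycle: "\<And>u v w. {u, v, w} : Sigma2 M (flats M, \<Gamma>) \<Longrightarrow> a u v + a v w = a u w"
begin

abbreviation "\<X> \<equiv> X2 M (flats M, \<Gamma>)"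

lemma Union_flats: "\<Union>(flats M) = E" using Union_usub[OF flats_usub(2)] flats_usub(1) by simp

lemma cut_flat: "F : \<Gamma> \<Longrightarrow> F : flats M" using mcut unfolding modular_cut_def by blast

lemma cut_up: "F : \<Gamma> \<Longrightarrow> G : flats M \<Longrightarrow> F <= G \<Longrightarrow> G : \<Gamma>" using mcut unfolding modular_cut_def by blast

lemma cut_modular: "F : \<Gamma> \<Longrightarrow> G : \<Gamma> \<Longrightarrow> rk M F + rk M G = rk M (F Int G) + rk M (cl M (F Un G)) \<Longrightarrow> F Int G : \<Gamma>"
 using mcut unfolding modular_cut_def by blast

lemma a_add:
 assumes "u : \<X>" "v : \<X>" "w : \<X>" "fst u <= fst v" "fst v <= fst w"
 shows "a u v + a v w = a u w"
proof (rule cocycle)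
 have "fst u <= fst w" using assms(4,5) by blast
 thus "{u, v, w} : Sigma2 M (flats M, \<Gamma>)"
  using assms by (simp add: Sigma2_def order_complex_def Complete_Partial_Order.chain_def sub_le_def)
qed

lemma X2_sub: assumes "\<sigma> : \<X>"
 shows "upper_sublattice M (fst \<sigma>)" "snd \<sigma> = \<Gamma> Int fst \<sigma>" "E : fst \<sigma>" "F : fst \<sigma> \<Longrightarrow> F : flats M"
proof -
 have "\<sigma> : subconstellations M (flats M, \<Gamma>)" using assms by (simp add: X2_def)
 then obtain L where L: "\<sigma> = (L, \<Gamma> Int L)" "upper_sublattice M L" unfolding subconstellations_def by auto
 thus u: "upper_sublattice M (fst \<sigma>)" "snd \<sigma> = \<Gamma> Int fst \<sigma>" by simp_all
 obtain I U where IU: "ups I U" "fst \<sigma> = usub I U" using u(1) unfolding upper_sublattice_iff by blast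
 show "E : fst \<sigma>" "F : fst \<sigma> \<Longrightarrow> F : flats M" using usub_top[OF IU(1)] usub_flat[OF IU(1)] IU(2) by auto
qed

definition off :: "'a set \<Rightarrow> bool" where
 "off H \<longleftrightarrow> H : flats M \<and> Suc (rk M H) = rk M E \<and> H ~: \<Gamma>"

lemma sub_constellation: "rep J x N L \<Longrightarrow> simple_mat N \<Longrightarrow> (L, \<Gamma> Int L) : subconstellations M (flats M, \<Gamma>)"
 unfolding subconstellations_def using rep_upper by fastforce

text \<open>A flat below an off hyperplane is off the cut, because cuts are closed upwards; this
  leaves the hyperplanes and the top.\<close>

lemma cut_lattice:
 assumes rep: "rep J x N L" and simple: "simple_mat N"
  and up: "\<And>F. F : L \<Longrightarrow> rk M F + 2 \<le> rk M E \<Longrightarrow> \<exists>H\<in>L. F <= H \<and> off H"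
 shows "\<Gamma> Int L = E+:{H : L. Suc (rk M H) = rk M E \<and> H : \<Gamma>}"
proof
 show "E+:{H : L. Suc (rk M H) = rk M E \<and> H : \<Gamma>} <= \<Gamma> Int L" using E_cut E_in_L[OF rep simple] by blast
 show "\<Gamma> Int L <= E+:{H : L. Suc (rk M H) = rk M E \<and> H : \<Gamma>}"
 proof
  fix F assume F: "F : \<Gamma> Int L"
  have le: "rk M F \<le> rk M E" using rk_mono[of F E] flatD(1) cut_flat F by blast
  have "\<not> rk M F + 2 \<le> rk M E"
  proof
   assume "rk M F + 2 \<le> rk M E"
   then obtain H where H: "F <= H" "off H" using up F by blast
   thus False using cut_up[of F H] F unfolding off_def by blast
  qed
  then consider "rk M F = rk M E" | "Suc (rk M F) = rk M E" using le by linarith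
  thus "F : E+:{H : L. Suc (rk M H) = rk M E \<and> H : \<Gamma>}"
  proof cases
   case 1
   hence "F = E" using flat_eqI[OF _ ground_flat, of F] cut_flat flatD(1) F by auto
   thus ?thesis by blast
  qed (use F in blast)
 qed
qed

lemma cut_trivial:
 assumes rep: "rep J x N L" and simple: "simple_mat N"
  and hyp: "\<And>H. H : L \<Longrightarrow> Suc (rk M H) = rk M E \<Longrightarrow> H ~: \<Gamma>"
 shows "\<Gamma> Int L = {E}"
proof -
 have "\<exists>H\<in>L. F <= H \<and> off H" if F: "F : L" "rk M F + 2 \<le> rk M E" for F
 proof -
  have "rk M F < rk M E" using F(2) by linarith
  from rep_above[OF rep simple F(1) this] obtain H where H: "H : L" "F <= H" "Suc (rk M H) = rk M E" by blast
  thus ?thesis using hyp[OF H(1,3)] rep_flat[OF rep simple] unfolding off_def by blast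
 qed
 from cut_lattice[OF rep simple this] show ?thesis using hyp by auto
qed

lemma Pow_1: "Pow {..<1::nat} = {{}, {0}}" by auto

lemma lt2: "{..<2::nat} = {0, 1}" and lt3: "{..<3::nat} = {0, 1, 2}" and lt4: "{..<4::nat} = {0, 1, 2, 3}" by auto

lemma class0_in: assumes "off H" shows "({H, E}, {E}) : \<X>"
proof -
 have H: "H : flats M" "Suc (rk M H) = rk M E" "H ~: \<Gamma>" using assms by (simp_all add: off_def)
 have HE: "H <= E" "cl M H = H" using flatD H(1) by blast+
 obtain e where e: "e : E" "e ~: C H" using ex_notin_C[OF fin_ground HE(1)] H(2) by fastforce
 have r: "rk M (e+:H) = rk M E" using r_notin[OF e(2)] H(2) by simp
 have X: "X = {0}" if "X <= {..<1}" "card X = 1" for X :: "nat set"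
  using that Pow_1 by (metis PowI card.empty insertE singletonD zero_neq_one)
 let ?x = "\<lambda>_::nat. e"
 have "rep H ?x (uniform_matroid 1 1) ((\<lambda>X. cl M (H Un ?x ` X)) ` Pow {..<1})"
 proof (rule uniform_repI[OF HE(1)])
  show "rk M (H Un ?x ` X) = rk M E" if "X <= {..<1}" "card X = 1" for X unfolding X[OF that] using r by simp
 qed (use e H(2) in auto)
 moreover have "cl M (e+:H) = E" using cl_ground_iff[of "e+:H"] HE(1) e(1) r by simp
 hence "(\<lambda>X. cl M (H Un ?x ` X)) ` Pow {..<1::nat} = {H, E}" unfolding Pow_1 using HE by simp
 ultimately have rep: "rep H ?x (uniform_matroid 1 1) {H, E}" by simp
 have simple: "simple_mat (uniform_matroid 1 1)" by (rule simple_uniform) simp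
 have "\<Gamma> Int {H, E} = {E}" using E_cut H(3) by blast
 thus ?thesis using sub_constellation[OF rep simple] rep_type[OF rep simple] Union_flats by (simp add: X2_def class0_def)
qed

lemma indecomposable_flats:
 assumes "F : flats M" "rk M F + 2 = rk M E" shows "indecomposable (flats M) F \<longleftrightarrow> tri E F"
 using indecomposable_iff[OF flats_usub(2) _ assms(2)] assms(1) flats_usub(1) by simp

lemma class1_in:
 assumes F: "F : flats M" "F <= H" "F <= H'" "rk M F + 2 = rk M E" "tri E F" and H: "off H" "off H'" "H \<noteq> H'"
 shows "({F, H, H', E}, {E}) : \<X>"
proof -
 have h: "H : flats M" "Suc (rk M H) = rk M E" "H ~: \<Gamma>" "H' : flats M" "Suc (rk M H') = rk M E" "H' ~: \<Gamma>"
  using H by (simp_all add: off_def)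
 have sE: "F <= E" "H <= E" "H' <= E" "cl M F = F" "cl M H = H" "cl M H' = H'" using flatD F(1) h by blast+
 obtain p where p: "p : H" "p ~: C F" using ex_notin_C[OF fin_sub[OF sE(2)] F(2)] F(4) h(2) by fastforce
 obtain q where q: "q : H'" "q ~: C F" using ex_notin_C[OF fin_sub[OF sE(3)] F(3)] F(4) h(5) by fastforce
 have sub: "p+:F <= H" "q+:F <= H'" using p q F by blast+
 have clp: "cl M (p+:F) = H" using cl_rank_eq[OF sub(1)] r_notin[OF p(2)] h(2) F(4) sE(5) by simp
 have clq: "cl M (q+:F) = H'" using cl_rank_eq[OF sub(2)] r_notin[OF q(2)] h(5) F(4) sE(6) by simp
 have qp: "q ~: C (p+:F)"
 proof
  assume "q : C (p+:F)"
  hence "q : H" using clp q(1) sE(3) cl_C by blast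
  hence "H' <= H" using clq cl_least[of "q+:F" H] F(2) h(1) by blast
  thus False using flat_eqI[OF h(4,1)] h(2,5) H(3) by simp
 qed
 have r: "rk M (q+:p+:F) = rk M E" using r_insert2[OF p(2) qp] F(4) by simp
 let ?x = "(!) [p, q]"
 have X: "X = {0, 1}" if "X <= {..<2}" "card X = 2" for X :: "nat set" using that card_subset_eq[of "{..<2}" X] lt2 by simp
 have P: "Pow {..<2::nat} = {{}, {0}, {1}, {0, 1}}" unfolding lt2 by (simp add: Pow_insert) blast
 have im: "?x ` {0} = {p}" "?x ` {1} = {q}" "?x ` {0, 1} = {p, q}" by simp_all
 have U: "F Un {p, q} = q+:p+:F" by blast
 have "rep F ?x (uniform_matroid 2 2) ((\<lambda>X. cl M (F Un ?x ` X)) ` Pow {..<2})"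
 proof (rule uniform_repI[OF sE(1)])
  show "?x ` {..<2} <= E" unfolding lt2 im using p q sE by blast
  show "rk M (F Un ?x ` X) = rk M E" if "X <= {..<2}" "card X = 2" for X unfolding X[OF that] im U r ..
 qed (use F(4) in simp_all)
 moreover have "cl M (q+:p+:F) = E" using cl_ground_iff[of "q+:p+:F"] r p q sE by blast
 hence c: "cl M (F Un {p, q}) = E" "cl M (F Un {p}) = H" "cl M (F Un {q}) = H'" "cl M (F Un ?x ` {}) = F"
  unfolding U using clp clq sE(4) by simp_all
 have "(\<lambda>X. cl M (F Un ?x ` X)) ` Pow {..<2} = {F, H, H', E}"
  unfolding P by (simp only: image_insert[of "\<lambda>X. cl M (F Un ?x ` X)"] image_empty[of "\<lambda>X. cl M (F Un ?x ` X)"] im c)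
 ultimately have rep: "rep F ?x (uniform_matroid 2 2) {F, H, H', E}" by simp
 have simple: "simple_mat (uniform_matroid 2 2)" by (rule simple_uniform) simp
 have "\<Gamma> Int {F, H, H', E} = {E}"
 proof (rule cut_trivial[OF rep simple])
  fix G assume "G : {F, H, H', E}" "Suc (rk M G) = rk M E"
  thus "G ~: \<Gamma>" using h F(4) by auto
 qed
 moreover have "indecomposable (flats M) (\<Inter>{F, H, H', E})"
  using rep_Inter[OF rep simple] sE(4) indecomposable_flats[OF F(1,4)] F(5) by simp
 ultimately show ?thesis
  using sub_constellation[OF rep simple] rep_type[OF rep simple] Union_flats by (simp add: X2_def class1_def)
qed

definition s0 :: "'a set \<Rightarrow> 'a constellation" where
 "s0 H = ({H, E}, {E})"

definition s1 :: "'a set \<Rightarrow> 'a set \<Rightarrow> 'a constellation" where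
 "s1 H H' = ({H Int H', H, H', E}, {E})"

text \<open>The value of the cocycle along the path from \<open>s0 H\<close> up to
  \<open>s1 H H'\<close> and down to \<open>s0 H'\<close>; pairs that are not adjacent get
  0.\<close>

definition b :: "'a set \<Rightarrow> 'a set \<Rightarrow> 'b" where
 "b H H' = (if off H \<and> off H' \<and> H \<noteq> H' \<and> rk M (H Int H') + 2 = rk M E \<and> tri E (H Int H')
   then a (s0 H) (s1 H H') - a (s0 H') (s1 H H') else 0)"

lemma s1_sym: "s1 H H' = s1 H' H" unfolding s1_def by (simp add: insert_commute Int_commute)

lemma b_anti: "b H' H = - b H H'" unfolding b_def s1_sym[of H' H] by (auto simp: Int_commute)

text \<open>An element of the poset that contains \<open>H\<close>, \<open>H'\<close> and their meet
  lies above \<open>s1 H H'\<close>, so it computes the same value. Around a cell of class 2 the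
  values therefore telescope.\<close>

lemma b_eq:
 assumes \<sigma>: "\<sigma> : \<X>" "F : fst \<sigma>" "H : fst \<sigma>" "H' : fst \<sigma>" and F: "F <= H" "F <= H'" "rk M F + 2 = rk M E" "tri E F"
  and H: "off H" "off H'"
 shows "b H H' = a (s0 H) \<sigma> - a (s0 H') \<sigma>"
proof (cases "H = H'")
 case False
 have h: "H : flats M" "Suc (rk M H) = rk M E" "H' : flats M" "Suc (rk M H') = rk M E" using H by (simp_all add: off_def)
 have Fl: "F : flats M" using X2_sub(4)[OF \<sigma>(1,2)] .
 have "\<not> H <= H'" using flat_eqI[OF h(1,3)] h(2,4) False by auto
 hence "H Int H' \<subset> H" by blast
 hence "rk M (H Int H') < rk M H" using flat_psubset[OF flat_Int[OF h(1,3)] h(1)] by blast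
 hence "F = H Int H'" using flat_eqI[OF Fl flat_Int[OF h(1,3)]] F(1-3) h(2) by auto
 hence s1: "s1 H H' = ({F, H, H', E}, {E})" by (simp add: s1_def)
 have 1: "s1 H H' : \<X>" unfolding s1 by (rule class1_in[OF Fl F H False])
 have 2: "s0 H : \<X>" "s0 H' : \<X>" unfolding s0_def using class0_in H by blast+
 have "fst (s0 H) <= fst (s1 H H')" "fst (s0 H') <= fst (s1 H H')" "fst (s1 H H') <= fst \<sigma>"
  unfolding s0_def s1 using \<sigma>(2-4) X2_sub(3)[OF \<sigma>(1)] by simp_all
 hence e: "a (s0 H) (s1 H H') + a (s1 H H') \<sigma> = a (s0 H) \<sigma>" "a (s0 H') (s1 H H') + a (s1 H H') \<sigma> = a (s0 H') \<sigma>"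
  using a_add 1 2 \<sigma>(1) by blast+
 have "a (s0 H) (s1 H H') - a (s0 H') (s1 H H') = a (s0 H) \<sigma> - a (s0 H') \<sigma>" unfolding e[symmetric] by simp
 thus ?thesis unfolding b_def using H False F(3,4) \<open>F = H Int H'\<close> by simp
qed (simp add: b_def)

text \<open>\<open>ga\<close> and \<open>co\<close> transport the cut and the cochain from flats to
  arbitrary sets, as \<open>tutte_cochain\<close> requires.\<close>

definition ga :: "'a set \<Rightarrow> bool" where "ga X \<longleftrightarrow> cl M X : \<Gamma>"
definition co :: "'a set \<Rightarrow> 'a set \<Rightarrow> 'b" where "co X Y = b (cl M X) (cl M Y)"

text \<open>For a modular pair of sets the closures are again a modular pair, and they intersect in
  the closure of the intersection.\<close>

lemma cut_ga: "cut E ga" unfolding cut_def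
proof (intro conjI allI impI)
 fix X Y assume "X <= Y" "Y <= E" "ga X"
 thus "ga Y" using cut_up[of "cl M X" "cl M Y"] cl_mono cl_flat unfolding ga_def by blast
next
 fix X Y assume "X <= Y" "Y <= E" "rk M Y = rk M X" "ga Y"
 thus "ga X" using cl_rank_eq unfolding ga_def by metis
next
 fix X Y assume XY: "X <= E" "Y <= E" "ga X" "ga Y" "rk M X + rk M Y = rk M (X Un Y) + rk M (X Int Y)"
 have f: "cl M X : \<Gamma>" "cl M Y : \<Gamma>" using XY by (simp_all add: ga_def)
 have u: "cl M (cl M X Un cl M Y) = cl M (X Un Y)"
  using cl_Un_cl[OF XY(1) cl_sub, of Y] cl_Un_cl[OF XY(2,1)] by (simp add: Un_commute)
 have ru: "rk M (cl M X Un cl M Y) = rk M (X Un Y)"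
  using rk_cl[of "cl M X Un cl M Y"] rk_cl[of "X Un Y"] u cl_sub XY(1,2) by simp
 have sub: "X Int Y <= cl M X Int cl M Y" using sub_cl XY(1,2) by blast
 have sm: "rk M (cl M X Un cl M Y) + rk M (cl M X Int cl M Y) \<le> rk M (cl M X) + rk M (cl M Y)" by (rule submod)
 have ri: "rk M (cl M X Int cl M Y) = rk M (X Int Y)"
  using sm ru rk_mono[OF sub] rk_cl[OF XY(1)] rk_cl[OF XY(2)] XY(5) by linarith
 have "rk M (cl M X) + rk M (cl M Y) = rk M (cl M X Int cl M Y) + rk M (cl M (cl M X Un cl M Y))"
  using u rk_cl[of "X Un Y"] ri rk_cl[OF XY(1)] rk_cl[OF XY(2)] XY(1,2,5) by simp
 hence "cl M X Int cl M Y : \<Gamma>" by (rule cut_modular[OF f])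
 moreover have "cl M (cl M X Int cl M Y) = cl M X Int cl M Y" using flatD(2)[OF flat_Int] cl_flat XY(1,2) by blast
 moreover have "cl M (cl M X Int cl M Y) = cl M (X Int Y)" by (rule cl_rank_eq[OF sub ri])
 ultimately show "ga (X Int Y)" unfolding ga_def by simp
qed

lemma offI: "X <= E \<Longrightarrow> Suc (rk M X) = rk M E \<Longrightarrow> \<not> ga X \<Longrightarrow> off (cl M X)" unfolding off_def ga_def using cl_flat rk_cl by simp

lemma co_eq:
 assumes \<sigma>: "\<sigma> : \<X>" "cl M L : fst \<sigma>" "cl M X : fst \<sigma>" "cl M Y : fst \<sigma>"
  and L: "L <= X" "L <= Y" "X <= E" "Y <= E" "rk M L + 2 = rk M E" "tri E L"
  and H: "off (cl M X)" "off (cl M Y)"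
 shows "co X Y = a (s0 (cl M X)) \<sigma> - a (s0 (cl M Y)) \<sigma>" unfolding co_def
proof (rule b_eq[OF \<sigma>])
 have LE: "L <= E" using L by blast
 show "cl M L <= cl M X" "cl M L <= cl M Y" using cl_mono L by blast+
 show "rk M (cl M L) + 2 = rk M E" using rk_cl[OF LE] L(5) by simp
 show "tri E (cl M L)" using tri_cong[OF C_cl[OF LE] fin_cl fin_sub[OF LE]] L(6) by blast
qed (rule H)+

end

lemma lt4: "{..<4::nat} = {0, 1, 2, 3}" by auto

lemma card2_3: assumes "X <= {..<3::nat}" "card X = 2" shows "X = {0,1} \<or> X = {0,2} \<or> X = {1,2}"
proof -
 obtain p q where pq: "X = {p,q}" "p \<noteq> q" using assms(2) card_2_iff by metis
 hence "p = 0 \<or> p = 1 \<or> p = 2" "q = 0 \<or> q = 1 \<or> q = 2" using assms(1) by auto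
 thus ?thesis using pq by (elim disjE) (simp_all add: doubleton_eq_iff)
qed

lemma card2_4:
 assumes "X <= {..<4::nat}" "card X = 2"
 shows "X = {0,1} \<or> X = {0,2} \<or> X = {0,3} \<or> X = {1,2} \<or> X = {1,3} \<or> X = {2,3}"
proof -
 obtain p q where pq: "X = {p,q}" "p \<noteq> q" using assms(2) card_2_iff by metis
 hence "p = 0 \<or> p = 1 \<or> p = 2 \<or> p = 3" "q = 0 \<or> q = 1 \<or> q = 2 \<or> q = 3" using assms(1) by auto
 thus ?thesis using pq by (elim disjE) (simp_all add: doubleton_eq_iff)
qed

lemma card3_4:
 assumes "X <= {..<4::nat}" "card X = 3"
 shows "X = {0,1,2} \<or> X = {0,1,3} \<or> X = {0,2,3} \<or> X = {1,2,3}"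
proof -
 have "card ({..<4} - X) = 1" using card_Diff_subset[OF finite_subset[OF assms(1)] assms(1)] assms(2) by simp
 then obtain i where i: "{..<4} - X = {i}" using card_1_singletonE by blast
 hence X: "X = {0,1,2,3} - {i}" using assms(1) lt4 by blast
 have "i = 0 \<or> i = 1 \<or> i = 2 \<or> i = 3" using i lt4 by blast
 thus ?thesis unfolding X by (elim disjE) (simp_all add: insert_Diff_if)
qed

lemma K6_three:
 assumes X: "X <= {..<6::nat}" "card X = 3"
 shows "X <= {0,1,2,3} \<or> X <= {0,1,4,5} \<or> X <= {2,3,4,5} \<or> (\<exists>p\<in>{0,1}. \<exists>q\<in>{2,3}. \<exists>w\<in>{4,5}. X = {p,q,w})"
proof -
 have X6: "X <= {0,1,2,3,4,5}" using X(1) lt6 by blast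
 consider "X Int {0,1} = {}" | "X Int {2,3} = {}" | "X Int {4,5} = {}" |
  "X Int {0,1} \<noteq> {} \<and> X Int {2,3} \<noteq> {} \<and> X Int {4,5} \<noteq> {}" by blast
 thus ?thesis
 proof cases
  case 4
  then obtain p q w where p: "p : X" "p : {0,1}" and q: "q : X" "q : {2,3}" and w: "w : X" "w : {4,5}" by blast
  have "card {p,q,w} = card X" using p q w X(2) by auto
  hence "X = {p,q,w}" using card_subset_eq[of X "{p,q,w}"] finite_subset[OF X(1)] p q w by simp
  hence "\<exists>p\<in>{0,1}. \<exists>q\<in>{2,3}. \<exists>w\<in>{4,5}. X = {p,q,w}" using p(2) q(2) w(2) by (intro bexI)
  thus ?thesis by simp
 next
  case 1
  hence "X <= {2,3,4,5}" using X6 by blast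
  thus ?thesis by simp
 next
  case 2
  hence "X <= {0,1,4,5}" using X6 by blast
  thus ?thesis by simp
 next
  case 3
  hence "X <= {0,1,2,3}" using X6 by blast
  thus ?thesis by simp
 qed
qed

lemma K6_two:
 assumes X: "X <= {..<6::nat}" "card X = 2"
 shows "X = {0,1} \<or> X = {2,3} \<or> X = {4,5} \<or> (\<exists>p q. X = {p,q} \<and> p < 6 \<and> q < 6 \<and> p div 2 \<noteq> q div 2)"
proof -
 obtain p q where pq: "X = {p,q}" "p \<noteq> q" using X(2) card_2_iff by metis
 hence lt: "p < 6" "q < 6" using X(1) by auto
 show ?thesis
 proof (cases "p div 2 = q div 2")
  case True
  hence "p = 0 \<and> q = 1 \<or> p = 1 \<and> q = 0 \<or> p = 2 \<and> q = 3 \<or> p = 3 \<and> q = 2 \<or> p = 4 \<and> q = 5 \<or> p = 5 \<and> q = 4"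
   using lt pq(2) by presburger
  thus ?thesis using pq(1) by (elim disjE) (simp_all add: insert_commute)
 qed (use pq lt in blast)
qed

lemma K6_cases: "p < 6 \<Longrightarrow> p = 0 \<or> p = 1 \<or> p = 2 \<or> p = 3 \<or> p = 4 \<or> p = 5" for p :: nat by linarith

lemma K6_transversal:
 assumes "p : {0,1}" "q : {2,3}" "w : {4,5}" "n < 6" "n ~: {p,q,w}"
 shows "n+:{p,q,w} : indep K6"
proof -
 have "p = 0 \<or> p = 1" "q = 2 \<or> q = 3" "w = 4 \<or> w = 5" using assms(1-3) by simp_all
 thus ?thesis using K6_cases[OF assms(4)] assms(5) by (elim disjE) (simp_all add: K6_def)
qed

lemma K6_pair:
 assumes "p < 6" "q < 6" "p div 2 \<noteq> q div 2"
 shows "\<exists>u v w. u < 6 \<and> v < 6 \<and> w < 6 \<and> u ~: {p,q} \<and> v ~: {p,q} \<and> w ~: {p,q} \<and> u \<noteq> v \<and> u \<noteq> w \<and> v \<noteq> w \<and>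
   u+:v+:{p,q} : indep K6 \<and> u+:w+:{p,q} : indep K6 \<and> v+:w+:{p,q} : indep K6"
proof -
 \<comment> \<open>\<open>?u\<close> and its successor form the third serial pair, since the indices
   0, 1, 2 of the pairs add up to 3; \<open>?w\<close> is the partner of \<open>p\<close>.\<close>
 let ?u = "2 * (3 - p div 2 - q div 2)" and ?w = "p + 1 - 2 * (p mod 2)"
 show ?thesis by (rule exI[of _ ?u], rule exI[of _ "Suc ?u"], rule exI[of _ ?w])
   (use K6_cases[OF assms(1)] K6_cases[OF assms(2)] assms(3) in \<open>elim disjE; simp add: K6_def\<close>)
qed

context mat
begin

context
 fixes J x and N :: "'b matroid" and L
 assumes rep: "rep J x N L" and simple: "simple_mat N"
begin

lemma closedI: assumes "Y <= ground N" "\<And>n. n : ground N \<Longrightarrow> n ~: Y \<Longrightarrow> n+:Y : indep N" shows "closedN J x N Y"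
 unfolding closedN_def[OF rep simple]
proof (intro conjI ballI assms(1))
 fix n assume "n : ground N - Y"
 thus "x n ~: C (J Un x ` Y)" using assms by (intro rep_notin[OF rep simple]) auto
qed

lemma closed_sub: assumes "closedN J x N Y" "Z <= ground N" "cl M (J Un x ` Z) <= cl M (J Un x ` Y)" shows "Z <= Y"
proof
 fix n assume n: "n : Z"
 have "x n : cl M (J Un x ` Z)" using sub_cl[OF rep_sub[OF rep simple assms(2)]] n by blast
 hence "x n : C (J Un x ` Y)" using assms(3) unfolding cl_C by blast
 thus "n : Y" using assms(1,2) n unfolding closedN_def[OF rep simple] by blast
qed

end

end

section \<open>Cocycle conditions from the classes 2a to 2c\<close>

context cocycle
begin

text \<open>The three hyperplanes generate an element of class 2a above all of them, in which each
  value of \<open>co\<close> is a difference of two terms. The other classes are treated in the same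
  way.\<close>

lemma class_2a_co:
 assumes L: "L <= E" "rk M L + 2 = rk M E" and xyz: "x : E" "y : E" "z : E"
  and r: "rk M (x+:y+:L) = rk M E" "rk M (x+:z+:L) = rk M E" "rk M (y+:z+:L) = rk M E"
  and off: "\<not> ga (x+:L)" "\<not> ga (y+:L)" "\<not> ga (z+:L)"
 shows "co (x+:L) (y+:L) + co (y+:L) (z+:L) = co (x+:L) (z+:L)"
proof -
 let ?x = "(!) [x, y, z]"
 let ?L = "(\<lambda>X. cl M (L Un ?x ` X)) ` Pow {..<3}"
 have im: "?x ` {0,1} = {x,y}" "?x ` {0,2} = {x,z}" "?x ` {1,2} = {y,z}" "?x ` {0} = {x}" "?x ` {1} = {y}" "?x ` {2} = {z}" "?x ` {} = {}"
  by (simp_all add: numeral_2_eq_2)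
 have xE: "?x ` {..<3} <= E" using xyz by (auto simp: lt3 numeral_2_eq_2)
 have rep: "rep L ?x (uniform_matroid 2 3) ?L"
 proof (rule uniform_repI[OF L(1) xE])
  show "rk M (L Un ?x ` X) = rk M E" if "X <= {..<3}" "card X = 2" for X
   using card2_3[OF that] r by (elim disjE) (simp_all only: im, simp_all)
 qed (use L in simp_all)
 have simple: "simple_mat (uniform_matroid 2 3)" by (rule simple_uniform) simp
 have tri: "tri E L" using indep2[of x y L] indep2[of x z L] indep2[of y z L] r L(2) xyz by (intro triI[of x _ y z]) simp_all
 have rX: "rk M (x+:L) + 1 = rk M E" "rk M (y+:L) + 1 = rk M E" "rk M (z+:L) + 1 = rk M E"
  using indep2[of x y L] indep2[of x z L] r L(2) by simp_all
 have "\<Gamma> Int ?L = {E}"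
 proof (rule cut_trivial[OF rep simple])
  fix H assume H: "H : ?L" "Suc (rk M H) = rk M E"
  obtain X where X: "X <= {..<3}" "card X = 1" "H = cl M (L Un ?x ` X)"
   using rep_hyp[OF rep simple _ H, of 1] L(2) unfolding ground_uniform by auto
  obtain i where i: "X = {i}" using X(2) card_1_singletonE by blast
  hence "i = 0 \<or> i = 1 \<or> i = 2" using X(1) by auto
  thus "H ~: \<Gamma>" using off unfolding X(3) i ga_def by (elim disjE) (simp_all only: im, simp_all)
 qed
 hence \<sigma>: "(?L, {E}) : \<X>"
  using sub_constellation[OF rep simple] rep_type[OF rep simple] Union_flats by (simp add: X2_def class2a_def)
 have "cl M (L Un ?x ` X) : ?L" if "X <= {..<3}" for X using that by blast
 from this[of "{}"] this[of "{0}"] this[of "{1}"] this[of "{2}"]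
 have mem: "cl M L : fst (?L, {E})" "cl M (x+:L) : fst (?L, {E})" "cl M (y+:L) : fst (?L, {E})" "cl M (z+:L) : fst (?L, {E})"
  unfolding im by simp_all
 have o: "off (cl M (x+:L))" "off (cl M (y+:L))" "off (cl M (z+:L))" by (rule offI; use L xyz rX off in simp)+
 have c: "co (p+:L) (q+:L) = a (s0 (cl M (p+:L))) (?L, {E}) - a (s0 (cl M (q+:L))) (?L, {E})"
  if "p : {x,y,z}" "q : {x,y,z}" for p q by (rule co_eq[OF \<sigma> mem(1) _ _ _ _ _ _ L(2) tri]) (use that L xyz o mem in auto)
 show ?thesis using c[of x y] c[of y z] c[of x z] by simp
qed

lemma class_2b_co:
 assumes J: "J <= E" "rk M J + 3 = rk M E" and xyz: "x : E" "y : E" "z : E"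
  and r: "rk M (x+:y+:z+:J) = rk M E"
  and tri: "tri E (x+:J)" "tri E (y+:J)" "tri E (z+:J)"
  and off: "\<not> ga (x+:y+:J)" "\<not> ga (x+:z+:J)" "\<not> ga (y+:z+:J)"
 shows "co (x+:y+:J) (x+:z+:J) + co (x+:z+:J) (y+:z+:J)
  = co (x+:y+:J) (y+:z+:J)"
proof -
 let ?x = "(!) [x, y, z]"
 let ?L = "(\<lambda>X. cl M (J Un ?x ` X)) ` Pow {..<3}"
 have im: "?x ` {0,1} = {x,y}" "?x ` {0,2} = {x,z}" "?x ` {1,2} = {y,z}" "?x ` {0} = {x}" "?x ` {1} = {y}" "?x ` {2} = {z}"
  "?x ` {0,1,2} = {x,y,z}" by (simp_all add: numeral_2_eq_2)
 have U: "J Un {p} = p+:J" "J Un {p,q} = p+:q+:J" "J Un {p,q,w} = p+:q+:w+:J" for p q w by blast+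
 have xE: "?x ` {..<3} <= E" using xyz by (auto simp: lt3 numeral_2_eq_2)
 have rep: "rep J ?x (uniform_matroid 3 3) ?L"
 proof (rule uniform_repI[OF J(1) xE])
  show "rk M (J Un ?x ` X) = rk M E" if "X <= {..<3}" "card X = 3" for X
  proof -
   have "X = {0,1,2}" using card_subset_eq[of "{..<3}" X] that lt3 by simp
   thus ?thesis using r by (simp only: im U)
  qed
 qed (use J in simp_all)
 have simple: "simple_mat (uniform_matroid 3 3)" by (rule simple_uniform) simp
 have r3: "rk M (x+:y+:z+:J) = rk M J + 3" using r J(2) by simp
 note i3 = indep3[OF r3]
 have rX: "Suc (rk M (x+:y+:J)) = rk M E" "Suc (rk M (x+:z+:J)) = rk M E" "Suc (rk M (y+:z+:J)) = rk M E"
  using r_notin i3 J(2) by simp_all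
 have r1: "rk M (x+:J) + 2 = rk M E" "rk M (y+:J) + 2 = rk M E" "rk M (z+:J) + 2 = rk M E" using r_notin i3 J(2) by simp_all
 have "\<Gamma> Int ?L = {E}"
 proof (rule cut_trivial[OF rep simple])
  fix H assume H: "H : ?L" "Suc (rk M H) = rk M E"
  obtain X where X: "X <= {..<3}" "card X = 2" "H = cl M (J Un ?x ` X)"
   using rep_hyp[OF rep simple _ H, of 2] J(2) unfolding ground_uniform by auto
  show "H ~: \<Gamma>" using card2_3[OF X(1,2)] off unfolding X(3) ga_def by (elim disjE) (simp_all only: im U not_False_eq_True)
 qed
 moreover have "indecomposable (flats M) F" if F: "F : ?L" "lat_corank ?L F = 2" for F
 proof -
  have rF: "rk M F + 2 = rk M E" using rep_corank[OF rep simple F(1)] F(2) by linarith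
  obtain X where X: "X <= {..<3}" "F = cl M (J Un ?x ` X)" "rk M F = rk M J + card X"
   using rep_basis[OF rep simple F(1)] unfolding ground_uniform by blast
  have "card X = 1" using X(3) rF J(2) by linarith
  then obtain i where i: "X = {i}" using card_1_singletonE by blast
  hence "i = 0 \<or> i = 1 \<or> i = 2" using X(1) by auto
  hence "\<exists>p\<in>{x,y,z}. F = cl M (p+:J)" unfolding X(2) i by (elim disjE) (simp_all only: im U, blast+)
  then obtain p where p: "p : {x,y,z}" "F = cl M (p+:J)" by blast
  have pE: "p+:J <= E" using p(1) xyz J by blast
  have "tri E F" unfolding p(2) using tri_cong[OF C_cl[OF pE] fin_cl fin_sub[OF pE]] p(1) tri by blast
  thus ?thesis using indecomposable_flats[OF rep_flat[OF rep simple F(1)] rF] by blast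
 qed
 ultimately have \<sigma>: "(?L, {E}) : \<X>"
  using sub_constellation[OF rep simple] rep_type[OF rep simple] Union_flats by (simp add: X2_def class2b_def)
 have "cl M (J Un ?x ` X) : fst (?L, {E})" if "X <= {..<3}" for X using that by simp
 from this[of "{0}"] this[of "{1}"] this[of "{2}"] this[of "{0,1}"] this[of "{0,2}"] this[of "{1,2}"]
 have mem: "cl M (x+:J) : fst (?L, {E})" "cl M (y+:J) : fst (?L, {E})" "cl M (z+:J) : fst (?L, {E})"
  "cl M (x+:y+:J) : fst (?L, {E})" "cl M (x+:z+:J) : fst (?L, {E})" "cl M (y+:z+:J) : fst (?L, {E})"
  unfolding im U by simp_all
 have o: "off (cl M (x+:y+:J))" "off (cl M (x+:z+:J))" "off (cl M (y+:z+:J))" by (rule offI; use J xyz rX off in simp)+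
 have 1: "co (x+:y+:J) (x+:z+:J) = a (s0 (cl M (x+:y+:J))) (?L, {E}) - a (s0 (cl M (x+:z+:J))) (?L, {E})"
  by (rule co_eq[OF \<sigma> mem(1,4,5) _ _ _ _ r1(1) tri(1) o(1,2)]) (use J xyz in blast)+
 have 2: "co (x+:z+:J) (y+:z+:J) = a (s0 (cl M (x+:z+:J))) (?L, {E}) - a (s0 (cl M (y+:z+:J))) (?L, {E})"
  by (rule co_eq[OF \<sigma> mem(3,5,6) _ _ _ _ r1(3) tri(3) o(2,3)]) (use J xyz in blast)+
 have 3: "co (x+:y+:J) (y+:z+:J) = a (s0 (cl M (x+:y+:J))) (?L, {E}) - a (s0 (cl M (y+:z+:J))) (?L, {E})"
  by (rule co_eq[OF \<sigma> mem(2,4,6) _ _ _ _ r1(2) tri(2) o(1,3)]) (use J xyz in blast)+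
 show ?thesis unfolding 1 2 3 by simp
qed

lemma class_2c_co:
 assumes J: "J <= E" "rk M J + 3 = rk M E" and xyz: "x : E" "y : E" "z : E" "w : E"
  and r: "rk M (x+:y+:z+:J) = rk M E" "rk M (x+:y+:w+:J) = rk M E"
   "rk M (x+:z+:w+:J) = rk M E" "rk M (y+:z+:w+:J) = rk M E"
  and on: "ga (x+:y+:J)" "ga (z+:w+:J)"
  and off: "\<not> ga (x+:z+:J)" "\<not> ga (x+:w+:J)" "\<not> ga (y+:z+:J)" "\<not> ga (y+:w+:J)"
 shows "co (x+:z+:J) (x+:w+:J) + co (x+:w+:J) (y+:w+:J)
  + co (y+:w+:J) (y+:z+:J) + co (y+:z+:J) (x+:z+:J) = 0"
proof -
 let ?x = "(!) [x, y, z, w]"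
 let ?N = "uniform_matroid 3 4"
 let ?L = "(\<lambda>X. cl M (J Un ?x ` X)) ` Pow {..<4}"
 let ?\<sigma> = "(?L, \<Gamma> Int ?L)"
 have im: "?x ` {0,1} = {x,y}" "?x ` {0,2} = {x,z}" "?x ` {0,3} = {x,w}" "?x ` {1,2} = {y,z}" "?x ` {1,3} = {y,w}" "?x ` {2,3} = {z,w}"
  "?x ` {0} = {x}" "?x ` {1} = {y}" "?x ` {2} = {z}" "?x ` {3} = {w}"
  "?x ` {0,1,2} = {x,y,z}" "?x ` {0,1,3} = {x,y,w}" "?x ` {0,2,3} = {x,z,w}" "?x ` {1,2,3} = {y,z,w}"
  by (simp_all add: numeral_2_eq_2 numeral_3_eq_3)
 have U: "J Un {p} = p+:J" "J Un {p,q} = p+:q+:J" "J Un {p,q,v} = p+:q+:v+:J" for p q v by blast+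
 have xE: "?x ` {..<4} <= E" using xyz by (auto simp: lt4 numeral_2_eq_2 numeral_3_eq_3)
 have rep: "rep J ?x ?N ?L"
 proof (rule uniform_repI[OF J(1) xE])
  show "rk M (J Un ?x ` X) = rk M E" if "X <= {..<4}" "card X = 3" for X
   using card3_4[OF that] r by (elim disjE) (simp_all only: im U)
 qed (use J in simp_all)
 have simple: "simple_mat ?N" by (rule simple_uniform) simp
 have r3: "rk M (x+:y+:z+:J) = rk M J + 3" "rk M (x+:y+:w+:J) = rk M J + 3"
  "rk M (x+:z+:w+:J) = rk M J + 3" "rk M (y+:z+:w+:J) = rk M J + 3" using r J(2) by simp_all
 note i3 = indep3[OF r3(1)] indep3[OF r3(2)] indep3[OF r3(3)] indep3[OF r3(4)]
 have rX: "Suc (rk M (x+:z+:J)) = rk M E" "Suc (rk M (x+:w+:J)) = rk M E"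
  "Suc (rk M (y+:z+:J)) = rk M E" "Suc (rk M (y+:w+:J)) = rk M E" using r_notin i3 J(2) by simp_all
 have r1: "rk M (x+:J) + 2 = rk M E" "rk M (y+:J) + 2 = rk M E" "rk M (z+:J) + 2 = rk M E" "rk M (w+:J) + 2 = rk M E"
  using r_notin i3 J(2) by simp_all
 have o: "off (cl M (x+:z+:J))" "off (cl M (x+:w+:J))" "off (cl M (y+:z+:J))" "off (cl M (y+:w+:J))"
  by (rule offI; use J xyz rX off in simp)+
 have "cl M (J Un ?x ` X) : ?L" if "X <= {..<4}" for X using that by blast
 from this[of "{0}"] this[of "{1}"] this[of "{2}"] this[of "{3}"] this[of "{0,2}"] this[of "{0,3}"] this[of "{1,2}"] this[of "{1,3}"]
  this[of "{0,1}"] this[of "{2,3}"]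
 have mem: "cl M (x+:J) : ?L" "cl M (y+:J) : ?L" "cl M (z+:J) : ?L" "cl M (w+:J) : ?L"
  "cl M (x+:z+:J) : ?L" "cl M (x+:w+:J) : ?L" "cl M (y+:z+:J) : ?L" "cl M (y+:w+:J) : ?L"
  "cl M (x+:y+:J) : ?L" "cl M (z+:w+:J) : ?L" unfolding im U by simp_all
 have up: "\<exists>H\<in>?L. F <= H \<and> off H" if F: "F : ?L" "rk M F + 2 \<le> rk M E" for F
 proof -
  obtain X where X: "X <= {..<4}" "F = cl M (J Un ?x ` X)" "rk M F = rk M J + card X"
   using rep_basis[OF rep simple F(1)] unfolding ground_uniform by blast
  have "card X \<le> 1" using X(3) F(2) J(2) by linarith
  hence "\<exists>i. X <= {i} \<and> i < 4"
  proof (cases "card X = 1")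
   case True
   then obtain i where "X = {i}" using card_1_singletonE by blast
   thus ?thesis using X(1) by auto
  next
   case False
   hence "card X = 0" using \<open>card X \<le> 1\<close> by linarith
   hence "X = {}" using finite_subset[OF X(1)] by simp
   thus ?thesis by (intro exI[of _ 0]) simp
  qed
  then obtain i where i: "X <= {i}" "i < 4" by blast
  \<comment> \<open>The lines \<open>xz\<close> and \<open>yw\<close> are off the cut and together
    contain all four points.\<close>
  have "X <= {0,2} \<or> X <= {1,3}" using i by (cases "i = 0 \<or> i = 2") auto
  thus ?thesis
  proof
   assume "X <= {0,2}"
   hence "F <= cl M (J Un ?x ` {0,2})" unfolding X(2) by (intro cl_mono) blast
   thus ?thesis using mem(5) o(1) unfolding im U by blast
  next
   assume "X <= {1,3}"
   hence "F <= cl M (J Un ?x ` {1,3})" unfolding X(2) by (intro cl_mono) blast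
   thus ?thesis using mem(8) o(4) unfolding im U by blast
  qed
 qed
 have hyps: "{H : ?L. Suc (rk M H) = rk M E \<and> H : \<Gamma>} = {cl M (x+:y+:J), cl M (z+:w+:J)}"
 proof
  show "{H : ?L. Suc (rk M H) = rk M E \<and> H : \<Gamma>} <= {cl M (x+:y+:J), cl M (z+:w+:J)}"
  proof
   fix H assume H: "H : {H : ?L. Suc (rk M H) = rk M E \<and> H : \<Gamma>}"
   obtain X where X: "X <= {..<4}" "card X = 2" "H = cl M (J Un ?x ` X)"
    using rep_hyp[OF rep simple, of 2 H] H J(2) unfolding ground_uniform by auto
   have "H : \<Gamma>" using H by blast
   thus "H : {cl M (x+:y+:J), cl M (z+:w+:J)}"
    using card2_4[OF X(1,2)] off unfolding X(3) ga_def by (elim disjE) (simp_all only: im U, simp_all)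
  qed
  have "Suc (rk M (cl M (x+:y+:J))) = rk M E" "Suc (rk M (cl M (z+:w+:J))) = rk M E"
   using rk_cl[of "x+:y+:J"] rk_cl[of "z+:w+:J"] r_notin i3 J xyz by simp_all
  thus "{cl M (x+:y+:J), cl M (z+:w+:J)} <= {H : ?L. Suc (rk M H) = rk M E \<and> H : \<Gamma>}"
   using mem(9,10) on unfolding ga_def by blast
 qed
 have snd: "\<Gamma> Int ?L = {cl M (x+:y+:J), cl M (z+:w+:J), E}" using cut_lattice[OF rep simple up] unfolding hyps by blast
 have cl2: "closedN J ?x ?N {i,j}" if "i < 4" "j < 4" for i j
  by (rule closedI[OF rep simple]) (use that in \<open>auto simp: ground_uniform indep_uniform card_insert_if\<close>)
 have meet: "lat_meet ?L (cl M (x+:y+:J)) (cl M (z+:w+:J)) = cl M J"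
  using rep_meet[OF rep simple cl2[of 0 1] cl2[of 2 3]] unfolding im U by simp
 have ne: "cl M (x+:y+:J) \<noteq> cl M (z+:w+:J)"
  using closed_sub[OF rep simple cl2[of 0 1], of "{2,3}"] unfolding im U ground_uniform by auto
 have hyp: "cl M (x+:y+:J) : hyperplanes ?L" "cl M (z+:w+:J) : hyperplanes ?L"
  using hyps unfolding rep_hyperplanes[OF rep simple] by blast+
 have "class2c (flats M, \<Gamma>) ?\<sigma>" unfolding class2c_def fst_conv snd_conv Union_flats
  by (rule conjI[OF rep_type[OF rep simple]], rule bexI[OF _ hyp(1)], rule bexI[OF _ hyp(2)],
    rule conjI[OF ne], rule conjI[OF snd]) (simp only: meet rep_Inter[OF rep simple])
 hence \<sigma>: "?\<sigma> : \<X>" using sub_constellation[OF rep simple] by (simp add: X2_def)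
 have tri4: "tri E (p+:J)"
  if E: "q : E" "u : E" "v : E" and r: "rk M (p+:q+:u+:J) = rk M J + 3"
   "rk M (p+:q+:v+:J) = rk M J + 3" "rk M (p+:u+:v+:J) = rk M J + 3" for p q u v
 proof (rule triI[OF E])
  have c: "q+:p+:J = p+:q+:J" "u+:p+:J = p+:u+:J" by blast+
  show "q ~: C (p+:J)" using indep3(5)[OF r(1)] .
  have "rk M (u+:p+:q+:J) = rk M J + 3" using r(1) by (simp only: insert_commute)
  thus "u ~: C (q+:p+:J)" unfolding c by (rule indep3_aux(1))
  have "rk M (v+:p+:q+:J) = rk M J + 3" using r(2) by (simp only: insert_commute)
  thus "v ~: C (q+:p+:J)" unfolding c by (rule indep3_aux(1))
  have "rk M (v+:p+:u+:J) = rk M J + 3" using r(3) by (simp only: insert_commute)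
  thus "v ~: C (u+:p+:J)" unfolding c by (rule indep3_aux(1))
 qed
 have tri: "tri E (x+:J)" "tri E (y+:J)" "tri E (z+:J)" "tri E (w+:J)"
 proof -
  have c: "p+:q+:u+:J = q+:p+:u+:J"
   "p+:q+:u+:J = q+:u+:p+:J" for p q u by blast+
  show "tri E (x+:J)" by (rule tri4[OF xyz(2-4)]) (rule r3)+
  show "tri E (y+:J)" by (rule tri4[OF xyz(1,3,4)]) (simp_all only: c(1)[of y x] r3)
  show "tri E (z+:J)" by (rule tri4[OF xyz(1,2,4)]) (simp_all only: c(2)[of z x y] c(1)[of z x w] c(1)[of z y w] r3)
  show "tri E (w+:J)" by (rule tri4[OF xyz(1,2,3)]) (simp_all only: c(2)[of w x y] c(2)[of w x z] c(2)[of w y z] r3)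
 qed
 have lift: "F : fst ?\<sigma>" if "F : ?L" for F using that by simp
 note mem' = mem[THEN lift]
 have 1: "co (x+:z+:J) (x+:w+:J) = a (s0 (cl M (x+:z+:J))) ?\<sigma> - a (s0 (cl M (x+:w+:J))) ?\<sigma>"
  by (rule co_eq[OF \<sigma> mem'(1,5,6) _ _ _ _ r1(1) tri(1) o(1,2)]) (use J xyz in blast)+
 have 2: "co (x+:w+:J) (y+:w+:J) = a (s0 (cl M (x+:w+:J))) ?\<sigma> - a (s0 (cl M (y+:w+:J))) ?\<sigma>"
  by (rule co_eq[OF \<sigma> mem'(4,6,8) _ _ _ _ r1(4) tri(4) o(2,4)]) (use J xyz in blast)+
 have 3: "co (y+:w+:J) (y+:z+:J) = a (s0 (cl M (y+:w+:J))) ?\<sigma> - a (s0 (cl M (y+:z+:J))) ?\<sigma>"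
  by (rule co_eq[OF \<sigma> mem'(2,8,7) _ _ _ _ r1(2) tri(2) o(4,3)]) (use J xyz in blast)+
 have 4: "co (y+:z+:J) (x+:z+:J) = a (s0 (cl M (y+:z+:J))) ?\<sigma> - a (s0 (cl M (x+:z+:J))) ?\<sigma>"
  by (rule co_eq[OF \<sigma> mem'(3,7,5) _ _ _ _ r1(3) tri(3) o(3,1)]) (use J xyz in blast)+
 show ?thesis unfolding 1 2 3 4 by simp
qed

end

section \<open>Cocycle condition from class 2d\<close>

lemma K6_le2:
 assumes X: "X <= {..<6::nat}" "card X \<le> 2"
 shows "X <= {0,1,2,3} \<or> X <= {0,1,4,5} \<or> X <= {2,3,4,5}"
proof (rule ccontr)
 assume n: "\<not> ?thesis"
 have X6: "X <= {0,1,2,3,4,5}" using X(1) lt6 by blast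
 obtain p where p: "p : X" "p : {4,5}" using n X6 by blast
 obtain q where q: "q : X" "q : {2,3}" using n X6 by blast
 obtain w where w: "w : X" "w : {0,1}" using n X6 by blast
 have "card {p,q,w} \<le> card X" by (rule card_mono) (use X(1) finite_subset p q w in auto)
 moreover have "card {p,q,w} = 3" using p(2) q(2) w(2) by auto
 ultimately show False using X(2) by simp
qed

definition K6_circuits :: "nat set set" where
 "K6_circuits = {{0,1,2,3},{0,1,4,5},{2,3,4,5}}"

lemma K6_circuit_sub: "Q : K6_circuits \<Longrightarrow> Q <= {..<6}" by (auto simp: K6_circuits_def)

context mat
begin

context
 fixes J and x :: "nat \<Rightarrow> 'a" and L
 assumes rep: "rep J x K6 L" and rE: "rk M E = rk M J + 4"
begin

lemma K6_circuit_rank: assumes "Q : K6_circuits" shows "rk M (J Un x ` Q) = rk M J + 3"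
proof -
 have "\<exists>P\<in>{{0,1,2},{0,1,4},{2,3,4}}. P <= Q \<and> card Q = 4 \<and> Q ~: indep K6"
  using assms unfolding K6_circuits_def insert_iff empty_iff by (elim disjE) (simp_all add: K6_def)
 moreover have "card P = 3 \<and> P : indep K6" if "P : {{0,1,2},{0,1,4},{2,3,4}}" for P
  using that unfolding insert_iff empty_iff by (elim disjE) (simp_all add: K6_def)
 ultimately obtain P where P: "P <= Q" "card P = 3" "P : indep K6" "card Q = 4" "Q ~: indep K6" by metis
 have Q: "Q <= ground K6" using K6_circuit_sub[OF assms] ground_K6 by simp
 have PN: "P <= ground K6" using P(1) Q by blast
 have "rk M (J Un x ` P) = rk M J + 3" using rep_indep[OF rep simple_K6 PN] P by simp
 moreover have "rk M (J Un x ` P) \<le> rk M (J Un x ` Q)" by (rule rk_mono) (use P(1) in blast)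
 moreover have "rk M (J Un x ` Q) \<noteq> rk M J + 4" using rep_indep[OF rep simple_K6 Q] P by simp
 moreover have "rk M (J Un x ` Q) \<le> rk M J + 4" using rk_add[of Q J x] P(4) finite_subset[OF K6_circuit_sub[OF assms]] by simp
 ultimately show ?thesis by linarith
qed

lemma K6_circuit_hyp: "Q : K6_circuits \<Longrightarrow> Suc (rk M (cl M (J Un x ` Q))) = rk M E"
 using rep_rank[OF rep simple_K6] K6_circuit_rank K6_circuit_sub ground_K6 rE by simp

lemma K6_mem: "X <= {..<6} \<Longrightarrow> cl M (J Un x ` X) : L" using rep_mem[OF rep simple_K6] ground_K6 by simp

lemma K6_transversal_hyp:
 assumes "p : {0,1}" "q : {2,3}" "w : {4,5}"
 shows "{p,q,w} <= {..<6}" "closedN J x K6 {p,q,w}" "Suc (rk M (cl M (J Un x ` {p,q,w}))) = rk M E"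
proof -
 show sub: "{p,q,w} <= {..<6}" using assms by auto
 show "closedN J x K6 {p,q,w}" by (rule closedI[OF rep simple_K6]) (use sub K6_transversal[OF assms] ground_K6 in auto)
 have "{p,q,w} : indep K6" "card {p,q,w} = 3" using assms by (auto simp: K6_def)
 thus "Suc (rk M (cl M (J Un x ` {p,q,w}))) = rk M E"
  using rep_rank_indep[OF rep simple_K6, of "{p,q,w}"] sub ground_K6 rE by simp
qed

lemma K6_hyp:
 assumes H: "H : L" "Suc (rk M H) = rk M E"
 shows "(\<exists>Q\<in>K6_circuits. H = cl M (J Un x ` Q)) \<or>
  (\<exists>p\<in>{0,1}. \<exists>q\<in>{2,3}. \<exists>w\<in>{4,5}. H = cl M (J Un x ` {p,q,w}))"
proof -
 obtain X where X: "X <= {..<6}" "X : indep K6" "card X = 3" "H = cl M (J Un x ` X)"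
  using rep_hyp[OF rep simple_K6 _ H, of 3] rE ground_K6 by auto
 have rX: "rk M (J Un x ` X) = rk M J + 3" using rep_indep[OF rep simple_K6, of X] X ground_K6 by simp
 have c: "\<exists>Q\<in>K6_circuits. H = cl M (J Un x ` Q)" if "X <= Q" "Q : K6_circuits" for Q
 proof -
  have "cl M (J Un x ` Q) = cl M (J Un x ` X)" by (rule cl_rank_eq) (use that(1) K6_circuit_rank[OF that(2)] rX in auto)
  thus ?thesis using X(4) that(2) by auto
 qed
 from K6_three[OF X(1,3)] show ?thesis
 proof (elim disjE)
  assume "\<exists>p\<in>{0,1}. \<exists>q\<in>{2,3}. \<exists>w\<in>{4,5}. X = {p,q,w}"
  thus ?thesis unfolding X(4) by blast
 qed (use c in \<open>simp_all add: K6_circuits_def\<close>)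
qed

lemma K6_pair_tri:
 assumes pq: "p < 6" "q < 6" "p div 2 \<noteq> q div 2"
 shows "cl M (J Un x ` {p,q}) : L" "rk M (cl M (J Un x ` {p,q})) + 2 = rk M E"
  "tri (x ` {..<6}) (cl M (J Un x ` {p,q}))"
proof -
 have sub: "{p,q} <= {..<6}" using pq by simp
 show "cl M (J Un x ` {p,q}) : L" by (rule K6_mem[OF sub])
 have "p \<noteq> q" using pq(3) by blast
 hence "card {p,q} = 2" by simp
 moreover have "\<not> Q <= {p,q}" if "card Q = 4" for Q :: "nat set" using card_mono[of "{p,q}" Q] that calculation by auto
 from this[of "{0,1,2,3}"] this[of "{0,1,4,5}"] this[of "{2,3,4,5}"]
 have "{p,q} : indep K6" using sub by (simp add: K6_def)
 ultimately show "rk M (cl M (J Un x ` {p,q})) + 2 = rk M E"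
  using rep_rank_indep[OF rep simple_K6, of "{p,q}"] sub ground_K6 rE by simp
 obtain u v w where uvw: "u < 6" "v < 6" "w < 6" "u ~: {p,q}" "v ~: {p,q}" "w ~: {p,q}" "u \<noteq> v" "u \<noteq> w" "v \<noteq> w"
  "u+:v+:{p,q} : indep K6" "u+:w+:{p,q} : indep K6" "v+:w+:{p,q} : indep K6" using K6_pair[OF pq] by blast
 show "tri (x ` {..<6}) (cl M (J Un x ` {p,q}))"
  using rep_tri[OF rep simple_K6 _ _ _ _ uvw(10-12) uvw(4-9)] uvw(1-3) sub unfolding ground_K6 by simp
qed

text \<open>A transversal of the serial pairs shares with a circuit two elements from different
  pairs, and these span an indecomposable corank 2 flat.\<close>

lemma K6_edge:
 assumes T: "p : {0,1}" "q : {2,3}" "w : {4,5}" and Q: "Q : K6_circuits"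
 shows "\<exists>F\<in>L. F <= cl M (J Un x ` {p,q,w}) \<and> F <= cl M (J Un x ` Q) \<and> rk M F + 2 = rk M E \<and> tri (x ` {..<6}) F"
proof -
 have lt: "p < 6" "q < 6" "w < 6" "p div 2 \<noteq> q div 2" "p div 2 \<noteq> w div 2" "q div 2 \<noteq> w div 2" using T by auto
 have e: ?thesis if "P <= {p,q,w}" "P <= Q" "cl M (J Un x ` P) : L" "rk M (cl M (J Un x ` P)) + 2 = rk M E"
  "tri (x ` {..<6}) (cl M (J Un x ` P))" for P
 proof (rule bexI[OF _ that(3)], intro conjI that(4,5))
  show "cl M (J Un x ` P) <= cl M (J Un x ` {p,q,w})" by (rule cl_mono) (use that(1) in blast)
  show "cl M (J Un x ` P) <= cl M (J Un x ` Q)" by (rule cl_mono) (use that(2) in blast)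
 qed
 consider "Q = {0,1,2,3}" | "Q = {0,1,4,5}" | "Q = {2,3,4,5}" using Q unfolding K6_circuits_def by blast
 thus ?thesis
 proof cases
  case 1
  show ?thesis by (rule e[OF _ _ K6_pair_tri[OF lt(1,2,4)]]) (use T 1 in auto)
 next
  case 2
  show ?thesis by (rule e[OF _ _ K6_pair_tri[OF lt(1,3,5)]]) (use T 2 in auto)
 next
  case 3
  show ?thesis by (rule e[OF _ _ K6_pair_tri[OF lt(2,3,6)]]) (use T 3 in auto)
 qed
qed

end

end

text \<open>The transversals of the serial pairs with an even number of odd members. They index the
  four hyperplanes in the cut; any two of them share exactly one element.\<close>

definition T_even :: "nat set set" where
 "T_even = {{0,2,4},{0,3,5},{1,2,5},{1,3,4}}"

lemma T_even_meet: "T : T_even \<Longrightarrow> T' : T_even \<Longrightarrow> T \<noteq> T' \<Longrightarrow> T Int T' : {{0},{1},{2},{3},{4},{5}}"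
 unfolding T_even_def insert_iff empty_iff by (elim disjE) simp_all

lemma T_even_point: assumes "i < 6" shows "\<exists>T\<in>T_even. \<exists>T'\<in>T_even. T \<noteq> T' \<and> T Int T' = {i}"
proof -
 have e: ?thesis if "T : T_even" "T' : T_even" "T Int T' = {i}" "T \<noteq> {i}" for T T' using that by blast
 from K6_cases[OF assms] show ?thesis
 proof (elim disjE)
  assume i: "i = 0" show ?thesis by (rule e[of "{0,2,4}" "{0,3,5}"]) (simp_all add: T_even_def i)
 next
  assume i: "i = 1" show ?thesis by (rule e[of "{1,2,5}" "{1,3,4}"]) (simp_all add: T_even_def i)
 next
  assume i: "i = 2" show ?thesis by (rule e[of "{0,2,4}" "{1,2,5}"]) (simp_all add: T_even_def i)
 next
  assume i: "i = 3" show ?thesis by (rule e[of "{0,3,5}" "{1,3,4}"]) (simp_all add: T_even_def i)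
 next
  assume i: "i = 4" show ?thesis by (rule e[of "{0,2,4}" "{1,3,4}"]) (simp_all add: T_even_def i)
 next
  assume i: "i = 5" show ?thesis by (rule e[of "{0,3,5}" "{1,2,5}"]) (simp_all add: T_even_def i)
 qed
qed

lemma T_even_transversal: "T : T_even \<Longrightarrow> \<exists>p\<in>{0,1}. \<exists>q\<in>{2,3}. \<exists>w\<in>{4,5}. T = {p,q,w}"
 unfolding T_even_def insert_iff empty_iff by (elim disjE) blast+

lemma card_T_even: "card T_even = 4"
proof -
 have "{0,2,4} ~: {{0,3,5},{1,2,5},{1,3,4::nat}}" "{0,3,5} ~: {{1,2,5},{1,3,4::nat}}" "{1,2,5} ~: {{1,3,4::nat}}"
  by (simp_all add: set_eq_subset)
 thus ?thesis unfolding T_even_def by (simp del: insert_iff)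
qed

context cocycle
begin

text \<open>Every flat of corank at least 2 lies below a circuit hyperplane, which is off the cut,
  so the cut in \<open>L\<close> consists of \<open>E\<close> and the four even transversals. Corank
  2 flats other than those of the serial pairs are indecomposable already in
  \<open>L\<close>.\<close>

lemma class2d_in:
 fixes x :: "nat \<Rightarrow> 'a"
 assumes rep: "rep J x K6 L" and rE: "rk M E = rk M J + 4"
  and on: "\<And>T. T : T_even \<Longrightarrow> cl M (J Un x ` T) : \<Gamma>"
  and offT: "\<And>p q w. p : {0,1} \<Longrightarrow> q : {2,3} \<Longrightarrow> w : {4,5} \<Longrightarrow> {p,q,w} ~: T_even \<Longrightarrow> cl M (J Un x ` {p,q,w}) ~: \<Gamma>"
  and offQ: "\<And>Q. Q : K6_circuits \<Longrightarrow> cl M (J Un x ` Q) ~: \<Gamma>"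
  and ser: "\<not> tri E (cl M (J Un x ` {0,1}))" "\<not> tri E (cl M (J Un x ` {2,3}))" "\<not> tri E (cl M (J Un x ` {4,5}))"
 shows "(L, \<Gamma> Int L) : \<X>"
proof -
 let ?h = "\<lambda>X. cl M (J Un x ` X)"
 note simple = simple_K6
 have Th: "T <= {..<6}" "closedN J x K6 T" "Suc (rk M (?h T)) = rk M E" "?h T : L" if "T : T_even" for T
 proof -
  obtain p q w where T: "p : {0,1}" "q : {2,3}" "w : {4,5}" "T = {p,q,w}" using T_even_transversal[OF \<open>T : T_even\<close>] by blast
  from K6_transversal_hyp[OF rep rE T(1-3)] show "T <= {..<6}" "closedN J x K6 T" "Suc (rk M (?h T)) = rk M E" unfolding T(4) .
  thus "?h T : L" using K6_mem[OF rep rE] by blast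
 qed
 have up: "\<exists>H\<in>L. F <= H \<and> off H" if F: "F : L" "rk M F + 2 \<le> rk M E" for F
 proof -
  obtain X where X: "X <= {..<6}" "F = ?h X" "rk M F = rk M J + card X"
   using rep_basis[OF rep simple F(1)] unfolding ground_K6 by blast
  have "card X \<le> 2" using X(3) F(2) rE by linarith
  from K6_le2[OF X(1) this] obtain Q where Q: "Q : K6_circuits" "X <= Q"
  proof (elim disjE)
  qed (rule that[rotated], assumption, simp add: K6_circuits_def)+
  have "?h Q : L" using K6_mem[OF rep rE K6_circuit_sub[OF Q(1)]] .
  moreover have "F <= ?h Q" unfolding X(2) by (rule cl_mono) (use Q(2) in blast)
  moreover have "off (?h Q)" unfolding off_def
   using rep_flat[OF rep simple calculation(1)] K6_circuit_hyp[OF rep rE Q(1)] offQ[OF Q(1)] by blast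
  ultimately show ?thesis by blast
 qed
 have hyps: "{H : L. Suc (rk M H) = rk M E \<and> H : \<Gamma>} = ?h ` T_even"
 proof
  show "{H : L. Suc (rk M H) = rk M E \<and> H : \<Gamma>} <= ?h ` T_even"
  proof
   fix H assume H: "H : {H : L. Suc (rk M H) = rk M E \<and> H : \<Gamma>}"
   hence H': "H : L" "Suc (rk M H) = rk M E" "H : \<Gamma>" by simp_all
   have "\<not> (\<exists>Q\<in>K6_circuits. H = ?h Q)" using offQ H'(3) by blast
   then obtain p q w where T: "p : {0,1}" "q : {2,3}" "w : {4,5}" "H = ?h {p,q,w}" using K6_hyp[OF rep rE H'(1,2)] by blast
   hence "{p,q,w} : T_even" using offT[OF T(1-3)] H'(3) by blast
   thus "H : ?h ` T_even" unfolding T(4) by (rule imageI)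
  qed
  show "?h ` T_even <= {H : L. Suc (rk M H) = rk M E \<and> H : \<Gamma>}" using Th(3,4) on by blast
 qed
 have snd: "\<Gamma> Int L = E+:(?h ` T_even)" using cut_lattice[OF rep simple up] hyps by simp
 have hsub: "?h ` T_even <= hyperplanes L" unfolding rep_hyperplanes[OF rep simple] using Th(3,4) by blast
 have inj: "T = T'" if "T : T_even" "T' : T_even" "?h T = ?h T'" for T T'
  using closed_sub[OF rep simple Th(2)[OF that(1)], of T'] closed_sub[OF rep simple Th(2)[OF that(2)], of T]
   Th(1)[OF that(1)] Th(1)[OF that(2)] that(3) unfolding ground_K6 by simp
 have "inj_on ?h T_even" using inj by (rule inj_onI)
 hence crd: "card (?h ` T_even) = 4" using card_T_even by (simp only: card_image)
 have meet: "lat_meet L (?h T) (?h T') = ?h (T Int T')" if "T : T_even" "T' : T_even" for T T'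
  using rep_meet[OF rep simple Th(2)[OF that(1)] Th(2)[OF that(2)]] .
 have pt: "?h {i} : atoms L" if "i < 6" for i
 proof -
  have i: "{i} <= {..<6}" "{i} : indep K6" using that by (auto simp: K6_def)
  have "rk M (?h {i}) = Suc (rk M J)" using rep_rank_indep[OF rep simple, of "{i}"] i unfolding ground_K6 by simp
  thus ?thesis unfolding rep_atoms[OF rep simple] using K6_mem[OF rep rE i(1)] by blast
 qed
 have atoms: "{lat_meet L H H' |H H'. H : ?h ` T_even \<and> H' : ?h ` T_even \<and> H \<noteq> H'} = atoms L" (is "?A = _")
 proof
  show "?A <= atoms L"
  proof
   fix A assume "A : ?A"
   then obtain T T' where T: "T : T_even" "T' : T_even" "?h T \<noteq> ?h T'" "A = lat_meet L (?h T) (?h T')" by blast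
   have "T \<noteq> T'" using T(3) by blast
   hence "T Int T' : {{0},{1},{2},{3},{4},{5}}" using T_even_meet[OF T(1,2)] by blast
   hence "\<exists>i<6. T Int T' = {i}" by auto
   then obtain i where i: "i < 6" "T Int T' = {i}" by blast
   show "A : atoms L" unfolding T(4) meet[OF T(1,2)] i(2) by (rule pt[OF i(1)])
  qed
  show "atoms L <= ?A"
  proof
   fix A assume "A : atoms L"
   hence A: "A : L" "rk M A = Suc (rk M J)" unfolding rep_atoms[OF rep simple] by simp_all
   obtain X where X: "X <= {..<6}" "A = ?h X" "rk M A = rk M J + card X"
    using rep_basis[OF rep simple A(1)] unfolding ground_K6 by blast
   have "card X = 1" using X(3) A(2) by linarith
   then obtain i where i: "X = {i}" using card_1_singletonE by blast
   hence "i < 6" using X(1) by simp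
   from T_even_point[OF this] obtain T T' where T: "T : T_even" "T' : T_even" "T \<noteq> T'" "T Int T' = {i}" by blast
   have A_eq: "A = lat_meet L (?h T) (?h T')" by (simp only: meet[OF T(1,2)] T(4) X(2) i)
   have ne: "?h T \<noteq> ?h T'" using inj[OF T(1,2)] T(3) by blast
   show "A : ?A" unfolding A_eq
    by (rule CollectI, rule exI[of _ "?h T"], rule exI[of _ "?h T'"]) (intro conjI refl imageI T(1,2) ne)
  qed
 qed
 have dec: "\<not> indecomposable (flats M) F" if F: "F : L" "lat_corank L F = 2" "\<not> indecomposable L F" for F
 proof -
  have rF: "rk M F + 2 = rk M E" using rep_corank[OF rep simple F(1)] F(2) by linarith
  have nt: "\<not> tri (x ` {..<6}) F" using rep_indecomposable[OF rep simple F(1) rF] F(3) unfolding ground_K6 by blast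
  obtain X where X: "X <= {..<6}" "F = ?h X" "rk M F = rk M J + card X"
   using rep_basis[OF rep simple F(1)] unfolding ground_K6 by blast
  have "card X = 2" using X(3) rF rE by linarith
  from K6_two[OF X(1) this] have "\<not> tri E F"
  proof (elim disjE)
   assume "\<exists>p q. X = {p,q} \<and> p < 6 \<and> q < 6 \<and> p div 2 \<noteq> q div 2"
   then obtain p q where pq: "X = {p,q}" "p < 6" "q < 6" "p div 2 \<noteq> q div 2" by blast
   have "tri (x ` {..<6}) F" unfolding X(2) pq(1) by (rule K6_pair_tri(3)[OF rep rE pq(2-4)])
   thus ?thesis using nt by blast
  qed (use ser X(2) in simp_all)
  thus ?thesis using indecomposable_flats[OF rep_flat[OF rep simple F(1)] rF] by blast
 qed
 have "class2d (flats M, \<Gamma>) (L, \<Gamma> Int L)" unfolding class2d_def fst_conv snd_conv Union_flats has_type_K23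
  by (intro conjI rep_type[OF rep simple] exI[of _ "?h ` T_even"] hsub crd snd atoms ballI impI dec)
 thus ?thesis using sub_constellation[OF rep simple] by (simp add: X2_def)
qed

text \<open>Numbering \<open>s,t,x,x',y,y'\<close> from 0 to 5 turns the four sets assumed to be in
  the cut into the even transversals.\<close>

lemma class_2d_co:
 assumes B: "B <= E" "rk M B + 4 = rk M E" and E: "{s,t,x,x',y,y'} <= E" and k: "k23 B s t x x' y y'"
  and ser: "\<not> tri E (s+:t+:B)" "\<not> tri E (x+:x'+:B)" "\<not> tri E (y+:y'+:B)"
  and on: "ga (s+:x+:y+:B)" "ga (s+:x'+:y'+:B)"
   "ga (t+:x+:y'+:B)" "ga (t+:x'+:y+:B)"
  and off: "\<not> ga (s+:x+:y'+:B)" "\<not> ga (s+:x'+:y+:B)"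
   "\<not> ga (t+:x+:y+:B)" "\<not> ga (t+:x'+:y'+:B)"
   "\<not> ga (s+:t+:x+:x'+:B)" "\<not> ga (s+:t+:y+:y'+:B)"
   "\<not> ga (x+:x'+:y+:y'+:B)"
 shows "co (s+:t+:x+:x'+:B) (s+:x+:y'+:B)
  + co (s+:x+:y'+:B) (s+:t+:y+:y'+:B)
  + co (s+:t+:y+:y'+:B) (t+:x+:y+:B)
  + co (t+:x+:y+:B) (s+:t+:x+:x'+:B) = 0"
proof -
 let ?x = "(!) [s,t,x,x',y,y']"
 let ?I = "\<lambda>X. B Un ?x ` X"
 let ?h = "\<lambda>X. cl M (?I X)"
 let ?L = "?h ` Pow {..<6}"
 let ?\<sigma> = "(?L, \<Gamma> Int ?L)"
 have nth: "?x 0 = s" "?x 1 = t" "?x 2 = x" "?x 3 = x'" "?x 4 = y" "?x 5 = y'"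
  by (simp_all add: numeral_2_eq_2 numeral_3_eq_3 nth_Cons_numeral)
 have I2: "?I {i,j} = (?x i)+:(?x j)+:B" and I3: "?I {i,j,k} = (?x i)+:(?x j)+:(?x k)+:B"
  and I4: "?I {i,j,k,l} = (?x i)+:(?x j)+:(?x k)+:(?x l)+:B" for i j k l by (simp_all add: insert_commute)
 have sub: "?x ` {..<6} <= E" using E unfolding lt6 image_insert nth by simp
 have rE: "rk M E = rk M B + 4" using B(2) by simp
 have k': "rk M (?I {0,1,2,3}) = rk M B + 3" "rk M (?I {0,1,4,5}) = rk M B + 3" "rk M (?I {2,3,4,5}) = rk M B + 3"
  using k unfolding k23_def I4 nth by blast+
 have kb: "p : {2,3} \<Longrightarrow> q : {4,5} \<Longrightarrow> rk M (?I {0,1,p,q}) = rk M E"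
  "p : {0,1} \<Longrightarrow> q : {4,5} \<Longrightarrow> rk M (?I {2,3,p,q}) = rk M E"
  "p : {0,1} \<Longrightarrow> q : {2,3} \<Longrightarrow> rk M (?I {4,5,p,q}) = rk M E" for p q
 proof -
  have c: "{2,3,p,q} = {p,2,3,q}" "{4,5,p,q} = {p,q,4,5}" by auto
  have k1: "rk M (s+:t+:a+:b+:B) = rk M E" if "a : {x,x'}" "b : {y,y'}" for a b
   unfolding rE using k that unfolding k23_def by blast
  have k2: "rk M (a+:x+:x'+:b+:B) = rk M E" if "a : {s,t}" "b : {y,y'}" for a b
   unfolding rE using k that unfolding k23_def by blast
  have k3: "rk M (a+:b+:y+:y'+:B) = rk M E" if "a : {s,t}" "b : {x,x'}" for a b
   unfolding rE using k that unfolding k23_def by blast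
  show "rk M (?I {0,1,p,q}) = rk M E" if "p : {2,3}" "q : {4,5}" unfolding I4 nth(1,2) by (rule k1) (use that nth in auto)
  show "rk M (?I {2,3,p,q}) = rk M E" if "p : {0,1}" "q : {4,5}"
   unfolding c(1) I4 nth(3,4) by (rule k2) (use that nth in auto)
  show "rk M (?I {4,5,p,q}) = rk M E" if "p : {0,1}" "q : {2,3}"
   unfolding c(2) I4 nth(5,6) by (rule k3) (use that nth in auto)
 qed
 have rep: "rep B ?x K6 ?L" by (rule K6_repI[OF B(1) sub rE _ kb]) (use k' in auto)
 have \<sigma>: "?\<sigma> : \<X>"
 proof (rule class2d_in[OF rep rE])
  show "?h T : \<Gamma>" if "T : T_even" for T using that on unfolding T_even_def insert_iff empty_iff ga_def
   by (elim disjE) (simp_all only: I3 nth simp_thms)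
  show "?h Q ~: \<Gamma>" if "Q : K6_circuits" for Q using that off unfolding K6_circuits_def insert_iff empty_iff ga_def
   by (elim disjE) (simp_all only: I4 nth simp_thms)
  show "?h {p,q,w} ~: \<Gamma>" if "p : {0,1}" "q : {2,3}" "w : {4,5}" "{p,q,w} ~: T_even" for p q w
  proof -
   have "p = 0 \<or> p = 1" "q = 2 \<or> q = 3" "w = 4 \<or> w = 5" using that(1-3) by simp_all
   thus ?thesis using that(4) off unfolding ga_def T_even_def by (elim disjE) (simp_all only: I3 nth insert_iff simp_thms)
  qed
  have c: "tri E (cl M X) \<longleftrightarrow> tri E X" if "X <= E" for X using tri_cong[OF C_cl[OF that] fin_cl fin_sub[OF that]] .
  show "\<not> tri E (?h {0,1})" "\<not> tri E (?h {2,3})" "\<not> tri E (?h {4,5})" unfolding I2 nth using ser B(1) E by (simp_all add: c)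
 qed
 have offh: "off (?h X)" if "X <= {..<6}" "Suc (rk M (?h X)) = rk M E" "\<not> ga (?I X)" for X
  using that rep_flat[OF rep simple_K6 K6_mem[OF rep rE that(1)]] unfolding off_def ga_def by blast
 have e: "b (?h {p,q,w}) (?h Q) = a (s0 (?h {p,q,w})) ?\<sigma> - a (s0 (?h Q)) ?\<sigma>"
  if T: "p : {0,1}" "q : {2,3}" "w : {4,5}" and Q: "Q : K6_circuits" and o: "\<not> ga (?I {p,q,w})" "\<not> ga (?I Q)" for p q w Q
 proof -
  obtain F where F: "F : ?L" "F <= ?h {p,q,w}" "F <= ?h Q" "rk M F + 2 = rk M E" "tri (?x ` {..<6}) F"
   using K6_edge[OF rep rE T Q] by blast
  have tr: "tri E F" using rep_tri_E[OF rep simple_K6] F(5) unfolding ground_K6 by blast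
  note h = K6_transversal_hyp[OF rep rE T]
  show ?thesis by (rule b_eq[OF \<sigma> _ _ _ F(2-4) tr])
    (use F(1) K6_mem[OF rep rE h(1)] K6_mem[OF rep rE K6_circuit_sub[OF Q]] offh[OF h(1,3) o(1)]
     offh[OF K6_circuit_sub[OF Q] K6_circuit_hyp[OF rep rE Q] o(2)] in simp_all)
 qed
 have Q: "{0,1,2,3} : K6_circuits" "{0,1,4,5} : K6_circuits" by (simp_all add: K6_circuits_def)
 have 1: "b (?h {0,2,5}) (?h {0,1,2,3}) = a (s0 (?h {0,2,5})) ?\<sigma> - a (s0 (?h {0,1,2,3})) ?\<sigma>"
  by (rule e[OF _ _ _ Q(1)]) (use off in \<open>simp_all only: I3 I4 nth insert_iff simp_thms\<close>)
 have 2: "b (?h {0,2,5}) (?h {0,1,4,5}) = a (s0 (?h {0,2,5})) ?\<sigma> - a (s0 (?h {0,1,4,5})) ?\<sigma>"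
  by (rule e[OF _ _ _ Q(2)]) (use off in \<open>simp_all only: I3 I4 nth insert_iff simp_thms\<close>)
 have 3: "b (?h {1,2,4}) (?h {0,1,2,3}) = a (s0 (?h {1,2,4})) ?\<sigma> - a (s0 (?h {0,1,2,3})) ?\<sigma>"
  by (rule e[OF _ _ _ Q(1)]) (use off in \<open>simp_all only: I3 I4 nth insert_iff simp_thms\<close>)
 have 4: "b (?h {1,2,4}) (?h {0,1,4,5}) = a (s0 (?h {1,2,4})) ?\<sigma> - a (s0 (?h {0,1,4,5})) ?\<sigma>"
  by (rule e[OF _ _ _ Q(2)]) (use off in \<open>simp_all only: I3 I4 nth insert_iff simp_thms\<close>)
 have "b (?h {0,1,2,3}) (?h {0,2,5}) + b (?h {0,2,5}) (?h {0,1,4,5}) + b (?h {0,1,4,5}) (?h {1,2,4}) + b (?h {1,2,4}) (?h {0,1,2,3}) = 0"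
  unfolding b_anti[of "?h {0,1,2,3}" "?h {0,2,5}"] b_anti[of "?h {0,1,4,5}" "?h {1,2,4}"] 1 2 3 4 by simp
 thus ?thesis unfolding co_def I3 I4 nth .
qed

end

section \<open>From a potential on hyperplanes to a splitting on the poset\<close>

context mat
begin

lemma upper_rep:
 assumes "upper_sublattice M L" "has_type L N"
 shows "\<exists>J x. rep J x N L"
proof -
 obtain I U where IU: "ups I U" "L = usub I U" using assms(1) unfolding upper_sublattice_iff by blast
 show ?thesis using rep_ex[OF IU assms(2)] by blast
qed

lemma uniform_rank:
 assumes rep: "rep J x (uniform_matroid d n) L" and simple: "simple_mat (uniform_matroid d n)" and "d \<le> n"
 shows "rk M E = rk M J + d"
proof -
 obtain X where X: "X : indep (uniform_matroid d n)" "rk M E = rk M J + card X"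
  using rep_basis[OF rep simple E_in_L[OF rep simple]] by blast
 have "{..<d} <= ground (uniform_matroid d n)" "{..<d} : indep (uniform_matroid d n)"
  using assms(3) by (auto simp: ground_uniform indep_uniform)
 hence "rk M (J Un x ` {..<d}) = rk M J + d" using rep_indep[OF rep simple] by simp
 moreover have "rk M (J Un x ` {..<d}) \<le> rk M E" by (rule rk_mono, rule rep_sub[OF rep simple]) fact
 ultimately show ?thesis using X by (simp add: indep_uniform)
qed

text \<open>A set of more than four indices omits at most one, and no index lies in all three
  circuits.\<close>

lemma K6_rank:
 assumes rep: "rep J x K6 L"
 shows "rk M E = rk M J + 4"
proof -
 obtain X where X: "X : indep K6" "rk M E = rk M J + card X"
  using rep_basis[OF rep simple_K6 E_in_L[OF rep simple_K6]] by blast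
 have nc: "X <= {..<6}" "\<not> {0,1,2,3} <= X" "\<not> {0,1,4,5} <= X" "\<not> {2,3,4,5} <= X" using X(1) by (simp_all add: K6_def)
 have "card X \<le> 4"
 proof (rule ccontr)
  assume "\<not> card X \<le> 4"
  hence "card ({..<6} - X) \<le> 1" using card_Diff_subset[OF finite_subset[OF nc(1)] nc(1)] by simp
  hence i: "\<And>i j. i : {..<6} - X \<Longrightarrow> j : {..<6} - X \<Longrightarrow> i = j" using card_le_Suc0_iff_eq[of "{..<6} - X"] by simp
  obtain p where p: "p : {0,1,2,3}" "p ~: X" using nc(2) by blast
  obtain q where q: "q : {0,1,4,5}" "q ~: X" using nc(3) by blast
  obtain w where w: "w : {2,3,4,5}" "w ~: X" using nc(4) by blast
  have "p : {..<6} - X" "q : {..<6} - X" "w : {..<6} - X" using p q w unfolding lt6 by blast+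
  hence "p = q" "p = w" using i by blast+
  thus False using p(1) q(1) w(1) by auto
 qed
 have "{0,1,2,4} <= ground K6" "{0,1,2,4} : indep K6" by (simp_all add: K6_def)
 hence "rk M (J Un x ` {0,1,2,4}) = rk M J + 4" using rep_indep[OF rep simple_K6] by simp
 moreover have "rk M (J Un x ` {0,1,2,4}) \<le> rk M E" by (rule rk_mono, rule rep_sub[OF rep simple_K6]) fact
 ultimately show ?thesis using X(2) \<open>card X \<le> 4\<close> by linarith
qed

end

context cocycle
begin

text \<open>A potential over the empty set, with its edges translated back from spanning sets to
  flats.\<close>

lemma ex_potential:
 "\<exists>f. \<forall>F H H'. F <= H \<longrightarrow> F <= H' \<longrightarrow> rk M F + 2 = rk M E \<longrightarrow> tri E F \<longrightarrow> off H \<longrightarrow> off H' \<longrightarrow>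
   f H' = f H + b H H'"
proof -
 interpret tc: tutte_cochain "rk M" E ga co
 proof unfold_locales
  show "finite E" by (rule fin_ground)
  show "cut E ga" by (rule cut_ga)
  show "ga E" using E_cut flatD(2)[OF ground_flat] by (simp add: ga_def)
  show "C X = C X' \<Longrightarrow> C Y = C Y' \<Longrightarrow> co X Y = co X' Y'" for X X' Y Y' unfolding co_def cl_eq_iff[symmetric] by simp
  show "co Y X = - co X Y" for X Y unfolding co_def by (rule b_anti)
  show "co X X = 0" for X by (simp add: co_def b_def)
 qed (rule class_2a_co class_2b_co class_2c_co class_2d_co; assumption)+
 obtain f where f: "tc.pot E {} f" using tc.exists_pot[of E "{}"] by blast
 have "f H' = f H + b H H'"
  if F: "F <= H" "F <= H'" "rk M F + 2 = rk M E" "tri E F" and H: "off H" "off H'" for F H H'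
 proof -
  have h: "H : flats M" "Suc (rk M H) = rk M E" "H ~: \<Gamma>" "H' : flats M" "Suc (rk M H') = rk M E" "H' ~: \<Gamma>"
   using H by (simp_all add: off_def)
  have sE: "F <= E" "H <= E" "H' <= E" "cl M H = H" "cl M H' = H'" using flatD F(1) h by blast+
  obtain p where p: "p : H" "p ~: C F" using ex_notin_C[OF fin_sub[OF sE(2)] F(1)] F(3) h(2) by fastforce
  obtain q where q: "q : H'" "q ~: C F" using ex_notin_C[OF fin_sub[OF sE(3)] F(2)] F(3) h(5) by fastforce
  have sub: "p+:F <= H" "q+:F <= H'" using p q F by blast+
  have clp: "cl M (p+:F) = H" using cl_rank_eq[OF sub(1)] r_notin[OF p(2)] h(2) F(3) sE(4) by simp
  have clq: "cl M (q+:F) = H'" using cl_rank_eq[OF sub(2)] r_notin[OF q(2)] h(5) F(3) sE(5) by simp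
  have ng: "\<not> ga (p+:F)" "\<not> ga (q+:F)" unfolding ga_def clp clq using h by blast+
  have pq: "p : E" "q : E" using p q sE by blast+
  have "f (q+:F) = f (p+:F) + co (p+:F) (q+:F)" by (rule tc.pot_step[OF f _ sE(1) F(3,4) pq p(2) q(2) ng]) simp
  moreover have "C (p+:F) = C H" using clp sE(4) cl_eq_iff[of "p+:F" H] by simp
  hence "f (p+:F) = f H" by (rule tc.pot_inv[OF f])
  moreover have "C (q+:F) = C H'" using clq sE(5) cl_eq_iff[of "q+:F" H'] by simp
  hence "f (q+:F) = f H'" by (rule tc.pot_inv[OF f])
  ultimately show ?thesis unfolding co_def clp clq by simp
 qed
 thus ?thesis by blast
qed

context
 fixes f
 assumes f: "\<And>F H H'. F <= H \<Longrightarrow> F <= H' \<Longrightarrow> rk M F + 2 = rk M E \<Longrightarrow> tri E F \<Longrightarrow> off H \<Longrightarrow> off H' \<Longrightarrow> f H' = f H + b H H'"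
begin

text \<open>The value at \<open>\<sigma>\<close> that the potential predicts when
  \<open>\<sigma>\<close> is reached from the class 0 element of \<open>H\<close>.\<close>

definition val :: "'a constellation \<Rightarrow> 'a set \<Rightarrow> 'b" where
 "val \<sigma> H = f H + a (s0 H) \<sigma>"

lemma val_eq:
 assumes \<sigma>: "\<sigma> : \<X>" "F : fst \<sigma>" "H : fst \<sigma>" "H' : fst \<sigma>" and F: "F <= H" "F <= H'" "rk M F + 2 = rk M E" "tri E F"
  and H: "off H" "off H'"
 shows "val \<sigma> H = val \<sigma> H'" unfolding val_def f[OF F H] b_eq[OF \<sigma> F H] by simp

text \<open>Some prediction exists and all of them agree, so a value at \<open>\<sigma>\<close> is
  well defined.\<close>

definition settled :: "'a constellation \<Rightarrow> bool" where
 "settled \<sigma> \<longleftrightarrow> (\<exists>H\<in>fst \<sigma>. off H) \<and> (\<forall>H\<in>fst \<sigma>. \<forall>H'\<in>fst \<sigma>. off H \<longrightarrow> off H' \<longrightarrow> val \<sigma> H = val \<sigma> H')"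

lemma off_hyp: "off H \<Longrightarrow> Suc (rk M H) = rk M E" by (simp add: off_def)

lemma trivial_ex:
 assumes \<sigma>: "\<sigma> : \<X>" and rep: "rep J x N (fst \<sigma>)" and simple: "simple_mat N"
  and snd: "snd \<sigma> = {E}" and rk: "rk M J < rk M E"
 shows "\<exists>H\<in>fst \<sigma>. off H"
proof -
 have J: "cl M J : fst \<sigma>" using rep_mem[OF rep simple, of "{}"] by simp
 have "rk M (cl M J) < rk M E" using rk_cl[OF J_E[OF rep simple]] rk by simp
 from rep_above[OF rep simple J this] obtain H where H: "H : fst \<sigma>" "Suc (rk M H) = rk M E" by blast
 have "H ~: \<Gamma>"
 proof
  assume "H : \<Gamma>"
  hence "H : snd \<sigma>" using X2_sub(2)[OF \<sigma>] H(1) by blast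
  thus False using snd H(2) by simp
 qed
 hence "off H" unfolding off_def using rep_flat[OF rep simple H(1)] H(2) by blast
 thus ?thesis using H(1) by blast
qed

lemma settled_0: assumes \<sigma>: "\<sigma> : \<X>" "class0 (flats M, \<Gamma>) \<sigma>" shows "settled \<sigma>"
proof -
 let ?N = "uniform_matroid 1 1"
 have c: "has_type (fst \<sigma>) ?N" "snd \<sigma> = {E}" using \<sigma>(2) Union_flats by (simp_all add: class0_def)
 obtain J x where rep: "rep J x ?N (fst \<sigma>)" using upper_rep[OF X2_sub(1)[OF \<sigma>(1)] c(1)] by blast
 have simple: "simple_mat ?N" by (rule simple_uniform) simp
 have rE: "rk M E = rk M J + 1" by (rule uniform_rank[OF rep simple]) simp
 have "H = cl M J" if H: "H : fst \<sigma>" "off H" for H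
 proof -
  obtain X where X: "X <= {..<1}" "card X = 0" "H = cl M (J Un x ` X)"
   using rep_hyp[OF rep simple _ H(1) off_hyp[OF H(2)], of 0] rE unfolding ground_uniform by auto
  have "X = {}" using X(2) finite_subset[OF X(1)] by simp
  thus ?thesis using X(3) by simp
 qed
 moreover have "\<exists>H\<in>fst \<sigma>. off H" by (rule trivial_ex[OF \<sigma>(1) rep simple c(2)]) (simp add: rE)
 ultimately show ?thesis unfolding settled_def by blast
qed

lemma settled_corank2:
 assumes \<sigma>: "\<sigma> : \<X>" "snd \<sigma> = {E}" and rep: "rep J x N (fst \<sigma>)" and simple: "simple_mat N"
  and rE: "rk M E = rk M J + 2" and tri: "tri E (cl M J)"
 shows "settled \<sigma>"
proof -
 have J: "cl M J : fst \<sigma>" "rk M (cl M J) + 2 = rk M E" using rep_mem[OF rep simple, of "{}"] rk_cl[OF J_E[OF rep simple]] rE by simp_all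
 have sub: "cl M J <= H" if "H : fst \<sigma>" for H using rep_Inter[OF rep simple] that by blast
 have "val \<sigma> H = val \<sigma> H'" if "H : fst \<sigma>" "H' : fst \<sigma>" "off H" "off H'" for H H'
  by (rule val_eq[OF \<sigma>(1) J(1) that(1,2) sub[OF that(1)] sub[OF that(2)] J(2) tri that(3,4)])
 moreover have "\<exists>H\<in>fst \<sigma>. off H" by (rule trivial_ex[OF \<sigma>(1) rep simple \<sigma>(2)]) (simp add: rE)
 ultimately show ?thesis unfolding settled_def by blast
qed

lemma settled_1: assumes \<sigma>: "\<sigma> : \<X>" "class1 (flats M, \<Gamma>) \<sigma>" shows "settled \<sigma>"
proof -
 let ?N = "uniform_matroid 2 2"
 have c: "has_type (fst \<sigma>) ?N" "snd \<sigma> = {E}" "indecomposable (flats M) (\<Inter>(fst \<sigma>))"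
  using \<sigma>(2) Union_flats by (simp_all add: class1_def)
 obtain J x where rep: "rep J x ?N (fst \<sigma>)" using upper_rep[OF X2_sub(1)[OF \<sigma>(1)] c(1)] by blast
 have simple: "simple_mat ?N" by (rule simple_uniform) simp
 have rE: "rk M E = rk M J + 2" by (rule uniform_rank[OF rep simple]) simp
 have "rk M (cl M J) + 2 = rk M E" using rk_cl[OF J_E[OF rep simple]] rE by simp
 hence "tri E (cl M J)" using c(3) indecomposable_flats[OF cl_flat[OF J_E[OF rep simple]]] rep_Inter[OF rep simple] by simp
 thus ?thesis by (rule settled_corank2[OF \<sigma>(1) c(2) rep simple rE])
qed

lemma settled_2a: assumes \<sigma>: "\<sigma> : \<X>" "class2a (flats M, \<Gamma>) \<sigma>" shows "settled \<sigma>"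
proof -
 let ?N = "uniform_matroid 2 3"
 have c: "has_type (fst \<sigma>) ?N" "snd \<sigma> = {E}" using \<sigma>(2) Union_flats by (simp_all add: class2a_def)
 obtain J x where rep: "rep J x ?N (fst \<sigma>)" using upper_rep[OF X2_sub(1)[OF \<sigma>(1)] c(1)] by blast
 have simple: "simple_mat ?N" by (rule simple_uniform) simp
 have rE: "rk M E = rk M J + 2" by (rule uniform_rank[OF rep simple]) simp
 have "tri (x ` ground ?N) (cl M (J Un x ` {}))"
  by (rule rep_tri[OF rep simple, of _ 0 1 2]) (simp_all add: ground_uniform indep_uniform)
 hence "tri E (cl M J)" using rep_tri_E[OF rep simple] by simp
 thus ?thesis by (rule settled_corank2[OF \<sigma>(1) c(2) rep simple rE])
qed

text \<open>Two sides of the triangle share a corner, which is indecomposable by the definition of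
  the class.\<close>

lemma settled_2b: assumes \<sigma>: "\<sigma> : \<X>" "class2b (flats M, \<Gamma>) \<sigma>" shows "settled \<sigma>"
proof -
 let ?N = "uniform_matroid 3 3"
 have c: "has_type (fst \<sigma>) ?N" "snd \<sigma> = {E}"
  "\<And>F. F : fst \<sigma> \<Longrightarrow> lat_corank (fst \<sigma>) F = 2 \<Longrightarrow> indecomposable (flats M) F"
  using \<sigma>(2) Union_flats by (simp_all add: class2b_def)
 obtain J x where rep: "rep J x ?N (fst \<sigma>)" using upper_rep[OF X2_sub(1)[OF \<sigma>(1)] c(1)] by blast
 have simple: "simple_mat ?N" by (rule simple_uniform) simp
 have rE: "rk M E = rk M J + 3" by (rule uniform_rank[OF rep simple]) simp
 let ?h = "\<lambda>X. cl M (J Un x ` X)"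
 have hyp: "\<exists>X. X <= {..<3} \<and> card X = 2 \<and> H = ?h X" if H: "H : fst \<sigma>" "off H" for H
  using rep_hyp[OF rep simple _ H(1) off_hyp[OF H(2)], of 2] rE unfolding ground_uniform by auto
 have "val \<sigma> H = val \<sigma> H'" if H: "H : fst \<sigma>" "H' : fst \<sigma>" "off H" "off H'" for H H'
 proof -
  obtain X where X: "X <= {..<3}" "card X = 2" "H = ?h X" using hyp[OF H(1,3)] by blast
  obtain Y where Y: "Y <= {..<3}" "card Y = 2" "H' = ?h Y" using hyp[OF H(2,4)] by blast
  have "X Int Y \<noteq> {}" using card2_3[OF X(1,2)] card2_3[OF Y(1,2)] by (elim disjE) simp_all
  then obtain i where i: "i : X" "i : Y" by blast
  have i3: "{i} <= ground ?N" "{i} : indep ?N" using i X(1) by (auto simp: ground_uniform indep_uniform)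
  have F: "?h {i} : fst \<sigma>" by (rule rep_mem[OF rep simple i3(1)])
  have r: "rk M (?h {i}) + 2 = rk M E" using rep_rank_indep[OF rep simple i3] rE by simp
  hence "lat_corank (fst \<sigma>) (?h {i}) = 2" using rep_corank[OF rep simple F] by linarith
  hence "tri E (?h {i})" using c(3)[OF F] indecomposable_flats[OF rep_flat[OF rep simple F] r] by blast
  moreover have "?h {i} <= H" "?h {i} <= H'" unfolding X(3) Y(3) using i by (intro cl_mono; blast)+
  ultimately show ?thesis using val_eq[OF \<sigma>(1) F H(1,2) _ _ r _ H(3,4)] by blast
 qed
 moreover have "\<exists>H\<in>fst \<sigma>. off H" by (rule trivial_ex[OF \<sigma>(1) rep simple c(2)]) (simp add: rE)
 ultimately show ?thesis unfolding settled_def by blast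
qed

text \<open>The two hyperplanes in the cut meet in the bottom, so they use complementary pairs
  \<open>P\<close>, \<open>Q\<close> of the four points. The other four hyperplanes form a
  quadrangle in which neighbours share a point.\<close>

lemma settled_2c: assumes \<sigma>: "\<sigma> : \<X>" "class2c (flats M, \<Gamma>) \<sigma>" shows "settled \<sigma>"
proof -
 let ?N = "uniform_matroid 3 4" and ?L = "fst \<sigma>"
 obtain H1 H2 where c: "has_type ?L ?N" "H1 : hyperplanes ?L" "H2 : hyperplanes ?L" "H1 \<noteq> H2"
  "snd \<sigma> = {H1, H2, E}" "lat_meet ?L H1 H2 = \<Inter>?L"
  using \<sigma>(2) unfolding class2c_def fst_conv Union_flats by (elim conjE bexE) (rule that)
 obtain J x where rep: "rep J x ?N ?L" using upper_rep[OF X2_sub(1)[OF \<sigma>(1)] c(1)] by blast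
 have simple: "simple_mat ?N" by (rule simple_uniform) simp
 have rE: "rk M E = rk M J + 3" by (rule uniform_rank[OF rep simple]) simp
 let ?h = "\<lambda>X. cl M (J Un x ` X)"
 have hyp: "\<exists>X. X <= {..<4} \<and> card X = 2 \<and> H = ?h X" if H: "H : ?L" "Suc (rk M H) = rk M E" for H
  using rep_hyp[OF rep simple _ H, of 2] rE unfolding ground_uniform by auto
 have h12: "H1 : ?L" "Suc (rk M H1) = rk M E" "H2 : ?L" "Suc (rk M H2) = rk M E"
  using c(2,3) unfolding rep_hyperplanes[OF rep simple] by simp_all
 obtain P where P: "P <= {..<4}" "card P = 2" "H1 = ?h P" using hyp[OF h12(1,2)] by blast
 obtain Q where Q: "Q <= {..<4}" "card Q = 2" "H2 = ?h Q" using hyp[OF h12(3,4)] by blast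
 have single: "{i} <= ground ?N" "?h {i} : ?L" "rk M (?h {i}) + 2 = rk M E" "tri E (?h {i})" if "i < 4" for i
 proof -
  show s: "{i} <= ground ?N" using that by (simp add: ground_uniform)
  show "?h {i} : ?L" by (rule rep_mem[OF rep simple s])
  have "{i} : indep ?N" using that by (simp add: indep_uniform)
  thus "rk M (?h {i}) + 2 = rk M E" using rep_rank_indep[OF rep simple s] rE by simp
  have t: "tri E (?h {i})" if "u < 4" "v < 4" "w < 4" "distinct [i, u, v, w]" for u v w
   by (rule rep_tri_E[OF rep simple], rule rep_tri[OF rep simple s, of u v w])
    (use that \<open>i < 4\<close> in \<open>simp_all add: ground_uniform indep_uniform card_insert_if\<close>)
  have "i = 0 \<or> i = 1 \<or> i = 2 \<or> i = 3" using that by linarith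
  thus "tri E (?h {i})" using t[of 1 2 3] t[of 0 2 3] t[of 0 1 3] t[of 0 1 2] by (elim disjE) simp_all
 qed
 have disj: "P Int Q = {}"
 proof (rule ccontr)
  assume "P Int Q \<noteq> {}"
  then obtain i where i: "i : P" "i : Q" by blast
  hence i4: "i < 4" using P(1) by blast
  have "?h {i} <= H1" "?h {i} <= H2" unfolding P(3) Q(3) using i by (intro cl_mono; blast)+
  hence "?h {i} <= lat_meet ?L H1 H2" unfolding lat_meet_def using single(2)[OF i4] by blast
  hence "?h {i} <= cl M J" using c(6) rep_Inter[OF rep simple] by simp
  from rk_mono[OF this] have "rk M (?h {i}) \<le> rk M J" using rk_cl[OF J_E[OF rep simple]] by simp
  thus False using single(3)[OF i4] rE by linarith
 qed
 have cov: "P Un Q = {..<4}"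
 proof (rule card_subset_eq)
  show "card (P Un Q) = card {..<4::nat}"
   using card_Un_disjoint[OF finite_subset[OF P(1)] finite_subset[OF Q(1)] disj] P(2) Q(2) by simp
 qed (use P Q in auto)
 have clsd: "closedN J x ?N X" if "X <= {..<4}" "card X = 2" for X by (rule closedI[OF rep simple])
   (use that finite_subset[OF that(1)] in \<open>auto simp: ground_uniform indep_uniform card_insert_if\<close>)
 have cross: "?h {u,v} : ?L" "off (?h {u,v})" if uv: "u : P" "v : Q" for u v
 proof -
  have s: "{u,v} <= {..<4}" "u \<noteq> v" "u ~: Q" "v ~: P" using uv P(1) Q(1) disj by blast+
  have sN: "{u,v} <= ground ?N" "{u,v} : indep ?N" using s by (simp_all add: ground_uniform indep_uniform)
  show L: "?h {u,v} : ?L" by (rule rep_mem[OF rep simple sN(1)])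
  have r: "Suc (rk M (?h {u,v})) = rk M E" using rep_rank_indep[OF rep simple sN] rE s(2) by simp
  have "?h {u,v} ~: \<Gamma>"
  proof
   assume "?h {u,v} : \<Gamma>"
   hence "?h {u,v} : {H1, H2, E}" using X2_sub(2)[OF \<sigma>(1)] c(5) L by blast
   moreover have "?h {u,v} \<noteq> E" using r by force
   moreover have "?h {u,v} \<noteq> H1" using closed_sub[OF rep simple clsd[OF P(1,2)] sN(1)] s(4) unfolding P(3) by blast
   moreover have "?h {u,v} \<noteq> H2" using closed_sub[OF rep simple clsd[OF Q(1,2)] sN(1)] s(3) unfolding Q(3) by blast
   ultimately show False by blast
  qed
  thus "off (?h {u,v})" unfolding off_def using rep_flat[OF rep simple L] r by blast
 qed
 have step: "val \<sigma> (?h {u,v}) = val \<sigma> (?h {u',v'})"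
  if "u : P" "v : Q" "u' : P" "v' : Q" "i : {u,v}" "i : {u',v'}" for u v u' v' i
 proof -
  have "i < 4" using that P(1) Q(1) by blast
  note s = single[OF this]
  show ?thesis
   by (rule val_eq[OF \<sigma>(1) s(2) cross(1)[OF that(1,2)] cross(1)[OF that(3,4)] _ _ s(3,4) cross(2)[OF that(1,2)] cross(2)[OF that(3,4)]];
     rule cl_mono; use that(5,6) in blast)
 qed
 have offs: "\<exists>u\<in>P. \<exists>v\<in>Q. H = ?h {u,v}" if H: "H : ?L" "off H" for H
 proof -
  obtain X where X: "X <= {..<4}" "card X = 2" "H = ?h X" using hyp[OF H(1) off_hyp[OF H(2)]] by blast
  have "H1 : \<Gamma>" "H2 : \<Gamma>" using c(5) X2_sub(2)[OF \<sigma>(1)] by blast+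
  hence ne: "X \<noteq> P" "X \<noteq> Q" using H(2) P(3) Q(3) X(3) unfolding off_def by blast+
  have "\<not> X <= P" using card_subset_eq[OF finite_subset[OF P(1)], of X] P(2) X(2) ne(1) by auto
  then obtain v where v: "v : X" "v : Q" using cov X(1) by blast
  have "\<not> X <= Q" using card_subset_eq[OF finite_subset[OF Q(1)], of X] Q(2) X(2) ne(2) by auto
  then obtain u where u: "u : X" "u : P" using cov X(1) by blast
  have "u \<noteq> v" using u v disj by blast
  hence "{u,v} = X" using card_subset_eq[OF finite_subset[OF X(1)], of "{u,v}"] u v X(2) by simp
  thus ?thesis using u v X(3) by blast
 qed
 have "val \<sigma> H = val \<sigma> H'" if H: "H : ?L" "H' : ?L" "off H" "off H'" for H H'
 proof -
  obtain u v where uv: "u : P" "v : Q" "H = ?h {u,v}" using offs[OF H(1,3)] by blast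
  obtain u' v' where uv': "u' : P" "v' : Q" "H' = ?h {u',v'}" using offs[OF H(2,4)] by blast
  show ?thesis unfolding uv(3) uv'(3) using step[OF uv(1,2) uv(1) uv'(2), of u] step[OF uv(1) uv'(2) uv'(1,2), of v'] by simp
 qed
 moreover obtain u v where "u : P" "v : Q" using P(2) Q(2) by fastforce
 hence "\<exists>H\<in>?L. off H" using cross by blast
 ultimately show ?thesis unfolding settled_def by blast
qed

text \<open>Two hyperplanes of the cut meet in an atom only, so they cannot share two independent
  elements. Hence a circuit hyperplane and a transversal hyperplane off the cut exist, and every
  hyperplane of one kind is adjacent to every one of the other.\<close>

lemma settled_2d: assumes \<sigma>: "\<sigma> : \<X>" "class2d (flats M, \<Gamma>) \<sigma>" shows "settled \<sigma>"
proof -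
 let ?L = "fst \<sigma>"
 obtain \<H> where c: "has_type ?L K6" "snd \<sigma> = E+:\<H>"
  "{lat_meet ?L H H' |H H'. H : \<H> \<and> H' : \<H> \<and> H \<noteq> H'} = atoms ?L"
  using \<sigma>(2) unfolding class2d_def fst_conv Union_flats has_type_K23 by (elim conjE exE) (rule that)
 obtain J x where rep: "rep J x K6 ?L" using upper_rep[OF X2_sub(1)[OF \<sigma>(1)] c(1)] by blast
 note rE = K6_rank[OF rep]
 let ?h = "\<lambda>X. cl M (J Un x ` X)"
 have no: False
  if XY: "?h X : ?L" "?h Y : ?L" "Suc (rk M (?h X)) = rk M E" "Suc (rk M (?h Y)) = rk M E" "?h X : \<Gamma>" "?h Y : \<Gamma>"
   and P: "P <= X" "P <= Y" "P <= {..<6}" "P : indep K6" "card P = 2"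
   and Z: "Z <= X Un Y" "Z <= {..<6}" "Z : indep K6" "card Z = 4" and sub: "X <= {..<6}" "Y <= {..<6}" for X Y P Z
 proof -
  have "?h X \<noteq> E" "?h Y \<noteq> E" using XY(3,4) by force+
  moreover have "?h X : E+:\<H>" "?h Y : E+:\<H>" using XY X2_sub(2)[OF \<sigma>(1)] c(2) by blast+
  ultimately have H: "?h X : \<H>" "?h Y : \<H>" by blast+
  have ne: "?h X \<noteq> ?h Y"
  proof
   assume eq: "?h X = ?h Y"
   have "J Un x ` X <= ?h X" "J Un x ` Y <= ?h Y" using sub_cl[OF rep_sub[OF rep simple_K6]] sub ground_K6 by blast+
   hence "J Un x ` Z <= ?h X" using Z(1) eq by blast
   from rk_mono[OF this] have "rk M (J Un x ` Z) \<le> rk M (?h X)" .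
   moreover have "rk M (J Un x ` Z) = rk M J + 4" using rep_indep[OF rep simple_K6, of Z] Z ground_K6 by simp
   ultimately show False using XY(3) rE by linarith
  qed
  have "lat_meet ?L (?h X) (?h Y) : atoms ?L" unfolding c(3)[symmetric] using H ne by blast
  hence r: "rk M (lat_meet ?L (?h X) (?h Y)) = Suc (rk M J)" unfolding rep_atoms[OF rep simple_K6] by blast
  have "?h P <= ?h X" "?h P <= ?h Y" using P(1,2) by (intro cl_mono; blast)+
  hence "?h P <= lat_meet ?L (?h X) (?h Y)" unfolding lat_meet_def using K6_mem[OF rep rE P(3)] by blast
  from rk_mono[OF this] have "rk M (?h P) \<le> Suc (rk M J)" using r by simp
  moreover have "rk M (?h P) = rk M J + 2" using rep_rank_indep[OF rep simple_K6, of P] P ground_K6 by simp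
  ultimately show False by simp
 qed
 have offI': "off (?h X)" if "?h X : ?L" "Suc (rk M (?h X)) = rk M E" "?h X ~: \<Gamma>" for X
  using that rep_flat[OF rep simple_K6] unfolding off_def by blast
 have Q: "{0,1,2,3} : K6_circuits" "{0,1,4,5} : K6_circuits" by (simp_all add: K6_circuits_def)
 note Qm = K6_mem[OF rep rE K6_circuit_sub] and Qh = K6_circuit_hyp[OF rep rE]
 have T: "{0,2,4} <= {..<6::nat}" "{0,2,5} <= {..<6::nat}" "Suc (rk M (?h {0,2,4})) = rk M E" "Suc (rk M (?h {0,2,5})) = rk M E"
  using K6_transversal_hyp(1,3)[OF rep rE, of 0 2 4] K6_transversal_hyp(1,3)[OF rep rE, of 0 2 5] by simp_all
 note Tm = K6_mem[OF rep rE T(1)] K6_mem[OF rep rE T(2)]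
 have "\<not> (?h {0,1,2,3} : \<Gamma> \<and> ?h {0,1,4,5} : \<Gamma>)"
  using no[OF Qm[OF Q(1)] Qm[OF Q(2)] Qh[OF Q(1)] Qh[OF Q(2)], of "{0,1}" "{0,1,2,4}"] by (auto simp: K6_def)
 then obtain Q0 where Q0: "Q0 : K6_circuits" "off (?h Q0)"
  using offI'[OF Qm[OF Q(1)] Qh[OF Q(1)]] offI'[OF Qm[OF Q(2)] Qh[OF Q(2)]] Q by blast
 have "\<not> (?h {0,2,4} : \<Gamma> \<and> ?h {0,2,5} : \<Gamma>)" using no[OF Tm T(3,4), of "{0,2}" "{0,2,4,5}"] by (auto simp: K6_def)
 hence "off (?h {0,2,4}) \<or> off (?h {0,2,5})" using offI'[OF Tm(1) T(3)] offI'[OF Tm(2) T(4)] by blast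
 then obtain w0 where w0: "w0 : {4,5}" "off (?h {0,2,w0})" by blast
 have step: "val \<sigma> (?h {p,q,w}) = val \<sigma> (?h Q)"
  if t: "p : {0,1}" "q : {2,3}" "w : {4,5}" "Q : K6_circuits" and o: "off (?h {p,q,w})" "off (?h Q)" for p q w Q
 proof -
  obtain F where F: "F : ?L" "F <= ?h {p,q,w}" "F <= ?h Q" "rk M F + 2 = rk M E" "tri (x ` {..<6}) F"
   using K6_edge[OF rep rE t] by blast
  have tr: "tri E F" using rep_tri_E[OF rep simple_K6] F(5) unfolding ground_K6 by blast
  show ?thesis
   by (rule val_eq[OF \<sigma>(1) F(1) K6_mem[OF rep rE K6_transversal_hyp(1)[OF rep rE t(1-3)]] Qm[OF t(4)] F(2-4) tr o])
 qed
 have t0: "(0::nat) : {0,1}" "(2::nat) : {2,3}" by simp_all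
 have "val \<sigma> H = val \<sigma> (?h Q0)" if H: "H : ?L" "off H" for H using K6_hyp[OF rep rE H(1) off_hyp[OF H(2)]]
 proof
  assume "\<exists>Q\<in>K6_circuits. H = ?h Q"
  then obtain Q where Q: "Q : K6_circuits" "H = ?h Q" by blast
  have o: "off (?h Q)" using H(2) unfolding Q(2) .
  show ?thesis unfolding Q(2) using step[OF t0 w0(1) Q(1) w0(2) o] step[OF t0 w0(1) Q0(1) w0(2) Q0(2)] by simp
 next
  assume "\<exists>p\<in>{0,1}. \<exists>q\<in>{2,3}. \<exists>w\<in>{4,5}. H = ?h {p,q,w}"
  then obtain p q w where t: "p : {0,1}" "q : {2,3}" "w : {4,5}" "H = ?h {p,q,w}" by blast
  have o: "off (?h {p,q,w})" using H(2) unfolding t(4) .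
  show ?thesis unfolding t(4) by (rule step[OF t(1-3) Q0(1) o Q0(2)])
 qed
 thus ?thesis unfolding settled_def using Qm[OF Q0(1)] Q0(2) by metis
qed

lemma settled: "\<sigma> : \<X> \<Longrightarrow> settled \<sigma>"
 using settled_0 settled_1 settled_2a settled_2b settled_2c settled_2d unfolding X2_def by blast

definition pick :: "'a constellation \<Rightarrow> 'a set" where
 "pick \<sigma> = (SOME H. H : fst \<sigma> \<and> off H)"

text \<open>Predictions from one and the same hyperplane differ by
  \<open>a \<sigma> \<sigma>'\<close>, by additivity; \<open>settled\<close> permits the change of
  hyperplane.\<close>

lemma split_le:
 assumes \<sigma>: "\<sigma> : \<X>" "\<sigma>' : \<X>" "fst \<sigma> <= fst \<sigma>'"
 shows "a \<sigma> \<sigma>' = val \<sigma>' (pick \<sigma>') - val \<sigma> (pick \<sigma>)"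
proof -
 have p: "pick \<rho> : fst \<rho> \<and> off (pick \<rho>)" if "\<rho> : \<X>" for \<rho>
 proof -
  have "\<exists>H. H : fst \<rho> \<and> off H" using settled[OF that] unfolding settled_def by blast
  thus ?thesis unfolding pick_def by (rule someI_ex)
 qed
 let ?H = "pick \<sigma>"
 have H: "?H : fst \<sigma>" "off ?H" "?H : fst \<sigma>'" using p[OF \<sigma>(1)] \<sigma>(3) by blast+
 have "val \<sigma>' (pick \<sigma>') = val \<sigma>' ?H" using settled[OF \<sigma>(2)] p[OF \<sigma>(2)] H unfolding settled_def by blast
 moreover have "s0 ?H : \<X>" using class0_in[OF H(2)] by (simp add: s0_def)
 moreover have "fst (s0 ?H) <= fst \<sigma>" using H(1) X2_sub(3)[OF \<sigma>(1)] by (simp add: s0_def)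
 ultimately show ?thesis using a_add[OF _ \<sigma>(1,2) _ \<sigma>(3), of "s0 ?H"] unfolding val_def by (simp add: algebra_simps)
qed

end

theorem cocycle_splits: "\<exists>f. \<forall>u v. {u, v} : Sigma2 M (flats M, \<Gamma>) \<longrightarrow> a u v = f v - f u"
proof -
 obtain f where f: "\<And>F H H'. F <= H \<Longrightarrow> F <= H' \<Longrightarrow> rk M F + 2 = rk M E \<Longrightarrow> tri E F \<Longrightarrow> off H \<Longrightarrow> off H' \<Longrightarrow> f H' = f H + b H H'"
  using ex_potential by blast
 let ?f = "\<lambda>\<sigma>. val f \<sigma> (pick \<sigma>)"
 have split: "a \<sigma> \<sigma>' = ?f \<sigma>' - ?f \<sigma>" if "\<sigma> : \<X>" "\<sigma>' : \<X>" "fst \<sigma> <= fst \<sigma>'" for \<sigma> \<sigma>'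
  by (rule split_le[of f, OF _ that]) (rule f; assumption)
 have "a u v = ?f v - ?f u" if uv: "{u, v} : Sigma2 M (flats M, \<Gamma>)" for u v
 proof -
  have X: "u : \<X>" "v : \<X>" "fst u <= fst v \<or> fst v <= fst u"
   using uv by (auto simp: Sigma2_def order_complex_def Complete_Partial_Order.chain_def sub_le_def)
  from X(3) show ?thesis
  proof
   assume "fst u <= fst v"
   thus ?thesis by (rule split[OF X(1,2)])
  next
   \<comment> \<open>Faces are unordered: the reversed edge takes the opposite value, by the cocycle
     condition on \<open>u\<close>, \<open>v\<close>, \<open>u\<close>.\<close>
   assume "fst v <= fst u"
   hence vu: "a v u = ?f u - ?f v" by (rule split[OF X(2,1)])
   have "a u u = 0" using a_add[OF X(1) X(1) X(1)] by simp
   moreover have "a u v + a v u = a u u" using cocycle[of u v u] uv by (simp add: insert_commute)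
   ultimately have "a u v = - a v u" by (simp add: eq_neg_iff_add_eq_0)
   thus ?thesis unfolding vu by simp
  qed
 qed
 thus ?thesis by (intro exI[of _ ?f] allI impI)
qed

end

theorem theorem4p6:
 fixes M :: "'a matroid" and \<tau> :: "'a constellation"
 assumes "tutte_constellation M \<tau>"
 shows "trivial_group (homology_group 1 (geometric_realization (Sigma2 M \<tau>)))"
proof (rule trivial_homology_1_if_cocycles_split)
 fix s t assume s: "s : Sigma2 M \<tau>"
 thus "finite s \<and> s \<noteq> {}" by (simp add: Sigma2_def order_complex_def)
 assume "t <= s" "t \<noteq> {}"
 thus "t : Sigma2 M \<tau>" using s finite_subset unfolding Sigma2_def order_complex_def Complete_Partial_Order.chain_def by blast
next
 have M: "matroid M" and \<tau>: "\<tau> = (flats M, snd \<tau>)" and cut: "modular_cut M (snd \<tau>)"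
  using assms by (auto simp: tutte_constellation_def prod_eq_iff)
 interpret mat M by unfold_locales (rule M)
 fix a :: "'a constellation \<Rightarrow> 'a constellation \<Rightarrow> ('a constellation \<Rightarrow> real) chain uq"
 assume a: "\<And>u v w. {u, v, w} : Sigma2 M \<tau> \<Longrightarrow> a u v + a v w = a u w"
 show "\<exists>f. \<forall>u v. {u, v} : Sigma2 M \<tau> \<longrightarrow> a u v = f v - f u"
 proof (cases "ground M : snd \<tau>")
  case True
  interpret cocycle M "snd \<tau>" a by unfold_locales (use cut True a \<tau> in simp_all)
  show ?thesis using cocycle_splits \<tau> by simp
 next
  \<comment> \<open>Every class requires the top to be in the cut, so here the complex is
    empty.\<close>
  case False
  have "\<Union>(fst \<tau>) = ground M" using Union_usub[OF flats_usub(2)] flats_usub(1) \<tau> by (metis fst_conv)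
  hence "\<sigma> ~: X2 M \<tau>" for \<sigma>
   using False by (auto simp: X2_def subconstellations_def class0_def class1_def class2a_def class2b_def class2c_def class2d_def)
  hence "Sigma2 M \<tau> = {}" by (auto simp: Sigma2_def order_complex_def)
  thus ?thesis by simp
 qed
qed

end
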